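(* Let $d\in(-1/2,3/2)$, let $s\ge 1$ be a fixed integer, and let $(X_t)_{t\ge 0}$ be an $I(d)$ process. Let $n=m\ell$ with $m=m(n)\to\infty$ and $\ell=\ell(n)\to\infty$ as $n\to\infty$. Then, as $n\to\infty$, the statistic $$Q_{n,m}(s,d)=m^{-2d}\sum_{j=1}^s\frac{I_n(\lambda_j)}{\frac1m\sum_{h=1}^m I_{n,h}(\lambda_j')}$$ converges in distribution to $$Q(s,d)=\sum_{i=1}^{2s}\zeta_i(d)\,Q_i ,$$ where $Q_1,\dots,Q_{2s}$ are i.i.d. $\chi^2(1)$ random variables and $\zeta_1(d),\dots,\zeta_{2s}(d)$ are the eigenvalues of the matrix $\Sigma(d)D^{-1}(d)$.
   Context: **$I(d)$ processes.** For $-1/2\le d<1/2$, $(X_t)$ is an $I(d)$ process if it is a linear process $X_t=\sum_{j=0}^\infty a_j\epsilon_{t-j}$, where $(\epsilon_j)_{j\in\mathbb Z}$ are i.i.d. with zero mean, variance $\sigma^2>0$ and finite fourth moment, $a_0=1$, $\sum_j a_j^2<\infty$, and - if $d=0$: $\sum_{j}|a_j|<\infty$ and $\sum_j a_j\ne 0$; - if $0<d<1/2$: $a_j\sim c(d)j^{-1+d}$ as $j\to\infty$; - if $-1/2\le d<0$: $\sum_{j}a_j=0$ and $a_j=c(d)j^{-1+d}(1+O(j^{-1}))$ as $j\to\infty$; where $c(d)>0$ is a constant. For $1/2\le d<3/2$, $(X_t)$ is an $I(d)$ process if $Y_t=X_t-X_{t-1}$ is an $I(d-1)$ process. **Periodograms.**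 The sample $X_1,\dots,X_n$ is split into $m$ consecutive blocks of size $\ell$ ($n=m\ell$). For $j=1,\dots,s$ let $\lambda_j=2\pi j/n$, $\lambda_j'=2\pi j/\ell$, and $$I_n(\lambda_j)=\frac1{2\pi n}\Big|\sum_{t=1}^nX_te^{\mathrm i t\lambda_j}\Big|^2,\qquad I_{n,h}(\lambda_j')=\frac1{2\pi\ell}\Big|\sum_{t=(h-1)\ell+1}^{h\ell}X_te^{\mathrm i t\lambda_j'}\Big|^2,\quad h=1,\dots,m.$$ **The constants $\delta$.** For an $I(d)$ process with $0<|d|<1/2$ the autocovariance function satisfies $\gamma(h)\sim C(d)h^{2d-1}$ as $h\to\infty$ for a nonzero constant $C(d)$. Set $\delta(-1/2)=8\sigma^2c^2(-1/2)$, $\delta(0)=\sigma^2\big(\sum_{i\ge0} a_i\big)^2$, and $\delta(d)=\frac{C(d)}{d(2d+1)}$ for $0<|d|<1/2$. When $d\in[1/2,3/2)$, $\delta(d-1)$ refers to the $I(d-1)$ process $Y_t=X_t-X_{t-1}$. **The matrices.** $\Sigma(d)$ is the $2s\times 2s$ block diagonal matrix with diagonal blocks $\Sigma^{(c)}(d)$ and $\Sigma^{(s)}(d)$ (each $s\times s$), where for $i,j=1,\dots,s$: - if $d=1/2$: $\Sigma^{(c)}_{ij}(d)=\frac{\delta(-1/2)}2\int_{[0,1]^2}\cos(2\pi ix)\cos(2\pi jy)(-\log|x-y|)\,dx\,dy$ and $\Sigma^{(s)}_{ij}(d)=\frac{\delta(-1/2)}2\int_{[0,1]^2}\sin(2\pi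 ix)\sin(2\pi jy)(-\log|x-y|)\,dx\,dy$; - if $1/2<d<3/2$: $\Sigma^{(c)}_{ij}(d)=-\frac{\delta(d-1)}2\int_{[0,1]^2}\cos(2\pi ix)\cos(2\pi jy)|x-y|^{2d-1}dx\,dy$ and $\Sigma^{(s)}_{ij}(d)=-\frac{\delta(d-1)}2\int_{[0,1]^2}\sin(2\pi ix)\sin(2\pi jy)|x-y|^{2d-1}dx\,dy$; - if $-1/2<d<1/2$: $\Sigma^{(c)}_{ij}(d)=-\delta(d)\Big[a_{ij}(d)+2\pi^2ij\int_{[0,1]^2}\sin(2\pi ix)\sin(2\pi jy)|x-y|^{2d+1}dx\,dy\Big]$ with $a_{ij}(d)=1-(2d+1)\int_0^1x^{2d}\big(\cos(2\pi ix)+\cos(2\pi jx)\big)dx$, and $\Sigma^{(s)}_{ij}(d)=-\delta(d)\,2\pi^2ij\int_{[0,1]^2}\cos(2\pi ix)\cos(2\pi jy)|x-y|^{2d+1}dx\,dy$. $D(d)$ is the $2s\times2s$ diagonal matrix with $D_{ii}(d)=D_{i+s,i+s}(d)=\Sigma^{(c)}_{ii}(d)+\Sigma^{(s)}_{ii}(d)$, $i=1,\dots,s$. *)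

theory Defs
  imports
    "HOL-Probability.Probability"
    "HOL-Library.Landau_Symbols"
    "Jordan_Normal_Form.Char_Poly"
begin

definition memory_coeffs :: "real \<Rightarrow> (nat \<Rightarrow> real) \<Rightarrow> real \<Rightarrow> bool" where
  "memory_coeffs d a c \<longleftrightarrow>
     a 0 = 1 \<and> summable (\<lambda>j. (a j)\<^sup>2) \<and>
     (d = 0 \<longrightarrow> summable (\<lambda>j. \<bar>a j\<bar>) \<and> (\<Sum>j. a j) \<noteq> 0) \<and>
     (0 < d \<longrightarrow> c > 0 \<and> a \<sim>[at_top] (\<lambda>j. c * real j powr (- 1 + d))) \<and>
     (d < 0 \<longrightarrow> c > 0 \<and> a sums 0 \<and>
        (\<exists>r. r \<in> O(\<lambda>j. 1 / real j) \<and>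
             (\<forall>\<^sub>F j in at_top. a j = c * real j powr (- 1 + d) * (1 + r j))))"

context prob_space
begin

text \<open>Integrability of the fourth power makes the lower moments genuine (not the default
  value of the integral of a non-integrable function).\<close>

definition innovations :: "real \<Rightarrow> (int \<Rightarrow> 'a \<Rightarrow> real) \<Rightarrow> bool" where
  "innovations \<sigma> \<epsilon> \<longleftrightarrow>
     \<sigma> > 0 \<and>
     indep_vars (\<lambda>_. borel) \<epsilon> UNIV \<and>
     (\<forall>i. distr M borel (\<epsilon> i) = distr M borel (\<epsilon> 0)) \<and>
     integrable M (\<lambda>\<omega>. (\<epsilon> 0 \<omega>) ^ 4) \<and>
     expectation (\<epsilon> 0) = 0 \<and>
     variance (\<epsilon> 0) = \<sigma>\<^sup>2"

text \<open>The series is read as an almost surely convergent one. For independent centred summands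
  with square-summable variances this is equivalent to convergence in mean square.
  \<open>T\<close> is the set of time points.\<close>

definition linear_process ::
  "nat set \<Rightarrow> (nat \<Rightarrow> real) \<Rightarrow> (int \<Rightarrow> 'a \<Rightarrow> real) \<Rightarrow> (nat \<Rightarrow> 'a \<Rightarrow> real) \<Rightarrow> bool" where
  "linear_process T a \<epsilon> Z \<longleftrightarrow>
     (\<forall>t\<in>T. random_variable borel (Z t) \<and>
        (AE \<omega> in M. (\<lambda>j. a j * \<epsilon> (int t - int j) \<omega>) sums Z t \<omega>))"

definition stationary_I_process ::
  "nat set \<Rightarrow> real \<Rightarrow> (nat \<Rightarrow> real) \<Rightarrow> real \<Rightarrow> real \<Rightarrow> (int \<Rightarrow> 'a \<Rightarrow> real) \<Rightarrow>
     (nat \<Rightarrow> 'a \<Rightarrow> real) \<Rightarrow> bool" where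
  "stationary_I_process T d a c \<sigma> \<epsilon> Z \<longleftrightarrow>
     - 1/2 \<le> d \<and> d < 1/2 \<and> memory_coeffs d a c \<and> innovations \<sigma> \<epsilon> \<and> linear_process T a \<epsilon> Z"

end

text \<open>Only the values at times \<open>t \<ge> 1\<close> are ever used.\<close>

definition increments :: "(nat \<Rightarrow> 'a \<Rightarrow> real) \<Rightarrow> nat \<Rightarrow> 'a \<Rightarrow> real" where
  "increments X t \<omega> = X t \<omega> - X (t - 1) \<omega>"

context prob_space
begin

text \<open>The parameters \<open>a\<close>, \<open>c\<close>, \<open>\<sigma>\<close>, \<open>\<epsilon>\<close> are those of \<open>X\<close> itself if \<open>d < 1/2\<close>, and those of its
  increments \<open>X\<^sub>t - X\<^sub>t\<^sub>-\<^sub>1\<close>, \<open>t \<ge> 1\<close>, otherwise; in the latter case the initial value \<open>X\<^sub>0\<close> is an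
  arbitrary random variable.\<close>

definition I_process ::
  "real \<Rightarrow> (nat \<Rightarrow> real) \<Rightarrow> real \<Rightarrow> real \<Rightarrow> (int \<Rightarrow> 'a \<Rightarrow> real) \<Rightarrow> (nat \<Rightarrow> 'a \<Rightarrow> real) \<Rightarrow> bool" where
  "I_process d a c \<sigma> \<epsilon> X \<longleftrightarrow>
     (if d < 1/2 then stationary_I_process {0..} d a c \<sigma> \<epsilon> X
      else random_variable borel (X 0) \<and>
           stationary_I_process {1..} (d - 1) a c \<sigma> \<epsilon> (increments X))"

text \<open>The processes considered are weakly stationary, so the base time is immaterial; time 1
  is available both for \<open>X\<close> and for its increments.\<close>

definition autocov :: "(nat \<Rightarrow> 'a \<Rightarrow> real) \<Rightarrow> nat \<Rightarrow> real" where
  "autocov Z h =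
     expectation (\<lambda>\<omega>. (Z 1 \<omega> - expectation (Z 1)) * (Z (1 + h) \<omega> - expectation (Z (1 + h))))"

definition autocov_const :: "real \<Rightarrow> (nat \<Rightarrow> 'a \<Rightarrow> real) \<Rightarrow> real" where
  "autocov_const d Z =
     (THE C. C \<noteq> 0 \<and> autocov Z \<sim>[at_top] (\<lambda>h. C * real h powr (2 * d - 1)))"

definition delta ::
  "real \<Rightarrow> (nat \<Rightarrow> real) \<Rightarrow> real \<Rightarrow> real \<Rightarrow> (nat \<Rightarrow> 'a \<Rightarrow> real) \<Rightarrow> real" where
  "delta d a c \<sigma> Z =
     (if d = - 1/2 then 8 * \<sigma>\<^sup>2 * c\<^sup>2
      else if d = 0 then \<sigma>\<^sup>2 * (\<Sum>i. a i)\<^sup>2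
      else autocov_const d Z / (d * (2 * d + 1)))"

definition I_delta ::
  "real \<Rightarrow> (nat \<Rightarrow> real) \<Rightarrow> real \<Rightarrow> real \<Rightarrow> (nat \<Rightarrow> 'a \<Rightarrow> real) \<Rightarrow> real" where
  "I_delta d a c \<sigma> X =
     (if d < 1/2 then delta d a c \<sigma> X else delta (d - 1) a c \<sigma> (increments X))"

end

text \<open>In the matrices \<open>\<delta>\<close> stands for \<open>\<delta>(d)\<close> if \<open>d < 1/2\<close> and for \<open>\<delta>(d - 1)\<close> otherwise.
  Frequency indices \<open>i\<close>, \<open>j\<close> start at 1, matrix positions at 0.\<close>

definition square_integral :: "(real \<Rightarrow> real \<Rightarrow> real) \<Rightarrow> real" where
  "square_integral f = (LINT z : {0..1} \<times> {0..1} | lborel. f (fst z) (snd z))"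

definition boundary_coeff :: "real \<Rightarrow> nat \<Rightarrow> nat \<Rightarrow> real" where
  "boundary_coeff d i j =
     1 - (2 * d + 1) *
       (LINT x : {0..1} | lborel. x powr (2 * d) * (cos (2 * pi * i * x) + cos (2 * pi * j * x)))"

definition Sigma_c :: "real \<Rightarrow> real \<Rightarrow> nat \<Rightarrow> nat \<Rightarrow> real" where
  "Sigma_c d \<delta> i j =
     (if d < 1/2 then
        - \<delta> * (boundary_coeff d i j + 2 * pi\<^sup>2 * i * j *
          square_integral (\<lambda>x y. sin (2 * pi * i * x) * sin (2 * pi * j * y) * \<bar>x - y\<bar> powr (2 * d + 1)))
      else if d = 1/2 then
        \<delta> / 2 * square_integral (\<lambda>x y. cos (2 * pi * i * x) * cos (2 * pi * j * y) * (- ln \<bar>x - y\<bar>))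
      else
        - \<delta> / 2 *
          square_integral (\<lambda>x y. cos (2 * pi * i * x) * cos (2 * pi * j * y) * \<bar>x - y\<bar> powr (2 * d - 1)))"

definition Sigma_s :: "real \<Rightarrow> real \<Rightarrow> nat \<Rightarrow> nat \<Rightarrow> real" where
  "Sigma_s d \<delta> i j =
     (if d < 1/2 then
        - \<delta> * 2 * pi\<^sup>2 * i * j *
          square_integral (\<lambda>x y. cos (2 * pi * i * x) * cos (2 * pi * j * y) * \<bar>x - y\<bar> powr (2 * d + 1))
      else if d = 1/2 then
        \<delta> / 2 * square_integral (\<lambda>x y. sin (2 * pi * i * x) * sin (2 * pi * j * y) * (- ln \<bar>x - y\<bar>))
      else
        - \<delta> / 2 *
          square_integral (\<lambda>x y. sin (2 * pi * i * x) * sin (2 * pi * j * y) * \<bar>x - y\<bar> powr (2 * d - 1)))"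

definition Sigma_mat :: "nat \<Rightarrow> real \<Rightarrow> real \<Rightarrow> real mat" where
  "Sigma_mat s d \<delta> =
     four_block_mat
       (Matrix.mat s s (\<lambda>(i, j). Sigma_c d \<delta> (i + 1) (j + 1))) (0\<^sub>m s s)
       (0\<^sub>m s s) (Matrix.mat s s (\<lambda>(i, j). Sigma_s d \<delta> (i + 1) (j + 1)))"

definition D_mat :: "nat \<Rightarrow> real \<Rightarrow> real \<Rightarrow> real mat" where
  "D_mat s d \<delta> =
     (let E = mat_diag s (\<lambda>i. Sigma_c d \<delta> (i + 1) (i + 1) + Sigma_s d \<delta> (i + 1) (i + 1))
      in four_block_mat E (0\<^sub>m s s) (0\<^sub>m s s) E)"

definition periodogram :: "(nat \<Rightarrow> 'a \<Rightarrow> real) \<Rightarrow> nat \<Rightarrow> real \<Rightarrow> 'a \<Rightarrow> real" where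
  "periodogram X n \<theta> \<omega> =
     1 / (2 * pi * n) *
     (cmod (\<Sum>t = 1..n. complex_of_real (X t \<omega>) * exp (\<i> * complex_of_real (t * \<theta>))))\<^sup>2"

definition block_periodogram :: "(nat \<Rightarrow> 'a \<Rightarrow> real) \<Rightarrow> nat \<Rightarrow> nat \<Rightarrow> real \<Rightarrow> 'a \<Rightarrow> real" where
  "block_periodogram X l h \<theta> \<omega> =
     1 / (2 * pi * l) *
     (cmod (\<Sum>t = (h - 1) * l + 1..h * l.
        complex_of_real (X t \<omega>) * exp (\<i> * complex_of_real (t * \<theta>))))\<^sup>2"

text \<open>Where the averaged periodogram in a denominator vanishes, the corresponding ratio is 0.\<close>

definition Q_stat ::
  "(nat \<Rightarrow> 'a \<Rightarrow> real) \<Rightarrow> nat \<Rightarrow> real \<Rightarrow> nat \<Rightarrow> nat \<Rightarrow> 'a \<Rightarrow> real" where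
  "Q_stat X s d m l \<omega> =
     (let n = m * l in
      real m powr (- 2 * d) *
      (\<Sum>j = (1::nat)..s.
         periodogram X n (2 * pi * real j / real n) \<omega> /
         (1 / m * (\<Sum>h = 1..m. block_periodogram X l h (2 * pi * real j / real l) \<omega>))))"

definition chi_square_1 :: "real measure" where
  "chi_square_1 = distr (density lborel std_normal_density) borel (\<lambda>x. x\<^sup>2)"

end

theory Submission
  imports Defs "HOL-Real_Asymp.Real_Asymp"
begin

text \<open>Put \<open>Y = X\<close> if \<open>d < 1/2\<close> and \<open>Y\<^sub>t = X\<^sub>t - X\<^sub>t\<^sub>-\<^sub>1\<close> otherwise. As full trigonometric sums vanish, every Fourier
  coefficient is a weighted sum of the stationary process \<open>Y\<close>, with tail sums of the trigonometric
  weights in the second case. Summation by parts expresses its variance through the variance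
  \<open>V h\<close> of partial sums of \<open>Y\<close>, and \<open>V h\<close> is asymptotic to a multiple of a power of \<open>h\<close> (of \<open>ln h\<close> at
  \<open>d = 1/2\<close>); so the scaled covariances are Riemann sums converging to the entries of \<open>\<Sigma>(d)\<close>.

  A weighted sum of \<open>Y\<close> is a linear form in the innovations whose largest coefficient is small
  compared with its standard deviation. Hence the full-sample coefficients are asymptotically
  normal, while fourth moments give a mean-square law of large numbers for the block
  averages, which tend to \<open>D\<^sub>j\<^sub>j(d) > 0\<close>. Diagonalising \<open>D\<^sup>-\<^sup>1\<^sup>/\<^sup>2 \<Sigma> D\<^sup>-\<^sup>1\<^sup>/\<^sup>2\<close> turns the limit into a weighted sum of
  independent \<open>\<chi>\<^sup>2(1)\<close> variables; weak convergence is read off from Laplace transforms.\<close>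

section \<open>Laplace transforms and weak convergence\<close>

text \<open>Two obstacles shape the proof. For d <= 0 the kernel |x - y|^(2 d - 1) suggested by the
  autocovariances is not integrable on the square, and for d < 0 the lag sums are small only through
  cancellation. Summation by parts in both variables passes to \<open>lag_variance\<close>, whose
  exponent \<alpha> = 2 d' + 1 lies in [0, 2), d' being the memory parameter of the stationary
  process. The jumps of the weights at both ends of a block then produce the terms a_ij(d); from d =
  1/2 on there are none, because the full trigonometric sum is 0. Second, no smoothness of
  \<open>a\<close> is assumed for d' >= 0, so the largest coefficient of a weighted sum is bounded
  through two l2 norms, both of which are again quadratic lag sums. All quantities are nonnegative,
  and on [0, \<infinity>) the function exp (- lam x) is bounded and Lipschitz: random denominators
  are replaced in mean, with no lower bound on them. Positivity of D_jj(d) is not visible from the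
  double integrals; cosine and sine entries together reduce to Fourier integrals of powers over full
  periods, whose signs follow by parts.\<close>

lemma continuous_on_cts_step_ln:
  assumes "x < (y::real)"
  shows "continuous_on {0..1} (\<lambda>t. if t \<le> 0 then 0 else cts_step x y (- ln t))"
proof -
  have *: "continuous_on A (cts_step x y)" for A
    using uniformly_continuous_imp_continuous[OF cts_step_uniformly_continuous[OF assms]]
    by (rule continuous_on_subset) auto
  \<comment> \<open>\<open>cts_step x y\<close> already vanishes beyond \<open>y\<close>, so the cut
    at t = 0 may be moved to t = exp (- y), where both branches agree; the branch with
    \<open>ln\<close> is then only needed for positive t.\<close>
  have eq: "(if t \<le> 0 then 0 else cts_step x y (- ln t))
      = (if t \<le> exp (- y) then 0 else cts_step x y (- ln t))" for t :: real
  proof (cases "t \<le> 0 \<or> t > exp (- y)")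
    case True
    then show ?thesis using exp_gt_zero[of "- y"] by (auto simp del: exp_gt_zero)
  next
    case False
    then have "ln t \<le> - y" using ln_le_cancel_iff[of t "exp (- y)"] by simp
    then show ?thesis using False assms by (simp add: cts_step_def)
  qed
  have "continuous_on {0..1} (\<lambda>t. if t \<le> exp (- y) then 0 else cts_step x y (- ln t))"
  proof (rule continuous_on_cases_le[where h = "\<lambda>t. t"])
    have "continuous_on {t. 0 < t} (\<lambda>t. cts_step x y (- ln t))"
      by (rule continuous_on_compose2[OF *[of UNIV]]) (auto intro!: continuous_intros)
    then show "continuous_on {t \<in> {0..1}. exp (- y) \<le> t} (\<lambda>t. cts_step x y (- ln t))"
      by (rule continuous_on_subset) (auto intro: less_le_trans[OF exp_gt_zero])
  qed (use assms in \<open>auto simp: cts_step_def\<close>)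
  then show ?thesis using eq by simp
qed

text \<open>The substitution t = exp (- u) maps [0, \<infinity>) into [0,1]. There polynomials are
  dense, and the integral of a polynomial in exp (- u) is a combination of Laplace transforms at
  natural numbers. Hence integer arguments suffice, the argument 0 being the total mass.\<close>

theorem weak_conv_m_Laplace:
  fixes \<mu> :: "nat \<Rightarrow> real measure" and \<nu> :: "real measure"
  assumes "\<And>n. real_distribution (\<mu> n)" and "real_distribution \<nu>"
    and pos: "\<And>n. AE x in \<mu> n. x \<ge> 0" "AE x in \<nu>. x \<ge> 0"
    and lim: "\<And>k::nat. k > 0 \<Longrightarrow>
      (\<lambda>n. \<integral>x. exp (- real k * x) \<partial>\<mu> n) \<longlonglongrightarrow> (\<integral>x. exp (- real k * x) \<partial>\<nu>)"
  shows "weak_conv_m \<mu> \<nu>"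
proof (rule integral_cts_step_conv_imp_weak_conv[OF assms(1,2)])
  fix x y :: real assume xy: "x < y"
  interpret \<mu>: real_distribution "\<mu> n" for n by fact
  interpret \<nu>: real_distribution \<nu> by fact
  define g where "g = (\<lambda>t. if t \<le> 0 then 0 else cts_step x y (- ln t))"
  have g_exp: "cts_step x y u = g (exp (- u))" for u by (simp add: g_def)
  have exp_int: "integrable \<rho> (\<lambda>x. exp (- real k * x))" if "real_distribution \<rho>" "AE x in \<rho>. x \<ge> 0"
    for \<rho> :: "real measure" and k
  proof -
    interpret \<rho>: real_distribution \<rho> by fact
    show ?thesis
      by (rule \<rho>.integrable_const_bound[of _ 1]) (use that(2) in auto)
  qed
  show "(\<lambda>n. integral\<^sup>L (\<mu> n) (cts_step x y)) \<longlonglongrightarrow> integral\<^sup>L \<nu> (cts_step x y)"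
  proof (rule LIMSEQ_I)
    fix e :: real assume e: "e > 0"
    obtain p where p: "real_polynomial_function p" "\<And>t. t \<in> {0..1} \<Longrightarrow> \<bar>g t - p t\<bar> < e / 4"
      using Stone_Weierstrass_real_polynomial_function[of "{0..1::real}" g "e / 4"]
        continuous_on_cts_step_ln[OF xy] e unfolding g_def by auto
    obtain a N where pa: "p = (\<lambda>t. \<Sum>i\<le>N. a i * t ^ i)"
      using p(1) real_polynomial_function_iff_sum by blast
    define P where "P u = (\<Sum>i\<le>N. a i * exp (- real i * u))" for u
    have P_p: "P u = p (exp (- u))" for u
      by (simp add: P_def pa exp_of_nat_mult[symmetric] mult_ac)
    have close: "\<bar>cts_step x y u - P u\<bar> \<le> e / 4" if "u \<ge> 0" for u
      using p(2)[of "exp (- u)"] that by (simp add: g_exp P_p less_imp_le)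
    have int_P: "integrable \<rho> P" "integral\<^sup>L \<rho> P = (\<Sum>i\<le>N. a i * (\<integral>x. exp (- real i * x) \<partial>\<rho>))"
      and close_int: "\<bar>integral\<^sup>L \<rho> (cts_step x y) - integral\<^sup>L \<rho> P\<bar> \<le> e / 4"
      if \<rho>: "real_distribution \<rho>" "AE x in \<rho>. x \<ge> 0" for \<rho> :: "real measure"
    proof -
      interpret \<rho>: real_distribution \<rho> by fact
      show i: "integrable \<rho> P" unfolding P_def
        by (intro Bochner_Integration.integrable_sum integrable_mult_right exp_int \<rho>)
      show "integral\<^sup>L \<rho> P = (\<Sum>i\<le>N. a i * (\<integral>x. exp (- real i * x) \<partial>\<rho>))" unfolding P_def
        by (subst Bochner_Integration.integral_sum)
           (auto intro!: integrable_mult_right exp_int[OF \<rho>, simplified])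
      note ic = \<rho>.integrable_cts_step[OF xy]
      have "\<bar>integral\<^sup>L \<rho> (cts_step x y) - integral\<^sup>L \<rho> P\<bar> = \<bar>\<integral>u. cts_step x y u - P u \<partial>\<rho>\<bar>"
        by (simp add: i ic)
      also have "\<dots> \<le> (\<integral>u. \<bar>cts_step x y u - P u\<bar> \<partial>\<rho>)"
        by (rule integral_abs_bound)
      also have "\<dots> \<le> (\<integral>u. e / 4 \<partial>\<rho>)"
        using \<rho>(2) close by (intro integral_mono_AE) (auto simp: i ic)
      also have "\<dots> = e / 4" using \<rho>.prob_space by simp
      finally show "\<bar>integral\<^sup>L \<rho> (cts_step x y) - integral\<^sup>L \<rho> P\<bar> \<le> e / 4" .
    qed
    have "(\<lambda>n. integral\<^sup>L (\<mu> n) P) \<longlonglongrightarrow> integral\<^sup>L \<nu> P"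
    proof -
      have "(\<lambda>n. \<integral>x. exp (- real k * x) \<partial>\<mu> n) \<longlonglongrightarrow> (\<integral>x. exp (- real k * x) \<partial>\<nu>)" for k :: nat
      proof (cases "k = 0")
        case True
        then show ?thesis using \<mu>.prob_space \<nu>.prob_space by simp
      qed (use lim in simp)
      then show ?thesis
        using assms(1,2) pos by (simp only: int_P) (intro tendsto_intros)
    qed
    then obtain n0 where n0: "\<And>n. n \<ge> n0 \<Longrightarrow> \<bar>integral\<^sup>L (\<mu> n) P - integral\<^sup>L \<nu> P\<bar> < e / 4"
      using LIMSEQ_D[of "\<lambda>n. integral\<^sup>L (\<mu> n) P" "integral\<^sup>L \<nu> P" "e / 4"] e by auto
    show "\<exists>n0. \<forall>n\<ge>n0. norm (integral\<^sup>L (\<mu> n) (cts_step x y) - integral\<^sup>L \<nu> (cts_step x y)) < e"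
    proof (intro exI[of _ n0] allI impI)
      fix n assume n: "n \<ge> n0"
      show "norm (integral\<^sup>L (\<mu> n) (cts_step x y) - integral\<^sup>L \<nu> (cts_step x y)) < e"
        using n0[OF n] close_int[OF assms(1)[of n] pos(1)] close_int[OF assms(2) pos(2)] e
        unfolding real_norm_def by arith
    qed
  qed
qed

context prob_space
begin

text \<open>The characteristic function of the normal law read from right to left (the
  Hubbard-Stratonovich identity): the square in the exponent becomes linear at the price of one more
  Gaussian integration.\<close>

lemma exp_square_conv_normal:
  "complex_of_real (exp (- lam * x\<^sup>2)) = (\<integral>g. iexp (sqrt (2 * lam) * x * g) \<partial>std_normal_distribution)"
  if "lam \<ge> 0" for lam x :: real
proof -
  have "(\<integral>g. iexp (sqrt (2 * lam) * x * g) \<partial>std_normal_distribution)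
    = char std_normal_distribution (sqrt (2 * lam) * x)"
    by (simp add: char_def)
  also have "\<dots> = complex_of_real (exp (- (sqrt (2 * lam) * x)\<^sup>2 / 2))"
    by (simp add: char_std_normal_distribution)
  also have "(sqrt (2 * lam) * x)\<^sup>2 = 2 * lam * x\<^sup>2" using that by (simp add: power_mult_distrib)
  finally show ?thesis by simp
qed

text \<open>The squares are linearised one at a time by integrating the characteristic function
  against a standard normal density.\<close>

lemma Laplace_sum_squares_tendsto:
  fixes L :: "nat \<Rightarrow> nat \<Rightarrow> 'a \<Rightarrow> real" and \<zeta> :: "nat \<Rightarrow> real" and N :: nat and lam :: real
  assumes meas[measurable]: "\<And>n p. p < N \<Longrightarrow> L n p \<in> borel_measurable M"
    and lim: "\<And>u. (\<lambda>n. expectation (\<lambda>\<omega>. iexp (\<Sum>p<N. u p * L n p \<omega>)))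
        \<longlonglongrightarrow> complex_of_real (exp (- (\<Sum>p<N. \<zeta> p * (u p)\<^sup>2) / 2))"
    and \<zeta>: "\<And>p. p < N \<Longrightarrow> \<zeta> p \<ge> 0" and lam: "lam \<ge> 0"
  shows "(\<lambda>n. expectation (\<lambda>\<omega>. exp (- lam * (\<Sum>p<N. (L n p \<omega>)\<^sup>2))))
        \<longlonglongrightarrow> (\<Prod>p<N. \<integral>g. exp (- lam * \<zeta> p * g\<^sup>2) \<partial>std_normal_distribution)"
proof -
  interpret G: real_distribution std_normal_distribution by (rule real_dist_normal_dist)
  interpret P: pair_prob_space M std_normal_distribution ..
  let ?G = "\<lambda>p. \<integral>g. exp (- lam * \<zeta> p * g\<^sup>2) \<partial>std_normal_distribution"
  \<comment> \<open>Induction invariant: the coordinates below \<open>q\<close> already carry their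
    squares, the others still enter linearly with frequencies \<open>u\<close>. The claim is for all
    \<open>u\<close> because the induction step needs it with entry \<open>q\<close> replaced by a
    multiple of the integration variable.\<close>
  have main: "q \<le> N \<Longrightarrow> (\<lambda>n. expectation (\<lambda>\<omega>. complex_of_real (exp (- lam * (\<Sum>p<q. (L n p \<omega>)\<^sup>2)))
         * iexp (\<Sum>p=q..<N. u p * L n p \<omega>)))
      \<longlonglongrightarrow> complex_of_real ((\<Prod>p<q. ?G p) * exp (- (\<Sum>p=q..<N. \<zeta> p * (u p)\<^sup>2) / 2))" for q u
  proof (induction q arbitrary: u)
    case 0
    show ?case using lim[of u] by (simp add: atLeast0LessThan)
  next
    case (Suc q)
    define U where "U g = u(q := sqrt (2 * lam) * g)" for g
    have sumU: "(\<Sum>p=q..<N. U g p * x p) = sqrt (2 * lam) * g * x q + (\<Sum>p=Suc q..<N. u p * x p)" for g x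
      using Suc.prems by (simp add: sum.atLeast_Suc_lessThan U_def)
    have sumU2: "(\<Sum>p=q..<N. \<zeta> p * (U g p)\<^sup>2) = 2 * lam * \<zeta> q * g\<^sup>2 + (\<Sum>p=Suc q..<N. \<zeta> p * (u p)\<^sup>2)" for g
      using Suc.prems lam by (simp add: sum.atLeast_Suc_lessThan U_def power_mult_distrib)
    define h where "h n \<omega> g = complex_of_real (exp (- lam * (\<Sum>p<q. (L n p \<omega>)\<^sup>2)))
         * iexp (\<Sum>p=q..<N. U g p * L n p \<omega>)" for n \<omega> g
    have Lm: "(\<lambda>x. L n p (fst x)) \<in> borel_measurable (M \<Otimes>\<^sub>M std_normal_distribution)" if "p < N" for n p
      using measurable_compose[OF measurable_fst meas[OF that]] .
    have hm: "(\<lambda>(\<omega>, g). h n \<omega> g) \<in> borel_measurable (M \<Otimes>\<^sub>M std_normal_distribution)" for n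
      unfolding h_def sumU split_def using Suc.prems
      by (intro borel_measurable_times borel_measurable_of_real borel_measurable_exp
          borel_measurable_sum borel_measurable_power borel_measurable_const borel_measurable_add Lm
          borel_measurable_continuous_onI measurable_compose[OF measurable_snd])
         (auto intro!: Lm measurable_compose[OF measurable_snd] continuous_intros borel_measurable_add
          borel_measurable_times borel_measurable_sum)
    have hb: "norm (h n \<omega> g) \<le> 1" for n \<omega> g
      unfolding h_def norm_mult using lam
      by (simp del: of_real_mult of_real_sum of_real_add of_real_exp add: norm_of_real sum_nonneg mult_nonneg_nonneg)
    have hi: "integrable (M \<Otimes>\<^sub>M std_normal_distribution) (\<lambda>(\<omega>, g). h n \<omega> g)" for n
      by (rule P.integrable_const_bound[of _ 1]) (use hb hm in auto)
    have "expectation (\<lambda>\<omega>. complex_of_real (exp (- lam * (\<Sum>p<Suc q. (L n p \<omega>)\<^sup>2)))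
         * iexp (\<Sum>p=Suc q..<N. u p * L n p \<omega>)) = (\<integral>g. expectation (\<lambda>\<omega>. h n \<omega> g) \<partial>std_normal_distribution)" for n
    proof -
      have "complex_of_real (exp (- lam * (\<Sum>p<Suc q. (L n p \<omega>)\<^sup>2))) * iexp (\<Sum>p=Suc q..<N. u p * L n p \<omega>)
        = (\<integral>g. h n \<omega> g \<partial>std_normal_distribution)" for \<omega>
      proof -
        have "h n \<omega> g = complex_of_real (exp (- lam * (\<Sum>p<q. (L n p \<omega>)\<^sup>2)))
           * iexp (\<Sum>p=Suc q..<N. u p * L n p \<omega>) * iexp (sqrt (2 * lam) * L n q \<omega> * g)" for g
          unfolding h_def sumU by (simp add: ring_distribs exp_add mult_ac)
        then have "(\<integral>g. h n \<omega> g \<partial>std_normal_distribution)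
          = complex_of_real (exp (- lam * (\<Sum>p<q. (L n p \<omega>)\<^sup>2)))
           * iexp (\<Sum>p=Suc q..<N. u p * L n p \<omega>) * complex_of_real (exp (- lam * (L n q \<omega>)\<^sup>2))"
          using exp_square_conv_normal[OF lam, of "L n q \<omega>"] by simp
        also have "\<dots> = complex_of_real (exp (- lam * (\<Sum>p<Suc q. (L n p \<omega>)\<^sup>2))) * iexp (\<Sum>p=Suc q..<N. u p * L n p \<omega>)"
          by (simp add: ring_distribs exp_add[symmetric] of_real_mult[symmetric] del: of_real_exp of_real_mult of_real_sum)
        finally show ?thesis by simp
      qed
      then show ?thesis using P.Fubini_integral[OF hi] by simp
    qed
    \<comment> \<open>For fixed g the convergence is the induction hypothesis at \<open>U g\<close>;
      dominated convergence with the constant bound 1 integrates it.\<close>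
    moreover have "(\<lambda>n. \<integral>g. expectation (\<lambda>\<omega>. h n \<omega> g) \<partial>std_normal_distribution) \<longlonglongrightarrow>
       (\<integral>g. complex_of_real ((\<Prod>p<q. ?G p) * exp (- (\<Sum>p=q..<N. \<zeta> p * (U g p)\<^sup>2) / 2)) \<partial>std_normal_distribution)"
    proof (rule integral_dominated_convergence[where w = "\<lambda>_. 1"])
      show "AE g in std_normal_distribution. (\<lambda>n. expectation (\<lambda>\<omega>. h n \<omega> g)) \<longlonglongrightarrow>
         complex_of_real ((\<Prod>p<q. ?G p) * exp (- (\<Sum>p=q..<N. \<zeta> p * (U g p)\<^sup>2) / 2))"
        unfolding h_def using Suc.IH Suc.prems by simp
      show "(\<lambda>g. expectation (\<lambda>\<omega>. h n \<omega> g)) \<in> borel_measurable std_normal_distribution" for n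
        using borel_measurable_integrable[OF P.integrable_snd[OF hi]] .
      have "norm (expectation (\<lambda>\<omega>. h n \<omega> g)) \<le> 1" for n g
      proof (rule order_trans[OF integral_norm_bound])
        show "expectation (\<lambda>\<omega>. norm (h n \<omega> g)) \<le> 1"
        proof (rule integral_le_const)
          have "(\<lambda>\<omega>. h n \<omega> g) \<in> borel_measurable M"
            using measurable_compose[OF measurable_Pair2'[of g std_normal_distribution M] hm[of n]] by simp
          then show "integrable M (\<lambda>\<omega>. norm (h n \<omega> g))"
            by (intro integrable_const_bound[of _ 1]) (auto simp: hb)
        qed (auto simp: hb)
      qed
      then show "AE g in std_normal_distribution. norm (expectation (\<lambda>\<omega>. h n \<omega> g)) \<le> 1" for n by simp
      show "(\<lambda>g. complex_of_real ((\<Prod>p<q. ?G p) * exp (- (\<Sum>p=q..<N. \<zeta> p * (U g p)\<^sup>2) / 2)))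
         \<in> borel_measurable std_normal_distribution"
        unfolding sumU2 by measurable
    qed simp
    moreover have "(\<integral>g. complex_of_real ((\<Prod>p<q. ?G p) * exp (- (\<Sum>p=q..<N. \<zeta> p * (U g p)\<^sup>2) / 2)) \<partial>std_normal_distribution)
      = complex_of_real ((\<Prod>p<Suc q. ?G p) * exp (- (\<Sum>p=Suc q..<N. \<zeta> p * (u p)\<^sup>2) / 2))"
    proof -
      have "exp (- (\<Sum>p=q..<N. \<zeta> p * (U g p)\<^sup>2) / 2) = exp (- lam * \<zeta> q * g\<^sup>2) * exp (- (\<Sum>p=Suc q..<N. \<zeta> p * (u p)\<^sup>2) / 2)" for g
        unfolding sumU2 by (simp add: exp_add[symmetric] field_simps)
      then show ?thesis by (simp add: integral_of_real[symmetric] mult_ac del: of_real_mult of_real_exp)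
    qed
    ultimately show ?case by (simp only:)
  qed
  have "(\<lambda>n. complex_of_real (expectation (\<lambda>\<omega>. exp (- lam * (\<Sum>p<N. (L n p \<omega>)\<^sup>2)))))
      \<longlonglongrightarrow> complex_of_real (\<Prod>p<N. ?G p)"
    using main[of N] by (simp add: integral_of_real[symmetric] del: of_real_exp)
  then show ?thesis by (simp only: tendsto_of_real_iff)
qed

end

section \<open>Diagonalisation of symmetric matrices\<close>

unbundle no inner_syntax and no vec_syntax

text \<open>The fundamental theorem of algebra supplies a complex eigenvector x + i y. Symmetry
  forces its eigenvalue to be real, after which x and y both satisfy the eigenvalue equation, and at
  least one of them is nonzero.\<close>

lemma real_symmetric_eigenvector:
  fixes A :: "real mat"
  assumes A: "A \<in> carrier_mat n n" and sym: "transpose_mat A = A" and n: "n > 0"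
  obtains e v where "v \<in> carrier_vec n" "v \<bullet> v = 1" "A *\<^sub>v v = e \<cdot>\<^sub>v v"
proof -
  define C where "C = map_mat complex_of_real A"
  have C: "C \<in> carrier_mat n n" using A by (simp add: C_def)
  have "degree (char_poly C) = n" using degree_monic_char_poly[OF C] by simp
  then have "\<not> constant (poly (char_poly C))" using n by (simp add: constant_degree)
  then obtain z where "poly (char_poly C) z = 0" using fundamental_theorem_of_algebra by blast
  then have "eigenvalue C z" using eigenvalue_root_char_poly[OF C] by simp
  then obtain w where w: "w \<in> carrier_vec n" "w \<noteq> 0\<^sub>v n" "C *\<^sub>v w = z \<cdot>\<^sub>v w"
    using C unfolding eigenvalue_def eigenvector_def by auto
  define x where "x = map_vec Re w"
  define y where "y = map_vec Im w"
  have xy: "x \<in> carrier_vec n" "y \<in> carrier_vec n" using w by (auto simp: x_def y_def)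
  have comp: "(\<Sum>j<n. A $$ (i,j) * x $ j) = Re z * x $ i - Im z * y $ i"
    "(\<Sum>j<n. A $$ (i,j) * y $ j) = Im z * x $ i + Re z * y $ i" if i: "i < n" for i
  proof -
    have "(C *\<^sub>v w) $ i = (\<Sum>j<n. complex_of_real (A $$ (i,j)) * w $ j)"
      using i A w(1) by (simp add: C_def scalar_prod_def atLeast0LessThan)
    moreover have "(C *\<^sub>v w) $ i = z * w $ i" using w i by simp
    ultimately have *: "(\<Sum>j<n. complex_of_real (A $$ (i,j)) * w $ j) = z * w $ i" by (simp only:)
    show "(\<Sum>j<n. A $$ (i,j) * x $ j) = Re z * x $ i - Im z * y $ i"
      using arg_cong[OF *, of Re] i w by (simp add: x_def y_def)
    show "(\<Sum>j<n. A $$ (i,j) * y $ j) = Im z * x $ i + Re z * y $ i"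
      using arg_cong[OF *, of Im] i w by (simp add: x_def y_def)
  qed
  have symij: "A $$ (i,j) = A $$ (j,i)" if "i < n" "j < n" for i j
    using that A arg_cong[OF sym, of "\<lambda>B. B $$ (j,i)"] by simp
  \<comment> \<open>Evaluating the symmetric form x A y = y A x with the two component equations
    leaves Im z times |x|^2 + |y|^2.\<close>
  have "(\<Sum>i<n. x $ i * (\<Sum>j<n. A $$ (i,j) * y $ j)) = (\<Sum>j<n. y $ j * (\<Sum>i<n. A $$ (j,i) * x $ i))"
    unfolding sum_distrib_left by (subst sum.swap) (auto intro!: sum.cong simp: symij)
  then have "(\<Sum>i<n. x $ i * (Im z * x $ i + Re z * y $ i)) = (\<Sum>i<n. y $ i * (Re z * x $ i - Im z * y $ i))"
    using comp by simp
  then have "Im z * (\<Sum>i<n. (x $ i)\<^sup>2 + (y $ i)\<^sup>2) = 0"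
    by (simp add: ring_distribs sum.distrib sum_subtractf sum_distrib_left power2_eq_square mult_ac)
  moreover have "(\<Sum>i<n. (x $ i)\<^sup>2 + (y $ i)\<^sup>2) \<noteq> 0"
  proof
    assume "(\<Sum>i<n. (x $ i)\<^sup>2 + (y $ i)\<^sup>2) = 0"
    then have "\<forall>i<n. (x $ i)\<^sup>2 + (y $ i)\<^sup>2 = 0" by (subst (asm) sum_nonneg_eq_0_iff) auto
    then have "\<forall>i<n. w $ i = 0" using w by (auto simp: x_def y_def complex_eq_iff sum_power2_eq_zero_iff)
    then show False using w by (auto intro!: eq_vecI)
  qed
  ultimately have im: "Im z = 0" by simp
  have ev: "A *\<^sub>v x = Re z \<cdot>\<^sub>v x" "A *\<^sub>v y = Re z \<cdot>\<^sub>v y"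
    using comp A xy im by (auto intro!: eq_vecI simp: scalar_prod_def atLeast0LessThan)
  have "\<exists>u\<in>{x, y}. u \<noteq> 0\<^sub>v n"
  proof (rule ccontr)
    assume "\<not> ?thesis"
    then have "x $ i = 0" "y $ i = 0" if "i < n" for i using that by auto
    then have "w $ i = 0" if "i < n" for i
      using that w by (auto simp: x_def y_def complex_eq_iff)
    then show False using w by (auto intro!: eq_vecI)
  qed
  then obtain u where u: "u \<in> carrier_vec n" "u \<noteq> 0\<^sub>v n" "A *\<^sub>v u = Re z \<cdot>\<^sub>v u" using ev xy by blast
  have "u \<bullet> u \<noteq> 0"
  proof
    assume "u \<bullet> u = 0"
    then have "(\<Sum>i<n. (u $ i)\<^sup>2) = 0" using u by (simp add: scalar_prod_def atLeast0LessThan power2_eq_square)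
    then have "\<forall>i<n. u $ i = 0" by (subst (asm) sum_nonneg_eq_0_iff) auto
    then show False using u by (auto intro!: eq_vecI)
  qed
  moreover have "u \<bullet> u \<ge> 0" using u by (auto simp: scalar_prod_def intro!: sum_nonneg)
  ultimately have pos: "u \<bullet> u > 0" by simp
  define v where "v = (1 / sqrt (u \<bullet> u)) \<cdot>\<^sub>v u"
  have "v \<in> carrier_vec n" using u by (simp add: v_def)
  moreover have "v \<bullet> v = 1" using u pos by (simp add: v_def)
  moreover have "A *\<^sub>v v = Re z \<cdot>\<^sub>v v"
    using u A by (simp add: v_def mult_mat_vec smult_smult_assoc mult.commute)
  ultimately show ?thesis using that by blast
qed

text \<open>The reflection is the Householder matrix of \<open>e\<^sub>0 - v\<close>.\<close>

lemma reflection_to_unit_vec: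
  fixes v :: "real vec"
  assumes v: "v \<in> carrier_vec n" "v \<bullet> v = 1" and n: "n > 0"
  obtains H where "H \<in> carrier_mat n n" "transpose_mat H = H" "H * H = 1\<^sub>m n" "H *\<^sub>v v = unit_vec n 0"
proof -
  define u where "u i = (if i = 0 then 1 else 0) - v $ i" for i
  have vv: "(\<Sum>i<n. v $ i * v $ i) = 1" using v by (simp add: scalar_prod_def atLeast0LessThan)
  have d: "(\<Sum>i<n. (if i = 0 then 1 else 0) * f i) = f 0" for f :: "nat \<Rightarrow> real"
  proof -
    have "(\<Sum>i<n. (if i = 0 then 1 else 0) * f i) = (\<Sum>i<n. if i = 0 then f i else 0)"
      by (intro sum.cong) auto
    then show ?thesis using n by simp
  qed
  have uv: "(\<Sum>i<n. u i * v $ i) = v $ 0 - 1"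
    by (simp add: u_def left_diff_distrib sum_subtractf vv d del: mult_cancel_right2)
  have u_0: "u 0 = 1 - v $ 0" by (simp add: u_def)
  have uu: "(\<Sum>i<n. u i * u i) = 2 - 2 * v $ 0"
  proof -
    have "(\<Sum>i<n. u i * u i) = (\<Sum>i<n. (if i = 0 then 1 else 0) * u i) - (\<Sum>i<n. u i * v $ i)"
      by (subst sum_subtractf[symmetric], intro sum.cong) (auto simp: u_def algebra_simps)
    then show ?thesis by (simp only: uv d u_0)
  qed
  \<comment> \<open>\<open>c\<close> is 2 / |u|^2, since |u|^2 = 2 - 2 v_0. If v_0 = 1, then v is
    already the first unit vector, u = 0, and the value 0 makes \<open>H\<close> the
    identity.\<close>
  define c where "c = (if v $ 0 = 1 then 0 else 1 / (1 - v $ 0))"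
  have c: "c * (c * (\<Sum>k<n. u k * u k)) = 2 * c"
    by (simp add: c_def uu divide_simps)
  have u0: "u i = 0" if "v $ 0 = 1" "i < n" for i
  proof -
    have "(\<Sum>i<n. u i * u i) = 0" using uu that by simp
    then have "\<forall>i<n. u i * u i = 0" by (subst (asm) sum_nonneg_eq_0_iff) auto
    then show ?thesis using that by simp
  qed
  define H where "H = mat n n (\<lambda>(i,j). (if i = j then 1 else 0) - c * u i * u j)"
  have H: "H \<in> carrier_mat n n" by (simp add: H_def)
  have "H * H = 1\<^sub>m n"
  proof (rule eq_matI)
    fix i j assume "i < dim_row (1\<^sub>m n :: real mat)" "j < dim_col (1\<^sub>m n :: real mat)"
    then have ij: "i < n" "j < n" by auto
    have "(H * H) $$ (i, j) = (\<Sum>k<n. ((if i = k then 1 else 0) - c * u i * u k) * ((if k = j then 1 else 0) - c * u k * u j))"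
      using ij by (simp add: H_def scalar_prod_def atLeast0LessThan)
    also have "\<dots> = (\<Sum>k<n. (if k = i then (if i = j then 1 else 0) - c * u i * u j else 0)
        - (if k = j then c * u i * u j else 0) + u i * u j * (c * (c * (u k * u k))))"
      by (intro sum.cong) (auto simp: algebra_simps)
    also have "\<dots> = (if i = j then 1 else 0) - c * u i * u j - c * u i * u j + u i * u j * (c * (c * (\<Sum>k<n. u k * u k)))"
      using ij by (simp only: sum.distrib sum_subtractf sum_distrib_left) simp
    also have "\<dots> = (if i = j then 1 else 0)" unfolding c by (simp add: algebra_simps)
    finally show "(H * H) $$ (i, j) = 1\<^sub>m n $$ (i, j)" using ij by simp
  qed (simp_all add: H_def)
  moreover have "H *\<^sub>v v = unit_vec n 0"
  proof (rule eq_vecI)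
    fix i assume "i < dim_vec (unit_vec n 0 :: real vec)"
    then have i: "i < n" by simp
    have "(H *\<^sub>v v) $ i = (\<Sum>k<n. ((if i = k then 1 else 0) - c * u i * u k) * v $ k)"
      using i v by (simp add: H_def scalar_prod_def atLeast0LessThan)
    also have "\<dots> = (\<Sum>k<n. (if k = i then v $ i else 0) - c * u i * (u k * v $ k))"
      by (intro sum.cong) (auto simp: algebra_simps)
    also have "\<dots> = v $ i - c * u i * (v $ 0 - 1)"
      using i by (simp only: sum_subtractf sum_distrib_left[symmetric] uv) simp
    also have "\<dots> = v $ i + u i" using u0[OF _ i] by (auto simp: c_def field_simps)
    finally show "(H *\<^sub>v v) $ i = unit_vec n 0 $ i" using i by (simp add: u_def)
  qed (simp_all add: H_def)
  moreover have "transpose_mat H = H" by (rule eq_matI) (auto simp: H_def)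
  ultimately show ?thesis using H that by blast
qed

text \<open>Induction on the dimension: a reflection carries a unit eigenvector to the first basis
  vector, so the first column of \<open>H * A * H\<close> is a multiple of that vector, by symmetry
  the first row as well, and the remaining block is symmetric of size n.\<close>

theorem real_symmetric_diagonalization:
  fixes A :: "real mat"
  assumes "A \<in> carrier_mat n n" and "transpose_mat A = A"
  obtains P \<zeta> where "P \<in> carrier_mat n n" "transpose_mat P * P = 1\<^sub>m n" "P * transpose_mat P = 1\<^sub>m n"
    "transpose_mat P * A * P = mat_diag n \<zeta>"
proof -
  have "\<exists>P \<zeta>. P \<in> carrier_mat n n \<and> transpose_mat P * P = 1\<^sub>m n \<and> transpose_mat P * A * P = mat_diag n \<zeta>"
    using assms
  proof (induction n arbitrary: A)
    case 0
    then show ?case by (intro exI[of _ A] exI[of _ "\<lambda>_. 0"]) (auto intro!: eq_matI simp: mat_diag_def)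
  next
    case (Suc n)
    obtain e v where v: "v \<in> carrier_vec (Suc n)" "v \<bullet> v = 1" "A *\<^sub>v v = e \<cdot>\<^sub>v v"
      using real_symmetric_eigenvector[OF Suc.prems zero_less_Suc] by blast
    obtain H where H: "H \<in> carrier_mat (Suc n) (Suc n)" "transpose_mat H = H" "H * H = 1\<^sub>m (Suc n)"
      "H *\<^sub>v v = unit_vec (Suc n) 0"
      using reflection_to_unit_vec[OF v(1,2)] by auto
    note A = Suc.prems(1)
    define B where "B = H * A * H"
    have B: "B \<in> carrier_mat (Suc n) (Suc n)" using H A by (simp add: B_def)
    have Bsym: "transpose_mat B = B"
      using H A Suc.prems(2) by (simp add: B_def transpose_mult[of _ "Suc n" "Suc n" _ "Suc n"] assoc_mult_mat[of _ "Suc n" "Suc n" _ "Suc n" _ "Suc n"])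
    \<comment> \<open>The reflection is its own inverse, so it carries the first unit vector back to
      v.\<close>
    have "H *\<^sub>v unit_vec (Suc n) 0 = v"
      using H v by (simp add: H(4)[symmetric] assoc_mult_mat_vec[symmetric, of _ "Suc n" "Suc n" _ "Suc n"])
    then have "B *\<^sub>v unit_vec (Suc n) 0 = e \<cdot>\<^sub>v unit_vec (Suc n) 0"
      using H A v by (simp add: B_def assoc_mult_mat_vec[of _ "Suc n" "Suc n" _ "Suc n"] mult_mat_vec[of _ "Suc n" "Suc n"])
    moreover have "(B *\<^sub>v unit_vec (Suc n) 0) $ i = B $$ (i, 0)" if "i < Suc n" for i
      using B that by simp
    ultimately have Bi0: "B $$ (i, 0) = (if i = 0 then e else 0)" if "i < Suc n" for i
      using that by (simp del: mult_mat_vec flip: \<open>\<And>i. i < Suc n \<Longrightarrow> (B *\<^sub>v unit_vec (Suc n) 0) $ i = B $$ (i, 0)\<close>)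
    have symB: "B $$ (i,j) = B $$ (j,i)" if "i < Suc n" "j < Suc n" for i j
      using that B arg_cong[OF Bsym, of "\<lambda>B. B $$ (j,i)"] by simp
    define A' where "A' = mat n n (\<lambda>(i,j). B $$ (Suc i, Suc j))"
    have A': "A' \<in> carrier_mat n n" by (simp add: A'_def)
    have "transpose_mat A' = A'" by (rule eq_matI) (auto simp: A'_def symB)
    then obtain P' \<zeta>' where P': "P' \<in> carrier_mat n n" "transpose_mat P' * P' = 1\<^sub>m n" "transpose_mat P' * A' * P' = mat_diag n \<zeta>'"
      using Suc.IH[OF A'] by blast
    define E where "E = mat 1 1 (\<lambda>_. e)"
    have E: "E \<in> carrier_mat 1 1" by (simp add: E_def)
    have B4: "B = four_block_mat E (0\<^sub>m 1 n) (0\<^sub>m n 1) A'"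
    proof (rule eq_matI, goal_cases)
      case (1 i j)
      then have "i < Suc n" "j < Suc n" using A' by (auto simp: E_def)
      then show ?case using Bi0 symB[of 0 j] A' by (auto simp: E_def A'_def)
    qed (use B A' in \<open>auto simp: E_def\<close>)
    define R where "R = four_block_mat (1\<^sub>m 1) (0\<^sub>m 1 n) (0\<^sub>m n 1) P'"
    have R: "R \<in> carrier_mat (Suc n) (Suc n)" using P' by (auto simp: R_def)
    have Rt: "transpose_mat R = four_block_mat (1\<^sub>m 1) (0\<^sub>m 1 n) (0\<^sub>m n 1) (transpose_mat P')"
      using P' by (simp add: R_def transpose_four_block_mat[of _ 1 1 _ n _ n])
    have RR: "transpose_mat R * R = 1\<^sub>m (Suc n)"
    proof -
      have "transpose_mat R * R = four_block_mat (1\<^sub>m 1) (0\<^sub>m 1 n) (0\<^sub>m n 1) (1\<^sub>m n)"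
        unfolding Rt unfolding R_def using P'
        by (subst mult_four_block_mat[of _ 1 1 _ n _ n _ _ 1 _ n]) auto
      then show ?thesis by (metis four_block_one_mat plus_1_eq_Suc)
    qed
    have RBR: "transpose_mat R * B * R = four_block_mat E (0\<^sub>m 1 n) (0\<^sub>m n 1) (mat_diag n \<zeta>')"
    proof -
      have "transpose_mat R * B = four_block_mat E (0\<^sub>m 1 n) (0\<^sub>m n 1) (transpose_mat P' * A')"
        unfolding Rt B4 using P' A' E by (subst mult_four_block_mat[of _ 1 1 _ n _ n _ _ 1 _ n]) auto
      then show ?thesis unfolding R_def using P' A' E
        by (simp, subst mult_four_block_mat[of _ 1 1 _ n _ n _ _ 1 _ n]) auto
    qed
    have diag: "four_block_mat E (0\<^sub>m 1 n) (0\<^sub>m n 1) (mat_diag n \<zeta>') = mat_diag (Suc n) (\<lambda>i. if i = 0 then e else \<zeta>' (i - 1))"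
      by (rule eq_matI) (auto simp: E_def mat_diag_def)
    show ?case
    proof (intro exI conjI)
      show "H * R \<in> carrier_mat (Suc n) (Suc n)" using H R by simp
      have t: "transpose_mat (H * R) = transpose_mat R * H"
        using transpose_mult[OF H(1) R] H(2) by simp
      have tR: "transpose_mat R \<in> carrier_mat (Suc n) (Suc n)" using R by simp
      note as = assoc_mult_mat[of _ "Suc n" "Suc n" _ "Suc n" _ "Suc n"]
      have "H * (H * R) = R" using as[OF H(1) H(1) R] H(3) R by simp
      then have "transpose_mat R * H * (H * R) = 1\<^sub>m (Suc n)"
        using H R tR RR by (simp add: as[OF tR])
      then show "transpose_mat (H * R) * (H * R) = 1\<^sub>m (Suc n)" using t by simp
      have "transpose_mat R * H * A * (H * R) = transpose_mat R * (H * A * H) * R"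
        using H R A tR by (simp add: as[OF tR] as[OF H(1)] as[OF A])
      then show "transpose_mat (H * R) * A * (H * R) = mat_diag (Suc n) (\<lambda>i. if i = 0 then e else \<zeta>' (i - 1))"
        using t RBR diag by (simp add: B_def)
    qed
  qed
  then obtain P \<zeta> where P: "P \<in> carrier_mat n n" "transpose_mat P * P = 1\<^sub>m n"
     "transpose_mat P * A * P = mat_diag n \<zeta>" by blast
  moreover have "P * transpose_mat P = 1\<^sub>m n"
    using mat_mult_left_right_inverse[OF _ P(1) P(2)] P(1) by simp
  ultimately show ?thesis using that by blast
qed

text \<open>With E = D^(1/2) and F = D^(-1/2), the symmetric matrix F A F is diagonalised by an
  orthogonal P, and \<open>w p\<close> is column p of P scaled by F. The first identity is
  orthonormality of the rows of P, the second the diagonal form, and the third holds since A D^(-1)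
  = E (F A F) F is similar to F A F. If A is a covariance matrix, the linear forms given by
  \<open>w\<close> are uncorrelated.\<close>

theorem scaled_diagonalization:
  fixes A :: "real mat" and D :: "nat \<Rightarrow> real"
  assumes A: "A \<in> carrier_mat n n" and sym: "transpose_mat A = A" and D: "\<And>i. i < n \<Longrightarrow> D i > 0"
  obtains w \<zeta> where "\<And>x. (\<Sum>p<n. (\<Sum>i<n. w p i * x i)\<^sup>2) = (\<Sum>i<n. (x i)\<^sup>2 / D i)"
    "\<And>p q. p < n \<Longrightarrow> q < n \<Longrightarrow>
      (\<Sum>i<n. \<Sum>j<n. w p i * w q j * A $$ (i, j)) = (if p = q then \<zeta> p else 0)"
    "char_poly (A * mat_diag n (\<lambda>i. 1 / D i)) = (\<Prod>i<n. [:- \<zeta> i, 1:])"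
proof -
  define E where "E = mat_diag n (\<lambda>i. sqrt (D i))"
  define F where "F = mat_diag n (\<lambda>i. 1 / sqrt (D i))"
  have EF: "E \<in> carrier_mat n n" "F \<in> carrier_mat n n" by (simp_all add: E_def F_def)
  have EFid: "E * F = 1\<^sub>m n"
  proof -
    have "E * F = mat_diag n (\<lambda>i. sqrt (D i) * (1 / sqrt (D i)))"
      unfolding E_def F_def by (rule mat_diag_diag)
    also have "\<dots> = 1\<^sub>m n" using D by (intro eq_matI) (auto simp: mat_diag_def less_imp_le dest: D)
    finally show ?thesis .
  qed
  have FE: "F * E = 1\<^sub>m n" using mat_mult_left_right_inverse[OF EF EFid] .
  have FF: "F * F = mat_diag n (\<lambda>i. 1 / D i)"
  proof -
    have "F * F = mat_diag n (\<lambda>i. 1 / sqrt (D i) * (1 / sqrt (D i)))"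
      unfolding F_def by (rule mat_diag_diag)
    also have "\<dots> = mat_diag n (\<lambda>i. 1 / D i)"
      using D by (intro eq_matI) (auto simp: mat_diag_def less_imp_le real_sqrt_mult_self dest!: D)
    finally show ?thesis .
  qed
  have Ft: "transpose_mat F = F" by (rule eq_matI) (auto simp: F_def mat_diag_def)
  define B where "B = F * A * F"
  have B: "B \<in> carrier_mat n n" using A EF by (simp add: B_def)
  note as = assoc_mult_mat[of _ n n _ n _ n]
  have "transpose_mat B = B"
    using A EF sym Ft by (simp add: B_def transpose_mult[of _ n n _ n] as)
  then obtain P \<zeta> where P: "P \<in> carrier_mat n n" "transpose_mat P * P = 1\<^sub>m n" "P * transpose_mat P = 1\<^sub>m n"
    "transpose_mat P * B * P = mat_diag n \<zeta>"
    using real_symmetric_diagonalization[OF B] by blast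
  have tP: "transpose_mat P \<in> carrier_mat n n" using P by simp
  define w where "w p i = P $$ (i, p) / sqrt (D i)" for p i
  show ?thesis
  proof
    fix x :: "nat \<Rightarrow> real"
    have PP: "(\<Sum>p<n. P $$ (i, p) * P $$ (j, p)) = (if i = j then 1 else 0)" if "i < n" "j < n" for i j
    proof -
      have "(P * transpose_mat P) $$ (i, j) = (\<Sum>p<n. P $$ (i, p) * P $$ (j, p))"
        using P(1) that by (simp add: scalar_prod_def atLeast0LessThan)
      then show ?thesis using P(3) that by simp
    qed
    define y where "y i = x i / sqrt (D i)" for i
    have "(\<Sum>p<n. (\<Sum>i<n. w p i * x i)\<^sup>2) = (\<Sum>p<n. \<Sum>i<n. \<Sum>j<n. y i * y j * (P $$ (i, p) * P $$ (j, p)))"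
      unfolding power2_eq_square sum_product
      by (intro sum.cong) (auto simp: w_def y_def)
    also have "\<dots> = (\<Sum>i<n. \<Sum>p<n. \<Sum>j<n. y i * y j * (P $$ (i, p) * P $$ (j, p)))"
      by (rule sum.swap)
    also have "\<dots> = (\<Sum>i<n. \<Sum>j<n. \<Sum>p<n. y i * y j * (P $$ (i, p) * P $$ (j, p)))"
      by (intro sum.cong refl sum.swap)
    also have "\<dots> = (\<Sum>i<n. \<Sum>j<n. if j = i then y i * y i else 0)"
      by (intro sum.cong refl) (auto simp: sum_distrib_left[symmetric] PP)
    also have "\<dots> = (\<Sum>i<n. (x i)\<^sup>2 / D i)"
      by (auto simp: y_def power2_eq_square[symmetric] power_divide less_imp_le D intro!: sum.cong)
    finally show "(\<Sum>p<n. (\<Sum>i<n. w p i * x i)\<^sup>2) = (\<Sum>i<n. (x i)\<^sup>2 / D i)" .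
  next
    fix p q assume pq: "p < n" "q < n"
    have Bij: "B $$ (i, j) = A $$ (i, j) / (sqrt (D i) * sqrt (D j))" if "i < n" "j < n" for i j
    proof -
      have "F * A = Matrix.mat n n (\<lambda>(i, j). 1 / sqrt (D i) * A $$ (i, j))"
        unfolding F_def by (rule mat_diag_mult_left[OF A])
      moreover have "F * A * F = Matrix.mat n n (\<lambda>(i, j). (F * A) $$ (i, j) * (1 / sqrt (D j)))"
        unfolding F_def by (rule mat_diag_mult_right) (rule mult_carrier_mat[OF EF(2)[unfolded F_def] A])
      ultimately show ?thesis using that by (simp add: B_def)
    qed
    have "(\<Sum>i<n. \<Sum>j<n. w p i * w q j * A $$ (i, j)) = (\<Sum>i<n. \<Sum>j<n. P $$ (i, p) * B $$ (i, j) * P $$ (j, q))"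
      by (auto intro!: sum.cong simp: w_def Bij)
    also have "\<dots> = (transpose_mat P * B * P) $$ (p, q)"
      using pq P(1) B by (simp add: scalar_prod_def atLeast0LessThan sum_distrib_left mult.assoc)
    finally show "(\<Sum>i<n. \<Sum>j<n. w p i * w q j * A $$ (i, j)) = (if p = q then \<zeta> p else 0)"
      using pq by (auto simp: P(4) mat_diag_def)
  next
    have "similar_mat_wit B (mat_diag n \<zeta>) P (transpose_mat P)"
    proof (rule similar_mat_witI)
      have "P * (transpose_mat P * B * P) * transpose_mat P = (P * transpose_mat P) * B * (P * transpose_mat P)"
        using P(1) tP B by (simp add: as del: P)
      then show "B = P * mat_diag n \<zeta> * transpose_mat P" using P B by simp
    qed (use P B in auto)
    then have "char_poly B = char_poly (mat_diag n \<zeta>)"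
      by (intro char_poly_similar) (auto simp: similar_mat_def)
    moreover have "similar_mat_wit (A * (F * F)) B E F"
    proof (rule similar_mat_witI)
      have "E * B * F = (E * F) * A * (F * F)"
        using A EF by (simp add: B_def as del: EFid)
      then show "A * (F * F) = E * B * F" using A EF EFid by simp
    qed (use A EF EFid FE B in auto)
    then have "char_poly (A * (F * F)) = char_poly B"
      by (intro char_poly_similar) (auto simp: similar_mat_def)
    moreover have "char_poly (mat_diag n \<zeta>) = (\<Prod>i<n. [:- \<zeta> i, 1:])"
    proof -
      have "char_poly (mat_diag n \<zeta>) = (\<Prod>a\<leftarrow>diag_mat (mat_diag n \<zeta>). [:- a, 1:])"
        by (rule char_poly_upper_triangular[of _ n]) (auto simp: mat_diag_def)
      also have "diag_mat (mat_diag n \<zeta>) = map \<zeta> [0..<n]"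
        by (auto simp: diag_mat_def mat_diag_def intro!: nth_equalityI)
      finally show ?thesis by (simp add: prod.list_conv_set_nth atLeast0LessThan o_def)
    qed
    ultimately show "char_poly (A * mat_diag n (\<lambda>i. 1 / D i)) = (\<Prod>i<n. [:- \<zeta> i, 1:])"
      by (simp add: FF)
  qed
qed

section \<open>Linear forms in the innovations\<close>

text \<open>The terms are nested to the left with the powers of \<open>e\<close> last, the shape in
  which the integrability and independence rules for products of four factors apply.\<close>

lemma square_times_square:
  fixes e j k x y :: real
  shows "(x * e + j)\<^sup>2 * (y * e + k)\<^sup>2
      = j * j * k * k + 2 * x * (j * k * k * e)
        + 2 * y * (j * j * k * e) + 4 * x * y * (j * k * e * e)
        + y\<^sup>2 * (j * j * e * e) + x\<^sup>2 * (k * k * e * e)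
        + 2 * x * y\<^sup>2 * (j * e * e * e) + 2 * x\<^sup>2 * y * (k * e * e * e)
        + x\<^sup>2 * y\<^sup>2 * (e * e * e * e)"
  by (simp add: power2_eq_square algebra_simps)

context prob_space
begin

text \<open>The space L^4: it is closed under linear combinations, and every product of at most four
  members is integrable, which covers the moments of linear forms up to order four.\<close>

definition fourth_power_integrable :: "('a \<Rightarrow> real) \<Rightarrow> bool" where
  "fourth_power_integrable f \<longleftrightarrow> f \<in> borel_measurable M \<and> integrable M (\<lambda>\<omega>. (f \<omega>) ^ 4)"

text \<open>Two rounds of the inequality between arithmetic and geometric mean bound the product by
  the sum of the fourth powers.\<close>

lemma integrable_mult4:
  assumes "fourth_power_integrable f" "fourth_power_integrable g"
    "fourth_power_integrable h" "fourth_power_integrable k"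
  shows "integrable M (\<lambda>\<omega>. f \<omega> * g \<omega> * h \<omega> * k \<omega>)"
proof (rule Bochner_Integration.integrable_bound)
  show "integrable M (\<lambda>\<omega>. (f \<omega>) ^ 4 + (g \<omega>) ^ 4 + (h \<omega>) ^ 4 + (k \<omega>) ^ 4)"
    using assms by (auto simp: fourth_power_integrable_def)
  show "(\<lambda>\<omega>. f \<omega> * g \<omega> * h \<omega> * k \<omega>) \<in> borel_measurable M"
    using assms by (auto simp: fourth_power_integrable_def)
  have "norm (a * b * c * d) \<le> norm (a ^ 4 + b ^ 4 + c ^ 4 + d ^ 4)" for a b c d :: real
  proof -
    define p q where "p = a * b" and "q = c * d"
    have pq: "\<bar>p * q\<bar> \<le> p\<^sup>2 + q\<^sup>2"
      using sum_squares_bound[of "\<bar>p\<bar>" "\<bar>q\<bar>"] mult_nonneg_nonneg[of "\<bar>p\<bar>" "\<bar>q\<bar>"]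
      by (simp add: abs_mult del: mult_nonneg_nonneg zero_le_mult_iff)
    have "x\<^sup>2 * y\<^sup>2 \<le> x ^ 4 + y ^ 4" for x y :: real
    proof -
      have "2 * (x\<^sup>2 * y\<^sup>2) \<le> x ^ 4 + y ^ 4"
        using sum_squares_bound[of "x\<^sup>2" "y\<^sup>2"] by (simp add: power_mult[symmetric] mult.assoc)
      moreover have "0 \<le> x\<^sup>2 * y\<^sup>2" by simp
      ultimately show ?thesis by linarith
    qed
    then have p: "p\<^sup>2 \<le> a ^ 4 + b ^ 4" and q: "q\<^sup>2 \<le> c ^ 4 + d ^ 4"
      by (auto simp: p_def q_def power_mult_distrib)
    have "a * b * c * d = p * q" by (simp add: p_def q_def)
    then show ?thesis using pq p q by simp
  qed
  then show "AE \<omega> in M. norm (f \<omega> * g \<omega> * h \<omega> * k \<omega>) \<le> norm ((f \<omega>) ^ 4 + (g \<omega>) ^ 4 + (h \<omega>) ^ 4 + (k \<omega>) ^ 4)"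
    by auto
qed

lemma fourth_power_integrable_const [simp]: "fourth_power_integrable (\<lambda>_. c)"
  by (simp add: fourth_power_integrable_def)

lemma fourth_power_integrable_cmult:
  "fourth_power_integrable f \<Longrightarrow> fourth_power_integrable (\<lambda>\<omega>. c * f \<omega>)"
  by (auto simp: fourth_power_integrable_def power_mult_distrib)

lemma fourth_power_integrable_add:
  assumes f: "fourth_power_integrable f" and g: "fourth_power_integrable g"
  shows "fourth_power_integrable (\<lambda>\<omega>. f \<omega> + g \<omega>)"
proof -
  have eq: "(f \<omega> + g \<omega>) ^ 4 = f \<omega> * f \<omega> * f \<omega> * f \<omega> + 4 * (f \<omega> * f \<omega> * f \<omega> * g \<omega>)
     + 6 * (f \<omega> * f \<omega> * g \<omega> * g \<omega>) + 4 * (f \<omega> * g \<omega> * g \<omega> * g \<omega>) + g \<omega> * g \<omega> * g \<omega> * g \<omega>" for \<omega>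
    by (simp add: power4_eq_xxxx algebra_simps)
  show ?thesis unfolding fourth_power_integrable_def eq
    using f g by (auto intro!: Bochner_Integration.integrable_add integrable_mult_right integrable_mult4
      simp: fourth_power_integrable_def[of f] fourth_power_integrable_def[of g])
qed

lemma fourth_power_integrable_sum:
  "(\<And>i. i \<in> F \<Longrightarrow> fourth_power_integrable (f i)) \<Longrightarrow> fourth_power_integrable (\<lambda>\<omega>. \<Sum>i\<in>F. f i \<omega>)"
  by (induction F rule: infinite_finite_induct) (auto intro: fourth_power_integrable_add)

lemma integrable_mult_le4:
  assumes "fourth_power_integrable f"
  shows "integrable M f" "fourth_power_integrable g \<Longrightarrow> integrable M (\<lambda>\<omega>. f \<omega> * g \<omega>)"
    "fourth_power_integrable g \<Longrightarrow> fourth_power_integrable h \<Longrightarrow> integrable M (\<lambda>\<omega>. f \<omega> * g \<omega> * h \<omega>)"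
  using integrable_mult4[OF assms, of "\<lambda>_. 1" "\<lambda>_. 1" "\<lambda>_. 1"]
    integrable_mult4[OF assms, of g "\<lambda>_. 1" "\<lambda>_. 1"] integrable_mult4[OF assms, of g h "\<lambda>_. 1"] by auto

text \<open>Nonnegativity of the variance of |f|.\<close>

lemma expectation_abs_le_sqrt:
  assumes "f \<in> borel_measurable M" "integrable M (\<lambda>\<omega>. (f \<omega>)\<^sup>2)"
  shows "expectation (\<lambda>\<omega>. \<bar>f \<omega>\<bar>) \<le> sqrt (expectation (\<lambda>\<omega>. (f \<omega>)\<^sup>2))"
proof -
  have "(expectation (\<lambda>\<omega>. \<bar>f \<omega>\<bar>))\<^sup>2 \<le> expectation (\<lambda>\<omega>. \<bar>f \<omega>\<bar>\<^sup>2)"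
  proof -
    have i: "integrable M f" using square_integrable_imp_integrable[OF assms] .
    have "0 \<le> variance (\<lambda>\<omega>. \<bar>f \<omega>\<bar>)" by simp
    also have "\<dots> = expectation (\<lambda>\<omega>. \<bar>f \<omega>\<bar>\<^sup>2) - (expectation (\<lambda>\<omega>. \<bar>f \<omega>\<bar>))\<^sup>2"
      using i assms by (subst variance_eq) auto
    finally show ?thesis by simp
  qed
  then show ?thesis by (simp add: real_le_rsqrt)
qed

end

section \<open>Moments and characteristic functions of finite linear forms\<close>

locale innovation_space = prob_space M for M :: "'a measure" +
  fixes \<sigma> :: real and \<epsilon> :: "int \<Rightarrow> 'a \<Rightarrow> real"
  assumes innovations: "innovations \<sigma> \<epsilon>"
begin

definition linear_form :: "int set \<Rightarrow> (int \<Rightarrow> real) \<Rightarrow> 'a \<Rightarrow> real" where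
  "linear_form F b \<omega> = (\<Sum>k\<in>F. b k * \<epsilon> k \<omega>)"

definition fourth_moment :: real where
  "fourth_moment = expectation (\<lambda>\<omega>. (\<epsilon> 0 \<omega>) ^ 4)"

lemma sigma_pos: "\<sigma> > 0" using innovations by (simp add: innovations_def)

lemma indep: "indep_vars (\<lambda>_. borel) \<epsilon> UNIV" using innovations by (simp add: innovations_def)

lemma eps_measurable [measurable]: "\<epsilon> k \<in> borel_measurable M"
  using indep by (simp add: indep_vars_def)

lemma distr_eps: "distr M borel (\<epsilon> k) = distr M borel (\<epsilon> 0)"
  using innovations unfolding innovations_def by blast

lemma eps_integral:
  fixes g :: "real \<Rightarrow> real"
  assumes [measurable]: "g \<in> borel_measurable borel"
  shows "expectation (\<lambda>\<omega>. g (\<epsilon> k \<omega>)) = expectation (\<lambda>\<omega>. g (\<epsilon> 0 \<omega>))"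
    "integrable M (\<lambda>\<omega>. g (\<epsilon> k \<omega>)) \<longleftrightarrow> integrable M (\<lambda>\<omega>. g (\<epsilon> 0 \<omega>))"
  using integral_distr[of "\<epsilon> k" M borel g] integral_distr[of "\<epsilon> 0" M borel g]
    integrable_distr_eq[of "\<epsilon> k" M borel g] integrable_distr_eq[of "\<epsilon> 0" M borel g] distr_eps[of k]
  by simp_all

lemma eps_fourth: "fourth_power_integrable (\<epsilon> k)"
  using eps_integral(2)[of "\<lambda>x. x ^ 4" k] innovations
  by (simp add: fourth_power_integrable_def innovations_def)

lemma eps_moments:
  "expectation (\<epsilon> k) = 0" "expectation (\<lambda>\<omega>. \<epsilon> k \<omega> * \<epsilon> k \<omega>) = \<sigma>\<^sup>2"
  "expectation (\<lambda>\<omega>. \<epsilon> k \<omega> * \<epsilon> k \<omega> * \<epsilon> k \<omega> * \<epsilon> k \<omega>) = fourth_moment"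
proof -
  show "expectation (\<epsilon> k) = 0"
    using eps_integral(1)[of "\<lambda>x. x" k] innovations by (simp add: innovations_def)
  have v: "variance (\<epsilon> 0) = \<sigma>\<^sup>2" and z: "expectation (\<epsilon> 0) = 0"
    using innovations unfolding innovations_def by blast+
  have "expectation (\<lambda>\<omega>. (\<epsilon> 0 \<omega>)\<^sup>2) = \<sigma>\<^sup>2" using v unfolding z by simp
  then show "expectation (\<lambda>\<omega>. \<epsilon> k \<omega> * \<epsilon> k \<omega>) = \<sigma>\<^sup>2"
    using eps_integral(1)[of "\<lambda>x. x * x" k] by (simp add: power2_eq_square)
  show "expectation (\<lambda>\<omega>. \<epsilon> k \<omega> * \<epsilon> k \<omega> * \<epsilon> k \<omega> * \<epsilon> k \<omega>) = fourth_moment"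
    using eps_integral(1)[of "\<lambda>x. x * x * x * x" k] by (simp add: fourth_moment_def power4_eq_xxxx)
qed

lemma linear_form_fourth: "fourth_power_integrable (linear_form F b)"
  unfolding linear_form_def[abs_def]
  by (intro fourth_power_integrable_sum fourth_power_integrable_cmult eps_fourth)

lemma linear_form_measurable [measurable]: "linear_form F b \<in> borel_measurable M"
  using linear_form_fourth by (simp add: fourth_power_integrable_def)

text \<open>Independence of the innovation at \<open>i\<close> from those in \<open>F\<close>. The
  exponents p and q let one rule cover every mixed moment that arises when an index is added to two
  linear forms.\<close>

lemma expectation_mult_eps:
  assumes F: "finite F" "i \<notin> F" and [measurable]: "g \<in> borel_measurable borel"
    and G: "G = (\<lambda>\<omega>. linear_form F b \<omega> ^ p * linear_form F c \<omega> ^ q)" "integrable M G"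
    and g: "integrable M (\<lambda>\<omega>. g (\<epsilon> i \<omega>))"
  shows "expectation (\<lambda>\<omega>. G \<omega> * g (\<epsilon> i \<omega>)) = expectation G * expectation (\<lambda>\<omega>. g (\<epsilon> i \<omega>))"
proof -
  define H where "H f = (\<Sum>k\<in>F. b k * f k) ^ p * (\<Sum>k\<in>F. c k * f k) ^ q" for f :: "int \<Rightarrow> real"
  have [measurable]: "H \<in> borel_measurable (Pi\<^sub>M F (\<lambda>_. borel))"
    unfolding H_def by measurable
  have "indep_var borel ((\<lambda>f. g (f i)) \<circ> (\<lambda>\<omega>. restrict (\<lambda>i. \<epsilon> i \<omega>) {i}))
     borel (H \<circ> (\<lambda>\<omega>. restrict (\<lambda>i. \<epsilon> i \<omega>) F))"
    using F by (intro indep_var_compose[OF indep_var_restrict[OF indep]]) auto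
  also have "(\<lambda>f. g (f i)) \<circ> (\<lambda>\<omega>. restrict (\<lambda>i. \<epsilon> i \<omega>) {i}) = (\<lambda>\<omega>. g (\<epsilon> i \<omega>))" by auto
  also have "H \<circ> (\<lambda>\<omega>. restrict (\<lambda>i. \<epsilon> i \<omega>) F) = G"
    by (auto simp: H_def G linear_form_def cong: sum.cong)
  finally have "expectation (\<lambda>\<omega>. g (\<epsilon> i \<omega>) * G \<omega>) = expectation (\<lambda>\<omega>. g (\<epsilon> i \<omega>)) * expectation G"
    using indep_var_lebesgue_integral g G(2) by blast
  then show ?thesis by (simp add: mult.commute)
qed

text \<open>The third identity is the Gaussian (Isserlis) value plus a correction by the fourth
  cumulant. In the induction on \<open>F\<close>, a third moment of the innovations appears only
  multiplied by the mean of a linear form, so it drops out.\<close>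

lemma linear_form_moments:
  assumes "finite F"
  shows "expectation (linear_form F b) = 0"
    and "expectation (\<lambda>\<omega>. linear_form F b \<omega> * linear_form F c \<omega>) = \<sigma>\<^sup>2 * (\<Sum>k\<in>F. b k * c k)"
    and "expectation (\<lambda>\<omega>. (linear_form F b \<omega>)\<^sup>2 * (linear_form F c \<omega>)\<^sup>2)
      = \<sigma> ^ 4 * ((\<Sum>k\<in>F. (b k)\<^sup>2) * (\<Sum>k\<in>F. (c k)\<^sup>2) + 2 * (\<Sum>k\<in>F. b k * c k)\<^sup>2)
        + (fourth_moment - 3 * \<sigma> ^ 4) * (\<Sum>k\<in>F. (b k)\<^sup>2 * (c k)\<^sup>2)"
proof -
  show E1: "expectation (linear_form F b) = 0" for b and F
    unfolding linear_form_def[abs_def]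
    by (subst Bochner_Integration.integral_sum)
       (auto simp: eps_moments intro!: integrable_mult_right integrable_mult_le4(1) eps_fourth)
  have cov: "expectation (\<lambda>\<omega>. linear_form F b \<omega> * linear_form F c \<omega>) = \<sigma>\<^sup>2 * (\<Sum>k\<in>F. b k * c k)"
    if "finite F" for F b c using that
  proof (induction F)
    case empty
    then show ?case by (simp add: linear_form_def)
  next
    case (insert i F)
    note L = linear_form_fourth eps_fourth
    have ins: "linear_form (insert i F) b \<omega> = b i * \<epsilon> i \<omega> + linear_form F b \<omega>" for b \<omega>
      using insert by (simp add: linear_form_def)
    have e1: "expectation (\<lambda>\<omega>. linear_form F b \<omega> * \<epsilon> i \<omega>) = 0" for b
      using expectation_mult_eps[OF insert(1,2), of "\<lambda>x. x" "linear_form F b" b 1 b 0]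
        integrable_mult_le4(1)[OF linear_form_fourth] integrable_mult_le4(1)[OF eps_fourth]
      by (simp add: E1)
    then have e1': "expectation (\<lambda>\<omega>. \<epsilon> i \<omega> * linear_form F b \<omega>) = 0" for b
      by (simp add: mult.commute)
    have "linear_form (insert i F) b \<omega> * linear_form (insert i F) c \<omega>
      = b i * c i * (\<epsilon> i \<omega> * \<epsilon> i \<omega>) + b i * (linear_form F c \<omega> * \<epsilon> i \<omega>) + c i * (linear_form F b \<omega> * \<epsilon> i \<omega>)
        + linear_form F b \<omega> * linear_form F c \<omega>" for \<omega>
      by (simp add: ins algebra_simps)
    then show ?case using insert
      by (simp add: integrable_mult_le4(2) L e1 e1' eps_moments algebra_simps)
  qed
  show "expectation (\<lambda>\<omega>. linear_form F b \<omega> * linear_form F c \<omega>) = \<sigma>\<^sup>2 * (\<Sum>k\<in>F. b k * c k)"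
    using cov assms .
  show "expectation (\<lambda>\<omega>. (linear_form F b \<omega>)\<^sup>2 * (linear_form F c \<omega>)\<^sup>2)
      = \<sigma> ^ 4 * ((\<Sum>k\<in>F. (b k)\<^sup>2) * (\<Sum>k\<in>F. (c k)\<^sup>2) + 2 * (\<Sum>k\<in>F. b k * c k)\<^sup>2)
        + (fourth_moment - 3 * \<sigma> ^ 4) * (\<Sum>k\<in>F. (b k)\<^sup>2 * (c k)\<^sup>2)"
    using assms
  proof (induction F)
    case empty
    then show ?case by (simp add: linear_form_def)
  next
    case (insert i F)
    note L = linear_form_fourth eps_fourth
    let ?e = "\<epsilon> i" and ?J = "linear_form F b" and ?K = "linear_form F c"
    let ?x = "b i" and ?y = "c i"
    have ins: "linear_form (insert i F) b \<omega> = b i * \<epsilon> i \<omega> + linear_form F b \<omega>" for b \<omega>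
      using insert by (simp add: linear_form_def)
    note I = integrable_mult_le4(1)[OF eps_fourth] integrable_mult_le4(1)[OF linear_form_fourth]
      integrable_mult_le4(2)[OF eps_fourth eps_fourth] integrable_mult_le4(2)[OF linear_form_fourth linear_form_fourth]
      integrable_mult_le4(3)[OF eps_fourth eps_fourth eps_fourth]
      integrable_mult_le4(3)[OF linear_form_fourth linear_form_fourth linear_form_fourth]
      integrable_mult4[OF eps_fourth eps_fourth eps_fourth eps_fourth]
      integrable_mult4[OF linear_form_fourth linear_form_fourth linear_form_fourth linear_form_fourth]
    note ex = expectation_mult_eps[OF insert(1,2)]
    have m1: "expectation (\<lambda>\<omega>. ?J \<omega> * ?K \<omega> * ?K \<omega> * ?e \<omega>) = 0"
      using ex[of "\<lambda>x. x" "\<lambda>\<omega>. ?J \<omega> * ?K \<omega> * ?K \<omega>" b 1 c 2] I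
      by (simp add: eps_moments power2_eq_square mult.assoc)
    have m2: "expectation (\<lambda>\<omega>. ?J \<omega> * ?J \<omega> * ?K \<omega> * ?e \<omega>) = 0"
      using ex[of "\<lambda>x. x" "\<lambda>\<omega>. ?J \<omega> * ?J \<omega> * ?K \<omega>" b 2 c 1] I
      by (simp add: eps_moments power2_eq_square mult.assoc)
    have m3: "expectation (\<lambda>\<omega>. ?J \<omega> * ?K \<omega> * ?e \<omega> * ?e \<omega>) = \<sigma>\<^sup>2 * expectation (\<lambda>\<omega>. ?J \<omega> * ?K \<omega>)"
      using ex[of "\<lambda>x. x * x" "\<lambda>\<omega>. ?J \<omega> * ?K \<omega>" b 1 c 1] I
      by (simp add: eps_moments mult.assoc)
    have m4: "expectation (\<lambda>\<omega>. ?J \<omega> * ?J \<omega> * ?e \<omega> * ?e \<omega>) = \<sigma>\<^sup>2 * expectation (\<lambda>\<omega>. ?J \<omega> * ?J \<omega>)"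
      using ex[of "\<lambda>x. x * x" "\<lambda>\<omega>. ?J \<omega> * ?J \<omega>" b 2 c 0] I
      by (simp add: eps_moments power2_eq_square mult.assoc)
    have m5: "expectation (\<lambda>\<omega>. ?K \<omega> * ?K \<omega> * ?e \<omega> * ?e \<omega>) = \<sigma>\<^sup>2 * expectation (\<lambda>\<omega>. ?K \<omega> * ?K \<omega>)"
      using ex[of "\<lambda>x. x * x" "\<lambda>\<omega>. ?K \<omega> * ?K \<omega>" b 0 c 2] I
      by (simp add: eps_moments power2_eq_square mult.assoc)
    have m6: "expectation (\<lambda>\<omega>. ?J \<omega> * ?e \<omega> * ?e \<omega> * ?e \<omega>) = 0"
      using ex[of "\<lambda>x. x * x * x" "\<lambda>\<omega>. ?J \<omega>" b 1 c 0] I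
      by (simp add: E1 mult.assoc)
    have m7: "expectation (\<lambda>\<omega>. ?K \<omega> * ?e \<omega> * ?e \<omega> * ?e \<omega>) = 0"
      using ex[of "\<lambda>x. x * x * x" "\<lambda>\<omega>. ?K \<omega>" b 0 c 1] I
      by (simp add: E1 mult.assoc)
    have exp: "(linear_form (insert i F) b \<omega>)\<^sup>2 * (linear_form (insert i F) c \<omega>)\<^sup>2
      = ?J \<omega> * ?J \<omega> * ?K \<omega> * ?K \<omega> + 2 * ?x * (?J \<omega> * ?K \<omega> * ?K \<omega> * ?e \<omega>)
        + 2 * ?y * (?J \<omega> * ?J \<omega> * ?K \<omega> * ?e \<omega>) + 4 * ?x * ?y * (?J \<omega> * ?K \<omega> * ?e \<omega> * ?e \<omega>)
        + ?y\<^sup>2 * (?J \<omega> * ?J \<omega> * ?e \<omega> * ?e \<omega>) + ?x\<^sup>2 * (?K \<omega> * ?K \<omega> * ?e \<omega> * ?e \<omega>)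
        + 2 * ?x * ?y\<^sup>2 * (?J \<omega> * ?e \<omega> * ?e \<omega> * ?e \<omega>) + 2 * ?x\<^sup>2 * ?y * (?K \<omega> * ?e \<omega> * ?e \<omega> * ?e \<omega>)
        + ?x\<^sup>2 * ?y\<^sup>2 * (?e \<omega> * ?e \<omega> * ?e \<omega> * ?e \<omega>)" for \<omega>
      unfolding ins by (rule square_times_square)
    have IH: "expectation (\<lambda>\<omega>. ?J \<omega> * ?J \<omega> * ?K \<omega> * ?K \<omega>)
       = \<sigma> ^ 4 * ((\<Sum>k\<in>F. (b k)\<^sup>2) * (\<Sum>k\<in>F. (c k)\<^sup>2) + 2 * (\<Sum>k\<in>F. b k * c k)\<^sup>2)
        + (fourth_moment - 3 * \<sigma> ^ 4) * (\<Sum>k\<in>F. (b k)\<^sup>2 * (c k)\<^sup>2)"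
      using insert.IH by (simp add: power2_eq_square mult.assoc)
    have cov2: "expectation (\<lambda>\<omega>. linear_form F b \<omega> * linear_form F b \<omega>) = \<sigma>\<^sup>2 * (\<Sum>k\<in>F. (b k)\<^sup>2)" for b
      using cov[OF insert(1), of b b] by (simp add: power2_eq_square)
    show ?case unfolding exp
      apply (simp add: integrable_mult4 L m1 m2 m3 m4 m5 m6 m7 IH cov[OF insert(1)] cov2 eps_moments insert(1,2))
      apply (simp add: power2_eq_square power4_eq_xxxx algebra_simps)
      done
  qed
qed

text \<open>The covariance of two squared linear forms is 2 \<sigma>^4 times the squared inner
  product of the coefficient vectors plus a cumulant term; summation gives the variance of the sum,
  whose root bounds the mean absolute deviation.\<close>

lemma sum_squares_deviation:
  fixes b :: "'i \<Rightarrow> int \<Rightarrow> real"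
  assumes F: "finite F"
  shows "expectation (\<lambda>\<omega>. \<bar>\<Sum>h\<in>I. (linear_form F (b h) \<omega>)\<^sup>2 - \<sigma>\<^sup>2 * (\<Sum>k\<in>F. (b h k)\<^sup>2)\<bar>)
    \<le> sqrt (\<Sum>h\<in>I. \<Sum>h'\<in>I. 2 * \<sigma> ^ 4 * (\<Sum>k\<in>F. b h k * b h' k)\<^sup>2
        + (fourth_moment - 3 * \<sigma> ^ 4) * (\<Sum>k\<in>F. (b h k)\<^sup>2 * (b h' k)\<^sup>2))"
proof -
  define q where "q h = \<sigma>\<^sup>2 * (\<Sum>k\<in>F. (b h k)\<^sup>2)" for h
  let ?J = "\<lambda>h. linear_form F (b h)"
  note L = linear_form_fourth
  have J2: "integrable M (\<lambda>\<omega>. (?J h \<omega>)\<^sup>2)" for h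
    using integrable_mult_le4(2)[OF L L] by (simp add: power2_eq_square)
  have J4: "integrable M (\<lambda>\<omega>. (?J h \<omega>)\<^sup>2 * (?J h' \<omega>)\<^sup>2)" for h h'
    using integrable_mult4[OF L L L L] by (simp add: power2_eq_square mult.assoc)
  have EJ2: "expectation (\<lambda>\<omega>. (?J h \<omega>)\<^sup>2) = q h" for h
    using linear_form_moments(2)[OF F, of "b h" "b h"] by (simp add: power2_eq_square q_def)
  have sq: "(\<Sum>h\<in>I. (?J h \<omega>)\<^sup>2 - q h)\<^sup>2
    = (\<Sum>h\<in>I. \<Sum>h'\<in>I. (?J h \<omega>)\<^sup>2 * (?J h' \<omega>)\<^sup>2 - q h * (?J h' \<omega>)\<^sup>2 - q h' * (?J h \<omega>)\<^sup>2 + q h * q h')" for \<omega>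
    unfolding power2_eq_square sum_product by (intro sum.cong refl) (simp add: algebra_simps)
  have int: "integrable M (\<lambda>\<omega>. (?J h \<omega>)\<^sup>2 * (?J h' \<omega>)\<^sup>2 - q h * (?J h' \<omega>)\<^sup>2 - q h' * (?J h \<omega>)\<^sup>2 + q h * q h')" for h h'
    using J2 J4 by simp
  have "expectation (\<lambda>\<omega>. (\<Sum>h\<in>I. (?J h \<omega>)\<^sup>2 - q h)\<^sup>2)
    = (\<Sum>h\<in>I. \<Sum>h'\<in>I. expectation (\<lambda>\<omega>. (?J h \<omega>)\<^sup>2 * (?J h' \<omega>)\<^sup>2) - q h * q h')"
  proof -
    have swap: "expectation (\<lambda>\<omega>. \<Sum>h\<in>I. \<Sum>h'\<in>I. f h h' \<omega>) = (\<Sum>h\<in>I. \<Sum>h'\<in>I. expectation (f h h'))"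
      if "\<And>h h'. integrable M (f h h')" for f :: "'i \<Rightarrow> 'i \<Rightarrow> 'a \<Rightarrow> real"
      using that by (simp add: Bochner_Integration.integral_sum)
    show ?thesis unfolding sq swap[OF int] by (simp add: J2 J4 EJ2 prob_space)
  qed
  also have "\<dots> = (\<Sum>h\<in>I. \<Sum>h'\<in>I. 2 * \<sigma> ^ 4 * (\<Sum>k\<in>F. b h k * b h' k)\<^sup>2
        + (fourth_moment - 3 * \<sigma> ^ 4) * (\<Sum>k\<in>F. (b h k)\<^sup>2 * (b h' k)\<^sup>2))"
    unfolding linear_form_moments(3)[OF F] q_def
    by (intro sum.cong refl) (simp add: power2_eq_square power4_eq_xxxx algebra_simps)
  finally have E: "expectation (\<lambda>\<omega>. (\<Sum>h\<in>I. (?J h \<omega>)\<^sup>2 - q h)\<^sup>2) = \<dots>" .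
  show ?thesis unfolding E[symmetric] q_def[symmetric]
    by (rule expectation_abs_le_sqrt) (measurable, unfold sq, intro Bochner_Integration.integrable_sum int)
qed

text \<open>A quantitative central limit theorem by factorwise comparison: all factors of both
  products have modulus at most 1, so the products differ by at most the sum of the differences of
  the factors. These are of third and fourth order in \<open>b k\<close>; the powers in excess of
  the square are bounded by \<open>B\<close>, which leaves the variance times a quantity vanishing
  with \<open>B\<close>.\<close>

lemma char_linear_form:
  assumes F: "finite F" and B: "\<And>k. k \<in> F \<Longrightarrow> \<bar>b k\<bar> \<le> B"
  shows "cmod (expectation (\<lambda>\<omega>. iexp (linear_form F b \<omega>)) - exp (- \<sigma>\<^sup>2 * (\<Sum>k\<in>F. (b k)\<^sup>2) / 2))
    \<le> (expectation (\<lambda>\<omega>. \<bar>\<epsilon> 0 \<omega>\<bar> ^ 3) * B + \<sigma> ^ 4 * B\<^sup>2) * (\<Sum>k\<in>F. (b k)\<^sup>2)"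
proof -
  define \<phi> where "\<phi> = char (distr M borel (\<epsilon> 0))"
  define m3 where "m3 = expectation (\<lambda>\<omega>. \<bar>\<epsilon> 0 \<omega>\<bar> ^ 3)"
  have m3: "m3 \<ge> 0" by (simp add: m3_def)
  interpret D: real_distribution "distr M borel (\<epsilon> 0)" by (rule real_distribution_distr) simp
  have "char (distr M borel (\<lambda>\<omega>. \<Sum>k\<in>F. b k * \<epsilon> k \<omega>)) 1 = (\<Prod>k\<in>F. char (distr M borel (\<lambda>\<omega>. b k * \<epsilon> k \<omega>)) 1)"
  proof (rule char_distr_sum)
    have "indep_vars (\<lambda>_. borel) \<epsilon> F" by (rule indep_vars_subset[OF indep]) simp
    then show "indep_vars (\<lambda>_. borel) (\<lambda>k \<omega>. b k * \<epsilon> k \<omega>) F"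
      by (rule indep_vars_compose2[where Y = "\<lambda>k x. b k * x"]) simp
  qed
  moreover have "char (distr M borel (\<lambda>\<omega>. b k * \<epsilon> k \<omega>)) 1 = \<phi> (b k)" for k
  proof -
    have "char (distr M borel (\<lambda>\<omega>. b k * \<epsilon> k \<omega>)) 1 = char (distr M borel (\<epsilon> k)) (b k)"
      by (simp add: char_def integral_distr)
    then show ?thesis using distr_eps[of k] by (simp add: \<phi>_def)
  qed
  moreover have "char (distr M borel (\<lambda>\<omega>. \<Sum>k\<in>F. b k * \<epsilon> k \<omega>)) 1 = expectation (\<lambda>\<omega>. iexp (linear_form F b \<omega>))"
    by (simp add: char_def integral_distr linear_form_def)
  ultimately have 1: "expectation (\<lambda>\<omega>. iexp (linear_form F b \<omega>)) = (\<Prod>k\<in>F. \<phi> (b k))" by simp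
  have 2: "complex_of_real (exp (- \<sigma>\<^sup>2 * (\<Sum>k\<in>F. (b k)\<^sup>2) / 2)) = (\<Prod>k\<in>F. complex_of_real (exp (- \<sigma>\<^sup>2 * (b k)\<^sup>2 / 2)))"
    using F by (simp add: exp_sum[symmetric] sum_distrib_left sum_divide_distrib sum_negf
        del: of_real_prod of_real_exp add: of_real_prod[symmetric])
  have "cmod (\<phi> (b k) - complex_of_real (exp (- \<sigma>\<^sup>2 * (b k)\<^sup>2 / 2))) \<le> (m3 * B + \<sigma> ^ 4 * B\<^sup>2) * (b k)\<^sup>2"
    if k: "k \<in> F" for k
  proof -
    let ?t = "b k"
  let ?u = "1 - ?t\<^sup>2 * \<sigma>\<^sup>2 / 2"
    have c1: "cmod (\<phi> ?t - ?u) \<le> ?t\<^sup>2 / 6 * expectation (\<lambda>x. min (6 * (\<epsilon> 0 x)\<^sup>2) (\<bar>?t\<bar> * \<bar>\<epsilon> 0 x\<bar> ^ 3))"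
      unfolding \<phi>_def
      by (rule char_approx3')
         (use innovations integrable_mult_le4(1,2)[OF eps_fourth] eps_fourth in \<open>auto simp: innovations_def power2_eq_square\<close>)
    have i3: "integrable M (\<lambda>x. \<bar>\<epsilon> 0 x\<bar> ^ 3)"
      using integrable_mult_le4(3)[OF eps_fourth eps_fourth eps_fourth, of 0 0 0, THEN integrable_abs]
      by (simp add: power3_eq_cube abs_mult)
    \<comment> \<open>Only the cubic branch of the minimum is kept; it is integrable because fourth
      moments exist.\<close>
    have "expectation (\<lambda>x. min (6 * (\<epsilon> 0 x)\<^sup>2) (\<bar>?t\<bar> * \<bar>\<epsilon> 0 x\<bar> ^ 3)) \<le> expectation (\<lambda>x. \<bar>?t\<bar> * \<bar>\<epsilon> 0 x\<bar> ^ 3)"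
    proof (rule integral_mono)
      show "integrable M (\<lambda>x. min (6 * (\<epsilon> 0 x)\<^sup>2) (\<bar>?t\<bar> * \<bar>\<epsilon> 0 x\<bar> ^ 3))"
        by (rule Bochner_Integration.integrable_bound[OF integrable_mult_right[OF i3, of "\<bar>?t\<bar>"]]) auto
    qed (use i3 in auto)
    also have "\<dots> = \<bar>?t\<bar> * m3" by (simp add: m3_def)
    also have "\<dots> \<le> B * m3" using B[OF k] m3 by (rule mult_right_mono)
    finally have "cmod (\<phi> ?t - ?u) \<le> ?t\<^sup>2 / 6 * (B * m3)"
      using c1 by (meson mult_left_mono order_trans divide_nonneg_nonneg zero_le_power2 zero_le_numeral)
    also have "\<dots> \<le> ?t\<^sup>2 * (B * m3)"
      using B[OF k] m3 by (intro mult_right_mono) auto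
    finally have c2: "cmod (\<phi> ?t - ?u) \<le> m3 * B * ?t\<^sup>2" by (simp add: mult_ac)
    define x where "x = \<sigma>\<^sup>2 * ?t\<^sup>2 / 2"
    have x: "x \<ge> 0" by (simp add: x_def)
    \<comment> \<open>Second-order error of the Gaussian factor: exp (- x) <= 1 / (1 + x), and (1 +
      x) (1 - x + x^2) = 1 + x^3 >= 1.\<close>
    have "exp (- x) \<le> 1 - x + x\<^sup>2"
    proof -
      have "exp (- x) \<le> 1 / (1 + x)"
        using x exp_ge_add_one_self[of x] by (simp add: exp_minus field_simps)
      also have "\<dots> \<le> 1 - x + x\<^sup>2" using x by (simp add: field_simps power2_eq_square)
      finally show ?thesis .
    qed
    moreover have "exp (- x) \<ge> 1 - x" using exp_ge_add_one_self[of "- x"] by simp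
    ultimately have "\<bar>exp (- x) - (1 - x)\<bar> \<le> x\<^sup>2" by simp
    also have "x\<^sup>2 = \<sigma> ^ 4 * ?t\<^sup>2 * ?t\<^sup>2 / 4" by (simp add: x_def power2_eq_square power4_eq_xxxx)
    also have "\<dots> \<le> \<sigma> ^ 4 * B\<^sup>2 * ?t\<^sup>2"
    proof -
      have "?t\<^sup>2 \<le> B\<^sup>2" using B[OF k] by (metis abs_ge_zero power2_abs power_mono)
      then have "\<sigma> ^ 4 * ?t\<^sup>2 * ?t\<^sup>2 \<le> \<sigma> ^ 4 * B\<^sup>2 * ?t\<^sup>2"
        by (intro mult_right_mono mult_left_mono) auto
      moreover have "0 \<le> \<sigma> ^ 4 * ?t\<^sup>2 * ?t\<^sup>2" by simp
      ultimately show ?thesis by linarith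
    qed
    finally have "\<bar>exp (- x) - (1 - x)\<bar> \<le> \<sigma> ^ 4 * B\<^sup>2 * ?t\<^sup>2" .
    then have c3: "cmod (?u - complex_of_real (exp (- \<sigma>\<^sup>2 * ?t\<^sup>2 / 2))) \<le> \<sigma> ^ 4 * B\<^sup>2 * ?t\<^sup>2"
      by (subst of_real_diff[symmetric], subst norm_of_real) (simp add: x_def mult.commute abs_minus_commute)
    have "cmod (\<phi> ?t - complex_of_real (exp (- \<sigma>\<^sup>2 * ?t\<^sup>2 / 2)))
      \<le> cmod (\<phi> ?t - ?u) + cmod (?u - complex_of_real (exp (- \<sigma>\<^sup>2 * ?t\<^sup>2 / 2)))"
      using norm_triangle_ineq[of "\<phi> ?t - ?u" "?u - complex_of_real (exp (- \<sigma>\<^sup>2 * ?t\<^sup>2 / 2))"]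
      by simp
    then show ?thesis using c2 c3 by (simp add: algebra_simps)
  qed
  note 3 = this
  have "cmod ((\<Prod>k\<in>F. \<phi> (b k)) - (\<Prod>k\<in>F. complex_of_real (exp (- \<sigma>\<^sup>2 * (b k)\<^sup>2 / 2))))
    \<le> (\<Sum>k\<in>F. cmod (\<phi> (b k) - complex_of_real (exp (- \<sigma>\<^sup>2 * (b k)\<^sup>2 / 2))))"
    by (rule norm_prod_diff) (auto simp: \<phi>_def D.cmod_char_le_1)
  also have "\<dots> \<le> (\<Sum>k\<in>F. (m3 * B + \<sigma> ^ 4 * B\<^sup>2) * (b k)\<^sup>2)" by (intro sum_mono 3)
  also have "\<dots> = (m3 * B + \<sigma> ^ 4 * B\<^sup>2) * (\<Sum>k\<in>F. (b k)\<^sup>2)" by (simp add: sum_distrib_left)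
  finally show ?thesis unfolding 1 2 m3_def .
qed

end

text \<open>The discriminant criterion behind the Cauchy-Schwarz inequality, a degenerate leading
  coefficient included.\<close>

lemma abs_le_of_quadratic_nonneg:
  fixes A B C :: real
  assumes "\<And>t. A * t\<^sup>2 + 2 * B * t + C \<ge> 0" and "A \<ge> 0"
  shows "B\<^sup>2 \<le> A * C"
proof (cases "A = 0")
  case True
  have "B = 0"
  proof (rule ccontr)
    assume B: "B \<noteq> 0"
    \<comment> \<open>For A = 0 the polynomial is affine, and this argument is chosen to give it the
      value - 1.\<close>
    have "A * (- (C + 1) / (2 * B))\<^sup>2 + 2 * B * (- (C + 1) / (2 * B)) + C = - 1"
      using B True by (simp add: field_simps)
    then show False using assms(1)[of "- (C + 1) / (2 * B)"] by simp
  qed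
  then show ?thesis using True by simp
next
  case False
  then have A: "A > 0" using assms(2) by simp
  have "A * (- B / A)\<^sup>2 + 2 * B * (- B / A) + C = C - B\<^sup>2 / A"
    using A by (simp add: field_simps power2_eq_square)
  then have "B\<^sup>2 / A \<le> C" using assms(1)[of "- B / A"] by simp
  then show ?thesis using A by (simp add: field_simps)
qed

text \<open>Applied to the coefficients of a weighted sum of the process: the increments of its coefficients are
  the coefficients of the sum with incremented weights, so no regularity of \<open>a\<close> is needed.\<close>

lemma square_le_norm_times_increment_norm:
  fixes f :: "int \<Rightarrow> real"
  assumes supp: "\<And>k. k < lo \<Longrightarrow> f k = 0" and k: "lo \<le> k" "k \<le> hi"
  shows "(f k)\<^sup>2 \<le> 2 * sqrt (\<Sum>j\<in>{lo..hi}. (f j)\<^sup>2) * sqrt (\<Sum>j\<in>{lo..hi}. (f j - f (j - 1))\<^sup>2)"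
proof -
  let ?N = "sqrt (\<Sum>j\<in>{lo..hi}. (f j)\<^sup>2)" and ?D = "sqrt (\<Sum>j\<in>{lo..hi}. (f j - f (j - 1))\<^sup>2)"
  \<comment> \<open>Since f vanishes below \<open>lo\<close>, its square telescopes from there. Each
    difference factors as (f j - f (j - 1)) (f j + f (j - 1)), and Cauchy-Schwarz separates the
    increments from the values.\<close>
  have tel: "(f k)\<^sup>2 = (\<Sum>j\<in>{lo..k}. (f j)\<^sup>2 - (f (j - 1))\<^sup>2)"
    using k(1)
  proof (induction k rule: int_ge_induct)
    case base
    then show ?case using supp[of "lo - 1"] by simp
  next
    case (step i)
    have "{lo..i + 1} = insert (i + 1) {lo..i}" using step by auto
    then show ?case using step by simp
  qed
  have cs: "(\<Sum>j\<in>{lo..hi}. \<bar>f j - f (j - 1)\<bar> * \<bar>g j\<bar>) \<le> ?D * sqrt (\<Sum>j\<in>{lo..hi}. (g j)\<^sup>2)" for g :: "int \<Rightarrow> real"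
  proof -
    have "(\<Sum>j\<in>{lo..hi}. \<bar>f j - f (j - 1)\<bar> * \<bar>g j\<bar>)\<^sup>2 \<le> (\<Sum>j\<in>{lo..hi}. (f j - f (j - 1))\<^sup>2) * (\<Sum>j\<in>{lo..hi}. (g j)\<^sup>2)"
      using Cauchy_Schwarz_ineq_sum[of "\<lambda>j. \<bar>f j - f (j - 1)\<bar>" "\<lambda>j. \<bar>g j\<bar>" "{lo..hi}"] by simp
    then show ?thesis unfolding real_sqrt_mult[symmetric] by (rule real_le_rsqrt)
  qed
  have shift: "(\<Sum>j\<in>{lo..hi}. (f (j - 1))\<^sup>2) \<le> (\<Sum>j\<in>{lo..hi}. (f j)\<^sup>2)"
  proof -
    have "(\<Sum>j\<in>{lo..hi}. (f (j - 1))\<^sup>2) = (\<Sum>j\<in>{lo-1..hi-1}. (f j)\<^sup>2)"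
      by (rule sum.reindex_bij_witness[of _ "\<lambda>j. j + 1" "\<lambda>j. j - 1"]) auto
    also have "\<dots> \<le> (\<Sum>j\<in>insert (lo - 1) {lo..hi}. (f j)\<^sup>2)"
      by (rule sum_mono2) auto
    also have "\<dots> = (\<Sum>j\<in>{lo..hi}. (f j)\<^sup>2)" using supp[of "lo - 1"] by simp
    finally show ?thesis .
  qed
  have "(f k)\<^sup>2 \<le> (\<Sum>j\<in>{lo..k}. \<bar>f j - f (j - 1)\<bar> * \<bar>f j\<bar> + \<bar>f j - f (j - 1)\<bar> * \<bar>f (j - 1)\<bar>)"
    unfolding tel
  proof (rule sum_mono)
    fix j
    have "(f j)\<^sup>2 - (f (j - 1))\<^sup>2 = (f j - f (j - 1)) * f j + (f j - f (j - 1)) * f (j - 1)"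
      by (simp add: power2_eq_square algebra_simps)
    also have "\<dots> \<le> \<bar>(f j - f (j - 1)) * f j\<bar> + \<bar>(f j - f (j - 1)) * f (j - 1)\<bar>" by linarith
    finally show "(f j)\<^sup>2 - (f (j - 1))\<^sup>2 \<le> \<bar>f j - f (j - 1)\<bar> * \<bar>f j\<bar> + \<bar>f j - f (j - 1)\<bar> * \<bar>f (j - 1)\<bar>"
      by (simp add: abs_mult)
  qed
  also have "\<dots> \<le> (\<Sum>j\<in>{lo..hi}. \<bar>f j - f (j - 1)\<bar> * \<bar>f j\<bar> + \<bar>f j - f (j - 1)\<bar> * \<bar>f (j - 1)\<bar>)"
    using k by (intro sum_mono2) auto
  also have "\<dots> = (\<Sum>j\<in>{lo..hi}. \<bar>f j - f (j - 1)\<bar> * \<bar>f j\<bar>) + (\<Sum>j\<in>{lo..hi}. \<bar>f j - f (j - 1)\<bar> * \<bar>f (j - 1)\<bar>)"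
    by (rule sum.distrib)
  also have "\<dots> \<le> ?D * ?N + ?D * sqrt (\<Sum>j\<in>{lo..hi}. (f (j - 1))\<^sup>2)"
    by (intro add_mono cs)
  also have "\<dots> \<le> ?D * ?N + ?D * ?N"
    using shift by (intro add_left_mono mult_left_mono) (auto intro!: sum_nonneg)
  finally show ?thesis by (simp add: mult.commute)
qed

text \<open>Fatou's lemma. The series defining the process is known to converge almost surely, and
  this is how moment bounds for its truncations reach the limit.\<close>

lemma integral_le_of_tendsto_AE:
  fixes f :: "'a \<Rightarrow> real"
  assumes "\<And>n. integrable M (F n)" "\<And>n x. F n x \<ge> 0" "f \<in> borel_measurable M"
    and lim: "AE x in M. (\<lambda>n. F n x) \<longlonglongrightarrow> f x"
    and bd: "\<And>n. integral\<^sup>L M (F n) \<le> c n" "c \<longlonglongrightarrow> C"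
  shows "integrable M f" "integral\<^sup>L M f \<le> C"
proof -
  have nonneg: "AE x in M. f x \<ge> 0"
    using lim by eventually_elim (use assms(2) in \<open>auto intro: LIMSEQ_le_const\<close>)
  have c0: "c n \<ge> 0" for n
  proof -
    have "0 \<le> integral\<^sup>L M (F n)" by (rule Bochner_Integration.integral_nonneg) (rule assms(2))
    then show ?thesis using bd(1)[of n] by linarith
  qed
  then have C: "C \<ge> 0" using bd(2) by (auto intro: LIMSEQ_le_const)
  have "(\<integral>\<^sup>+ x. ennreal (f x) \<partial>M) = (\<integral>\<^sup>+ x. liminf (\<lambda>n. ennreal (F n x)) \<partial>M)"
  proof (rule nn_integral_cong_AE)
    show "AE x in M. ennreal (f x) = liminf (\<lambda>n. ennreal (F n x))"
      using lim
    proof eventually_elim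
      case (elim x)
      then have "(\<lambda>n. ennreal (F n x)) \<longlonglongrightarrow> ennreal (f x)" by (rule tendsto_ennrealI)
      then show ?case by (simp add: lim_imp_Liminf)
    qed
  qed
  also have "\<dots> \<le> liminf (\<lambda>n. \<integral>\<^sup>+ x. ennreal (F n x) \<partial>M)"
    by (rule nn_integral_liminf) (use assms(1) in auto)
  also have "\<dots> = liminf (\<lambda>n. ennreal (integral\<^sup>L M (F n)))"
    using assms(1,2) by (simp add: nn_integral_eq_integral)
  also have "\<dots> \<le> liminf (\<lambda>n. ennreal (c n))"
    by (intro Liminf_mono always_eventually allI ennreal_leI bd)
  also have "\<dots> = ennreal C"
    by (intro lim_imp_Liminf tendsto_ennrealI bd) simp
  finally have le: "(\<integral>\<^sup>+ x. ennreal (f x) \<partial>M) \<le> ennreal C" .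
  have "(\<integral>\<^sup>+ x. ennreal (norm (f x)) \<partial>M) = (\<integral>\<^sup>+ x. ennreal (f x) \<partial>M)"
    by (rule nn_integral_cong_AE) (use nonneg in \<open>auto\<close>)
  then show i: "integrable M f"
    using le_less_trans[OF le ennreal_less_top] assms(3) by (intro integrableI_bounded) simp_all
  have "ennreal (integral\<^sup>L M f) \<le> ennreal C"
    using le nn_integral_eq_integral[OF i nonneg] by simp
  then show "integral\<^sup>L M f \<le> C" using C by (simp add: ennreal_le_iff)
qed

lemma (in prob_space) abs_expectation_mult_le:
  assumes [measurable]: "f \<in> borel_measurable M" "g \<in> borel_measurable M"
    and i: "integrable M (\<lambda>\<omega>. (f \<omega>)\<^sup>2)" "integrable M (\<lambda>\<omega>. (g \<omega>)\<^sup>2)"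
  shows "integrable M (\<lambda>\<omega>. f \<omega> * g \<omega>)"
    "\<bar>expectation (\<lambda>\<omega>. f \<omega> * g \<omega>)\<bar> \<le> sqrt (expectation (\<lambda>\<omega>. (f \<omega>)\<^sup>2)) * sqrt (expectation (\<lambda>\<omega>. (g \<omega>)\<^sup>2))"
proof -
  let ?fg = "\<lambda>\<omega>. f \<omega> * g \<omega>"
  let ?g2 = "\<lambda>\<omega>. (g \<omega>)\<^sup>2"
  let ?f2 = "\<lambda>\<omega>. (f \<omega>)\<^sup>2"
  show fg: "integrable M ?fg"
  proof (rule Bochner_Integration.integrable_bound)
    show "integrable M (\<lambda>\<omega>. (f \<omega>)\<^sup>2 + (g \<omega>)\<^sup>2)" using i by simp
    have "\<bar>x * y\<bar> \<le> x\<^sup>2 + y\<^sup>2" for x y :: real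
    proof -
      have "2 * \<bar>x * y\<bar> \<le> x\<^sup>2 + y\<^sup>2" using sum_squares_bound[of "\<bar>x\<bar>" "\<bar>y\<bar>"] by (simp add: abs_mult)
      then show ?thesis using abs_ge_zero[of "x * y"] by linarith
    qed
    then show "AE \<omega> in M. norm (f \<omega> * g \<omega>) \<le> norm ((f \<omega>)\<^sup>2 + (g \<omega>)\<^sup>2)" by simp
  qed simp
  have "(expectation ?fg)\<^sup>2 \<le> expectation ?f2 * expectation ?g2"
  proof (rule abs_le_of_quadratic_nonneg)
    fix t
    have "0 \<le> expectation (\<lambda>\<omega>. (t * f \<omega> + g \<omega>)\<^sup>2)" by simp
    also have "\<dots> = expectation (\<lambda>\<omega>. t\<^sup>2 * (f \<omega>)\<^sup>2 + 2 * t * (f \<omega> * g \<omega>) + (g \<omega>)\<^sup>2)"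
      by (intro Bochner_Integration.integral_cong refl) (simp add: power2_eq_square algebra_simps)
    also have "\<dots> = t\<^sup>2 * expectation ?f2 + 2 * t * expectation ?fg + expectation ?g2"
      using i fg by simp
    also have "\<dots> = expectation ?f2 * t\<^sup>2 + 2 * expectation ?fg * t + expectation ?g2"
      by simp
    finally show "0 \<le> \<dots>" .
  qed simp
  then show "\<bar>expectation ?fg\<bar> \<le> sqrt (expectation ?f2) * sqrt (expectation ?g2)"
    unfolding real_sqrt_mult[symmetric] by (intro real_le_rsqrt) simp
qed

section \<open>Lag products: autocovariances divided by the innovation variance\<close>

definition lag_product :: "(nat \<Rightarrow> real) \<Rightarrow> nat \<Rightarrow> real" where
  "lag_product a h = (\<Sum>j. a j * a (j + h))"

text \<open>The analogue of \<open>lag_product\<close> for the series truncated after index N; the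
  set notation makes it the empty sum for h > N.\<close>

definition lag_product_upto :: "(nat \<Rightarrow> real) \<Rightarrow> nat \<Rightarrow> nat \<Rightarrow> real" where
  "lag_product_upto a N h = (\<Sum>j\<in>{j. j + h \<le> N}. a j * a (j + h))"

lemma summable_lag_product:
  fixes a :: "nat \<Rightarrow> real"
  assumes "summable (\<lambda>j. (a j)\<^sup>2)"
  shows "summable (\<lambda>j. \<bar>a j * a (j + h)\<bar>)"
proof (rule summable_comparison_test')
  show "summable (\<lambda>j. (a j)\<^sup>2 + (a (j + h))\<^sup>2)"
    using assms by (intro summable_add) (auto simp: summable_iff_shift[of "\<lambda>j. (a j)\<^sup>2"])
  fix j
  have "2 * \<bar>a j * a (j + h)\<bar> \<le> (a j)\<^sup>2 + (a (j + h))\<^sup>2"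
    using sum_squares_bound[of "\<bar>a j\<bar>" "\<bar>a (j + h)\<bar>"] by (simp add: abs_mult)
  then show "norm \<bar>a j * a (j + h)\<bar> \<le> (a j)\<^sup>2 + (a (j + h))\<^sup>2"
    using abs_ge_zero[of "a j * a (j + h)"] by simp
qed

lemma lag_product_upto_tendsto:
  assumes "summable (\<lambda>j. (a j)\<^sup>2)"
  shows "(\<lambda>N. lag_product_upto a N h) \<longlonglongrightarrow> lag_product a h"
proof -
  have "(\<lambda>n. \<Sum>j<n. a j * a (j + h)) \<longlonglongrightarrow> lag_product a h"
    unfolding lag_product_def
    by (rule summable_LIMSEQ[OF summable_rabs_cancel[OF summable_lag_product[OF assms]]])
  moreover have "filterlim (\<lambda>N. N + 1 - h) sequentially sequentially"
    by (rule filterlim_at_top_mono[of "\<lambda>N. N - h"]) (auto simp: filterlim_minus_const_nat_at_top intro!: always_eventually diff_le_mono)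
  ultimately have "(\<lambda>N. \<Sum>j<N + 1 - h. a j * a (j + h)) \<longlonglongrightarrow> lag_product a h"
    by (rule filterlim_compose)
  moreover have "{j. j + h \<le> N} = {..<N + 1 - h}" for N by auto
  ultimately show ?thesis by (simp add: lag_product_upto_def)
qed

text \<open>Extension by 0 to all integers, so that translates can be summed over one common window
  without case distinctions.\<close>

definition truncated_coeff :: "(nat \<Rightarrow> real) \<Rightarrow> nat \<Rightarrow> int \<Rightarrow> real" where
  "truncated_coeff a N i = (if 0 \<le> i \<and> i \<le> int N then a (nat i) else 0)"

lemma sum_truncated_coeff:
  fixes p q :: int
  assumes "finite F" "{p - int N..p} \<subseteq> F"
  shows "(\<Sum>k\<in>F. truncated_coeff a N (p - k) * truncated_coeff a N (q - k)) = lag_product_upto a N (nat \<bar>p - q\<bar>)"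
proof -
  have "(\<Sum>k\<in>F. truncated_coeff a N (p - k) * truncated_coeff a N (q - k))
    = (\<Sum>k\<in>{k. p - int N \<le> k \<and> k \<le> p \<and> q - int N \<le> k \<and> k \<le> q}. a (nat (p - k)) * a (nat (q - k)))"
    using assms by (intro sum.mono_neutral_cong_right) (auto simp: truncated_coeff_def)
  also have "\<dots> = (\<Sum>j\<in>{j. j + nat \<bar>p - q\<bar> \<le> N}. a j * a (j + nat \<bar>p - q\<bar>))"
  proof (cases "p \<le> q")
    case True
    show ?thesis
      by (rule sum.reindex_bij_witness[of _ "\<lambda>j. p - int j" "\<lambda>k. nat (p - k)"])
         (use True in \<open>auto simp: nat_add_distrib[symmetric] algebra_simps intro!: arg_cong[of _ _ a]\<close>)
  next
    case False
    show ?thesis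
      by (rule sum.reindex_bij_witness[of _ "\<lambda>j. q - int j" "\<lambda>k. nat (q - k)"])
         (use False in \<open>auto simp: algebra_simps intro!: arg_cong[of _ _ a]\<close>)
  qed
  finally show ?thesis by (simp add: lag_product_upto_def)
qed

text \<open>For \<open>r = lag_product a\<close> this is the covariance, divided by \<sigma>^2, of
  two weighted sums of the process over blocks that start after the times p and q. Keeping
  \<open>r\<close> general lets the same algebra serve the truncated process.\<close>

definition weighted_lag_sum ::
  "(nat \<Rightarrow> real) \<Rightarrow> (nat \<Rightarrow> real) \<Rightarrow> (nat \<Rightarrow> real) \<Rightarrow> nat \<Rightarrow> nat \<Rightarrow> nat \<Rightarrow> real" where
  "weighted_lag_sum r W W' p q l
     = (\<Sum>u = 1..l. \<Sum>v = 1..l. W u * W' v * r (nat \<bar>int (p + u) - int (q + v)\<bar>))"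

text \<open>The weight sequence is extended by 0 beyond both ends of \<open>{1..l}\<close>.\<close>

definition weight_increment :: "nat \<Rightarrow> (nat \<Rightarrow> real) \<Rightarrow> nat \<Rightarrow> real" where
  "weight_increment l W u = (if u \<le> l then W u else 0) - (if u = 1 then 0 else W (u - 1))"

text \<open>For \<open>r = lag_product a\<close>, the squared l2 norm of the increments of the
  coefficient sequence of a weighted sum; the extra index \<open>Suc l\<close> carries the jump from
  the last weight to 0.\<close>

abbreviation increment_lag_sum :: "(nat \<Rightarrow> real) \<Rightarrow> nat \<Rightarrow> (nat \<Rightarrow> real) \<Rightarrow> real" where
  "increment_lag_sum r l W \<equiv> weighted_lag_sum r (weight_increment l W) (weight_increment l W) 0 0 (Suc l)"

definition weighted_sum :: "(nat \<Rightarrow> 'a \<Rightarrow> real) \<Rightarrow> (nat \<Rightarrow> real) \<Rightarrow> nat \<Rightarrow> nat \<Rightarrow> 'a \<Rightarrow> real" where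
  "weighted_sum Y W p l \<omega> = (\<Sum>u = 1..l. W u * Y (p + u) \<omega>)"

text \<open>The coefficient of the innovation at time k in the weighted sum of the truncated
  process.\<close>

definition weighted_coeff :: "(nat \<Rightarrow> real) \<Rightarrow> nat \<Rightarrow> (nat \<Rightarrow> real) \<Rightarrow> nat \<Rightarrow> nat \<Rightarrow> int \<Rightarrow> real" where
  "weighted_coeff a N W p l k = (\<Sum>u = 1..l. W u * truncated_coeff a N (int (p + u) - k))"

lemma weighted_coeff_eq_0: "k < - int N \<Longrightarrow> weighted_coeff a N W p l k = 0"
  by (auto simp: weighted_coeff_def truncated_coeff_def)

text \<open>\<open>truncated_coeff\<close> is evaluated at p + u - k only, so lowering k by 1
  amounts to moving the weights one place to the right.\<close>

lemma weighted_coeff_increment: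
  "weighted_coeff a N W p l k - weighted_coeff a N W p l (k - 1)
     = weighted_coeff a N (weight_increment l W) p (Suc l) k"
proof -
  have "weighted_coeff a N W p l (k - 1) = (\<Sum>u = 2..Suc l. W (u - 1) * truncated_coeff a N (int (p + u) - k))"
    unfolding weighted_coeff_def
    by (rule sum.reindex_bij_witness[of _ "\<lambda>u. u - 1" Suc])
       (auto simp: algebra_simps intro!: arg_cong[of _ _ "truncated_coeff a N"])
  also have "\<dots> = (\<Sum>u = 1..Suc l. (if u = 1 then 0 else W (u - 1)) * truncated_coeff a N (int (p + u) - k))"
    by (rule sum.mono_neutral_cong_left) auto
  finally have 1: "weighted_coeff a N W p l (k - 1) = \<dots>" .
  have 2: "weighted_coeff a N W p l k = (\<Sum>u = 1..Suc l. (if u \<le> l then W u else 0) * truncated_coeff a N (int (p + u) - k))"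
    unfolding weighted_coeff_def by (rule sum.mono_neutral_cong_left) auto
  show ?thesis unfolding 1 2 sum_subtractf[symmetric]
    by (simp only: weighted_coeff_def weight_increment_def left_diff_distrib)
qed

text \<open>The products vanish off the support of the first coefficient sequence, which is why the
  window is tied to the first block.\<close>

lemma sum_weighted_coeff:
  assumes "p + l \<le> T"
  shows "(\<Sum>k = - int N..int T. weighted_coeff a N W p l k * weighted_coeff a N W' q l k)
     = weighted_lag_sum (lag_product_upto a N) W W' p q l"
proof -
  have "(\<Sum>k = - int N..int T. weighted_coeff a N W p l k * weighted_coeff a N W' q l k)
    = (\<Sum>k = - int N..int T. \<Sum>u = 1..l. \<Sum>v = 1..l.
        W u * W' v * (truncated_coeff a N (int (p + u) - k) * truncated_coeff a N (int (q + v) - k)))"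
    unfolding weighted_coeff_def sum_product by (intro sum.cong refl) (simp add: mult_ac)
  also have "\<dots> = (\<Sum>u = 1..l. \<Sum>v = 1..l. \<Sum>k = - int N..int T.
        W u * W' v * (truncated_coeff a N (int (p + u) - k) * truncated_coeff a N (int (q + v) - k)))"
    by (subst sum.swap, rule sum.cong[OF refl], subst sum.swap) simp
  also have "\<dots> = (\<Sum>u = 1..l. \<Sum>v = 1..l. W u * W' v * lag_product_upto a N (nat \<bar>int (p + u) - int (q + v)\<bar>))"
    unfolding sum_distrib_left[symmetric]
    by (intro sum.cong refl arg_cong2[of _ _ _ _ "(*)"] sum_truncated_coeff) (use assms in auto)
  finally show ?thesis by (simp add: weighted_lag_sum_def)
qed

lemma weighted_lag_sum_tendsto:
  assumes "summable (\<lambda>j. (a j)\<^sup>2)"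
  shows "(\<lambda>N. weighted_lag_sum (lag_product_upto a N) W W' p q l) \<longlonglongrightarrow> weighted_lag_sum (lag_product a) W W' p q l"
  unfolding weighted_lag_sum_def by (intro tendsto_intros lag_product_upto_tendsto assms)

lemma weighted_lag_sum_shift: "weighted_lag_sum r W W' p p l = weighted_lag_sum r W W' 0 0 l"
  by (simp add: weighted_lag_sum_def)

text \<open>Norm and increment norm of the coefficients are rewritten as lag sums, which are free of
  the offset p by stationarity. The window leaves room for the one additional index of the
  increments.\<close>

lemma abs_weighted_coeff_le:
  assumes "p + l + 1 \<le> T" "k \<in> {- int N..int T}"
  shows "\<bar>weighted_coeff a N W p l k\<bar> \<le>
    sqrt (2 * sqrt (weighted_lag_sum (lag_product_upto a N) W W 0 0 l)
      * sqrt (increment_lag_sum (lag_product_upto a N) l W))"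
proof -
  let ?b = "weighted_coeff a N W p l"
  have "(?b k)\<^sup>2 \<le> 2 * sqrt (\<Sum>j = - int N..int T. (?b j)\<^sup>2) * sqrt (\<Sum>j = - int N..int T. (?b j - ?b (j - 1))\<^sup>2)"
    by (rule square_le_norm_times_increment_norm) (use assms weighted_coeff_eq_0 in auto)
  also have "(\<Sum>j = - int N..int T. (?b j)\<^sup>2) = weighted_lag_sum (lag_product_upto a N) W W 0 0 l"
    unfolding power2_eq_square by (subst sum_weighted_coeff) (use assms weighted_lag_sum_shift[of _ _ _ p] in auto)
  also have "(\<Sum>j = - int N..int T. (?b j - ?b (j - 1))\<^sup>2)
     = increment_lag_sum (lag_product_upto a N) l W"
    unfolding power2_eq_square weighted_coeff_increment
    by (subst sum_weighted_coeff) (use assms weighted_lag_sum_shift[of _ _ _ p] in auto)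
  finally show ?thesis by (simp add: real_le_rsqrt)
qed

section \<open>Weighted sums of the linear process\<close>

locale linear_proc = innovation_space M \<sigma> \<epsilon>
  for M :: "'a measure" and \<sigma> :: real and \<epsilon> :: "int \<Rightarrow> 'a \<Rightarrow> real" +
  fixes a :: "nat \<Rightarrow> real" and Y :: "nat \<Rightarrow> 'a \<Rightarrow> real"
  assumes summable_sq: "summable (\<lambda>j. (a j)\<^sup>2)"
    and process: "linear_process {1..} a \<epsilon> Y"
begin

abbreviation "cross_sum \<equiv> weighted_lag_sum (lag_product a)"

text \<open>The bound of \<open>abs_weighted_coeff_le\<close> after the truncation level has tended
  to infinity.\<close>

definition sup_bound :: "(nat \<Rightarrow> real) \<Rightarrow> nat \<Rightarrow> real" where
  "sup_bound W l = sqrt (2 * sqrt (cross_sum W W 0 0 l)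
      * sqrt (increment_lag_sum (lag_product a) l W))"

lemma Y_measurable [measurable]: "t \<ge> 1 \<Longrightarrow> Y t \<in> borel_measurable M"
  using process by (simp add: linear_process_def)

lemma weighted_sum_measurable [measurable]: "weighted_sum Y W p l \<in> borel_measurable M"
  unfolding weighted_sum_def[abs_def] by (intro borel_measurable_sum borel_measurable_times) auto

abbreviation approx :: "(nat \<Rightarrow> real) \<Rightarrow> nat \<Rightarrow> nat \<Rightarrow> nat \<Rightarrow> nat \<Rightarrow> 'a \<Rightarrow> real" where
  "approx W p l T N \<equiv> linear_form {- int N..int T} (weighted_coeff a N W p l)"

lemma approx_eq:
  assumes "p + l \<le> T"
  shows "approx W p l T N \<omega> = (\<Sum>u = 1..l. W u * (\<Sum>j\<le>N. a j * \<epsilon> (int (p + u) - int j) \<omega>))"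
proof -
  let ?K = "\<lambda>u. \<Sum>k = - int N..int T. truncated_coeff a N (int (p + u) - k) * \<epsilon> k \<omega>"
  have "approx W p l T N \<omega> = (\<Sum>u = 1..l. W u * (?K u))"
    unfolding linear_form_def weighted_coeff_def sum_distrib_right sum_distrib_left
    by (subst sum.swap) (simp add: mult.assoc)
  also have "(?K u)
      = (\<Sum>j\<le>N. a j * \<epsilon> (int (p + u) - int j) \<omega>)" if "u \<in> {1..l}" for u
  proof -
    have "(?K u)
      = (\<Sum>k \<in> {int (p + u) - int N..int (p + u)}. a (nat (int (p + u) - k)) * \<epsilon> k \<omega>)"
      using that assms by (intro sum.mono_neutral_cong_right) (auto simp: truncated_coeff_def)
    also have "\<dots> = (\<Sum>j\<le>N. a j * \<epsilon> (int (p + u) - int j) \<omega>)"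
      by (rule sum.reindex_bij_witness[of _ "\<lambda>j. int (p + u) - int j" "\<lambda>k. nat (int (p + u) - k)"]) auto
    finally show ?thesis .
  qed
  then have "(\<Sum>u = 1..l. W u * (?K u))
     = (\<Sum>u = 1..l. W u * (\<Sum>j\<le>N. a j * \<epsilon> (int (p + u) - int j) \<omega>))"
    by (intro sum.cong) auto
  finally show ?thesis .
qed

lemma AE_series: "AE \<omega> in M. \<forall>t\<ge>1. (\<lambda>j. a j * \<epsilon> (int t - int j) \<omega>) sums Y t \<omega>"
  using process by (subst AE_all_countable) (auto simp: linear_process_def AE_all_countable)

text \<open>A single null set serves all weights, blocks and windows, because it only excludes
  failure of convergence at one of countably many times.\<close>

lemma approx_tendsto:
  "AE \<omega> in M. \<forall>W p l T. p + l \<le> T \<longrightarrow> (\<lambda>N. approx W p l T N \<omega>) \<longlonglongrightarrow> weighted_sum Y W p l \<omega>"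
  using AE_series
proof eventually_elim
  case (elim \<omega>)
  show ?case
  proof (intro allI impI)
    fix W p l T assume T: "p + l \<le> (T :: nat)"
    have "(\<lambda>N. \<Sum>j\<le>N. a j * \<epsilon> (int (p + u) - int j) \<omega>) \<longlonglongrightarrow> Y (p + u) \<omega>" if "u \<in> {1..l}" for p l u
    proof -
      have "(\<lambda>j. a j * \<epsilon> (int (p + u) - int j) \<omega>) sums Y (p + u) \<omega>" using elim that
        by (auto simp del: of_nat_add)
      then show ?thesis by (simp only: sums_def_le)
    qed
    then show "(\<lambda>N. approx W p l T N \<omega>) \<longlonglongrightarrow> weighted_sum Y W p l \<omega>"
      unfolding approx_eq[OF T] weighted_sum_def by (intro tendsto_sum tendsto_mult tendsto_const) (auto simp del: of_nat_add)
  qed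
qed

lemma cross_sum_nonneg: "cross_sum W W 0 0 l \<ge> 0"
proof (rule LIMSEQ_le_const[OF weighted_lag_sum_tendsto[OF summable_sq]])
  show "\<exists>N. \<forall>n\<ge>N. 0 \<le> weighted_lag_sum (lag_product_upto a n) W W 0 0 l"
  proof (intro exI allI impI)
    fix n
    have "0 \<le> (\<Sum>k = - int n..int l. weighted_coeff a n W 0 l k * weighted_coeff a n W 0 l k)"
      by (intro sum_nonneg) simp
    then show "0 \<le> weighted_lag_sum (lag_product_upto a n) W W 0 0 l"
      using sum_weighted_coeff[of 0 l l a n W W 0] by simp
  qed
qed

text \<open>\<open>char_linear_form\<close> for the truncated sums, passed to the limit: the
  characteristic function by bounded convergence, the remaining terms because they are continuous in
  finitely many lag products.\<close>

lemma char_weighted_sum: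
  "cmod (expectation (\<lambda>\<omega>. iexp (weighted_sum Y W p l \<omega>)) - exp (- \<sigma>\<^sup>2 * cross_sum W W 0 0 l / 2))
    \<le> (expectation (\<lambda>\<omega>. \<bar>\<epsilon> 0 \<omega>\<bar> ^ 3) * sup_bound W l + \<sigma> ^ 4 * (sup_bound W l)\<^sup>2) * cross_sum W W 0 0 l"
proof -
  define T where "T = p + l + 1"
  let ?r = "lag_product_upto a"
  define B where "B N = sqrt (2 * sqrt (weighted_lag_sum (?r N) W W 0 0 l)
      * sqrt (increment_lag_sum (?r N) l W))" for N
  have B: "B \<longlonglongrightarrow> sup_bound W l"
    unfolding B_def sup_bound_def by (intro tendsto_intros weighted_lag_sum_tendsto summable_sq)
  have "cmod (expectation (\<lambda>\<omega>. iexp (approx W p l T N \<omega>)) - exp (- \<sigma>\<^sup>2 * weighted_lag_sum (?r N) W W 0 0 l / 2))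
    \<le> (expectation (\<lambda>\<omega>. \<bar>\<epsilon> 0 \<omega>\<bar> ^ 3) * B N + \<sigma> ^ 4 * (B N)\<^sup>2) * weighted_lag_sum (?r N) W W 0 0 l" for N
  proof -
    have "(\<Sum>k = - int N..int T. (weighted_coeff a N W p l k)\<^sup>2) = weighted_lag_sum (?r N) W W 0 0 l"
      unfolding power2_eq_square by (subst sum_weighted_coeff) (auto simp: T_def weighted_lag_sum_shift[of _ _ _ p])
    then show ?thesis
      using char_linear_form[of "{- int N..int T}" "weighted_coeff a N W p l" "B N"]
        abs_weighted_coeff_le[of p l T _ N a W] by (simp add: B_def T_def)
  qed
  moreover have "(\<lambda>N. expectation (\<lambda>\<omega>. iexp (approx W p l T N \<omega>))) \<longlonglongrightarrow> expectation (\<lambda>\<omega>. iexp (weighted_sum Y W p l \<omega>))"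
  proof (rule integral_dominated_convergence[where w = "\<lambda>_. 1"])
    show "AE \<omega> in M. (\<lambda>N. iexp (approx W p l T N \<omega>)) \<longlonglongrightarrow> iexp (weighted_sum Y W p l \<omega>)"
      using approx_tendsto
    proof eventually_elim
      case (elim \<omega>)
      moreover have "p + l \<le> T" by (simp add: T_def)
      ultimately have "(\<lambda>N. approx W p l T N \<omega>) \<longlonglongrightarrow> weighted_sum Y W p l \<omega>" by blast
      then show ?case by (intro tendsto_intros)
    qed
  qed auto
  ultimately show ?thesis
    by (intro LIMSEQ_le[of "\<lambda>N. cmod (expectation (\<lambda>\<omega>. iexp (approx W p l T N \<omega>)) - exp (- \<sigma>\<^sup>2 * weighted_lag_sum (?r N) W W 0 0 l / 2))" _
        "\<lambda>N. (expectation (\<lambda>\<omega>. \<bar>\<epsilon> 0 \<omega>\<bar> ^ 3) * B N + \<sigma> ^ 4 * (B N)\<^sup>2) * weighted_lag_sum (?r N) W W 0 0 l"])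
       (auto intro!: tendsto_intros weighted_lag_sum_tendsto summable_sq B)
qed

text \<open>\<open>sum_squares_deviation\<close> carried over by Fatou. The cumulant term is
  simplified on the way: one squared coefficient is bounded by its maximum, and the sum over the
  other is a squared norm.\<close>

lemma weighted_sum_squares_deviation:
  "expectation (\<lambda>\<omega>. \<bar>\<Sum>h<m. (weighted_sum Y W (h * l) l \<omega>)\<^sup>2 - \<sigma>\<^sup>2 * cross_sum W W 0 0 l\<bar>)
    \<le> sqrt (\<Sum>h<m. \<Sum>h'<m. 2 * \<sigma> ^ 4 * (cross_sum W W (h * l) (h' * l) l)\<^sup>2
        + \<bar>fourth_moment - 3 * \<sigma> ^ 4\<bar> * ((sup_bound W l)\<^sup>2 * cross_sum W W 0 0 l))" (is "_ \<le> ?C")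
proof -
  let ?G = "\<lambda>\<omega>. \<bar>\<Sum>h<m. (weighted_sum Y W (h * l) l \<omega>)\<^sup>2 - \<sigma>\<^sup>2 * cross_sum W W 0 0 l\<bar>"
  define T where "T = m * l + l + 1"
  have T: "h * l + l + 1 \<le> T" if "h < m" for h
    using that by (simp add: T_def mult_le_mono1 less_imp_le)
  let ?r = "lag_product_upto a"
  let ?q = "\<lambda>N. weighted_lag_sum (?r N) W W 0 0 l"
  let ?I = "\<lambda>N. {- int N..int T}"
  define B where "B N = sqrt (2 * sqrt (?q N)
      * sqrt (increment_lag_sum (?r N) l W))" for N
  have B: "B \<longlonglongrightarrow> sup_bound W l"
    unfolding B_def sup_bound_def by (intro tendsto_intros weighted_lag_sum_tendsto summable_sq)
  let ?b = "\<lambda>N h. weighted_coeff a N W (h * l) l"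
  let ?f = "\<lambda>N h h'. \<Sum>k\<in>?I N. (?b N h k)\<^sup>2 * (?b N h' k)\<^sup>2"
  let ?F = "\<lambda>N \<omega>. \<bar>\<Sum>h<m. (approx W (h * l) l T N \<omega>)\<^sup>2 - \<sigma>\<^sup>2 * ?q N\<bar>"
  let ?c = "\<lambda>N. sqrt (\<Sum>h<m. \<Sum>h'<m. 2 * \<sigma> ^ 4 * (weighted_lag_sum (?r N) W W (h * l) (h' * l) l)\<^sup>2
        + \<bar>fourth_moment - 3 * \<sigma> ^ 4\<bar> * ((B N)\<^sup>2 * ?q N))"
  have bb: "(\<Sum>k\<in>?I N. ?b N h k * ?b N h' k) = weighted_lag_sum (?r N) W W (h * l) (h' * l) l" if "h < m" for N h h'
    using T[OF that] by (intro sum_weighted_coeff) simp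
  have b2: "(\<Sum>k\<in>?I N. (?b N h k)\<^sup>2) = ?q N" if "h < m" for N h
    using bb[OF that, of N h] by (simp add: power2_eq_square weighted_lag_sum_shift[of _ _ _ "h * l"])
  have intF: "integrable M (?F N)" for N
  proof -
    have "integrable M (\<lambda>\<omega>. (approx W (h * l) l T N \<omega>)\<^sup>2)" for h
      using integrable_mult_le4(2)[OF linear_form_fourth linear_form_fourth] by (simp add: power2_eq_square)
    then show ?thesis by (intro integrable_abs Bochner_Integration.integrable_sum) simp
  qed
  have le: "expectation (?F N) \<le> ?c N" for N
  proof -
    have "expectation (?F N) = expectation (\<lambda>\<omega>. \<bar>\<Sum>h<m. (approx W (h * l) l T N \<omega>)\<^sup>2 - \<sigma>\<^sup>2 * (\<Sum>k\<in>?I N. (?b N h k)\<^sup>2)\<bar>)"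
      by (intro Bochner_Integration.integral_cong refl arg_cong[of _ _ abs] sum.cong) (simp add: b2)
    also have "\<dots> \<le> sqrt (\<Sum>h<m. \<Sum>h'<m. 2 * \<sigma> ^ 4 * (\<Sum>k\<in>?I N. ?b N h k * ?b N h' k)\<^sup>2
        + (fourth_moment - 3 * \<sigma> ^ 4) * (?f N h h'))"
      by (rule sum_squares_deviation) simp
    also have "\<dots> \<le> ?c N"
    proof (intro real_sqrt_le_mono sum_mono add_mono)
      fix h h' assume h: "h \<in> {..<m}" and h': "h' \<in> {..<m}"
      then show "2 * \<sigma> ^ 4 * (\<Sum>k\<in>?I N. ?b N h k * ?b N h' k)\<^sup>2 \<le> 2 * \<sigma> ^ 4 * (weighted_lag_sum (?r N) W W (h * l) (h' * l) l)\<^sup>2"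
        by (simp add: bb)
      have "(?f N h h') \<le> (\<Sum>k\<in>?I N. (B N)\<^sup>2 * (?b N h' k)\<^sup>2)"
      proof (intro sum_mono mult_right_mono)
        fix k assume "k \<in> ?I N"
        then have "\<bar>?b N h k\<bar> \<le> B N"
          using abs_weighted_coeff_le[of "h * l" l T k N a W] T h by (simp add: B_def)
        then show "(?b N h k)\<^sup>2 \<le> (B N)\<^sup>2" by (metis abs_ge_zero power2_abs power_mono)
      qed simp
      also have "\<dots> = (B N)\<^sup>2 * ?q N" using b2 h' by (simp add: sum_distrib_left[symmetric])
      finally have s: "(?f N h h') \<le> (B N)\<^sup>2 * ?q N" .
      have s0: "0 \<le> (?f N h h')" by (intro sum_nonneg) simp
      have "(fourth_moment - 3 * \<sigma> ^ 4) * (?f N h h')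
        \<le> \<bar>fourth_moment - 3 * \<sigma> ^ 4\<bar> * (?f N h h')"
        using s0 by (intro mult_right_mono) auto
      also have "\<dots> \<le> \<bar>fourth_moment - 3 * \<sigma> ^ 4\<bar> * ((B N)\<^sup>2 * ?q N)"
        using s by (intro mult_left_mono) auto
      finally show "(fourth_moment - 3 * \<sigma> ^ 4) * (?f N h h')
        \<le> \<bar>fourth_moment - 3 * \<sigma> ^ 4\<bar> * ((B N)\<^sup>2 * ?q N)" .
    qed
    finally show ?thesis .
  qed
  have clim: "?c \<longlonglongrightarrow> ?C"
    by (intro tendsto_intros weighted_lag_sum_tendsto summable_sq B)
  have AE: "AE \<omega> in M. (\<lambda>N. ?F N \<omega>) \<longlonglongrightarrow> \<bar>\<Sum>h<m. (weighted_sum Y W (h * l) l \<omega>)\<^sup>2 - \<sigma>\<^sup>2 * cross_sum W W 0 0 l\<bar>"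
    using approx_tendsto
  proof eventually_elim
    case (elim \<omega>)
    have "(\<lambda>N. approx W (h * l) l T N \<omega>) \<longlonglongrightarrow> weighted_sum Y W (h * l) l \<omega>" if "h \<in> {..<m}" for h
    proof -
      have "h * l + l \<le> T" using T[of h] that by simp
      then show ?thesis using elim by blast
    qed
    then show ?case
      by (intro tendsto_intros weighted_lag_sum_tendsto summable_sq) auto
  qed
  have meas: "?G \<in> borel_measurable M"
    by measurable
  note F = integral_le_of_tendsto_AE[where F = ?F and c = ?c and C = ?C, OF intF abs_ge_zero meas AE le clim]
  show "expectation ?G \<le> ?C"
    by (rule F(2))
qed

text \<open>Fatou yields an inequality, which is what the uniform bound on the numerators of the
  statistic asks for.\<close>

lemma weighted_sum_square:
  "integrable M (\<lambda>\<omega>. (weighted_sum Y W p l \<omega>)\<^sup>2)"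
  "expectation (\<lambda>\<omega>. (weighted_sum Y W p l \<omega>)\<^sup>2) \<le> \<sigma>\<^sup>2 * cross_sum W W 0 0 l"
proof -
  let ?f = "\<lambda>\<omega>. (weighted_sum Y W p l \<omega>)\<^sup>2"
  define T where "T = p + l"
  have int: "integrable M (\<lambda>\<omega>. (approx W p l T N \<omega>)\<^sup>2)" for N
    using integrable_mult_le4(2)[OF linear_form_fourth linear_form_fourth] by (simp add: power2_eq_square)
  have le: "expectation (\<lambda>\<omega>. (approx W p l T N \<omega>)\<^sup>2) \<le> \<sigma>\<^sup>2 * weighted_lag_sum (lag_product_upto a N) W W 0 0 l" for N
  proof -
    have "(\<Sum>k = - int N..int T. weighted_coeff a N W p l k * weighted_coeff a N W p l k)
      = weighted_lag_sum (lag_product_upto a N) W W 0 0 l"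
      by (subst sum_weighted_coeff) (simp_all add: T_def weighted_lag_sum_shift[of _ _ _ p])
    then show ?thesis
      using linear_form_moments(2)[of "{- int N..int T}" "weighted_coeff a N W p l" "weighted_coeff a N W p l"]
      by (simp add: power2_eq_square)
  qed
  have lim: "(\<lambda>N. \<sigma>\<^sup>2 * weighted_lag_sum (lag_product_upto a N) W W 0 0 l) \<longlonglongrightarrow> \<sigma>\<^sup>2 * cross_sum W W 0 0 l"
    by (intro tendsto_intros weighted_lag_sum_tendsto summable_sq)
  have AE: "AE \<omega> in M. (\<lambda>N. (approx W p l T N \<omega>)\<^sup>2) \<longlonglongrightarrow> (weighted_sum Y W p l \<omega>)\<^sup>2"
    using approx_tendsto
  proof eventually_elim
    case (elim \<omega>)
    have "p + l \<le> T" by (simp add: T_def)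
    then have "(\<lambda>N. approx W p l T N \<omega>) \<longlonglongrightarrow> weighted_sum Y W p l \<omega>" using elim by blast
    then show ?case by (intro tendsto_intros)
  qed
  have meas: "?f \<in> borel_measurable M" by measurable
  note F = integral_le_of_tendsto_AE[where F = "\<lambda>N \<omega>. (approx W p l T N \<omega>)\<^sup>2"
      and c = "\<lambda>N. \<sigma>\<^sup>2 * weighted_lag_sum (lag_product_upto a N) W W 0 0 l"
      and C = "\<sigma>\<^sup>2 * cross_sum W W 0 0 l", OF int zero_le_power2 meas AE le lim]
  show "integrable M ?f" by (rule F(1))
  show "expectation ?f \<le> \<sigma>\<^sup>2 * cross_sum W W 0 0 l" by (rule F(2))
qed

text \<open>Almost sure convergence is upgraded to convergence in mean square, with the tail of the
  sum of squared coefficients as rate. This leads to exact covariances, where Fatou applied to the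
  products would give bounds only.\<close>

lemma truncation_error:
  assumes t: "t \<ge> 1"
  shows "integrable M (\<lambda>\<omega>. (Y t \<omega> - (\<Sum>j\<le>N. a j * \<epsilon> (int t - int j) \<omega>))\<^sup>2)"
    "expectation (\<lambda>\<omega>. (Y t \<omega> - (\<Sum>j\<le>N. a j * \<epsilon> (int t - int j) \<omega>))\<^sup>2)
      \<le> \<sigma>\<^sup>2 * ((\<Sum>j. (a j)\<^sup>2) - (\<Sum>j\<le>N. (a j)\<^sup>2))"
proof -
  let ?U = "\<lambda>\<omega>. Y t \<omega> - (\<Sum>j\<le>N. a j * \<epsilon> (int t - int j) \<omega>)"
  define b where "b k = a (nat (int t - k))" for k
  define F where "F K = (\<lambda>j. int t - int j) ` {N<..K}" for K
  have form: "linear_form (F K) b \<omega> = (\<Sum>j\<in>{N<..K}. a j * \<epsilon> (int t - int j) \<omega>)" for K \<omega>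
    unfolding linear_form_def F_def by (subst sum.reindex) (auto simp: inj_on_def b_def)
  have sq: "(\<Sum>k\<in>F K. b k * b k) = (\<Sum>j\<in>{N<..K}. (a j)\<^sup>2)" for K
    unfolding F_def by (subst sum.reindex) (auto simp: inj_on_def b_def power2_eq_square)
  have split: "(\<Sum>j\<le>K + N. f j) = (\<Sum>j\<le>N. f j) + (\<Sum>j\<in>{N<..K + N}. f j)" for f :: "nat \<Rightarrow> real" and K
    by (subst sum.union_disjoint[symmetric]) (auto intro!: sum.cong)
  have int: "integrable M (\<lambda>\<omega>. (linear_form (F (K + N)) b \<omega>)\<^sup>2)" for K
    using integrable_mult_le4(2)[OF linear_form_fourth linear_form_fourth] by (simp add: power2_eq_square)
  have le: "expectation (\<lambda>\<omega>. (linear_form (F (K + N)) b \<omega>)\<^sup>2) \<le> \<sigma>\<^sup>2 * ((\<Sum>j\<le>K + N. (a j)\<^sup>2) - (\<Sum>j\<le>N. (a j)\<^sup>2))" for K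
  proof -
    have "finite (F (K + N))" by (simp add: F_def)
    from linear_form_moments(2)[OF this, of b b] show ?thesis
      unfolding power2_eq_square[of "linear_form (F (K + N)) b _"] sq split by simp
  qed
  have lim: "(\<lambda>K. \<sigma>\<^sup>2 * ((\<Sum>j\<le>K + N. (a j)\<^sup>2) - (\<Sum>j\<le>N. (a j)\<^sup>2))) \<longlonglongrightarrow> \<sigma>\<^sup>2 * ((\<Sum>j. (a j)\<^sup>2) - (\<Sum>j\<le>N. (a j)\<^sup>2))"
    by (intro tendsto_intros LIMSEQ_ignore_initial_segment[of "\<lambda>K. \<Sum>j\<le>K. (a j)\<^sup>2"] summable_LIMSEQ' summable_sq)
  have AE: "AE \<omega> in M. (\<lambda>K. (linear_form (F (K + N)) b \<omega>)\<^sup>2) \<longlonglongrightarrow> (?U \<omega>)\<^sup>2"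
    using AE_series
  proof eventually_elim
    case (elim \<omega>)
    then have "(\<lambda>K. \<Sum>j\<le>K. a j * \<epsilon> (int t - int j) \<omega>) \<longlonglongrightarrow> Y t \<omega>"
      using t by (simp add: sums_def_le)
    from LIMSEQ_ignore_initial_segment[OF this, of N]
    have "(\<lambda>K. (\<Sum>j\<le>K + N. a j * \<epsilon> (int t - int j) \<omega>) - (\<Sum>j\<le>N. a j * \<epsilon> (int t - int j) \<omega>)) \<longlonglongrightarrow> Y t \<omega> - (\<Sum>j\<le>N. a j * \<epsilon> (int t - int j) \<omega>)"
      by (intro tendsto_intros)
    then have "(\<lambda>K. linear_form (F (K + N)) b \<omega>) \<longlonglongrightarrow> Y t \<omega> - (\<Sum>j\<le>N. a j * \<epsilon> (int t - int j) \<omega>)"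
      by (simp add: form split)
    then show ?case by (intro tendsto_intros)
  qed
  have meas: "(\<lambda>\<omega>. (?U \<omega>)\<^sup>2) \<in> borel_measurable M"
    using t by measurable
  note I = integral_le_of_tendsto_AE[where F = "\<lambda>K \<omega>. (linear_form (F (K + N)) b \<omega>)\<^sup>2"
      and c = "\<lambda>K. \<sigma>\<^sup>2 * ((\<Sum>j\<le>K + N. (a j)\<^sup>2) - (\<Sum>j\<le>N. (a j)\<^sup>2))"
      and C = "\<sigma>\<^sup>2 * ((\<Sum>j. (a j)\<^sup>2) - (\<Sum>j\<le>N. (a j)\<^sup>2))", OF int zero_le_power2 meas AE le lim]
  show "integrable M (\<lambda>\<omega>. (?U \<omega>)\<^sup>2)" by (rule I(1))
  show "expectation (\<lambda>\<omega>. (?U \<omega>)\<^sup>2)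
      \<le> \<sigma>\<^sup>2 * ((\<Sum>j. (a j)\<^sup>2) - (\<Sum>j\<le>N. (a j)\<^sup>2))" by (rule I(2))
qed

text \<open>Exact moments are called for because \<delta> is defined through the autocovariance
  function of the process itself. They are the limits of the moments of the truncated
  series.\<close>

lemma Y_moments:
  "expectation (Y (Suc p)) = 0"
  "expectation (\<lambda>\<omega>. Y (Suc p) \<omega> * Y (Suc q) \<omega>) = \<sigma>\<^sup>2 * lag_product a (nat \<bar>int p - int q\<bar>)"
proof -
  let ?YY = "\<lambda>\<omega>. Y (Suc p) \<omega> * Y (Suc q) \<omega>"
  define T where "T = p + q + 1"
  let ?A = "\<lambda>p. approx (\<lambda>_. 1) p 1 T"
  let ?E = "\<lambda>p N \<omega>. Y (Suc p) \<omega> - ?A p N \<omega>"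
  define e where "e N = \<sigma>\<^sup>2 * ((\<Sum>j. (a j)\<^sup>2) - (\<Sum>j\<le>N. (a j)\<^sup>2))" for N
  have e: "e \<longlonglongrightarrow> 0"
  proof -
    have "e \<longlonglongrightarrow> \<sigma>\<^sup>2 * ((\<Sum>j. (a j)\<^sup>2) - (\<Sum>j. (a j)\<^sup>2))"
      unfolding e_def by (intro tendsto_intros summable_LIMSEQ' summable_sq)
    then show ?thesis by simp
  qed
  have e0: "e N \<ge> 0" for N
    unfolding e_def by (intro mult_nonneg_nonneg) (auto intro!: sum_le_suminf summable_sq)
  have A_eq: "?A p N \<omega> = (\<Sum>j\<le>N. a j * \<epsilon> (int (Suc p) - int j) \<omega>)" if "p + 1 \<le> T" for p N \<omega>
    using that by (simp add: approx_eq)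
  have A2: "integrable M (\<lambda>\<omega>. (?A p N \<omega>)\<^sup>2)" for p N
    using integrable_mult_le4(2)[OF linear_form_fourth linear_form_fourth] by (simp add: power2_eq_square)
  have Y2: "integrable M (\<lambda>\<omega>. (Y (Suc p) \<omega>)\<^sup>2)" for p
    using weighted_sum_square(1)[of "\<lambda>_. 1" p 1] by (simp add: weighted_sum_def)
  have d2: "integrable M (\<lambda>\<omega>. (?E p N \<omega>)\<^sup>2)"
    "expectation (\<lambda>\<omega>. (?E p N \<omega>)\<^sup>2) \<le> e N" if "p + 1 \<le> T" for p N
    using truncation_error[of "Suc p" N] unfolding A_eq[OF that] e_def by simp_all
  have m[measurable]: "Y (Suc p) \<in> borel_measurable M" for p by measurable
  have iY: "integrable M (Y (Suc p))" for p
    by (rule square_integrable_imp_integrable[OF m Y2])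
  have iA: "integrable M (?A p N)" for p N by (rule integrable_mult_le4(1)[OF linear_form_fourth])
  have T: "p + 1 \<le> T" "q + 1 \<le> T" by (auto simp: T_def)
  have "\<bar>expectation (Y (Suc p))\<bar> \<le> sqrt (e N)" for N
  proof -
    have "expectation (Y (Suc p)) = expectation (\<lambda>\<omega>. Y (Suc p) \<omega> - ?A p N \<omega>)"
      by (subst Bochner_Integration.integral_diff[OF iY iA]) (simp add: linear_form_moments(1))
    then have "\<bar>expectation (Y (Suc p))\<bar> \<le> expectation (\<lambda>\<omega>. \<bar>Y (Suc p) \<omega> - ?A p N \<omega>\<bar>)"
      by simp
    also have "\<dots> \<le> sqrt (expectation (\<lambda>\<omega>. (?E p N \<omega>)\<^sup>2))"
      by (rule expectation_abs_le_sqrt) (simp, rule d2[OF T(1)])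
    also have "\<dots> \<le> sqrt (e N)" using d2(2)[OF T(1)] by (rule real_sqrt_le_mono)
    finally show ?thesis .
  qed
  moreover have "(\<lambda>N. sqrt (e N)) \<longlonglongrightarrow> 0" using tendsto_real_sqrt[OF e] by simp
  ultimately have "\<bar>expectation (Y (Suc p))\<bar> \<le> 0" by (intro LIMSEQ_le_const) auto
  then show "expectation (Y (Suc p)) = 0" by simp
  define C where "C = max (expectation (\<lambda>\<omega>. (Y (Suc q) \<omega>)\<^sup>2)) (\<sigma>\<^sup>2 * (\<Sum>j. (a j)\<^sup>2))"
  have C0: "C \<ge> 0" by (simp add: C_def le_max_iff_disj)
  have AC: "expectation (\<lambda>\<omega>. (?A p N \<omega>)\<^sup>2) \<le> C" for N
  proof -
    have "expectation (\<lambda>\<omega>. (?A p N \<omega>)\<^sup>2) = \<sigma>\<^sup>2 * lag_product_upto a N 0"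
      using linear_form_moments(2)[of "{- int N..int T}" "weighted_coeff a N (\<lambda>_. 1) p 1" "weighted_coeff a N (\<lambda>_. 1) p 1"]
        sum_weighted_coeff[of p 1 T a N "\<lambda>_. 1" "\<lambda>_. 1" p] T
      by (simp add: power2_eq_square weighted_lag_sum_def)
    also have "lag_product_upto a N 0 = (\<Sum>j\<le>N. (a j)\<^sup>2)"
      by (simp add: lag_product_upto_def power2_eq_square atMost_def)
    also have "\<sigma>\<^sup>2 * \<dots> \<le> \<sigma>\<^sup>2 * (\<Sum>j. (a j)\<^sup>2)"
      by (intro mult_left_mono sum_le_suminf summable_sq) auto
    finally show ?thesis by (simp add: C_def)
  qed
  let ?c = "\<lambda>N. expectation (\<lambda>\<omega>. ?A p N \<omega> * ?A q N \<omega>)"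
  \<comment> \<open>Y Y' - A A' = (Y - A) Y' + (Y' - A') A, and both products are bounded by
    Cauchy-Schwarz with a small first factor.\<close>
  have diff: "\<bar>expectation ?YY - ?c N\<bar> \<le> 2 * (sqrt (e N) * sqrt C)" for N
  proof -
    have i1: "integrable M (\<lambda>\<omega>. (?E p N \<omega>) * Y (Suc q) \<omega>)"
      and b1: "\<bar>expectation (\<lambda>\<omega>. (?E p N \<omega>) * Y (Suc q) \<omega>)\<bar>
        \<le> sqrt (expectation (\<lambda>\<omega>. (?E p N \<omega>)\<^sup>2)) * sqrt (expectation (\<lambda>\<omega>. (Y (Suc q) \<omega>)\<^sup>2))"
      using abs_expectation_mult_le[of "\<lambda>\<omega>. Y (Suc p) \<omega> - ?A p N \<omega>" "Y (Suc q)"] d2(1)[OF T(1)] Y2 by auto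
    have i2: "integrable M (\<lambda>\<omega>. (?E q N \<omega>) * ?A p N \<omega>)"
      and b2: "\<bar>expectation (\<lambda>\<omega>. (?E q N \<omega>) * ?A p N \<omega>)\<bar>
        \<le> sqrt (expectation (\<lambda>\<omega>. (?E q N \<omega>)\<^sup>2)) * sqrt (expectation (\<lambda>\<omega>. (?A p N \<omega>)\<^sup>2))"
      using abs_expectation_mult_le[of "\<lambda>\<omega>. Y (Suc q) \<omega> - ?A q N \<omega>" "?A p N"] d2(1)[OF T(2)] A2 by auto
    have i3: "integrable M (\<lambda>\<omega>. ?A p N \<omega> * ?A q N \<omega>)"
      by (rule integrable_mult_le4(2)[OF linear_form_fourth linear_form_fourth])
    have "expectation ?YY
      = expectation (\<lambda>\<omega>. (?E p N \<omega>) * Y (Suc q) \<omega> + (?E q N \<omega>) * ?A p N \<omega> + ?A p N \<omega> * ?A q N \<omega>)"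
      by (intro Bochner_Integration.integral_cong refl) (simp add: algebra_simps)
    also have "\<dots> = expectation (\<lambda>\<omega>. (?E p N \<omega>) * Y (Suc q) \<omega>)
       + expectation (\<lambda>\<omega>. (?E q N \<omega>) * ?A p N \<omega>) + ?c N"
      by (simp only: Bochner_Integration.integral_add Bochner_Integration.integrable_add i1 i2 i3)
    finally have eq: "expectation ?YY - ?c N
       = expectation (\<lambda>\<omega>. (?E p N \<omega>) * Y (Suc q) \<omega>)
       + expectation (\<lambda>\<omega>. (?E q N \<omega>) * ?A p N \<omega>)" by simp
    have "sqrt (expectation (\<lambda>\<omega>. (?E p N \<omega>)\<^sup>2)) * sqrt (expectation (\<lambda>\<omega>. (Y (Suc q) \<omega>)\<^sup>2)) \<le> sqrt (e N) * sqrt C"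
      using d2(2)[OF T(1)] by (intro mult_mono real_sqrt_le_mono) (auto simp: C_def C0 e0)
    moreover have "sqrt (expectation (\<lambda>\<omega>. (?E q N \<omega>)\<^sup>2)) * sqrt (expectation (\<lambda>\<omega>. (?A p N \<omega>)\<^sup>2)) \<le> sqrt (e N) * sqrt C"
      using d2(2)[OF T(2)] AC by (intro mult_mono real_sqrt_le_mono) (auto simp: C0 e0)
    ultimately show ?thesis unfolding eq using b1 b2 by linarith
  qed
  have "(\<lambda>N. 2 * (sqrt (e N) * sqrt C)) \<longlonglongrightarrow> 2 * (sqrt 0 * sqrt C)" by (intro tendsto_intros e)
  then have "(\<lambda>N. 2 * (sqrt (e N) * sqrt C)) \<longlonglongrightarrow> 0" by simp
  then have "(\<lambda>N. expectation ?YY - ?c N) \<longlonglongrightarrow> 0"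
    by (rule Lim_null_comparison[rotated]) (use diff in auto)
  then have "(\<lambda>N. expectation ?YY - (expectation ?YY - ?c N))
     \<longlonglongrightarrow> expectation ?YY - 0" by (intro tendsto_intros)
  then have c1: "?c \<longlonglongrightarrow> expectation ?YY" by simp
  have "?c N = \<sigma>\<^sup>2 * lag_product_upto a N (nat \<bar>int p - int q\<bar>)" for N
    using linear_form_moments(2)[of "{- int N..int T}" "weighted_coeff a N (\<lambda>_. 1) p 1" "weighted_coeff a N (\<lambda>_. 1) q 1"]
      sum_weighted_coeff[of p 1 T a N "\<lambda>_. 1" "\<lambda>_. 1" q] T
    by (simp add: weighted_lag_sum_def)
  then have "?c \<longlonglongrightarrow> \<sigma>\<^sup>2 * lag_product a (nat \<bar>int p - int q\<bar>)"
    by (simp add: tendsto_mult_left lag_product_upto_tendsto[OF summable_sq])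
  then show "expectation ?YY = \<sigma>\<^sup>2 * lag_product a (nat \<bar>int p - int q\<bar>)"
    using LIMSEQ_unique[OF c1] by simp
qed

lemma autocov_Y: "autocov Y h = \<sigma>\<^sup>2 * lag_product a h"
  using Y_moments(1)[of 0] Y_moments(1)[of h] Y_moments(2)[of 0 h] by (simp add: autocov_def)

end

section \<open>Asymptotics of lag products\<close>

text \<open>For x > 0, the index t of the cell ((t - 1) / n, t / n] containing x. Sums over t become
  integrals of step functions of x, so that Riemann sums are treated by dominated
  convergence.\<close>

abbreviation grid :: "nat \<Rightarrow> real \<Rightarrow> nat" where
  "grid n x \<equiv> nat \<lceil>real n * x\<rceil>"

lemma step_function_integral:
  fixes f :: "nat \<Rightarrow> real"
  assumes h: "h > 0"
  shows "integrable lborel (\<lambda>x. indicator {0<..real J / real h} x * f (grid h x))"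
    and "(\<integral>x. indicator {0<..real J / real h} x * f (grid h x) \<partial>lborel) = (\<Sum>j = 1..J. f j) / real h"
proof -
  have eq: "indicator {0<..real J / real h} x * f (grid h x)
    = (\<Sum>j = 1..J. f j * indicator {(real j - 1) / real h<..real j / real h} x)" for x
  proof (cases "x \<in> {0<..real J / real h}")
    case True
    define i where "i = grid h x"
    have pos: "real h * x > 0" using True h by simp
    then have i: "real i - 1 < real h * x" "real h * x \<le> real i"
      unfolding i_def by linarith+
    have "real h * x \<le> real J" using True h by (simp add: field_simps)
    then have iJ: "i \<in> {1..J}" using i pos by (auto simp: i_def) linarith+
    have ind: "indicator {(real j - 1) / real h<..real j / real h} x = (if j = i then 1 else (0 :: real))" for j
    proof -
      have "x \<in> {(real j - 1) / real h<..real j / real h} \<longleftrightarrow> real j - 1 < real h * x \<and> real h * x \<le> real j"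
        using h by (auto simp: field_simps)
      also have "\<dots> \<longleftrightarrow> j = i" using i by linarith
      finally show ?thesis by (simp add: indicator_def)
    qed
    have "(\<Sum>j = 1..J. f j * indicator {(real j - 1) / real h<..real j / real h} x) = (\<Sum>j = 1..J. if j = i then f j else 0)"
      unfolding ind by (intro sum.cong) auto
    then show ?thesis using True iJ by (simp add: i_def)
  next
    case False
    have "x \<notin> {(real j - 1) / real h<..real j / real h}" if "j \<in> {1..J}" for j
    proof
      assume "x \<in> {(real j - 1) / real h<..real j / real h}"
      moreover have "0 \<le> (real j - 1) / real h" "real j / real h \<le> real J / real h"
        using that h by (auto simp: field_simps)
      ultimately show False using False by auto
    qed
    then have "(\<Sum>j = 1..J. f j * indicator {(real j - 1) / real h<..real j / real h} x) = 0"
      by (intro sum.neutral) auto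
    then show ?thesis using False by simp
  qed
  have le: "(real j - 1) / real h \<le> real j / real h" for j using h by (simp add: field_simps)
  have i: "integrable lborel (\<lambda>x. f j * indicator {(real j - 1) / real h<..real j / real h} x)" for j
    by (intro integrable_mult_right integrable_real_indicator) (auto simp: emeasure_lborel_Ioc[OF le])
  show "integrable lborel (\<lambda>x. indicator {0<..real J / real h} x * f (grid h x))"
    unfolding eq by (intro Bochner_Integration.integrable_sum i)
  show "(\<integral>x. indicator {0<..real J / real h} x * f (grid h x) \<partial>lborel) = (\<Sum>j = 1..J. f j) / real h"
    unfolding eq by (subst Bochner_Integration.integral_sum[OF i])
      (simp add: le diff_divide_distrib[symmetric] sum_divide_distrib)
qed

lemma nat_ceiling_mult_bounds:
  assumes "x > 0" "h > (0 :: nat)"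
  shows "grid h x \<ge> 1" "real (grid h x) \<ge> real h * x" "real (grid h x) < real h * x + 1"
proof -
  have "real h * x > 0" using assms by simp
  then show "grid h x \<ge> 1" "real (grid h x) \<ge> real h * x" "real (grid h x) < real h * x + 1"
    by linarith+
qed

lemma nat_ceiling_mult_tendsto:
  assumes "x > 0"
  shows "(\<lambda>h. real (grid h x) / real h) \<longlonglongrightarrow> x"
    and "filterlim (\<lambda>h. grid h x) sequentially sequentially"
proof -
  show "(\<lambda>h. real (grid h x) / real h) \<longlonglongrightarrow> x"
  proof (rule tendsto_sandwich)
    show "\<forall>\<^sub>F h in sequentially. x \<le> real (grid h x) / real h"
      using eventually_gt_at_top[of 0] by eventually_elim (use nat_ceiling_mult_bounds[OF assms] in \<open>simp add: field_simps\<close>)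
    show "\<forall>\<^sub>F h in sequentially. real (grid h x) / real h \<le> x + 1 / real h"
      using eventually_gt_at_top[of 0]
      by eventually_elim (use nat_ceiling_mult_bounds(3)[OF assms] in \<open>simp add: field_simps less_imp_le\<close>)
    show "(\<lambda>h. x + 1 / real h) \<longlonglongrightarrow> x" by real_asymp
  qed simp
  have "filterlim (\<lambda>h. real h * x) at_top sequentially" using assms by real_asymp
  then have "filterlim (\<lambda>h. real (grid h x)) at_top sequentially"
    by (rule filterlim_at_top_mono) (use real_nat_ceiling_ge in \<open>auto simp: always_eventually\<close>)
  then show "filterlim (\<lambda>h. grid h x) sequentially sequentially"
    by (simp add: filterlim_sequentially_iff_filterlim_real)
qed

text \<open>The dominating function does two things: it makes the series converge and it identifies
  its sum with the integral over (0, \<infinity>).\<close>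

lemma sums_step_function:
  fixes f :: "nat \<Rightarrow> real" and w :: "real \<Rightarrow> real"
  assumes h: "h > 0" and w: "integrable lborel (\<lambda>x. indicator {0<..} x * w x)"
    and bound: "\<And>x. x > 0 \<Longrightarrow> \<bar>f (grid h x)\<bar> \<le> w x"
  shows "(\<lambda>j. f (Suc j)) sums (real h * (\<integral>x. indicator {0<..} x * f (grid h x) \<partial>lborel))"
proof -
  have "(\<lambda>J. \<integral>x. indicator {0<..real J / real h} x * f (grid h x) \<partial>lborel)
    \<longlonglongrightarrow> (\<integral>x. indicator {0<..} x * f (grid h x) \<partial>lborel)"
  proof (rule integral_dominated_convergence[OF _ _ w])
    have "(\<lambda>J. indicator {0<..real J / real h} x * f (grid h x)) \<longlonglongrightarrow> indicator {0<..} x * f (grid h x)" for x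
    proof (rule tendsto_eventually)
      have "filterlim (\<lambda>J. real J / real h) at_top sequentially" using h by real_asymp
      then have "\<forall>\<^sub>F J in sequentially. x \<le> real J / real h" by (simp add: filterlim_at_top)
      then show "\<forall>\<^sub>F J in sequentially. indicator {0<..real J / real h} x * f (grid h x) = indicator {0<..} x * f (grid h x)"
        by eventually_elim (auto simp: indicator_def)
    qed
    then show "AE x in lborel. (\<lambda>J. indicator {0<..real J / real h} x * f (grid h x)) \<longlonglongrightarrow> indicator {0<..} x * f (grid h x)"
      by simp
    show "AE x in lborel. norm (indicator {0<..real J / real h} x * f (grid h x)) \<le> indicator {0<..} x * w x" for J
      using bound by (auto simp: indicator_def intro: order_trans[OF abs_ge_zero])
    show "(\<lambda>x. indicator {0<..real J / real h} x * f (grid h x)) \<in> borel_measurable lborel" for J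
      using step_function_integral(1)[OF h] by (rule borel_measurable_integrable)
    show "(\<lambda>x. indicator {0<..} x * f (grid h x)) \<in> borel_measurable lborel" by measurable
  qed
  then have "(\<lambda>J. real h * ((\<Sum>j = 1..J. f j) / real h)) \<longlonglongrightarrow> real h * (\<integral>x. indicator {0<..} x * f (grid h x) \<partial>lborel)"
    unfolding step_function_integral(2)[OF h] by (intro tendsto_intros)
  moreover have "(\<Sum>j = 1..J. f j) = (\<Sum>j<J. f (Suc j))" for J
    by (simp add: sum.atLeast1_atMost_eq)
  ultimately show ?thesis using h by (simp add: sums_def)
qed

lemma integrable_powr_0_1:
  assumes "\<beta> > -1"
  shows "integrable lborel (\<lambda>x :: real. indicator {0<..<1} x * x powr \<beta>)"
proof -
  have "set_integrable lborel (einterval (ereal 0) (ereal 1)) (\<lambda>x. x powr \<beta>)"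
  proof (rule interval_integral_FTC_nonneg[where F = "\<lambda>x. x powr (\<beta> + 1) / (\<beta> + 1)" and A = 0 and B = "1 / (\<beta> + 1)"])
    show "(((\<lambda>x. x powr (\<beta> + 1) / (\<beta> + 1)) \<circ> real_of_ereal) \<longlongrightarrow> 0) (at_right (ereal 0))"
      using assms unfolding ereal_tendsto_simps by real_asymp
    show "(((\<lambda>x. x powr (\<beta> + 1) / (\<beta> + 1)) \<circ> real_of_ereal) \<longlongrightarrow> 1 / (\<beta> + 1)) (at_left (ereal 1))"
      unfolding ereal_tendsto_simps using assms by (auto intro!: tendsto_eq_intros)
  qed (use assms in \<open>auto intro!: derivative_eq_intros continuous_intros simp: powr_diff\<close>)
  then show ?thesis by (simp add: set_integrable_def)
qed

lemma integrable_powr_1_inf: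
  assumes "\<beta> < -1"
  shows "integrable lborel (\<lambda>x :: real. indicator {1<..} x * x powr \<beta>)"
proof -
  have "set_integrable lborel (einterval (ereal 1) \<infinity>) (\<lambda>x. x powr \<beta>)"
  proof (rule interval_integral_FTC_nonneg[where F = "\<lambda>x. x powr (\<beta> + 1) / (\<beta> + 1)" and A = "1 / (\<beta> + 1)" and B = 0])
    show "(((\<lambda>x. x powr (\<beta> + 1) / (\<beta> + 1)) \<circ> real_of_ereal) \<longlongrightarrow> 0) (at_left \<infinity>)"
      using assms unfolding ereal_tendsto_simps by real_asymp
    show "(((\<lambda>x. x powr (\<beta> + 1) / (\<beta> + 1)) \<circ> real_of_ereal) \<longlongrightarrow> 1 / (\<beta> + 1)) (at_right (ereal 1))"
      unfolding ereal_tendsto_simps using assms by (auto intro!: tendsto_eq_intros)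
  qed (use assms in \<open>auto intro!: derivative_eq_intros continuous_intros simp: powr_diff\<close>)
  moreover have "einterval (ereal 1) \<infinity> = {1<..}" by (auto simp: einterval_def)
  ultimately show ?thesis by (simp add: set_integrable_def)
qed

text \<open>x - L y has increments that are eventually small compared with those of y; summing them
  from a fixed index and dividing by the divergent y leaves an arbitrarily small quotient.\<close>

lemma Stolz_Cesaro_at_top:
  fixes x y :: "nat \<Rightarrow> real"
  assumes mono: "\<And>n. y n < y (Suc n)" and top: "filterlim y at_top sequentially"
    and lim: "(\<lambda>n. (x (Suc n) - x n) / (y (Suc n) - y n)) \<longlonglongrightarrow> L"
  shows "(\<lambda>n. x n / y n) \<longlonglongrightarrow> L"
proof (rule LIMSEQ_I)
  fix e :: real assume e: "e > 0"
  obtain n0 where n0: "\<And>n. n \<ge> n0 \<Longrightarrow> \<bar>(x (Suc n) - x n) / (y (Suc n) - y n) - L\<bar> < e / 2"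
    using LIMSEQ_D[OF lim, of "e / 2"] e by auto
  define z where "z n = x n - L * y n" for n
  have dz: "\<bar>z (Suc n) - z n\<bar> \<le> e / 2 * (y (Suc n) - y n)" if "n \<ge> n0" for n
  proof -
    have p: "y (Suc n) - y n > 0" using mono[of n] by simp
    have "z (Suc n) - z n = ((x (Suc n) - x n) / (y (Suc n) - y n) - L) * (y (Suc n) - y n)"
      using p by (simp add: z_def field_simps)
    then show ?thesis using n0[OF that] p by (simp add: abs_mult mult_right_mono less_imp_le)
  qed
  have zb: "\<bar>z n - z n0\<bar> \<le> e / 2 * (y n - y n0)" if "n \<ge> n0" for n
    using that
  proof (induction n rule: dec_induct)
    case (step n)
    have "\<bar>z (Suc n) - z n0\<bar> \<le> \<bar>z (Suc n) - z n\<bar> + \<bar>z n - z n0\<bar>" by linarith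
    also have "\<dots> \<le> e / 2 * (y (Suc n) - y n) + e / 2 * (y n - y n0)" using dz[of n] step by linarith
    also have "\<dots> = e / 2 * (y (Suc n) - y n0)" by (simp add: field_simps)
    finally show ?case .
  qed simp
  \<comment> \<open>\<open>K\<close> collects what depends on the starting index; eventually it is
    less than e y_n / 2.\<close>
  define K where "K = \<bar>z n0\<bar> + e / 2 * \<bar>y n0\<bar>"
  have "\<forall>\<^sub>F n in sequentially. y n \<ge> max 1 (2 * K / e + 1)"
    using top unfolding filterlim_at_top by blast
  then obtain n1 where n1: "\<And>n. n \<ge> n1 \<Longrightarrow> y n \<ge> max 1 (2 * K / e + 1)" by (auto simp: eventually_sequentially)
  show "\<exists>no. \<forall>n\<ge>no. norm (x n / y n - L) < e"
  proof (intro exI allI impI)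
    fix n assume n: "n \<ge> max n0 n1"
    have y1: "y n > 0" and y2: "2 * K / e + 1 \<le> y n" using n1[of n] n by auto
    have "\<bar>z n\<bar> \<le> \<bar>z n0\<bar> + \<bar>z n - z n0\<bar>" by linarith
    also have "\<dots> \<le> \<bar>z n0\<bar> + e / 2 * (y n - y n0)" using zb[of n] n by simp
    also have "\<dots> \<le> K + e / 2 * y n"
    proof -
      have "e / 2 * - y n0 \<le> e / 2 * \<bar>y n0\<bar>" using e by (intro mult_left_mono) auto
      then show ?thesis by (simp add: K_def right_diff_distrib)
    qed
    also have "K < e / 2 * y n" using y2 e by (simp add: field_simps)
    finally have "\<bar>z n\<bar> < e * y n" by simp
    moreover have "x n / y n - L = z n / y n" using y1 by (simp add: z_def field_simps)
    ultimately show "norm (x n / y n - L) < e" using y1 by (simp add: field_simps)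
  qed
qed

text \<open>For null sequences the increments are summed from n to infinity instead of from a fixed
  index to n. This version transfers lag asymptotics to \<open>lag_partial_sum\<close> for d < 0,
  where these partial sums tend to 0.\<close>

lemma Stolz_Cesaro_0:
  fixes x y :: "nat \<Rightarrow> real"
  assumes mono: "\<And>n. n \<ge> 1 \<Longrightarrow> y (Suc n) < y n" and x0: "x \<longlonglongrightarrow> 0" and y0: "y \<longlonglongrightarrow> 0"
    and lim: "(\<lambda>n. (x (Suc n) - x n) / (y (Suc n) - y n)) \<longlonglongrightarrow> L"
  shows "(\<lambda>n. x n / y n) \<longlonglongrightarrow> L"
proof (rule LIMSEQ_I)
  fix e :: real assume e: "e > 0"
  obtain n0 where n0: "\<And>n. n \<ge> n0 \<Longrightarrow> \<bar>(x (Suc n) - x n) / (y (Suc n) - y n) - L\<bar> < e / 2"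
    using LIMSEQ_D[OF lim, of "e / 2"] e by auto
  define z where "z n = x n - L * y n" for n
  have dz: "\<bar>z (Suc n) - z n\<bar> \<le> e / 2 * (y n - y (Suc n))" if "n \<ge> max 1 n0" for n
  proof -
    have p: "y n - y (Suc n) > 0" using mono[of n] that by simp
    then have "z (Suc n) - z n = ((x (Suc n) - x n) / (y (Suc n) - y n) - L) * (y (Suc n) - y n)"
      by (simp add: z_def field_simps)
    then have "\<bar>z (Suc n) - z n\<bar> = \<bar>(x (Suc n) - x n) / (y (Suc n) - y n) - L\<bar> * (y n - y (Suc n))"
      using p by (simp add: abs_mult)
    then show ?thesis using n0[of n] p that by (simp add: mult_right_mono less_imp_le)
  qed
  show "\<exists>no. \<forall>n\<ge>no. norm (x n / y n - L) < e"
  proof (intro exI allI impI)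
    fix n assume n: "n \<ge> max 1 n0"
    have zb: "\<bar>z k - z n\<bar> \<le> e / 2 * (y n - y k)" if "k \<ge> n" for k
      using that
    proof (induction k rule: dec_induct)
      case (step k)
      have "\<bar>z (Suc k) - z n\<bar> \<le> \<bar>z (Suc k) - z k\<bar> + \<bar>z k - z n\<bar>" by linarith
      also have "\<dots> \<le> e / 2 * (y k - y (Suc k)) + e / 2 * (y n - y k)" using dz[of k] step n by simp
      also have "\<dots> = e / 2 * (y n - y (Suc k))" by (simp add: field_simps)
      finally show ?case .
    qed simp
    \<comment> \<open>Letting k tend to infinity in \<open>zb\<close>, where z k and y k vanish in
      the limit, bounds z n by a multiple of y n alone.\<close>
    have "z \<longlonglongrightarrow> 0 - L * 0" unfolding z_def by (intro tendsto_intros x0 y0)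
    then have "(\<lambda>k. \<bar>z k - z n\<bar>) \<longlonglongrightarrow> \<bar>0 - z n\<bar>" by (intro tendsto_intros) simp
    moreover have "(\<lambda>k. e / 2 * (y n - y k)) \<longlonglongrightarrow> e / 2 * (y n - 0)" by (intro tendsto_intros y0)
    ultimately have "\<bar>0 - z n\<bar> \<le> e / 2 * (y n - 0)"
      by (rule LIMSEQ_le) (use zb in auto)
    then have zn: "\<bar>z n\<bar> \<le> e / 2 * y n" by simp
    have "y k \<le> y (Suc n)" if "k \<ge> Suc n" for k
      using that by (induction k rule: dec_induct) (use mono less_imp_le order_trans in \<open>auto intro: order_trans[OF less_imp_le[OF mono]]\<close>)
    then have "0 \<le> y (Suc n)" using y0 by (intro LIMSEQ_le_const2[OF y0]) auto
    then have y: "y n > 0" using mono[of n] n by simp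
    have "x n / y n - L = z n / y n" using y by (simp add: z_def field_simps)
    then have "\<bar>x n / y n - L\<bar> \<le> e / 2" using y zn by (simp add: field_simps)
    then show "norm (x n / y n - L) < e" using e by simp
  qed
qed

lemma eventually_bound_imp_bound:
  fixes f g :: "nat \<Rightarrow> real"
  assumes ev: "\<forall>\<^sub>F j in sequentially. \<bar>f j\<bar> \<le> C * g j" and pos: "\<And>j. j \<ge> 1 \<Longrightarrow> g j > 0"
  obtains K where "K > 0" "\<And>j. j \<ge> 1 \<Longrightarrow> \<bar>f j\<bar> \<le> K * g j"
proof -
  obtain n where n: "\<And>j. j \<ge> n \<Longrightarrow> \<bar>f j\<bar> \<le> C * g j" using ev by (auto simp: eventually_sequentially)
  \<comment> \<open>The finitely many early indices are absorbed by adding up their ratios.\<close>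
  define K where "K = \<bar>C\<bar> + (\<Sum>j = 1..n. \<bar>f j\<bar> / g j) + 1"
  have s0: "0 \<le> (\<Sum>j = 1..n. \<bar>f j\<bar> / g j)" by (intro sum_nonneg) (use pos in \<open>auto simp: less_imp_le\<close>)
  show ?thesis
  proof
    show "K > 0" using s0 by (simp add: K_def)
    fix j :: nat assume j: "j \<ge> 1"
    show "\<bar>f j\<bar> \<le> K * g j"
    proof (cases "j \<ge> n")
      case True
      have "C * g j \<le> K * g j" using pos[OF j] s0 by (intro mult_right_mono) (auto simp: K_def)
      then show ?thesis using n[OF True] by simp
    next
      case False
      have "\<bar>f j\<bar> / g j \<le> (\<Sum>j = 1..n. \<bar>f j\<bar> / g j)"
        by (rule member_le_sum) (use False j pos in \<open>auto simp: less_imp_le\<close>)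
      also have "\<dots> \<le> K" by (simp add: K_def)
      finally show ?thesis using pos[OF j] by (simp add: field_simps)
    qed
  qed
qed

lemma tendsto_imp_bound:
  fixes f g :: "nat \<Rightarrow> real"
  assumes lim: "(\<lambda>j. f j / g j) \<longlonglongrightarrow> L" and pos: "\<And>j. j \<ge> 1 \<Longrightarrow> g j > 0"
  obtains K where "K > 0" "\<And>j. j \<ge> 1 \<Longrightarrow> \<bar>f j\<bar> \<le> K * g j"
proof -
  have "\<forall>\<^sub>F j in sequentially. \<bar>f j\<bar> \<le> (\<bar>L\<bar> + 1) * g j"
    using tendstoD[OF lim, of 1, simplified] eventually_ge_at_top[of 1]
  proof eventually_elim
    case (elim j)
    then have "\<bar>f j / g j\<bar> \<le> \<bar>L\<bar> + 1" unfolding dist_real_def by linarith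
    then show ?case using pos[OF elim(2)] by (simp add: field_simps)
  qed
  from eventually_bound_imp_bound[OF this pos]
  obtain K where "K > 0" "\<And>j. j \<ge> 1 \<Longrightarrow> \<bar>f j\<bar> \<le> K * g j" by blast
  then show ?thesis by (rule that)
qed

lemma one_plus_powr_ge:
  fixes t p :: real
  assumes "t \<ge> 0" "p \<le> 0"
  shows "1 + p * t \<le> (1 + t) powr p"
proof -
  have "1 + p * t \<le> 1 + p * ln (1 + t)"
    using assms ln_add_one_self_le_self[of t] by (simp add: mult_left_mono_neg)
  also have "\<dots> \<le> exp (p * ln (1 + t))" by (rule exp_ge_add_one_self)
  also have "\<dots> = (1 + t) powr p" using assms by (simp add: powr_def)
  finally show ?thesis .
qed

lemma integrable_two_powr:
  fixes \<beta> \<gamma> :: real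
  assumes "\<beta> > -1" "\<gamma> < -1"
  shows "integrable lborel (\<lambda>x. indicator {0<..} x * (if x \<le> 1 then x powr \<beta> else x powr \<gamma>))"
proof -
  have "integrable lborel (\<lambda>x. indicator {0<..<1} x * x powr \<beta> + indicator {1<..} x * x powr \<gamma>)"
    by (intro Bochner_Integration.integrable_add integrable_powr_0_1 integrable_powr_1_inf assms)
  moreover have "AE x in lborel. indicator {0<..<1} x * x powr \<beta> + indicator {1<..} x * x powr \<gamma>
     = indicator {0<..} x * (if x \<le> 1 then x powr \<beta> else x powr \<gamma>)"
    using AE_lborel_singleton[of 1] by eventually_elim (auto simp: indicator_def)
  ultimately show ?thesis
    by (subst integrable_cong_AE[symmetric]) auto
qed

text \<open>Writing j = h x turns the sum into an integral: two coefficients contribute h^(2 d - 2)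
  and the number of cells h, together h^(2 d - 1). The parameter \<theta> is 0 for d > 0 and 1 for d
  < 0. In the second case x^(d - 1) alone is not integrable at 0; the subtracted \<open>a h\<close>,
  harmless since the coefficients sum to 0, restores integrability. The index 0 is left out because
  the power law of \<open>a\<close> describes positive indices only.\<close>

lemma lag_series_asymptotics:
  fixes a :: "nat \<Rightarrow> real"
  assumes c: "c \<noteq> 0"
    and lim: "(\<lambda>j. a j / real j powr (d - 1)) \<longlonglongrightarrow> c"
    and w: "integrable lborel (\<lambda>x. indicator {0<..} x * w x)"
    and bound: "\<And>h x. h \<ge> 1 \<Longrightarrow> x > 0 \<Longrightarrow>
      \<bar>a (grid h x) * (a (grid h x + h) - \<theta> * a h)\<bar> \<le> w x * real h powr (2 * d - 2)"
  shows "integrable lborel (\<lambda>x. indicator {0<..} x * (x powr (d - 1) * ((1 + x) powr (d - 1) - \<theta>)))"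
    and "(\<lambda>h. (\<Sum>j. a (Suc j) * (a (Suc j + h) - \<theta> * a h)) * real h powr (1 - 2 * d))
      \<longlonglongrightarrow> c\<^sup>2 * (\<integral>x. indicator {0<..} x * (x powr (d - 1) * ((1 + x) powr (d - 1) - \<theta>)) \<partial>lborel)"
proof -
  define f where "f h j = real h powr (2 - 2 * d) * (a j * (a (j + h) - \<theta> * a h))" for h j
  define g where "g x = x powr (d - 1) * ((1 + x) powr (d - 1) - \<theta>)" for x :: real
  have fb: "\<bar>f h (grid h x)\<bar> \<le> w x" if "h \<ge> 1" "x > 0" for h x
  proof -
    have "\<bar>f h (grid h x)\<bar> \<le> real h powr (2 - 2 * d) * (w x * real h powr (2 * d - 2))"
      unfolding f_def abs_mult[of "real h powr _"] using bound[OF that] by (intro mult_mono) auto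
    also have "\<dots> = w x * (real h powr (2 - 2 * d) * real h powr (2 * d - 2))" by simp
    also have "real h powr (2 - 2 * d) * real h powr (2 * d - 2) = 1"
      using that by (simp add: powr_add[symmetric])
    finally show ?thesis by simp
  qed
  have lim': "(\<lambda>h. f h (grid h x)) \<longlonglongrightarrow> c\<^sup>2 * g x" if x: "x > 0" for x
  proof -
    define j where "j h = grid h x" for h
    have j1: "j h \<ge> 1" if "h \<ge> 1" for h using nat_ceiling_mult_bounds(1)[OF x, of h] that by (simp add: j_def)
    have jt: "(\<lambda>h. real (j h) / real h) \<longlonglongrightarrow> x" and jf: "filterlim j sequentially sequentially"
      using nat_ceiling_mult_tendsto[OF x] unfolding j_def by auto
    have jhf: "filterlim (\<lambda>h. j h + h) sequentially sequentially"
      by (rule filterlim_at_top_mono[OF filterlim_ident]) (auto intro: always_eventually)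
    have jht: "(\<lambda>h. 1 + real (j h) / real h) \<longlonglongrightarrow> 1 + x" by (intro tendsto_intros jt)
    \<comment> \<open>Each coefficient is normalised by its own power law; what remains are powers
      of j / h and 1 + j / h, which tend to powers of x and 1 + x.\<close>
    have "(\<lambda>h. (a (j h) / real (j h) powr (d - 1)) * (real (j h) / real h) powr (d - 1)
        * ((a (j h + h) / real (j h + h) powr (d - 1)) * (1 + real (j h) / real h) powr (d - 1) - \<theta> * (a h / real h powr (d - 1))))
      \<longlonglongrightarrow> c * x powr (d - 1) * (c * (1 + x) powr (d - 1) - \<theta> * c)"
      using x by (intro tendsto_intros filterlim_compose[OF lim jf] filterlim_compose[OF lim jhf] lim jt jht) auto
    moreover have "\<forall>\<^sub>F h in sequentially. (a (j h) / real (j h) powr (d - 1)) * (real (j h) / real h) powr (d - 1)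
        * ((a (j h + h) / real (j h + h) powr (d - 1)) * (1 + real (j h) / real h) powr (d - 1) - \<theta> * (a h / real h powr (d - 1)))
       = f h (j h)"
      using eventually_ge_at_top[of 1]
    proof eventually_elim
      case (elim h)
      have p: "real (j h) > 0" "real h > 0" using j1[OF elim] elim by auto
      have e1: "(a (j h) / real (j h) powr (d - 1)) * (real (j h) / real h) powr (d - 1) = a (j h) / real h powr (d - 1)"
        using p by (simp add: powr_divide)
      have "1 + real (j h) / real h = real (j h + h) / real h" using p by (simp add: field_simps)
      then have e2: "(a (j h + h) / real (j h + h) powr (d - 1)) * (1 + real (j h) / real h) powr (d - 1) = a (j h + h) / real h powr (d - 1)"
        using p by (simp add: powr_divide)
      have "1 / real h powr (d - 1) = real h powr (1 - d)" by (metis minus_diff_eq powr_minus_divide)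
      then have "real h powr (2 - 2 * d) = (1 / real h powr (d - 1)) * (1 / real h powr (d - 1))"
        by (simp add: powr_add[symmetric])
      then have h2: "f h (j h) = (1 / real h powr (d - 1)) * (1 / real h powr (d - 1)) * (a (j h) * (a (j h + h) - \<theta> * a h))"
        by (simp only: f_def)
      have gen: "u / H * (v / H - \<theta> * (z / H)) = (1 / H) * (1 / H) * (u * (v - \<theta> * z))" for u v z H :: real
        by (simp add: algebra_simps diff_divide_distrib)
      show ?case unfolding e1 e2 h2 by (rule gen)
    qed
    ultimately have "(\<lambda>h. f h (j h)) \<longlonglongrightarrow> c * x powr (d - 1) * (c * (1 + x) powr (d - 1) - \<theta> * c)"
      by (rule Lim_transform_eventually)
    then show ?thesis by (simp add: j_def g_def power2_eq_square algebra_simps)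
  qed
  have [measurable]: "g \<in> borel_measurable borel" unfolding g_def by measurable
  have AElim: "AE x in lborel. (\<lambda>h. indicator {0<..} x * f (Suc h) (nat \<lceil>real (Suc h) * x\<rceil>)) \<longlonglongrightarrow> indicator {0<..} x * (c\<^sup>2 * g x)"
  proof -
    have "(\<lambda>h. indicator {0<..} x * f (Suc h) (nat \<lceil>real (Suc h) * x\<rceil>)) \<longlonglongrightarrow> indicator {0<..} x * (c\<^sup>2 * g x)" for x
    proof (cases "x > 0")
      case True
      then show ?thesis using LIMSEQ_Suc[OF lim'[OF True]] by simp
    qed simp
    then show ?thesis by simp
  qed
  have AEbound: "AE x in lborel. norm (indicator {0<..} x * f (Suc h) (nat \<lceil>real (Suc h) * x\<rceil>)) \<le> indicator {0<..} x * w x" for h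
    using fb[of "Suc h"] by (auto simp: indicator_def)
  have conv: "(\<lambda>h. \<integral>x. indicator {0<..} x * f (Suc h) (nat \<lceil>real (Suc h) * x\<rceil>) \<partial>lborel) \<longlonglongrightarrow> (\<integral>x. indicator {0<..} x * (c\<^sup>2 * g x) \<partial>lborel)"
    by (rule integral_dominated_convergence[OF _ _ w AElim AEbound]) measurable
  have "integrable lborel (\<lambda>x. indicator {0<..} x * (c\<^sup>2 * g x))"
    by (rule integrable_dominated_convergence[OF _ _ w AElim AEbound]) measurable
  then have "integrable lborel (\<lambda>x. (1 / c\<^sup>2) * (indicator {0<..} x * (c\<^sup>2 * g x)))"
    by (rule integrable_mult_right)
  then show "integrable lborel (\<lambda>x. indicator {0<..} x * (x powr (d - 1) * ((1 + x) powr (d - 1) - \<theta>)))"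
    using c by (simp add: g_def)
  have sums: "(\<lambda>j. f h (Suc j)) sums (real h * (\<integral>x. indicator {0<..} x * f h (grid h x) \<partial>lborel))" if "h \<ge> 1" for h
    by (rule sums_step_function[OF _ w]) (use fb that in auto)
  have eq: "(\<Sum>j. a (Suc j) * (a (Suc j + h) - \<theta> * a h)) * real h powr (1 - 2 * d)
     = (\<integral>x. indicator {0<..} x * f h (grid h x) \<partial>lborel)" if h: "h \<ge> 1" for h
  proof -
    have p: "real h powr (2 - 2 * d) > 0" using h by simp
    have "(\<lambda>j. real h powr (2 - 2 * d) * (a (Suc j) * (a (Suc j + h) - \<theta> * a h))) sums (real h * (\<integral>x. indicator {0<..} x * f h (grid h x) \<partial>lborel))"
      using sums[OF h] by (simp add: f_def)
    from sums_divide[OF this, of "real h powr (2 - 2 * d)"]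
    have "(\<lambda>j. a (Suc j) * (a (Suc j + h) - \<theta> * a h)) sums (real h * (\<integral>x. indicator {0<..} x * f h (grid h x) \<partial>lborel) / real h powr (2 - 2 * d))"
      using p by simp
    then have "(\<Sum>j. a (Suc j) * (a (Suc j + h) - \<theta> * a h)) = real h * (\<integral>x. indicator {0<..} x * f h (grid h x) \<partial>lborel) / real h powr (2 - 2 * d)"
      by (rule sums_unique[symmetric])
    moreover have "real h powr (2 - 2 * d) = real h * real h powr (1 - 2 * d)"
      using h powr_add[of "real h" 1 "1 - 2 * d"] by simp
    ultimately show ?thesis using h by (simp add: field_simps)
  qed
  have "(\<lambda>h. (\<Sum>j. a (Suc j) * (a (Suc j + Suc h) - \<theta> * a (Suc h))) * real (Suc h) powr (1 - 2 * d)) \<longlonglongrightarrow> (\<integral>x. indicator {0<..} x * (c\<^sup>2 * g x) \<partial>lborel)"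
  proof -
    have "(\<Sum>j. a (Suc j) * (a (Suc j + Suc h) - \<theta> * a (Suc h))) * real (Suc h) powr (1 - 2 * d)
      = (\<integral>x. indicator {0<..} x * f (Suc h) (nat \<lceil>real (Suc h) * x\<rceil>) \<partial>lborel)" for h
      by (rule eq) simp
    then show ?thesis using conv by (simp only:)
  qed
  then have "(\<lambda>h. (\<Sum>j. a (Suc j) * (a (Suc j + h) - \<theta> * a h)) * real h powr (1 - 2 * d)) \<longlonglongrightarrow> (\<integral>x. indicator {0<..} x * (c\<^sup>2 * g x) \<partial>lborel)"
    by (rule LIMSEQ_imp_Suc)
  also have "(\<integral>x. indicator {0<..} x * (c\<^sup>2 * g x) \<partial>lborel) = c\<^sup>2 * (\<integral>x. indicator {0<..} x * g x \<partial>lborel)"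
    by (simp only: mult.left_commute[of "indicator _ _"] integral_mult_right_zero)
  finally show "(\<lambda>h. (\<Sum>j. a (Suc j) * (a (Suc j + h) - \<theta> * a h)) * real h powr (1 - 2 * d))
      \<longlonglongrightarrow> c\<^sup>2 * (\<integral>x. indicator {0<..} x * (x powr (d - 1) * ((1 + x) powr (d - 1) - \<theta>)) \<partial>lborel)"
    by (simp add: g_def)
qed

lemma integral_pos_of_pos_on_interval:
  fixes f :: "real \<Rightarrow> real"
  assumes f: "integrable lborel f" and nonneg: "AE x in lborel. f x \<ge> 0"
    and pos: "AE x in lborel. x \<in> {p<..<q} \<longrightarrow> f x > 0" and pq: "p < q"
  shows "(\<integral>x. f x \<partial>lborel) > 0"
proof -
  have "(\<integral>x. f x \<partial>lborel) \<noteq> 0"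
  proof
    assume "(\<integral>x. f x \<partial>lborel) = 0"
    then have "AE x in lborel. f x = 0" using integral_nonneg_eq_0_iff_AE[OF f nonneg] by simp
    then have "AE x in lborel. x \<notin> {p<..<q}" using pos by eventually_elim auto
    then have "{p<..<q} \<in> null_sets lborel" using AE_iff_null_sets[of "{p<..<q}" lborel] by simp
    then show False using pq by (auto simp: null_sets_def)
  qed
  then show ?thesis using integral_nonneg_AE[OF nonneg] by simp
qed

text \<open>The exact value matters because \<delta>(- 1/2) = 8 \<sigma>^2 c^2 is prescribed: the
  lag constant - 4 c^2 divided by d = - 1/2 is 8 c^2.\<close>

lemma integral_lag_kernel_half:
  "(\<integral>x. indicator {0<..} x * ((x::real) powr (- 1/2 - 1) * ((1 + x) powr (- 1/2 - 1) - 1)) \<partial>lborel) = - 4"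
proof -
  let ?f = "\<lambda>x::real. x powr (- 3/2) * (1 - (1 + x) powr (- 3/2))"
  \<comment> \<open>The sum of the primitives - 2 x^(- 1/2) of x^(- 3/2) and 2 (1 + 2 x) / sqrt (x
    (1 + x)) of - (x (1 + x))^(- 3/2). Each diverges at 0, the sum tends to 0 there.\<close>
  let ?F = "\<lambda>x::real. 2 * (1 + 2 * x) * (x powr (- 1/2) * (1 + x) powr (- 1/2)) - 2 * x powr (- 1/2)"
  have lim0: "(?F \<longlongrightarrow> 0) (at_right 0)" by real_asymp
  have liminf: "(?F \<longlongrightarrow> 4) at_top" by real_asymp
  have "(LBINT x=0..\<infinity>. ?f x) = 4 - 0"
  proof (rule interval_integral_FTC_nonneg(2)[where F = ?F])
    fix x :: real assume "0 < ereal x" "ereal x < \<infinity>"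
    then have x: "x > 0" by simp
    have p: "x powr (- 3/2) = x powr (- 1/2) / x" "(1 + x) powr (- 3/2) = (1 + x) powr (- 1/2) / (1 + x)"
      using x powr_add[of x "- 1/2" "- 1"] powr_add[of "1 + x" "- 1/2" "- 1"]
      by (simp_all add: powr_minus_divide)
    have 1: "((\<lambda>x. x powr (- 1/2)) has_real_derivative (- 1/2 * (x powr (- 1/2) / x))) (at x)"
      using has_real_derivative_powr[OF x, of "- 1/2"] p(1) by (simp add: mult.commute)
    have 2: "((\<lambda>x. (1 + x) powr (- 1/2)) has_real_derivative (- 1/2 * ((1 + x) powr (- 1/2) / (1 + x)))) (at x)"
      using DERIV_shift[of "\<lambda>z. z powr (- 1/2)" "- 1/2 * ((1 + x) powr (- 1/2) / (1 + x))" x 1]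
        has_real_derivative_powr[of "1 + x" "- 1/2"] x p(2)
      by (simp add: add.commute[of x 1] add.commute[of _ "1::real"] mult.commute)
    have 3: "((\<lambda>x::real. 2 * (1 + 2 * x)) has_real_derivative 4) (at x)"
      by (auto intro!: derivative_eq_intros)
    have alg: "4 * (u * v) + (- 1/2 * (u / x) * v + - 1/2 * (v / (1 + x)) * u) * (2 * (1 + 2 * x)) - 2 * (- 1/2 * (u / x))
       = u / x * (1 - v / (1 + x))" for u v :: real
      using x by (simp add: divide_simps) (simp add: algebra_simps)
    show "DERIV ?F x :> ?f x"
      using DERIV_diff[OF DERIV_mult[OF 3 DERIV_mult[OF 1 2]] DERIV_cmult[OF 1, of 2]]
      unfolding p alg .
    show "isCont ?f x" using x by (intro continuous_intros) auto
  next
    show "AE x in lborel. 0 < ereal x \<longrightarrow> ereal x < \<infinity> \<longrightarrow> 0 \<le> ?f x"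
    proof (intro AE_I2 impI mult_nonneg_nonneg)
      fix x :: real assume "0 < ereal x"
      then have "(1 + x) powr (- 3/2) \<le> 1 powr (- 3/2)" by (intro powr_mono2') auto
      then show "0 \<le> 1 - (1 + x) powr (- 3/2)" by simp
    qed simp
    show "((?F \<circ> real_of_ereal) \<longlongrightarrow> 0) (at_right 0)"
      using lim0 unfolding zero_ereal_def ereal_tendsto_simps .
    show "((?F \<circ> real_of_ereal) \<longlongrightarrow> 4) (at_left \<infinity>)"
      using liminf unfolding ereal_tendsto_simps .
  qed simp
  moreover have "(LBINT x=0..\<infinity>. ?f x) = (\<integral>x. indicator {0<..} x * ?f x \<partial>lborel)"
    by (simp add: interval_lebesgue_integral_def set_lebesgue_integral_def einterval_def zero_ereal_def greaterThan_def)
  moreover have "(\<integral>x. indicator {0<..} x * ((x::real) powr (- 1/2 - 1) * ((1 + x) powr (- 1/2 - 1) - 1)) \<partial>lborel)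
     = (\<integral>x. - (indicator {0<..} x * ?f x) \<partial>lborel)"
    by (intro Bochner_Integration.integral_cong refl) (simp add: algebra_simps)
  moreover have "(\<integral>x. - (indicator {0<..} x * ?f x) \<partial>lborel) = - (\<integral>x. indicator {0<..} x * ?f x \<partial>lborel)"
    by (rule integral_minus)
  ultimately show ?thesis by linarith
qed

section \<open>Autocovariance asymptotics from the memory conditions\<close>

lemma memory_coeffs_tendsto:
  assumes "memory_coeffs d a c" "d \<noteq> 0"
  shows "c > 0" "(\<lambda>j. a j / real j powr (d - 1)) \<longlonglongrightarrow> c"
proof -
  show c: "c > 0" using assms by (cases "d > 0") (auto simp: memory_coeffs_def)
  show "(\<lambda>j. a j / real j powr (d - 1)) \<longlonglongrightarrow> c"
  proof (cases "d > 0")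
    case True
    then have "a \<sim>[at_top] (\<lambda>j. c * real j powr (- 1 + d))" using assms by (simp add: memory_coeffs_def)
    moreover have "\<forall>\<^sub>F j in at_top. a j \<noteq> 0 \<or> c * real j powr (- 1 + d) \<noteq> 0"
      using eventually_gt_at_top[of 0] by eventually_elim (use c in auto)
    ultimately have "(\<lambda>j. a j / (c * real j powr (- 1 + d))) \<longlonglongrightarrow> 1" by (rule asymp_equivD_strong)
    then have "(\<lambda>j. c * (a j / (c * real j powr (- 1 + d)))) \<longlonglongrightarrow> c * 1" by (intro tendsto_intros)
    then show ?thesis using c by (simp add: add.commute)
  next
    case False
    then obtain r where r: "r \<in> O(\<lambda>j. 1 / real j)" "\<forall>\<^sub>F j in at_top. a j = c * real j powr (- 1 + d) * (1 + r j)"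
      using assms by (auto simp: memory_coeffs_def)
    obtain B where "\<forall>\<^sub>F j in at_top. norm (r j) \<le> B * norm (1 / real j)" using r(1) by (auto elim: landau_o.bigE)
    moreover have "(\<lambda>j. B * norm (1 / real j)) \<longlonglongrightarrow> 0"
      by (intro tendsto_mult_right_zero tendsto_norm_zero) real_asymp
    ultimately have "r \<longlonglongrightarrow> 0" by (rule Lim_null_comparison)
    then have "(\<lambda>j. c * (1 + r j)) \<longlonglongrightarrow> c * (1 + 0)" by (intro tendsto_intros)
    moreover have "\<forall>\<^sub>F j in sequentially. c * (1 + r j) = a j / real j powr (d - 1)"
      using r(2) eventually_gt_at_top[of 0] by eventually_elim (simp add: add.commute)
    ultimately show ?thesis using Lim_transform_eventually by fastforce
  qed
qed

text \<open>For the dominating function, \<open>a (j + h)\<close> is bounded at scale h if x <= 1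
  and at scale h x beyond, so it behaves like x^(d - 1) at 0 and x^(2 d - 2) at infinity; the latter
  is integrable because d < 1/2. The omitted term \<open>a 0 * a h\<close> has the smaller order
  h^(d - 1).\<close>

lemma lag_product_asymptotics_pos:
  assumes mc: "memory_coeffs d a c" and d: "0 < d" "d < 1/2"
  obtains C where "C > 0" "(\<lambda>h. lag_product a h * real h powr (1 - 2 * d)) \<longlonglongrightarrow> C"
proof -
  note c = memory_coeffs_tendsto(1)[OF mc] and lim = memory_coeffs_tendsto(2)[OF mc]
  have sq: "summable (\<lambda>j. (a j)\<^sup>2)" using mc by (simp add: memory_coeffs_def)
  obtain K where K: "K > 0" "\<And>j. j \<ge> 1 \<Longrightarrow> \<bar>a j\<bar> \<le> K * real j powr (d - 1)"
    using tendsto_imp_bound[OF lim] d by auto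
  define w where "w x = K\<^sup>2 * (if x \<le> 1 then x powr (d - 1) else x powr (2 * d - 2))" for x :: real
  have wi: "integrable lborel (\<lambda>x. indicator {0<..} x * w x)"
    using integrable_mult_right[OF integrable_two_powr[of "d - 1" "2 * d - 2"], of "K\<^sup>2"] d
    by (simp add: w_def mult.left_commute)
  have bound: "\<bar>a (grid h x) * (a (grid h x + h) - 0 * a h)\<bar> \<le> w x * real h powr (2 * d - 2)"
    if h: "h \<ge> 1" and x: "x > 0" for h x
  proof -
    define j where "j = grid h x"
    have j: "j \<ge> 1" "real j \<ge> real h * x" using nat_ceiling_mult_bounds[OF x, of h] h by (auto simp: j_def)
    have "\<bar>a j\<bar> \<le> K * (real h * x) powr (d - 1)"
      using K(2)[OF j(1)] powr_mono2'[of "1 - d" "real h * x" "real j"] j x h d K(1)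
      by (intro order_trans[OF K(2)[OF j(1)]] mult_left_mono powr_mono2') auto
    then have 1: "\<bar>a j\<bar> \<le> K * x powr (d - 1) * real h powr (d - 1)" using x by (simp add: powr_mult mult_ac)
    have "\<bar>a (j + h)\<bar> \<le> K * (real h * (if x \<le> 1 then 1 else x)) powr (d - 1)"
      using j x h d K(1) by (intro order_trans[OF K(2)] mult_left_mono powr_mono2') auto
    then have 2: "\<bar>a (j + h)\<bar> \<le> K * (if x \<le> 1 then 1 else x powr (d - 1)) * real h powr (d - 1)"
      using x by (auto simp: powr_mult mult_ac split: if_splits)
    have "\<bar>a j * a (j + h)\<bar> \<le> (K * x powr (d - 1) * real h powr (d - 1)) * (K * (if x \<le> 1 then 1 else x powr (d - 1)) * real h powr (d - 1))"
      unfolding abs_mult using 1 2 K(1) by (intro mult_mono) auto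
    also have "\<dots> = w x * real h powr (2 * d - 2)"
    proof -
      have "real h powr (2 * d - 2) = real h powr (d - 1) * real h powr (d - 1)" by (simp add: powr_add[symmetric])
      moreover have "x powr (2 * d - 2) = x powr (d - 1) * x powr (d - 1)" by (simp add: powr_add[symmetric])
      ultimately show ?thesis by (simp add: w_def power2_eq_square)
    qed
    finally show ?thesis by (simp add: j_def)
  qed
  have c0: "c \<noteq> 0" "d \<noteq> 0" using c d by auto
  note L = lag_series_asymptotics[OF c0(1) lim[OF c0(2)] wi bound]
  define I where "I = (\<integral>x. indicator {0<..} x * (x powr (d - 1) * ((1 + x) powr (d - 1) - 0)) \<partial>lborel)"
  have I: "I > 0" unfolding I_def
    by (rule integral_pos_of_pos_on_interval[OF L(1), of 0 1]) auto
  have "(\<lambda>h. a h / real h powr (d - 1) * real h powr (- d) * a 0) \<longlonglongrightarrow> c * 0 * a 0"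
    using d by (intro tendsto_intros lim c0) real_asymp
  moreover have "\<forall>\<^sub>F h in sequentially. a h / real h powr (d - 1) * real h powr (- d) * a 0 = a 0 * a h * real h powr (1 - 2 * d)"
    using eventually_gt_at_top[of 0]
    by eventually_elim (simp add: powr_diff powr_minus_divide powr_add[symmetric] field_simps flip: powr_add)
  ultimately have z: "(\<lambda>h. a 0 * a h * real h powr (1 - 2 * d)) \<longlonglongrightarrow> 0"
    using Lim_transform_eventually by fastforce
  have "lag_product a h = a 0 * a h + (\<Sum>j. a (Suc j) * (a (Suc j + h) - 0 * a h))" for h
    using suminf_split_head[OF summable_rabs_cancel[OF summable_lag_product[OF sq, of h]]]
    by (simp add: lag_product_def)
  then have "(\<lambda>h. lag_product a h * real h powr (1 - 2 * d)) \<longlonglongrightarrow> 0 + c\<^sup>2 * I"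
    using tendsto_add[OF z L(2)] by (simp add: I_def ring_distribs)
  then show ?thesis using that[of "c\<^sup>2 * I"] I c0 by simp
qed

text \<open>The increment bound is where the error factor 1 + O(1/j) enters: asymptotic equivalence
  alone would not control a (j + h) - a h for j small compared with h.\<close>

lemma memory_coeffs_neg_bounds:
  assumes mc: "memory_coeffs d a c" and d: "-1/2 \<le> d" "d < 0"
  obtains K where "K > 0" "\<And>j. j \<ge> 1 \<Longrightarrow> \<bar>a j\<bar> \<le> K * real j powr (d - 1)"
    "\<And>j h. j \<ge> 1 \<Longrightarrow> h \<ge> 1 \<Longrightarrow> \<bar>a (j + h) - a h\<bar> \<le> K * real j * real h powr (d - 2)"
proof -
  have c: "c > 0" and lim: "(\<lambda>j. a j / real j powr (d - 1)) \<longlonglongrightarrow> c"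
    using memory_coeffs_tendsto[OF mc] d by auto
  obtain K where K: "K > 0" "\<And>j. j \<ge> 1 \<Longrightarrow> \<bar>a j\<bar> \<le> K * real j powr (d - 1)"
    using tendsto_imp_bound[OF lim] by auto
  obtain r where r: "r \<in> O(\<lambda>j. 1 / real j)" "\<forall>\<^sub>F j in at_top. a j = c * real j powr (- 1 + d) * (1 + r j)"
    using mc d by (auto simp: memory_coeffs_def)
  obtain B where B: "\<forall>\<^sub>F j in at_top. norm (r j) \<le> B * norm (1 / real j)" using r(1) by (auto elim: landau_o.bigE)
  have "\<forall>\<^sub>F j in sequentially. \<bar>a j - c * real j powr (d - 1)\<bar> \<le> (c * B) * real j powr (d - 2)"
    using r(2) B eventually_gt_at_top[of 0]
  proof eventually_elim
    case (elim j)
    have "a j - c * real j powr (d - 1) = c * real j powr (d - 1) * r j"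
      using elim by (simp add: algebra_simps)
    then have "\<bar>a j - c * real j powr (d - 1)\<bar> = c * real j powr (d - 1) * \<bar>r j\<bar>" using c by (simp add: abs_mult)
    also have "\<dots> \<le> c * real j powr (d - 1) * (B * (1 / real j))" using elim c by (intro mult_left_mono) auto
    also have "\<dots> = (c * B) * real j powr (d - 2)"
      using elim powr_add[of "real j" 1 "d - 2"] by simp
    finally show ?case .
  qed
  from eventually_bound_imp_bound[OF this]
  obtain K1 where K1: "K1 > 0" "\<And>j. j \<ge> 1 \<Longrightarrow> \<bar>a j - c * real j powr (d - 1)\<bar> \<le> K1 * real j powr (d - 2)" by auto
  define K2 where "K2 = K + 2 * K1 + c * (1 - d)"
  have K2: "K2 \<ge> K" "K2 \<ge> 2 * K1 + c * (1 - d)" using K K1 c d by (auto simp: K2_def)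
  show ?thesis
  proof
    show "K2 > 0" using K K2 by simp
    fix j :: nat assume j: "j \<ge> 1"
    have "K * real j powr (d - 1) \<le> K2 * real j powr (d - 1)" using K2 by (intro mult_right_mono) auto
    then show "\<bar>a j\<bar> \<le> K2 * real j powr (d - 1)" using K(2)[OF j] by simp
    fix h :: nat assume h: "h \<ge> 1"
    have p: "real (j + h) powr (d - 2) \<le> real h powr (d - 2)" using h d by (intro powr_mono2') auto
    have e1: "\<bar>a (j + h) - c * real (j + h) powr (d - 1)\<bar> \<le> K1 * real h powr (d - 2)"
      using K1(2)[of "j + h"] p h K1(1) by (auto intro: order_trans mult_left_mono)
    have e2: "\<bar>a h - c * real h powr (d - 1)\<bar> \<le> K1 * real h powr (d - 2)" using K1(2)[OF h] .
    have t: "real (j + h) powr (d - 1) = real h powr (d - 1) * (1 + real j / real h) powr (d - 1)"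
    proof -
      have "real (j + h) = real h * (1 + real j / real h)" using h by (simp add: field_simps)
      then show ?thesis by (simp only: powr_mult)
    qed
    have "1 + (d - 1) * (real j / real h) \<le> (1 + real j / real h) powr (d - 1)"
      by (rule one_plus_powr_ge) (use d in auto)
    then have "real h powr (d - 1) * (1 - (1 + real j / real h) powr (d - 1)) \<le> real h powr (d - 1) * ((1 - d) * (real j / real h))"
      by (intro mult_left_mono) (auto simp: algebra_simps diff_divide_distrib)
    also have "\<dots> = (1 - d) * real j * real h powr (d - 2)"
      using h powr_add[of "real h" 1 "d - 2"] by simp
    finally have u: "real h powr (d - 1) - real (j + h) powr (d - 1) \<le> (1 - d) * real j * real h powr (d - 2)"
      unfolding t by (simp add: algebra_simps)
    have l: "real (j + h) powr (d - 1) \<le> real h powr (d - 1)" using h d by (intro powr_mono2') auto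
    have e3: "\<bar>c * real (j + h) powr (d - 1) - c * real h powr (d - 1)\<bar> \<le> c * ((1 - d) * real j * real h powr (d - 2))"
    proof -
      have "\<bar>c * real (j + h) powr (d - 1) - c * real h powr (d - 1)\<bar> = c * (real h powr (d - 1) - real (j + h) powr (d - 1))"
        using l c by (simp add: right_diff_distrib[symmetric] abs_mult)
      then show ?thesis using u c by (simp add: mult_left_mono)
    qed
    have "\<bar>a (j + h) - a h\<bar> \<le> K1 * real h powr (d - 2) + K1 * real h powr (d - 2) + c * ((1 - d) * real j * real h powr (d - 2))"
      using e1 e2 e3 by linarith
    \<comment> \<open>The error terms lack the factor j; j >= 1 supplies it.\<close>
    also have "\<dots> \<le> K1 * (real j * real h powr (d - 2)) + K1 * (real j * real h powr (d - 2)) + c * ((1 - d) * real j * real h powr (d - 2))"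
      using j K1(1) by (intro add_mono mult_left_mono order_refl) (auto simp: mult_le_cancel_right1)
    also have "\<dots> = (2 * K1 + c * (1 - d)) * (real j * real h powr (d - 2))" by (simp add: algebra_simps)
    also have "\<dots> \<le> K2 * (real j * real h powr (d - 2))" using K2 by (intro mult_right_mono) auto
    finally show "\<bar>a (j + h) - a h\<bar> \<le> K2 * real j * real h powr (d - 2)" by (simp add: mult.assoc)
  qed
qed

text \<open>As the coefficients sum to 0, \<open>a h\<close> may be subtracted inside the lag
  product. The term j = 0 then vanishes, and near x = 0 the increment bound improves x^(d - 1) to
  x^d, which is integrable. The limit is negative because (1 + x)^(d - 1) < 1.\<close>

lemma lag_product_asymptotics_neg:
  assumes mc: "memory_coeffs d a c" and d: "-1/2 \<le> d" "d < 0"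
  obtains C where "C < 0" "(\<lambda>h. lag_product a h * real h powr (1 - 2 * d)) \<longlonglongrightarrow> C" "d = - 1/2 \<Longrightarrow> C = - 4 * c\<^sup>2"
proof -
  have c: "c > 0" and lim: "(\<lambda>j. a j / real j powr (d - 1)) \<longlonglongrightarrow> c"
    using memory_coeffs_tendsto[OF mc] d by auto
  have sq: "summable (\<lambda>j. (a j)\<^sup>2)" and a0: "a sums 0" using mc d by (simp_all add: memory_coeffs_def)
  obtain K where K: "K > 0" "\<And>j. j \<ge> 1 \<Longrightarrow> \<bar>a j\<bar> \<le> K * real j powr (d - 1)"
    "\<And>j h. j \<ge> 1 \<Longrightarrow> h \<ge> 1 \<Longrightarrow> \<bar>a (j + h) - a h\<bar> \<le> K * real j * real h powr (d - 2)"
    using memory_coeffs_neg_bounds[OF assms] by auto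
  define w where "w x = 2 * K\<^sup>2 * (if x \<le> 1 then x powr d else x powr (d - 1))" for x :: real
  have wi: "integrable lborel (\<lambda>x. indicator {0<..} x * w x)"
    using integrable_mult_right[OF integrable_two_powr[of d "d - 1"], of "2 * K\<^sup>2"] d
    by (simp add: w_def mult.left_commute)
  have bound: "\<bar>a (grid h x) * (a (grid h x + h) - 1 * a h)\<bar> \<le> w x * real h powr (2 * d - 2)"
    if h: "h \<ge> 1" and x: "x > 0" for h x
  proof -
    define j where "j = grid h x"
    have j: "j \<ge> 1" "real j \<ge> real h * x" using nat_ceiling_mult_bounds[OF x, of h] h by (auto simp: j_def)
    have hh: "real h powr (2 * d - 2) = real h powr (d - 1) * real h powr (d - 1)"
      "real h powr (2 * d - 2) = real h powr d * real h powr (d - 2)" by (simp_all add: powr_add[symmetric])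
    have "\<bar>a j * (a (j + h) - a h)\<bar> \<le> 2 * K\<^sup>2 * (if x \<le> 1 then x powr d else x powr (d - 1)) * real h powr (2 * d - 2)"
    proof (cases "x \<le> 1")
      case True
      have "\<bar>a j * (a (j + h) - a h)\<bar> \<le> (K * real j powr (d - 1)) * (K * real j * real h powr (d - 2))"
        unfolding abs_mult using K(1) K(2)[OF j(1)] K(3)[OF j(1) h] by (intro mult_mono) auto
      also have "\<dots> = K\<^sup>2 * real j powr d * real h powr (d - 2)"
        using j(1) powr_add[of "real j" 1 "d - 1"] by (simp add: power2_eq_square)
      also have "\<dots> \<le> K\<^sup>2 * (real h * x) powr d * real h powr (d - 2)"
        using j x h d by (intro mult_right_mono mult_left_mono powr_mono2') auto
      also have "\<dots> = K\<^sup>2 * x powr d * real h powr (2 * d - 2)" using x by (simp add: powr_mult hh(2))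
      also have "\<dots> \<le> 2 * (K\<^sup>2 * x powr d * real h powr (2 * d - 2))" by simp
      finally show ?thesis using True by simp
    next
      case False
      have 1: "\<bar>a j\<bar> \<le> K * (real h * x) powr (d - 1)"
        using j x h d K(1) by (intro order_trans[OF K(2)] mult_left_mono powr_mono2') auto
      have "\<bar>a (j + h)\<bar> \<le> K * real h powr (d - 1)"
        using h d K(1) by (intro order_trans[OF K(2)] mult_left_mono powr_mono2') auto
      then have 2: "\<bar>a (j + h) - a h\<bar> \<le> 2 * K * real h powr (d - 1)" using K(2)[OF h] by linarith
      have "\<bar>a j * (a (j + h) - a h)\<bar> \<le> (K * (real h * x) powr (d - 1)) * (2 * K * real h powr (d - 1))"
        unfolding abs_mult using 1 2 K(1) by (intro mult_mono) auto
      also have "\<dots> = 2 * K\<^sup>2 * x powr (d - 1) * real h powr (2 * d - 2)"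
        using x by (simp add: powr_mult hh(1) power2_eq_square)
      finally show ?thesis using False by simp
    qed
    then show ?thesis by (simp add: j_def w_def)
  qed
  have c0: "c \<noteq> 0" using c by simp
  note L = lag_series_asymptotics[OF c0 lim wi bound]
  define I where "I = (\<integral>x. indicator {0<..} x * (x powr (d - 1) * ((1 + x) powr (d - 1) - 1)) \<partial>lborel)"
  have "0 < (\<integral>x. - (indicator {0<..} x * (x powr (d - 1) * ((1 + x) powr (d - 1) - 1))) \<partial>lborel)"
  proof (rule integral_pos_of_pos_on_interval[of _ 0 1])
    have lt: "(1 + x) powr (d - 1) < 1" if "x > 0" for x :: real
      using that d powr_less_one by auto
    then show "AE x in lborel. 0 \<le> - (indicat_real {0<..} x * (x powr (d - 1) * ((1 + x) powr (d - 1) - 1)))"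
      by (auto simp: indicator_def mult_le_0_iff less_imp_le)
    show "AE x in lborel. x \<in> {0<..<1} \<longrightarrow> 0 < - (indicat_real {0<..} x * (x powr (d - 1) * ((1 + x) powr (d - 1) - 1)))"
      using lt by (auto simp: mult_less_0_iff)
  qed (use L(1) in auto)
  then have I: "I < 0" by (simp add: I_def)
  have eq: "lag_product a h = (\<Sum>j. a (Suc j) * (a (Suc j + h) - 1 * a h))" for h
  proof -
    have "(\<lambda>j. a j * a (j + h) - a h * a j) sums (lag_product a h - a h * 0)"
      unfolding lag_product_def
      by (intro sums_diff summable_sums sums_mult a0 summable_rabs_cancel[OF summable_lag_product[OF sq]])
    then have s: "(\<lambda>j. a j * (a (j + h) - 1 * a h)) sums lag_product a h" by (simp add: algebra_simps)
    then have "(\<lambda>j. a (Suc j) * (a (Suc j + h) - 1 * a h)) sums (lag_product a h - a 0 * (a (0 + h) - 1 * a h))"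
      by (subst sums_Suc_iff) simp
    then show ?thesis by (simp add: sums_iff)
  qed
  have "(\<lambda>h. lag_product a h * real h powr (1 - 2 * d)) \<longlonglongrightarrow> c\<^sup>2 * I"
    using L(2) unfolding eq I_def .
  moreover have "c\<^sup>2 * I < 0" using I c by (simp add: mult_pos_neg)
  moreover have "c\<^sup>2 * I = - 4 * c\<^sup>2" if "d = - 1/2"
    using integral_lag_kernel_half by (simp add: I_def that)
  ultimately show ?thesis using that by blast
qed

text \<open>For an autocovariance r, the sum over all lags from - h to h: the amount by which the
  variance of a partial sum grows when term h + 1 is added.\<close>

definition lag_partial_sum :: "(nat \<Rightarrow> real) \<Rightarrow> nat \<Rightarrow> real" where
  "lag_partial_sum r h = r 0 + 2 * (\<Sum>k = 1..h. r k)"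

text \<open>For \<open>r = lag_product a\<close>, the variance of the sum of h consecutive values of
  the process, divided by \<sigma>^2.\<close>

definition lag_variance :: "(nat \<Rightarrow> real) \<Rightarrow> nat \<Rightarrow> real" where
  "lag_variance r h = (\<Sum>i<h. lag_partial_sum r i)"

text \<open>Summed over all h and j, the products |a_j a_(j + h)| amount to at most the squared l1
  norm of \<open>a\<close>.\<close>

lemma lag_product_abs_summable:
  assumes abs: "summable (\<lambda>j. \<bar>a j\<bar>)" and sq: "summable (\<lambda>j. (a j)\<^sup>2)"
  shows "summable (\<lambda>h. \<bar>lag_product a h\<bar>)"
proof (rule bounded_imp_summable)
  define S where "S = (\<Sum>j. \<bar>a j\<bar>)"
  have S0: "S \<ge> 0" unfolding S_def by (rule suminf_nonneg[OF abs]) simp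
  note s = summable_lag_product[OF sq]
  fix n
  have "(\<Sum>h\<le>n. \<bar>lag_product a h\<bar>) \<le> (\<Sum>h\<le>n. \<Sum>j. \<bar>a j * a (j + h)\<bar>)"
    unfolding lag_product_def by (intro sum_mono summable_rabs s)
  also have "\<dots> = (\<Sum>j. \<Sum>h\<le>n. \<bar>a j * a (j + h)\<bar>)"
    by (rule suminf_sum[symmetric]) (rule s)
  also have "\<dots> \<le> (\<Sum>j. \<bar>a j\<bar> * S)"
  proof (rule suminf_le)
    fix j
    have "(\<Sum>h\<le>n. \<bar>a (j + h)\<bar>) = sum (\<lambda>i. \<bar>a i\<bar>) ((+) j ` {..n})"
      by (subst sum.reindex) auto
    also have "\<dots> \<le> S" unfolding S_def by (rule sum_le_suminf[OF abs]) auto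
    finally have "\<bar>a j\<bar> * (\<Sum>h\<le>n. \<bar>a (j + h)\<bar>) \<le> \<bar>a j\<bar> * S" by (intro mult_left_mono) auto
    then show "(\<Sum>h\<le>n. \<bar>a j * a (j + h)\<bar>) \<le> \<bar>a j\<bar> * S" by (simp add: abs_mult sum_distrib_left)
  qed (intro summable_sum s summable_mult2 abs)+
  also have "\<dots> = S * S" using abs by (simp add: S_def suminf_mult2)
  finally show "(\<Sum>h\<le>n. \<bar>lag_product a h\<bar>) \<le> S * S" .
qed simp

text \<open>Summation over the lags first leaves differences of the partial sums \<open>P\<close>.
  The remaining sum of a_j P_j is half of A^2 plus half of the sum of squares, since P_n^2 grows by
  2 a_n P_n - a_n^2. Besides d = 0 this covers d < 0, with limit 0.\<close>

lemma lag_partial_sum_tendsto_square: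
  assumes abs: "summable (\<lambda>j. \<bar>a j\<bar>)" and sq: "summable (\<lambda>j. (a j)\<^sup>2)"
  shows "lag_partial_sum (lag_product a) \<longlonglongrightarrow> (\<Sum>j. a j)\<^sup>2"
proof -
  define S where "S = (\<Sum>j. \<bar>a j\<bar>)"
  define A where "A = (\<Sum>j. a j)"
  define P where "P n = (\<Sum>i\<le>n. a i)" for n
  define T where "T n = S - (\<Sum>i\<le>n. \<bar>a i\<bar>)" for n
  have S0: "S \<ge> 0" unfolding S_def by (rule suminf_nonneg[OF abs]) simp
  have sa: "summable a" by (rule summable_rabs_cancel[OF abs])
  have P: "P \<longlonglongrightarrow> A" unfolding P_def A_def by (rule summable_LIMSEQ'[OF sa])
  have T: "T \<longlonglongrightarrow> S - S" unfolding T_def S_def by (intro tendsto_intros summable_LIMSEQ' abs)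
  have PT: "\<bar>A - P n\<bar> \<le> T m" if "m \<le> n" for m n
  proof -
    have "\<bar>P k - P n\<bar> \<le> T m" if "n \<le> k" for k
    proof -
      have "P k - P n = (\<Sum>i\<in>{n<..k}. a i)" unfolding P_def using that
        by (subst sum_diff[symmetric]) (auto intro!: sum.cong)
      then have "\<bar>P k - P n\<bar> \<le> (\<Sum>i\<in>{n<..k}. \<bar>a i\<bar>)" by simp
      also have "\<dots> \<le> S - (\<Sum>i\<le>m. \<bar>a i\<bar>)"
      proof -
        have "(\<Sum>i\<in>{n<..k}. \<bar>a i\<bar>) + (\<Sum>i\<le>m. \<bar>a i\<bar>) = (\<Sum>i\<in>{n<..k} \<union> {..m}. \<bar>a i\<bar>)"
          using \<open>m \<le> n\<close> by (intro sum.union_disjoint[symmetric]) auto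
        also have "\<dots> \<le> S" unfolding S_def by (rule sum_le_suminf[OF abs]) auto
        finally show ?thesis by simp
      qed
      finally show ?thesis by (simp add: T_def)
    qed
    moreover have "(\<lambda>k. \<bar>P k - P n\<bar>) \<longlonglongrightarrow> \<bar>A - P n\<bar>" by (intro tendsto_intros P)
    ultimately show ?thesis by (intro LIMSEQ_le_const2[of "\<lambda>k. \<bar>P k - P n\<bar>"]) auto
  qed
  have Pb: "\<bar>P n\<bar> \<le> S" for n
  proof -
    have "\<bar>P n\<bar> \<le> (\<Sum>i\<le>n. \<bar>a i\<bar>)" by (simp add: P_def)
    also have "\<dots> \<le> S" unfolding S_def by (rule sum_le_suminf[OF abs]) auto
    finally show ?thesis .
  qed
  have sP: "summable (\<lambda>j. a j * P (j + H))" for H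
  proof (rule summable_rabs_cancel, rule summable_comparison_test')
    show "summable (\<lambda>j. \<bar>a j\<bar> * S)" by (intro summable_mult2 abs)
    show "norm \<bar>a j * P (j + H)\<bar> \<le> \<bar>a j\<bar> * S" for j using Pb by (simp add: abs_mult mult_left_mono)
  qed
  have rsum: "(\<Sum>k = 1..H. lag_product a k) = (\<Sum>j. a j * P (j + H)) - (\<Sum>j. a j * P j)" for H
  proof -
    have "(\<Sum>k = 1..H. lag_product a k) = (\<Sum>j. \<Sum>k = 1..H. a j * a (j + k))"
      unfolding lag_product_def
      by (rule suminf_sum[symmetric]) (rule summable_rabs_cancel[OF summable_lag_product[OF sq]])
    also have "(\<lambda>j. \<Sum>k = 1..H. a j * a (j + k)) = (\<lambda>j. a j * P (j + H) - a j * P j)"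
    proof
      fix j
      have "P (j + H) = P j + (\<Sum>k = 1..H. a (j + k))"
        by (induction H) (auto simp: P_def)
      then show "(\<Sum>k = 1..H. a j * a (j + k)) = a j * P (j + H) - a j * P j"
        by (simp add: sum_distrib_left algebra_simps)
    qed
    also have "(\<Sum>j. a j * P (j + H) - a j * P j) = (\<Sum>j. a j * P (j + H)) - (\<Sum>j. a j * P j)"
      using sP[of H] sP[of 0] by (intro suminf_diff[symmetric]) auto
    finally show ?thesis .
  qed
  have lim: "(\<lambda>H. \<Sum>j. a j * P (j + H)) \<longlonglongrightarrow> A * A"
  proof -
    have "(\<lambda>H. (\<Sum>j. a j * P (j + H)) - A * A) \<longlonglongrightarrow> 0"
    proof (rule Lim_null_comparison)
      show "\<forall>\<^sub>F H in sequentially. norm ((\<Sum>j. a j * P (j + H)) - A * A) \<le> S * T H"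
      proof (intro always_eventually allI)
        fix H
        have "(\<Sum>j. a j * P (j + H)) - A * A = (\<Sum>j. a j * P (j + H) - a j * A)"
          using sP[of H] sa by (subst suminf_diff[symmetric]) (auto intro: summable_mult2 simp: A_def suminf_mult2)
        also have "\<bar>\<dots>\<bar> \<le> (\<Sum>j. \<bar>a j * P (j + H) - a j * A\<bar>)"
        proof (rule summable_rabs, rule summable_comparison_test')
          show "summable (\<lambda>j. \<bar>a j\<bar> * T H)" by (intro summable_mult2 abs)
          show "norm \<bar>a j * P (j + H) - a j * A\<bar> \<le> \<bar>a j\<bar> * T H" for j
            using PT[of H "j + H"] by (simp add: abs_mult mult_left_mono abs_minus_commute flip: right_diff_distrib)
        qed
        also have "\<dots> \<le> (\<Sum>j. \<bar>a j\<bar> * T H)"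
        proof (rule suminf_le)
          show 1: "\<bar>a j * P (j + H) - a j * A\<bar> \<le> \<bar>a j\<bar> * T H" for j
            using PT[of H "j + H"] by (simp add: abs_mult mult_left_mono abs_minus_commute flip: right_diff_distrib)
          show 2: "summable (\<lambda>j. \<bar>a j\<bar> * T H)" by (intro summable_mult2 abs)
          show "summable (\<lambda>j. \<bar>a j * P (j + H) - a j * A\<bar>)"
            by (rule summable_comparison_test'[OF 2, of 0]) (use 1 in simp)
        qed
        also have "\<dots> = S * T H" using abs by (simp add: S_def suminf_mult2)
        finally show "norm ((\<Sum>j. a j * P (j + H)) - A * A) \<le> S * T H" by simp
      qed
      show "(\<lambda>H. S * T H) \<longlonglongrightarrow> 0" using tendsto_mult_right_zero[of T _ S] T by simp
    qed
    then show ?thesis by (simp add: LIM_zero_iff)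
  qed
  have half: "(\<Sum>j. a j * P j) = (A * A + lag_product a 0) / 2"
  proof -
    have "(P n)\<^sup>2 = (\<Sum>j\<le>n. 2 * (a j * P j) - (a j)\<^sup>2)" for n
    proof (induction n)
      case (Suc n)
      then show ?case by (simp add: P_def power2_eq_square algebra_simps)
    qed (simp add: P_def power2_eq_square)
    moreover have "(\<lambda>n. (P n)\<^sup>2) \<longlonglongrightarrow> A\<^sup>2" by (intro tendsto_intros P)
    ultimately have "(\<lambda>n. \<Sum>j\<le>n. 2 * (a j * P j) - (a j)\<^sup>2) \<longlonglongrightarrow> A\<^sup>2" by simp
    then have "(\<Sum>j. 2 * (a j * P j) - (a j)\<^sup>2) = A\<^sup>2"
      by (simp add: sums_def_le[symmetric] sums_iff)
    moreover have "(\<Sum>j. 2 * (a j * P j) - (a j)\<^sup>2) = 2 * (\<Sum>j. a j * P j) - (\<Sum>j. (a j)\<^sup>2)"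
      using sP[of 0] sq by (subst suminf_diff[symmetric]) (auto simp: suminf_mult intro: summable_mult)
    ultimately show ?thesis by (simp add: lag_product_def power2_eq_square)
  qed
  have "(\<lambda>H. lag_product a 0 + 2 * ((\<Sum>j. a j * P (j + H)) - (\<Sum>j. a j * P j))) \<longlonglongrightarrow> lag_product a 0 + 2 * (A * A - (A * A + lag_product a 0) / 2)"
    unfolding half by (intro tendsto_intros lim)
  moreover have "lag_product a 0 + 2 * (A * A - (A * A + lag_product a 0) / 2) = A\<^sup>2"
    by (simp add: field_simps power2_eq_square)
  ultimately show ?thesis unfolding lag_partial_sum_def[abs_def] rsum A_def by simp
qed

lemma memory_coeffs_abs_summable:
  assumes mc: "memory_coeffs d a c" and d: "d \<le> 0"
  shows "summable (\<lambda>j. \<bar>a j\<bar>)"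
proof (cases "d = 0")
  case True
  then show ?thesis using mc by (simp add: memory_coeffs_def)
next
  case False
  then obtain K where K: "K > 0" "\<And>j. j \<ge> 1 \<Longrightarrow> \<bar>a j\<bar> \<le> K * real j powr (d - 1)"
    using tendsto_imp_bound[OF memory_coeffs_tendsto(2)[OF mc False]] by auto
  have "summable (\<lambda>j. K * real j powr (d - 1))"
  proof (rule summable_mult)
    show "summable (\<lambda>j. real j powr (d - 1))" using d False summable_real_powr_iff[of "d - 1"] by auto
  qed
  then show ?thesis by (rule summable_comparison_test'[where N = 1]) (use K in auto)
qed

text \<open>One constant g > 0 describes all cases: lag products of order d g h^(2 d - 1) add up to
  g h^(2 d), since their sign agrees with that of d. For d > 0 the partial sums diverge, for d < 0
  they tend to 0, and the two Stolz-Cesaro theorems apply accordingly.\<close>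

theorem memory_coeffs_lag_asymptotics:
  assumes mc: "memory_coeffs d a c" and d: "-1/2 \<le> d" "d < 1/2"
  obtains g where "g > 0" "(\<lambda>h. lag_partial_sum (lag_product a) h / real h powr (2 * d)) \<longlonglongrightarrow> g"
    "d \<noteq> 0 \<Longrightarrow> (\<lambda>h. lag_product a h / real h powr (2 * d - 1)) \<longlonglongrightarrow> d * g"
    "d = 0 \<Longrightarrow> g = (\<Sum>j. a j)\<^sup>2" "d = - 1/2 \<Longrightarrow> g = 8 * c\<^sup>2"
proof (cases "d = 0")
  case True
  have sq: "summable (\<lambda>j. (a j)\<^sup>2)" and nz: "(\<Sum>j. a j) \<noteq> 0" using mc True by (simp_all add: memory_coeffs_def)
  have "lag_partial_sum (lag_product a) \<longlonglongrightarrow> (\<Sum>j. a j)\<^sup>2"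
    using memory_coeffs_abs_summable[OF mc] True sq by (intro lag_partial_sum_tendsto_square) auto
  then have "(\<lambda>h. lag_partial_sum (lag_product a) h / real h powr (2 * d)) \<longlonglongrightarrow> (\<Sum>j. a j)\<^sup>2"
  proof (rule Lim_transform_eventually)
    show "\<forall>\<^sub>F h in sequentially. lag_partial_sum (lag_product a) h = lag_partial_sum (lag_product a) h / real h powr (2 * d)"
      using eventually_gt_at_top[of 0] by eventually_elim (simp add: True)
  qed
  then show ?thesis using that[of "(\<Sum>j. a j)\<^sup>2"] nz True by simp
next
  case False
  obtain C where C: "C / d > 0" "(\<lambda>h. lag_product a h * real h powr (1 - 2 * d)) \<longlonglongrightarrow> C" "d = - 1/2 \<Longrightarrow> C = - 4 * c\<^sup>2"
  proof (cases "d > 0")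
    case True
    with d mc show ?thesis using that by (elim lag_product_asymptotics_pos[of d a c]) (auto simp: zero_less_divide_iff)
  next
    case F: False
    with d mc False show ?thesis using that by (elim lag_product_asymptotics_neg[of d a c]) (auto simp: zero_less_divide_iff)
  qed
  have r: "(\<lambda>h. lag_product a h / real h powr (2 * d - 1)) \<longlonglongrightarrow> C"
  proof -
    have "real h powr (1 - 2 * d) = 1 / real h powr (2 * d - 1)" for h
      by (metis minus_diff_eq powr_minus_divide)
    then show ?thesis using C(2) by simp
  qed
  let ?y = "\<lambda>n. real (Suc n) powr (2 * d)" and ?x = "\<lambda>n. lag_partial_sum (lag_product a) (Suc n)"
  have "(\<lambda>n. 2 * (lag_product a (Suc (Suc n)) / real (Suc (Suc n)) powr (2 * d - 1))
      * (real (Suc (Suc n)) powr (2 * d - 1) / (real (Suc (Suc n)) powr (2 * d) - real (Suc n) powr (2 * d)))) \<longlonglongrightarrow> 2 * C * (1 / (2 * d))"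
  proof (intro tendsto_mult tendsto_const)
    show "(\<lambda>n. lag_product a (Suc (Suc n)) / real (Suc (Suc n)) powr (2 * d - 1)) \<longlonglongrightarrow> C"
      using LIMSEQ_Suc[OF LIMSEQ_Suc[OF r]] .
    show "(\<lambda>n. real (Suc (Suc n)) powr (2 * d - 1) / (real (Suc (Suc n)) powr (2 * d) - real (Suc n) powr (2 * d))) \<longlonglongrightarrow> 1 / (2 * d)"
    proof -
      have "(\<lambda>n. real (Suc (Suc n)) powr (2 * d - 1) / (real (Suc (Suc n)) powr (2 * d) - real (Suc n) powr (2 * d))) \<longlonglongrightarrow> inverse d / 2"
        using False by real_asymp
      moreover have "inverse d / 2 = 1 / (2 * d)" using False by (simp add: field_simps)
      ultimately show ?thesis by (simp only:)
    qed
  qed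
  then have ratio: "(\<lambda>n. (?x (Suc n) - ?x n) / (?y (Suc n) - ?y n)) \<longlonglongrightarrow> C / d"
    by (simp add: lag_partial_sum_def)
  have "(\<lambda>n. ?x n / ?y n) \<longlonglongrightarrow> C / d"
  proof (cases "d > 0")
    case True
    show ?thesis
    proof (rule Stolz_Cesaro_at_top[OF _ _ ratio])
      show "?y n < ?y (Suc n)" for n using True by (intro powr_less_mono2) auto
      show "filterlim ?y at_top sequentially" using True by real_asymp
    qed
  next
    case neg: False
    have abs: "summable (\<lambda>j. \<bar>a j\<bar>)" using memory_coeffs_abs_summable[OF mc] neg by simp
    have "a sums 0" and sq: "summable (\<lambda>j. (a j)\<^sup>2)" using mc neg False by (simp_all add: memory_coeffs_def)
    then have "lag_partial_sum (lag_product a) \<longlonglongrightarrow> 0"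
      using lag_partial_sum_tendsto_square[OF abs sq] by (simp add: sums_iff)
    from LIMSEQ_Suc[OF this] show ?thesis
    proof (rule Stolz_Cesaro_0[OF _ _ _ ratio, rotated])
      show "?y (Suc n) < ?y n" for n using neg False by (intro powr_less_mono2_neg) auto
      show "?y \<longlonglongrightarrow> 0" using neg False by real_asymp
    qed
  qed
  then have "(\<lambda>h. lag_partial_sum (lag_product a) h / real h powr (2 * d)) \<longlonglongrightarrow> C / d"
    by (rule LIMSEQ_imp_Suc)
  then show ?thesis
  proof (rule that[of "C / d", OF C(1)])
    show "(\<lambda>h. lag_product a h / real h powr (2 * d - 1)) \<longlonglongrightarrow> d * (C / d)" using r False by simp
    show "C / d = 8 * c\<^sup>2" if "d = - 1/2" using C(3)[OF that] that by simp
  qed (use False in simp)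
qed

text \<open>Lags between blocks at distance \<rho> are at least (\<rho> - 1) l + 1; for neighbouring
  blocks they would go down to 1. The bound separates a power of l from a factor that tends to 0
  with growing \<rho>, uniformly in l.\<close>

lemma cross_block_lag_bound:
  assumes mc: "memory_coeffs d a c" and d: "-1/2 \<le> d" "d < 1/2"
  obtains \<eta> where "\<eta> \<longlonglongrightarrow> 0"
    "\<And>\<rho> l. \<rho> \<ge> 2 \<Longrightarrow> l \<ge> 1 \<Longrightarrow>
      (\<Sum>u = 1..l. \<Sum>v = 1..l. \<bar>lag_product a (\<rho> * l + u - v)\<bar>) \<le> real l powr (2 * d + 1) * \<eta> \<rho>"
proof (cases "d = 0")
  case True
  have abs: "summable (\<lambda>h. \<bar>lag_product a h\<bar>)"
    using memory_coeffs_abs_summable[OF mc] mc True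
    by (intro lag_product_abs_summable) (auto simp: memory_coeffs_def)
  define S where "S = (\<Sum>h. \<bar>lag_product a h\<bar>)"
  define \<eta> where "\<eta> \<rho> = S - (\<Sum>h<\<rho> - 1. \<bar>lag_product a h\<bar>)" for \<rho>
  show ?thesis
  proof
    have "(\<lambda>n. S - (\<Sum>h<n. \<bar>lag_product a h\<bar>)) \<longlonglongrightarrow> S - S"
      unfolding S_def by (intro tendsto_intros summable_LIMSEQ abs)
    then have "(\<lambda>n. \<eta> (Suc n)) \<longlonglongrightarrow> 0" by (simp add: \<eta>_def)
    then show "\<eta> \<longlonglongrightarrow> 0" by (rule LIMSEQ_imp_Suc)
    fix \<rho> l :: nat assume \<rho>: "\<rho> \<ge> 2" and l: "l \<ge> 1"
    have "(\<Sum>v = 1..l. \<bar>lag_product a (\<rho> * l + u - v)\<bar>) \<le> \<eta> \<rho>" for u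
    proof -
      \<comment> \<open>This is (\<rho> - 1) (l - 1) >= 0. It shows that all lags involved are at
        least \<rho> - 1, so one tail of the absolutely convergent series bounds every row, whatever
        l is.\<close>
      have rl: "\<rho> - 1 + l \<le> \<rho> * l"
      proof -
        obtain k where "\<rho> = Suc k" using \<rho> by (cases \<rho>) auto
        then show ?thesis using l by (cases l) auto
      qed
      have "(\<Sum>v = 1..l. \<bar>lag_product a (\<rho> * l + u - v)\<bar>) = (\<Sum>h\<in>(\<lambda>v. \<rho> * l + u - v) ` {1..l}. \<bar>lag_product a h\<bar>)"
        using rl by (subst sum.reindex) (auto simp: inj_on_def)
      also have "\<dots> + (\<Sum>h<\<rho> - 1. \<bar>lag_product a h\<bar>) = (\<Sum>h\<in>(\<lambda>v. \<rho> * l + u - v) ` {1..l} \<union> {..<\<rho> - 1}. \<bar>lag_product a h\<bar>)"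
        using rl by (intro sum.union_disjoint[symmetric]) auto
      also have "\<dots> \<le> S" unfolding S_def by (rule sum_le_suminf[OF abs]) auto
      finally show ?thesis by (simp add: \<eta>_def)
    qed
    then have "(\<Sum>u = 1..l. \<Sum>v = 1..l. \<bar>lag_product a (\<rho> * l + u - v)\<bar>) \<le> (\<Sum>u = 1..l. \<eta> \<rho>)"
      by (intro sum_mono)
    then show "(\<Sum>u = 1..l. \<Sum>v = 1..l. \<bar>lag_product a (\<rho> * l + u - v)\<bar>) \<le> real l powr (2 * d + 1) * \<eta> \<rho>"
      using True l by simp
  qed
next
  case False
  obtain g where g: "(\<lambda>h. lag_product a h / real h powr (2 * d - 1)) \<longlonglongrightarrow> d * g"
    using memory_coeffs_lag_asymptotics[OF assms] False by metis
  obtain K where K: "K > 0" "\<And>h. h \<ge> 1 \<Longrightarrow> \<bar>lag_product a h\<bar> \<le> K * real h powr (2 * d - 1)"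
    using tendsto_imp_bound[OF g] by auto
  show ?thesis
  proof
    show "(\<lambda>\<rho>. K * (real \<rho> - 1) powr (2 * d - 1)) \<longlonglongrightarrow> 0" using d by real_asymp
    fix \<rho> l :: nat assume \<rho>: "\<rho> \<ge> 2" and l: "l \<ge> 1"
    have "\<bar>lag_product a (\<rho> * l + u - v)\<bar> \<le> K * ((real \<rho> - 1) * real l) powr (2 * d - 1)" if "u \<in> {1..l}" "v \<in> {1..l}" for u v
    proof -
      have "2 * l \<le> \<rho> * l" using \<rho> by simp
      moreover have "v \<le> n + u" "1 \<le> n + u - v" if "2 * l \<le> n" for n
        using that \<open>u \<in> {1..l}\<close> \<open>v \<in> {1..l}\<close> by auto
      ultimately have vl: "v \<le> \<rho> * l + u" "1 \<le> \<rho> * l + u - v" by blast+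
      have "(real \<rho> - 1) * real l \<le> real (\<rho> * l + u - v)" using vl that by (simp add: of_nat_diff algebra_simps)
      moreover have "0 < (real \<rho> - 1) * real l" using \<rho> l by simp
      ultimately have "real (\<rho> * l + u - v) powr (2 * d - 1) \<le> ((real \<rho> - 1) * real l) powr (2 * d - 1)"
        using d by (intro powr_mono2') linarith+
      then show ?thesis using K(2)[OF vl(2)] K(1) by (meson mult_left_mono order_trans less_imp_le)
    qed
    then have le: "(\<Sum>u = 1..l. \<Sum>v = 1..l. \<bar>lag_product a (\<rho> * l + u - v)\<bar>) \<le> (\<Sum>u = 1..l. \<Sum>v = 1..l. K * ((real \<rho> - 1) * real l) powr (2 * d - 1))"
      by (intro sum_mono)
    have "(\<Sum>u = 1..l. \<Sum>v = 1..l. K * ((real \<rho> - 1) * real l) powr (2 * d - 1))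
      = (real l * real l * real l powr (2 * d - 1)) * (K * (real \<rho> - 1) powr (2 * d - 1))"
      by (simp add: powr_mult)
    also have "\<dots> = real l powr (2 * d + 1) * (K * (real \<rho> - 1) powr (2 * d - 1))"
    proof -
      have "real l powr (2 * d + 1) = real l powr (2 + (2 * d - 1))" by (rule arg_cong) simp
      also have "\<dots> = real l powr 2 * real l powr (2 * d - 1)" by (rule powr_add)
      also have "real l powr 2 = real l * real l" using l by (simp add: power2_eq_square)
      finally show ?thesis by (simp only:)
    qed
    finally have eq: "(\<Sum>u = 1..l. \<Sum>v = 1..l. K * ((real \<rho> - 1) * real l) powr (2 * d - 1))
      = real l powr (2 * d + 1) * (K * (real \<rho> - 1) powr (2 * d - 1))" .
    show "(\<Sum>u = 1..l. \<Sum>v = 1..l. \<bar>lag_product a (\<rho> * l + u - v)\<bar>) \<le> real l powr (2 * d + 1) * (K * (real \<rho> - 1) powr (2 * d - 1))"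
      using le unfolding eq .
  qed
qed

section \<open>Quadratic lag sums with trigonometric weights\<close>

lemma lag_variance_simps:
  "lag_variance r 0 = 0" "lag_variance r (Suc h) = lag_variance r h + lag_partial_sum r h"
  by (simp_all add: lag_variance_def)

text \<open>\<open>lag_variance\<close> is extended evenly to the integers. At lag 0 the corner of
  the even extension contributes \<open>r 0\<close> from each side, so the formula holds there
  too.\<close>

lemma lag_variance_second_difference:
  "lag_variance r (nat \<bar>k + 1\<bar>) - 2 * lag_variance r (nat \<bar>k\<bar>) + lag_variance r (nat \<bar>k - 1\<bar>) = 2 * r (nat \<bar>k\<bar>)"
proof -
  have step: "lag_variance r (Suc (Suc h)) - 2 * lag_variance r (Suc h) + lag_variance r h = 2 * r (Suc h)" for h
    by (simp add: lag_variance_simps lag_partial_sum_def)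
  consider "k = 0" | h where "k = int (Suc h)" | h where "k = - int (Suc h)"
    by (metis int_cases int_cases2 neg_0_equal_iff_equal not0_implies_Suc of_nat_0)
  then show ?thesis
  proof cases
    case 1
    then show ?thesis by (simp add: lag_variance_def lag_partial_sum_def)
  next
    case (2 h)
    then have "nat \<bar>k + 1\<bar> = Suc (Suc h)" "nat \<bar>k\<bar> = Suc h" "nat \<bar>k - 1\<bar> = h" by auto
    then show ?thesis using step by simp
  next
    case (3 h)
    then have "nat \<bar>k + 1\<bar> = h" "nat \<bar>k\<bar> = Suc h" "nat \<bar>k - 1\<bar> = Suc (Suc h)" by auto
    then show ?thesis using step[of h] by simp
  qed
qed

text \<open>The signed masses that summation by parts puts on the points 0..l: differences of the
  weights extended by 0, with boundary masses - W 1 at 0 and W l at l.\<close>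

definition weight_decrement :: "nat \<Rightarrow> (nat \<Rightarrow> real) \<Rightarrow> nat \<Rightarrow> real" where
  "weight_decrement l W t = (if t = 0 then 0 else W t) - (if t < l then W (Suc t) else 0)"

lemma sum_weight_decrement:
  "(\<Sum>t\<le>l. weight_decrement l W t * f t) = (\<Sum>u = 1..l. W u * (f u - f (u - 1)))"
proof -
  have "(\<Sum>t\<le>l. (if t = 0 then 0 else W t) * f t) = (\<Sum>u = 1..l. W u * f u)"
    by (rule sum.mono_neutral_cong_right) auto
  moreover have "(\<Sum>t\<le>l. (if t < l then W (Suc t) else 0) * f t) = (\<Sum>u = 1..l. W u * f (u - 1))"
  proof -
    have "(\<Sum>t\<le>l. (if t < l then W (Suc t) else 0) * f t) = (\<Sum>t<l. W (Suc t) * f t)"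
      by (rule sum.mono_neutral_cong_right) auto
    also have "\<dots> = (\<Sum>u = 1..l. W u * f (u - 1))" by (simp add: sum.atLeast1_atMost_eq)
    finally show ?thesis .
  qed
  ultimately show ?thesis
    by (simp add: weight_decrement_def left_diff_distrib right_diff_distrib sum_subtractf)
qed

text \<open>Summation by parts in both variables. The mixed difference of V(|t - s|) is minus the
  second difference of V in t - s, that is - 2 r, hence the factor - 1/2.\<close>

lemma weighted_lag_sum_by_parts:
  "weighted_lag_sum r W W' 0 0 l = - 1/2 * (\<Sum>t\<le>l. \<Sum>s\<le>l. weight_decrement l W t * weight_decrement l W' s
      * lag_variance r (nat \<bar>int t - int s\<bar>))"
proof -
  let ?V = "\<lambda>t s. lag_variance r (nat \<bar>int t - int s\<bar>)"
  have "(\<Sum>t\<le>l. \<Sum>s\<le>l. weight_decrement l W t * weight_decrement l W' s * ?V t s)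
    = (\<Sum>t\<le>l. weight_decrement l W t * (\<Sum>v = 1..l. W' v * (?V t v - ?V t (v - 1))))"
    using sum_weight_decrement[of l W' "?V t" for t] by (simp only: mult.assoc sum_distrib_left[symmetric])
  also have "\<dots> = (\<Sum>u = 1..l. W u * ((\<Sum>v = 1..l. W' v * (?V u v - ?V u (v - 1))) - (\<Sum>v = 1..l. W' v * (?V (u - 1) v - ?V (u - 1) (v - 1)))))"
    by (rule sum_weight_decrement)
  also have "\<dots> = (\<Sum>u = 1..l. \<Sum>v = 1..l. W u * W' v * (?V u v - ?V u (v - 1) - (?V (u - 1) v - ?V (u - 1) (v - 1))))"
    by (simp add: sum_distrib_left sum_subtractf[symmetric] algebra_simps)
  also have "\<dots> = (\<Sum>u = 1..l. \<Sum>v = 1..l. - 2 * (W u * W' v * r (nat \<bar>int u - int v\<bar>)))"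
  proof (intro sum.cong refl)
    fix u v assume uv: "u \<in> {1..l}" "v \<in> {1..l}"
    have e: "int u - int (v - 1) = (int u - int v) + 1" "int (u - 1) - int v = (int u - int v) - 1"
      "int (u - 1) - int (v - 1) = int u - int v" using uv by auto
    have "?V u v - ?V u (v - 1) - (?V (u - 1) v - ?V (u - 1) (v - 1)) = - (2 * r (nat \<bar>int u - int v\<bar>))"
      unfolding e using lag_variance_second_difference[of r "int u - int v"] by linarith
    then show "W u * W' v * (?V u v - ?V u (v - 1) - (?V (u - 1) v - ?V (u - 1) (v - 1))) = - 2 * (W u * W' v * r (nat \<bar>int u - int v\<bar>))"
      by simp
  qed
  finally show ?thesis by (simp add: weighted_lag_sum_def sum_distrib_left[symmetric] sum_negf)
qed

section \<open>Growth of the variance of partial sums\<close>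

lemma lag_variance_powr_tendsto:
  assumes g: "(\<lambda>h. lag_partial_sum r h / real h powr (\<alpha> - 1)) \<longlonglongrightarrow> g" and \<alpha>: "\<alpha> > 0"
  shows "(\<lambda>h. lag_variance r h / real h powr \<alpha>) \<longlonglongrightarrow> g / \<alpha>"
proof (rule LIMSEQ_imp_Suc)
  let ?y = "\<lambda>n. real (Suc n) powr \<alpha>" and ?x = "\<lambda>n. lag_variance r (Suc n)"
  have e: "lag_partial_sum r (Suc n) / real (Suc n) powr (\<alpha> - 1) * (real (Suc n) powr (\<alpha> - 1) / (?y (Suc n) - ?y n))
     = (?x (Suc n) - ?x n) / (?y (Suc n) - ?y n)" for n
    by (simp add: lag_variance_simps)
  have "(\<lambda>n. lag_partial_sum r (Suc n) / real (Suc n) powr (\<alpha> - 1)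
      * (real (Suc n) powr (\<alpha> - 1) / (?y (Suc n) - ?y n))) \<longlonglongrightarrow> g * inverse \<alpha>"
    by (intro tendsto_mult LIMSEQ_Suc[OF g]) (use \<alpha> in real_asymp)
  then have ratio: "(\<lambda>n. (?x (Suc n) - ?x n) / (?y (Suc n) - ?y n)) \<longlonglongrightarrow> g / \<alpha>"
    unfolding e by (simp only: divide_inverse)
  show "(\<lambda>n. ?x n / ?y n) \<longlonglongrightarrow> g / \<alpha>"
  proof (rule Stolz_Cesaro_at_top[OF _ _ ratio])
    show "?y n < ?y (Suc n)" for n using \<alpha> by (intro powr_less_mono2) auto
    show "filterlim ?y at_top sequentially" using \<alpha> by real_asymp
  qed
qed

text \<open>Stated with a free g for two uses: with the limit g and small K it yields the
  logarithmic asymptotics, with g = 0 a global bound.\<close>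

lemma lag_variance_ln_bound:
  assumes b: "\<And>h. h \<ge> k0 \<Longrightarrow> \<bar>lag_partial_sum r h - g * (ln (real (Suc h)) - ln (real h))\<bar> \<le> K * (ln (real (Suc h)) - ln (real h))"
    and "k0 \<le> k" "k \<le> n" "1 \<le> k"
  shows "\<bar>lag_variance r n - lag_variance r k - g * ln (real n / real k)\<bar> \<le> K * ln (real n / real k)"
  using assms(3)
proof (induction n rule: dec_induct)
  case base
  then show ?case using assms(4) by simp
next
  case (step n)
  have n: "n \<ge> 1" using step assms by simp
  have l: "ln (real (Suc n) / real k) = ln (real n / real k) + (ln (real (Suc n)) - ln (real n))"
    using n assms(4) by (simp add: ln_div)
  have "lag_variance r (Suc n) - lag_variance r k - g * ln (real (Suc n) / real k)
    = (lag_variance r n - lag_variance r k - g * ln (real n / real k))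
      + (lag_partial_sum r n - g * (ln (real (Suc n)) - ln (real n)))"
    unfolding l lag_variance_simps by (simp add: algebra_simps)
  also have "\<bar>\<dots>\<bar> \<le> K * ln (real n / real k) + K * (ln (real (Suc n)) - ln (real n))"
    using step.IH b[of n] step assms(2) by linarith
  also have "\<dots> = K * ln (real (Suc n) / real k)" unfolding l by (simp add: algebra_simps)
  finally show ?case .
qed

text \<open>Replaces 1 / h by the equivalent ln (h + 1) - ln h, which telescopes exactly.\<close>

lemma lag_partial_sum_div_ln:
  assumes g: "(\<lambda>h. lag_partial_sum r h / real h powr (- 1)) \<longlonglongrightarrow> g"
  shows "(\<lambda>h. lag_partial_sum r h / (ln (real (Suc h)) - ln (real h))) \<longlonglongrightarrow> g"
proof -
  have "(\<lambda>h. lag_partial_sum r h / real h powr (- 1) * (real h powr (- 1) / (ln (real (Suc h)) - ln (real h)))) \<longlonglongrightarrow> g * 1"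
    by (intro tendsto_mult g) real_asymp
  moreover have "\<forall>\<^sub>F h in sequentially. lag_partial_sum r h / real h powr (- 1) * (real h powr (- 1) / (ln (real (Suc h)) - ln (real h)))
     = lag_partial_sum r h / (ln (real (Suc h)) - ln (real h))"
    using eventually_gt_at_top[of 0] by eventually_elim simp
  ultimately show ?thesis using Lim_transform_eventually by fastforce
qed

text \<open>At this exponent the variance grows like g ln n, so only differences have a limit; ln (k
  n / n) tends to ln x.\<close>

lemma lag_variance_diff_tendsto_ln:
  assumes g: "(\<lambda>h. lag_partial_sum r h / real h powr (- 1)) \<longlonglongrightarrow> g"
    and k: "(\<lambda>n. real (k n) / real n) \<longlonglongrightarrow> x" and x: "0 < x" "\<And>n. k n \<le> n"
  shows "(\<lambda>n. lag_variance r (k n) - lag_variance r n) \<longlonglongrightarrow> g * ln x"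
proof -
  have kinf: "filterlim k sequentially sequentially"
  proof -
    have "filterlim (\<lambda>n. (real (k n) / real n) * real n) at_top sequentially"
      by (rule filterlim_tendsto_pos_mult_at_top[OF k x(1) filterlim_real_sequentially])
    moreover have "\<forall>\<^sub>F n in sequentially. (real (k n) / real n) * real n = real (k n)"
      using eventually_gt_at_top[of 0] by eventually_elim simp
    ultimately have "filterlim (\<lambda>n. real (k n)) at_top sequentially"
      by (subst filterlim_cong[OF refl refl, of _ "\<lambda>n. (real (k n) / real n) * real n"]) (auto simp: eq_commute)
    then show ?thesis by (simp add: filterlim_sequentially_iff_filterlim_real)
  qed
  define L where "L n = ln (real n / real (k n))" for n
  have L: "L \<longlonglongrightarrow> - ln x"
  proof -
    have "(\<lambda>n. - ln (real (k n) / real n)) \<longlonglongrightarrow> - ln x" using x by (intro tendsto_intros k) auto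
    moreover have "\<forall>\<^sub>F n in sequentially. - ln (real (k n) / real n) = L n"
      using eventually_gt_at_top[of 0] kinf[unfolded filterlim_at_top, rule_format, of 1]
      by eventually_elim (simp add: L_def ln_div)
    ultimately show ?thesis by (rule Lim_transform_eventually)
  qed
  have "(\<lambda>n. lag_variance r n - lag_variance r (k n) - g * L n) \<longlonglongrightarrow> 0"
  proof (rule LIMSEQ_I)
    fix e :: real assume e: "e > 0"
    \<comment> \<open>Eventually \<open>L n\<close> is below |ln x| + 1, so \<eta> times it stays
      below e; the summand 2 makes the inequality strict.\<close>
    define \<eta> where "\<eta> = e / (\<bar>ln x\<bar> + 2)"
    have \<eta>: "\<eta> > 0" using e by (auto simp: \<eta>_def intro!: divide_pos_pos)
    obtain h0 where h0: "\<And>h. h \<ge> h0 \<Longrightarrow> \<bar>lag_partial_sum r h / (ln (real (Suc h)) - ln (real h)) - g\<bar> < \<eta>"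
      using LIMSEQ_D[OF lag_partial_sum_div_ln[OF g] \<eta>] by auto
    have b: "\<bar>lag_partial_sum r h - g * (ln (real (Suc h)) - ln (real h))\<bar> \<le> \<eta> * (ln (real (Suc h)) - ln (real h))"
      if "h \<ge> max h0 1" for h
    proof -
      have p: "ln (real (Suc h)) - ln (real h) > 0" using that by simp
      have "lag_partial_sum r h - g * (ln (real (Suc h)) - ln (real h))
        = (lag_partial_sum r h / (ln (real (Suc h)) - ln (real h)) - g) * (ln (real (Suc h)) - ln (real h))"
        using p by (simp add: field_simps)
      then show ?thesis using h0[of h] that p by (simp add: abs_mult mult_right_mono less_imp_le)
    qed
    have "\<forall>\<^sub>F n in sequentially. k n \<ge> max h0 1" using kinf unfolding filterlim_at_top by blast
    moreover have "\<forall>\<^sub>F n in sequentially. dist (L n) (- ln x) < 1" using L by (rule tendstoD) simp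
    ultimately have "\<forall>\<^sub>F n in sequentially. norm (lag_variance r n - lag_variance r (k n) - g * L n - 0) < e"
    proof eventually_elim
      case (elim n)
      have "\<bar>lag_variance r n - lag_variance r (k n) - g * L n\<bar> \<le> \<eta> * L n"
        unfolding L_def by (rule lag_variance_ln_bound[OF b, of "max h0 1"]) (use elim x(2) in auto)
      also have "\<dots> \<le> \<eta> * (\<bar>ln x\<bar> + 1)"
        using elim(2) \<eta> by (intro mult_left_mono) (auto simp: dist_real_def)
      also have "\<dots> < \<eta> * (\<bar>ln x\<bar> + 2)" using \<eta> by (intro mult_strict_left_mono) auto
      also have "\<dots> = e" by (simp add: \<eta>_def)
      finally show ?case by simp
    qed
    then show "\<exists>no. \<forall>n\<ge>no. norm (lag_variance r n - lag_variance r (k n) - g * L n - 0) < e"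
      by (simp add: eventually_sequentially)
  qed
  then have "(\<lambda>n. - (lag_variance r n - lag_variance r (k n) - g * L n) - g * L n) \<longlonglongrightarrow> - 0 - g * (- ln x)"
    by (intro tendsto_intros L)
  then show ?thesis by simp
qed

lemma lag_variance_diff_ln_bound:
  assumes g: "(\<lambda>h. lag_partial_sum r h / real h powr (- 1)) \<longlonglongrightarrow> g"
  obtains K where "K > 0" "\<And>k n. 1 \<le> k \<Longrightarrow> k \<le> n \<Longrightarrow> \<bar>lag_variance r n - lag_variance r k\<bar> \<le> K * ln (real n / real k)"
proof -
  obtain K where K: "K > 0" "\<And>h. h \<ge> 1 \<Longrightarrow> \<bar>lag_partial_sum r h\<bar> \<le> K * (ln (real (Suc h)) - ln (real h))"
    using tendsto_imp_bound[OF lag_partial_sum_div_ln[OF g]] by auto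
  show ?thesis
    by (rule that[OF K(1)]) (use lag_variance_ln_bound[of 1 r 0 K] K in auto)
qed

section \<open>Double Riemann sums on the unit square\<close>

abbreviation "square_ind \<equiv> (\<lambda>z :: real \<times> real. indicator ({0..1} \<times> {0..1}) z :: real)"

lemma AE_lborel_pair_fst_snd_neq:
  "AE z in (lborel :: (real \<times> real) measure). fst z \<noteq> snd z \<and> fst z \<noteq> 0 \<and> snd z \<noteq> 0"
proof -
  have "AE z in (lborel :: real measure) \<Otimes>\<^sub>M (lborel :: real measure). fst z \<noteq> snd z \<and> fst z \<noteq> 0 \<and> snd z \<noteq> 0"
  proof (rule lborel_pair.AE_pair_measure)
    show "AE x in lborel. AE y in lborel. fst (x, y) \<noteq> snd (x, y) \<and> fst (x, y) \<noteq> 0 \<and> snd (x, y) \<noteq> (0 :: real)"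
      using AE_lborel_singleton[of "0 :: real"]
    proof eventually_elim
      case (elim x)
      show ?case using AE_lborel_singleton[of "0 :: real"] AE_lborel_singleton[of x]
        by eventually_elim (use elim in auto)
    qed
  qed measurable
  then show ?thesis by (simp only: lborel_prod)
qed

lemma integrable_lborel_pair_bounded:
  fixes f :: "real \<times> real \<Rightarrow> real"
  assumes [measurable]: "f \<in> borel_measurable borel" and "\<And>z. \<bar>f z\<bar> \<le> B * square_ind z"
  shows "integrable lborel f"
proof (rule Bochner_Integration.integrable_bound)
  have "emeasure lborel ({0..1} \<times> {0..1} :: (real \<times> real) set) < \<infinity>"
    by (intro emeasure_bounded_finite bounded_Times) auto
  then show "integrable lborel (\<lambda>z. B * square_ind z)"
    by (intro integrable_mult_right integrable_real_indicator) (auto simp: borel_closed closed_Times)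
  show "AE z in lborel. norm (f z) \<le> norm (B * square_ind z)"
    using assms(2) by (intro AE_I2) (auto intro: order_trans[OF _ abs_ge_self])
qed simp

lemma step_function_integral_2D:
  fixes F :: "nat \<Rightarrow> nat \<Rightarrow> real"
  assumes n: "n > 0"
  defines "f \<equiv> (\<lambda>z. indicator {0<..1} (fst z) * indicator {0<..1} (snd z)
      * F (nat \<lceil>real n * fst z\<rceil>) (nat \<lceil>real n * snd z\<rceil>))"
  shows "integrable lborel f" "f \<in> borel_measurable borel"
    "(\<integral>z. f z \<partial>lborel) = (\<Sum>t = 1..n. \<Sum>s = 1..n. F t s) / (real n)\<^sup>2"
proof -
  have m1[measurable]: "(\<lambda>z. F (nat \<lceil>real n * fst z\<rceil>) (nat \<lceil>real n * snd z\<rceil>)) \<in> borel_measurable (borel \<Otimes>\<^sub>M borel :: (real \<times> real) measure)"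
  proof (rule measurable_compose_countable[where f = "\<lambda>i z. F i (nat \<lceil>real n * snd z\<rceil>)" and g = "\<lambda>z. nat \<lceil>real n * fst z\<rceil>"])
    show "(\<lambda>z. F i (nat \<lceil>real n * snd z\<rceil>)) \<in> borel_measurable (borel \<Otimes>\<^sub>M borel :: (real \<times> real) measure)" for i
      by (rule measurable_compose[where N = "count_space UNIV" and g = "F i"]) measurable
  qed measurable
  show m: "f \<in> borel_measurable borel" unfolding f_def borel_prod[symmetric] by measurable
  define B where "B = (\<Sum>t\<le>n. \<Sum>s\<le>n. \<bar>F t s\<bar>)"
  have "\<bar>f z\<bar> \<le> B * square_ind z" for z
  proof (cases "fst z \<in> {0<..1} \<and> snd z \<in> {0<..1}")
    case True
    define t s where "t = nat \<lceil>real n * fst z\<rceil>" and "s = nat \<lceil>real n * snd z\<rceil>"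
    have "real n * fst z \<le> real n" "real n * snd z \<le> real n" using True by (auto intro: mult_left_le)
    then have "t \<le> n" "s \<le> n" unfolding t_def s_def by linarith+
    then have "\<bar>F t s\<bar> \<le> (\<Sum>s\<le>n. \<bar>F t s\<bar>)"
      by (intro member_le_sum[of s "{..n}" "\<lambda>s. \<bar>F t s\<bar>"]) auto
    also have "\<dots> \<le> B" unfolding B_def
      using \<open>t \<le> n\<close> by (intro member_le_sum[of t "{..n}" "\<lambda>t. \<Sum>s\<le>n. \<bar>F t s\<bar>"]) (auto intro: sum_nonneg)
    finally have "\<bar>F t s\<bar> \<le> B" .
    then show ?thesis using True by (cases z) (auto simp: f_def t_def s_def indicator_def)
  next
    case False
    then show ?thesis by (auto simp: f_def B_def indicator_def intro!: sum_nonneg mult_nonneg_nonneg)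
  qed
  then show i: "integrable lborel f" by (rule integrable_lborel_pair_bounded[OF m])
  have i': "integrable (lborel \<Otimes>\<^sub>M lborel) (\<lambda>(x, y). f (x, y))" using i by (simp add: lborel_prod)
  have "(\<integral>z. f z \<partial>lborel) = (\<integral>z. (\<lambda>(x, y). f (x, y)) z \<partial>(lborel \<Otimes>\<^sub>M lborel))" by (simp add: lborel_prod)
  also have "\<dots> = (\<integral>x. \<integral>y. f (x, y) \<partial>lborel \<partial>lborel)"
    using lborel_pair.integral_fst'[OF i'] by simp
  also have "\<dots> = (\<integral>x. indicator {0<..real n / real n} x * ((\<Sum>s = 1..n. F (grid n x) s) / real n) \<partial>lborel)"
  proof (intro Bochner_Integration.integral_cong refl)
    fix x :: real
    have "(\<integral>y. f (x, y) \<partial>lborel) = (\<integral>y. indicator {0<..1} x * (indicator {0<..real n / real n} y * F (grid n x) (grid n y)) \<partial>lborel)"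
      using n by (simp add: f_def mult.assoc)
    also have "\<dots> = indicator {0<..1} x * (\<integral>y. indicator {0<..real n / real n} y * F (grid n x) (grid n y) \<partial>lborel)"
      by (rule integral_mult_right_zero)
    also have "\<dots> = indicator {0<..real n / real n} x * ((\<Sum>s = 1..n. F (grid n x) s) / real n)"
      unfolding step_function_integral(2)[OF n] using n by simp
    finally show "(\<integral>y. f (x, y) \<partial>lborel) = \<dots>" .
  qed
  also have "\<dots> = (\<Sum>t = 1..n. (\<Sum>s = 1..n. F t s) / real n) / real n"
    by (rule step_function_integral(2)[OF n])
  also have "\<dots> = (\<Sum>t = 1..n. \<Sum>s = 1..n. F t s) / (real n)\<^sup>2"
    by (simp add: sum_divide_distrib power2_eq_square)
  finally show "(\<integral>z. f z \<partial>lborel) = (\<Sum>t = 1..n. \<Sum>s = 1..n. F t s) / (real n)\<^sup>2" .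
qed

text \<open>Dominated convergence for step functions on the square. Limit and bound are demanded off
  the diagonal only, a null set, which admits kernels with a logarithmic singularity there.\<close>

lemma double_sum_tendsto_square_integral:
  fixes F :: "nat \<Rightarrow> nat \<Rightarrow> nat \<Rightarrow> real" and \<phi> B :: "real \<Rightarrow> real \<Rightarrow> real"
  assumes B: "integrable lborel (\<lambda>z. square_ind z * B (fst z) (snd z))"
    and \<phi>: "(\<lambda>z. \<phi> (fst z) (snd z)) \<in> borel_measurable borel"
    and lim: "\<And>x y. x \<in> {0<..1} \<Longrightarrow> y \<in> {0<..1} \<Longrightarrow> x \<noteq> y \<Longrightarrow>
      (\<lambda>n. F n (grid n x) (grid n y)) \<longlonglongrightarrow> \<phi> x y"
    and bound: "\<And>n x y. n \<ge> 1 \<Longrightarrow> x \<in> {0<..1} \<Longrightarrow> y \<in> {0<..1} \<Longrightarrow> x \<noteq> y \<Longrightarrow>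
      \<bar>F n (grid n x) (grid n y)\<bar> \<le> B x y"
  shows "(\<lambda>n. (\<Sum>t = 1..n. \<Sum>s = 1..n. F n t s) / (real n)\<^sup>2) \<longlonglongrightarrow> square_integral \<phi>"
proof (rule LIMSEQ_imp_Suc)
  note \<phi>[measurable]
  define f where "f n z = indicator {0<..1} (fst z) * indicator {0<..1} (snd z)
      * F n (nat \<lceil>real n * fst z\<rceil>) (nat \<lceil>real n * snd z\<rceil>)" for n z
  have conv: "(\<lambda>n. \<integral>z. f (Suc n) z \<partial>lborel) \<longlonglongrightarrow> (\<integral>z. square_ind z * \<phi> (fst z) (snd z) \<partial>lborel)"
  proof (rule integral_dominated_convergence[OF _ _ B])
    show "f (Suc n) \<in> borel_measurable lborel" for n
      using step_function_integral_2D(2)[of "Suc n" "F (Suc n)"] by (simp add: f_def[abs_def])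
    have [measurable]: "{0..1} \<times> {0..1} \<in> sets (borel :: (real \<times> real) measure)" by (simp add: borel_closed closed_Times)
    show "(\<lambda>z. square_ind z * \<phi> (fst z) (snd z)) \<in> borel_measurable lborel" by measurable
    show "AE z in lborel. (\<lambda>n. f (Suc n) z) \<longlonglongrightarrow> square_ind z * \<phi> (fst z) (snd z)"
      using AE_lborel_pair_fst_snd_neq
    proof eventually_elim
      case (elim z)
      show ?case
      proof (cases "z \<in> {0..1} \<times> {0..1}")
        case True
        then have z: "fst z \<in> {0<..1}" "snd z \<in> {0<..1}" using elim by (cases z, auto)+
        show ?thesis using LIMSEQ_Suc[OF lim[OF z]] elim z True by (simp add: f_def)
      next
        case False
        then have "\<not> (fst z \<in> {0<..1} \<and> snd z \<in> {0<..1})" by (cases z) auto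
        then have "f n z = 0" for n by (auto simp: f_def)
        then show ?thesis using False by simp
      qed
    qed
    show "AE z in lborel. norm (f (Suc n) z) \<le> square_ind z * B (fst z) (snd z)" for n
      using AE_lborel_pair_fst_snd_neq
    proof eventually_elim
      case (elim z)
      show ?case
      proof (cases "z \<in> {0..1} \<times> {0..1}")
        case True
        then have z: "fst z \<in> {0<..1}" "snd z \<in> {0<..1}" using elim by (cases z, auto)+
        show ?thesis using bound[of "Suc n", OF _ z] elim z True by (simp add: f_def)
      next
        case False
        then have "\<not> (fst z \<in> {0<..1} \<and> snd z \<in> {0<..1})" by (cases z) auto
        then have "f (Suc n) z = 0" by (auto simp: f_def)
        then show ?thesis using False by simp
      qed
    qed
  qed
  have "(\<integral>z. f (Suc n) z \<partial>lborel) = (\<Sum>t = 1..Suc n. \<Sum>s = 1..Suc n. F (Suc n) t s) / (real (Suc n))\<^sup>2" for n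
    unfolding f_def by (rule step_function_integral_2D(3)) simp
  then show "(\<lambda>n. (\<Sum>t = 1..Suc n. \<Sum>s = 1..Suc n. F (Suc n) t s) / (real (Suc n))\<^sup>2) \<longlonglongrightarrow> square_integral \<phi>"
    using conv by (simp only: square_integral_def set_lebesgue_integral_def real_scaleR_def)
qed

lemma sum_tendsto_set_integral:
  fixes F :: "nat \<Rightarrow> nat \<Rightarrow> real" and \<phi> :: "real \<Rightarrow> real"
  assumes [measurable]: "\<phi> \<in> borel_measurable borel"
    and lim: "\<And>x. x \<in> {0<..<1} \<Longrightarrow> (\<lambda>n. F n (grid n x)) \<longlonglongrightarrow> \<phi> x"
    and bound: "\<And>n x. n \<ge> 1 \<Longrightarrow> x \<in> {0<..1} \<Longrightarrow> \<bar>F n (grid n x)\<bar> \<le> B"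
  shows "(\<lambda>n. (\<Sum>t = 1..n. F n t) / real n) \<longlonglongrightarrow> (LINT x : {0..1} | lborel. \<phi> x)"
proof (rule LIMSEQ_imp_Suc)
  define f where "f n x = indicator {0<..real n / real n} x * F n (grid n x)" for n x
  have conv: "(\<lambda>n. \<integral>x. f (Suc n) x \<partial>lborel) \<longlonglongrightarrow> (\<integral>x. indicator {0..1} x * \<phi> x \<partial>lborel)"
  proof (rule integral_dominated_convergence[where w = "\<lambda>x. B * indicator {0..1} x"])
    show "integrable lborel (\<lambda>x. B * indicator {0..1::real} x)"
      by (intro integrable_mult_right integrable_real_indicator) auto
    show "f (Suc n) \<in> borel_measurable lborel" for n
      using step_function_integral(1)[of "Suc n" "Suc n" "F (Suc n)"]
      unfolding f_def[abs_def] by (intro borel_measurable_integrable) simp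
    show "AE x in lborel. (\<lambda>n. f (Suc n) x) \<longlonglongrightarrow> indicator {0..1} x * \<phi> x"
      using AE_lborel_singleton[of 0] AE_lborel_singleton[of 1]
    proof eventually_elim
      case (elim x)
      show ?case
      proof (cases "x \<in> {0..1}")
        case True
        then have "x \<in> {0<..<1}" using elim by auto
        then show ?thesis using LIMSEQ_Suc[OF lim[of x]] by (simp add: f_def)
      next
        case False
        then show ?thesis by (auto simp: f_def)
      qed
    qed
    show "AE x in lborel. norm (f (Suc n) x) \<le> B * indicator {0..1} x" for n
      using AE_lborel_singleton[of 0]
    proof eventually_elim
      case (elim x)
      show ?case
      proof (cases "x \<in> {0..1}")
        case True
        then have "x \<in> {0<..1}" using elim by auto
        then show ?thesis using bound[of "Suc n" x] by (simp add: f_def)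
      next
        case False
        then show ?thesis by (auto simp: f_def)
      qed
    qed
  qed measurable
  have "(\<integral>x. f (Suc n) x \<partial>lborel) = (\<Sum>t = 1..Suc n. F (Suc n) t) / real (Suc n)" for n
    unfolding f_def by (rule step_function_integral(2)) simp
  then show "(\<lambda>n. (\<Sum>t = 1..Suc n. F (Suc n) t) / real (Suc n)) \<longlonglongrightarrow> (LINT x : {0..1} | lborel. \<phi> x)"
    using conv by (simp only: set_lebesgue_integral_def real_scaleR_def)
qed

text \<open>The point reflection in the centre of the square preserves Lebesgue measure. It supplies
  the parity argument that separates sines from cosines.\<close>

lemma square_integral_reflect:
  assumes "(\<lambda>z. f (fst z) (snd z)) \<in> borel_measurable borel"
  shows "square_integral (\<lambda>x y. f (1 - x) (1 - y)) = square_integral f"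
proof -
  note assms[measurable]
  define h where "h z = square_ind z * f (fst z) (snd z)" for z
  have [measurable]: "{0..1} \<times> {0..1} \<in> sets (borel :: (real \<times> real) measure)" by (simp add: borel_closed closed_Times)
  have hm[measurable]: "h \<in> borel_measurable borel" unfolding h_def by measurable
  have "distr lborel borel (\<lambda>z :: real \<times> real. (1, 1) + (- 1) *\<^sub>R z) = lborel"
    using lborel_affine[of "- 1" "(1, 1) :: real \<times> real"] by (simp add: density_1)
  then have "(\<integral>z. h z \<partial>lborel) = (\<integral>z. h z \<partial>(distr lborel borel (\<lambda>z. (1, 1) + (- 1) *\<^sub>R z)))" by simp
  also have "\<dots> = (\<integral>z. h ((1, 1) + (- 1) *\<^sub>R z) \<partial>lborel)" by (subst integral_distr) auto
  also have "\<dots> = (\<integral>z. square_ind z * f (1 - fst z) (1 - snd z) \<partial>lborel)"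
    by (intro Bochner_Integration.integral_cong refl) (auto simp: h_def indicator_def)
  finally show ?thesis
    by (simp add: square_integral_def set_lebesgue_integral_def h_def)
qed

text \<open>For fixed v = x - y with |v| <= 1 the variable x ranges over an interval of length 1 -
  |v|; this is the triangular weight.\<close>

lemma square_integral_convolution:
  fixes h :: "real \<Rightarrow> real"
  assumes h: "integrable lborel h"
  shows "integrable lborel (\<lambda>z. square_ind z * h (fst z - snd z))"
    "square_integral (\<lambda>x y. h (x - y)) = (\<integral>v. h v * max 0 (1 - \<bar>v\<bar>) \<partial>lborel)"
proof -
  let ?J = "\<integral>v. \<bar>h v\<bar> \<partial>lborel"
  let ?I = "\<lambda>x :: real. indicator {0..1} x :: real"
  have [measurable]: "h \<in> borel_measurable borel" using borel_measurable_integrable[OF h] by simp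
  have hx: "integrable lborel (\<lambda>y. h (x - y))" "(\<integral>y. \<bar>h (x - y)\<bar> \<partial>lborel) = ?J" for x
  proof -
    show "integrable lborel (\<lambda>y. h (x - y))"
      using lborel_integrable_real_affine[OF h, of "- 1" x] by simp
    show "(\<integral>y. \<bar>h (x - y)\<bar> \<partial>lborel) = ?J"
      using lborel_integral_real_affine[of "- 1" "\<lambda>v. \<bar>h v\<bar>" x] by simp
  qed
  have Iint: "integrable lborel ?I" by (intro integrable_real_indicator) auto
  have 1: "integrable (lborel \<Otimes>\<^sub>M lborel) (\<lambda>(x, y). ?I x * ?I y * h (x - y))"
  proof (rule lborel_pair.Fubini_integrable)
    have i: "integrable lborel (\<lambda>y. ?I y * h (x - y))" for x
      using integrable_mult_indicator[OF _ hx(1), of "{0..1}" x] by simp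
    then have i': "integrable lborel (\<lambda>y. ?I x * ?I y * h (x - y))" for x
      by (simp add: mult.assoc)
    then show "AE x in lborel. integrable lborel (\<lambda>y. case (x, y) of (x, y) \<Rightarrow> ?I x * ?I y * h (x - y))" by simp
    show "integrable lborel (\<lambda>x. \<integral>y. norm (case (x, y) of (x, y) \<Rightarrow> ?I x * ?I y * h (x - y)) \<partial>lborel)"
    proof (rule Bochner_Integration.integrable_bound)
      show "integrable lborel (\<lambda>x. ?I x * ?J)" using Iint by simp
      show "AE x in lborel. norm (\<integral>y. norm (case (x, y) of (x, y) \<Rightarrow> ?I x * ?I y * h (x - y)) \<partial>lborel) \<le> norm (?I x * ?J)"
      proof (rule AE_I2)
        fix x :: real
        have "(\<integral>y. norm (?I x * ?I y * h (x - y)) \<partial>lborel) \<le> (\<integral>y. ?I x * \<bar>h (x - y)\<bar> \<partial>lborel)"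
        proof (rule integral_mono)
          show "integrable lborel (\<lambda>y. norm (?I x * ?I y * h (x - y)))" by (rule integrable_norm[OF i'])
          show "integrable lborel (\<lambda>y. ?I x * \<bar>h (x - y)\<bar>)" by (intro integrable_mult_right integrable_abs hx)
        qed (auto simp: abs_mult indicator_def)
        also have "\<dots> = ?I x * ?J" by (simp add: hx(2))
        finally show "norm (\<integral>y. norm (case (x, y) of (x, y) \<Rightarrow> ?I x * ?I y * h (x - y)) \<partial>lborel) \<le> norm (?I x * ?J)"
          by simp
      qed
    qed measurable
  qed measurable
  then show "integrable lborel (\<lambda>z. square_ind z * h (fst z - snd z))"
    by (simp add: lborel_prod case_prod_beta' indicator_times)
  have 2: "integrable (lborel \<Otimes>\<^sub>M lborel) (\<lambda>(x, v). ?I x * ?I (x - v) * h v)"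
  proof (rule Bochner_Integration.integrable_bound)
    have "integrable (lborel \<Otimes>\<^sub>M lborel) (\<lambda>(x, v). ?I x * \<bar>h v\<bar>)"
    proof (rule lborel_pair.Fubini_integrable)
      show "integrable lborel (\<lambda>x. \<integral>y. norm (case (x, y) of (x, v) \<Rightarrow> ?I x * \<bar>h v\<bar>) \<partial>lborel)"
        using Iint by (simp add: abs_mult)
    qed (use h in auto)
    then show "integrable (lborel \<Otimes>\<^sub>M lborel) (\<lambda>(x, v). ?I x * \<bar>h v\<bar>)" .
    show "AE z in lborel \<Otimes>\<^sub>M lborel. norm (case z of (x, v) \<Rightarrow> ?I x * ?I (x - v) * h v) \<le> norm (case z of (x, v) \<Rightarrow> ?I x * \<bar>h v\<bar>)"
      by (auto simp: indicator_def split: prod.splits)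
  qed measurable
  have "square_integral (\<lambda>x y. h (x - y)) = (\<integral>z. (\<lambda>(x, y). ?I x * ?I y * h (x - y)) z \<partial>(lborel \<Otimes>\<^sub>M lborel))"
    by (simp add: square_integral_def set_lebesgue_integral_def lborel_prod case_prod_beta' indicator_times)
  also have "\<dots> = (\<integral>x. \<integral>y. ?I x * ?I y * h (x - y) \<partial>lborel \<partial>lborel)"
    using lborel_pair.integral_fst'[OF 1] by simp
  also have "\<dots> = (\<integral>x. \<integral>v. ?I x * ?I (x - v) * h v \<partial>lborel \<partial>lborel)"
  proof (rule Bochner_Integration.integral_cong[OF refl])
    fix x :: real
    show "(\<integral>y. ?I x * ?I y * h (x - y) \<partial>lborel) = (\<integral>v. ?I x * ?I (x - v) * h v \<partial>lborel)"
      using lborel_integral_real_affine[of "- 1" "\<lambda>v. ?I x * ?I (x - v) * h v" x] by simp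
  qed
  also have "\<dots> = (\<integral>v. \<integral>x. ?I x * ?I (x - v) * h v \<partial>lborel \<partial>lborel)"
    using lborel_pair.Fubini_integral[OF 2] by simp
  also have "\<dots> = (\<integral>v. h v * max 0 (1 - \<bar>v\<bar>) \<partial>lborel)"
  proof (rule Bochner_Integration.integral_cong[OF refl])
    fix v :: real
    have "(\<integral>x. ?I x * ?I (x - v) * h v \<partial>lborel) = (\<integral>x. h v * indicator {max 0 v..min 1 (1 + v)} x \<partial>lborel)"
      by (intro Bochner_Integration.integral_cong refl) (auto simp: indicator_def)
    also have "\<dots> = h v * max 0 (1 - \<bar>v\<bar>)"
      by (cases "max 0 v \<le> min 1 (1 + v)") auto
    finally show "(\<integral>x. ?I x * ?I (x - v) * h v \<partial>lborel) = h v * max 0 (1 - \<bar>v\<bar>)" .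
  qed
  finally show "square_integral (\<lambda>x y. h (x - y)) = (\<integral>v. h v * max 0 (1 - \<bar>v\<bar>) \<partial>lborel)" .
qed

text \<open>\<open>True\<close> stands for the cosine and \<open>False\<close> for the sine, so that
  all covariances of Fourier coefficients, mixed ones included, are treated at once.\<close>

definition trig :: "bool \<Rightarrow> nat \<Rightarrow> real \<Rightarrow> real" where
  "trig b p x = (if b then cos (2 * pi * real p * x) else sin (2 * pi * real p * x))"

lemma abs_trig_le: "\<bar>trig b p x\<bar> \<le> 1"
  by (simp add: trig_def)

lemma trig_measurable [measurable]: "trig b p \<in> borel_measurable borel"
  unfolding trig_def[abs_def] by measurable

lemma isCont_trig: "isCont (trig b p) x"
  unfolding trig_def[abs_def] by (cases b) (auto intro!: continuous_intros)

text \<open>Real and imaginary part of a geometric sum over a root of unity, which differs from 1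
  because 1 <= p < n.\<close>

lemma sum_trig_eq_0:
  assumes "1 \<le> p" "p < n"
  shows "(\<Sum>t = 1..n. trig b p (real t / real n)) = 0"
proof -
  define z where "z = exp (2 * of_real pi * \<i> * of_nat p / of_nat n)"
  have z1: "z \<noteq> 1"
    using complex_root_unity_eq_1[of n p] assms unfolding z_def by (auto dest: dvd_imp_le)
  have zn: "z ^ n = 1"
    using assms unfolding z_def exp_of_nat_mult[symmetric]
    by (simp add: exp_eq_1 field_simps)
  have zt: "z ^ t = Complex (trig True p (real t / real n)) (trig False p (real t / real n))" for t
    unfolding z_def exp_of_nat_mult[symmetric]
    by (simp add: complex_eq_iff Re_exp Im_exp trig_def mult_ac)
  have "(\<Sum>t = 1..n. z ^ t) = z * (\<Sum>t<n. z ^ t)"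
    by (simp add: sum.atLeast1_atMost_eq sum_distrib_left)
  also have "(\<Sum>t<n. z ^ t) = 0" using z1 zn by (simp add: geometric_sum)
  finally have "(\<Sum>t = 1..n. Complex (trig True p (real t / real n)) (trig False p (real t / real n))) = 0"
    by (simp add: zt)
  from arg_cong[OF this, of Re] arg_cong[OF this, of Im] show ?thesis by (cases b) auto
qed

text \<open>At \<open>\<alpha> = 0\<close> the lag variance grows logarithmically; the subtracted constant is harmless since
  the weights sum to 0.\<close>

definition scaled_kernel :: "real \<Rightarrow> (nat \<Rightarrow> real) \<Rightarrow> nat \<Rightarrow> nat \<Rightarrow> nat \<Rightarrow> real" where
  "scaled_kernel \<alpha> r n t s = (lag_variance r (nat \<bar>int t - int s\<bar>) - (if \<alpha> = 0 then lag_variance r n else 0)) / real n powr \<alpha>"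

definition limit_kernel :: "real \<Rightarrow> real \<Rightarrow> real \<Rightarrow> real \<Rightarrow> real" where
  "limit_kernel \<alpha> g x y = (if \<alpha> = 0 then g * ln \<bar>x - y\<bar> else g / \<alpha> * \<bar>x - y\<bar> powr \<alpha>)"

lemma limit_kernel_measurable [measurable]:
  "(\<lambda>z. limit_kernel \<alpha> g (fst z) (snd z)) \<in> borel_measurable (borel \<Otimes>\<^sub>M borel)"
  unfolding limit_kernel_def by (cases "\<alpha> = 0") auto

lemma abs_ln_le: "\<bar>ln x\<bar> \<le> 2 * x powr (- 1/2)" if "0 < x" "x \<le> 1" for x :: real
proof -
  have "ln (x powr (- 1/2)) \<le> x powr (- 1/2)" using that by (intro ln_bound) auto
  moreover have "ln (x powr (- 1/2)) = - 1/2 * ln x" using that by (simp add: ln_powr)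
  moreover have "ln x \<le> 0" using that by simp
  ultimately show ?thesis by linarith
qed

lemma integrable_even_extension:
  fixes f :: "real \<Rightarrow> real"
  assumes i: "integrable lborel (\<lambda>x. indicator {0<..<1} x * f x)" and [measurable]: "f \<in> borel_measurable borel"
  shows "integrable lborel (\<lambda>x. indicator {-1..1} x * f \<bar>x\<bar>)"
proof -
  have "integrable lborel (\<lambda>x. indicator {0<..<1} (0 + (- 1) * x) * f (0 + (- 1) * x))"
    by (rule lborel_integrable_real_affine[OF i]) simp
  from Bochner_Integration.integrable_add[OF i this]
  have "integrable lborel (\<lambda>x. indicator {0<..<1} x * f x + indicator {0<..<1} (- x) * f (- x))" by simp
  moreover have "AE x in lborel. indicator {0<..<1} x * f x + indicator {0<..<1} (- x) * f (- x) = indicator {-1..1} x * f \<bar>x\<bar>"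
    using AE_lborel_singleton[of 0] AE_lborel_singleton[of 1] AE_lborel_singleton[of "- 1"]
    by eventually_elim (auto simp: indicator_def abs_if)
  ultimately show ?thesis by (subst integrable_cong_AE[symmetric]) auto
qed

text \<open>The common dominating function for all exponents \<alpha>. By the convolution formula
  its integrability is that of the logarithm at 0.\<close>

lemma integrable_log_square:
  "integrable lborel (\<lambda>z. square_ind z * (K * (1 + \<bar>ln \<bar>fst z - snd z\<bar>\<bar>)))"
proof -
  have i: "integrable lborel (\<lambda>x. indicator {0<..<1} x * (K * (1 + \<bar>ln x\<bar>)))"
  proof (rule Bochner_Integration.integrable_bound)
    show "integrable lborel (\<lambda>x. \<bar>K\<bar> * (indicator {0<..<1} x * x powr 0 + 2 * (indicator {0<..<1} x * x powr (- 1/2))))"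
      by (intro Bochner_Integration.integrable_add integrable_mult_right integrable_powr_0_1) auto
    show "AE x in lborel. norm (indicator {0<..<1} x * (K * (1 + \<bar>ln x\<bar>)))
       \<le> norm (\<bar>K\<bar> * (indicator {0<..<1} x * x powr 0 + 2 * (indicator {0<..<1} x * x powr (- 1/2))))"
    proof (rule AE_I2)
      fix x :: real
      show "norm (indicator {0<..<1} x * (K * (1 + \<bar>ln x\<bar>)))
       \<le> norm (\<bar>K\<bar> * (indicator {0<..<1} x * x powr 0 + 2 * (indicator {0<..<1} x * x powr (- 1/2))))"
      proof (cases "x \<in> {0<..<1}")
        case True
        define L where "L = \<bar>ln x\<bar>"
        have L: "0 \<le> L" "L \<le> 2 * x powr (- 1/2)" using abs_ln_le[of x] True by (auto simp: L_def)
        then have "\<bar>K\<bar> * (1 + L) \<le> \<bar>K\<bar> * (1 + 2 * x powr (- 1/2))" by (intro mult_left_mono) auto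
        then show ?thesis unfolding L_def[symmetric] using True L by (simp add: abs_mult)
      qed simp
    qed
  qed measurable
  have "integrable lborel (\<lambda>x. indicator {-1..1} x * (K * (1 + \<bar>ln \<bar>x\<bar>\<bar>)))"
    by (rule integrable_even_extension[OF i]) measurable
  from square_integral_convolution(1)[OF this]
  have "integrable lborel (\<lambda>z. square_ind z * (indicator {-1..1} (fst z - snd z) * (K * (1 + \<bar>ln \<bar>fst z - snd z\<bar>\<bar>))))" .
  moreover have "square_ind z * (indicator {-1..1} (fst z - snd z) * x) = square_ind z * x" for z x
    by (cases z) (auto simp: indicator_def)
  ultimately show ?thesis by (simp only:)
qed

context
  fixes r :: "nat \<Rightarrow> real" and \<alpha> g :: real
  assumes \<alpha>: "\<alpha> \<ge> 0" and g: "(\<lambda>h. lag_partial_sum r h / real h powr (\<alpha> - 1)) \<longlonglongrightarrow> g"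
begin

lemma scaled_kernel_tendsto:
  assumes x: "x \<in> {0<..1}" and y: "y \<in> {0..1}" and xy: "x \<noteq> y"
  shows "(\<lambda>n. scaled_kernel \<alpha> r n (grid n x) (grid n y)) \<longlonglongrightarrow> limit_kernel \<alpha> g x y"
proof -
  define k where "k n = nat \<bar>int (grid n x) - int (grid n y)\<bar>" for n
  have kr: "real (k n) = \<bar>real (grid n x) - real (grid n y)\<bar>" for n
    by (simp add: k_def)
  have "(\<lambda>n. \<bar>real (grid n x) / real n - real (grid n y) / real n\<bar>) \<longlonglongrightarrow> \<bar>x - y\<bar>"
  proof (cases "y = 0")
    case True
    have "(\<lambda>n. \<bar>real (grid n x) / real n\<bar>) \<longlonglongrightarrow> \<bar>x\<bar>"
      using x by (intro tendsto_intros nat_ceiling_mult_tendsto) auto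
    then show ?thesis by (simp add: True)
  qed (use x y in \<open>intro tendsto_intros nat_ceiling_mult_tendsto; auto\<close>)
  then have kt: "(\<lambda>n. real (k n) / real n) \<longlonglongrightarrow> \<bar>x - y\<bar>"
    by (simp add: kr diff_divide_distrib[symmetric])
  have pos: "\<bar>x - y\<bar> > 0" using xy by simp
  have kn: "k n \<le> n" for n
  proof -
    have "real n * x \<le> real n" "real n * y \<le> real n" using x y by (auto intro: mult_left_le)
    then have "grid n x \<le> n" "grid n y \<le> n" by linarith+
    then show ?thesis unfolding k_def by linarith
  qed
  show ?thesis
  proof (cases "\<alpha> = 0")
    case True
    have "(\<lambda>n. lag_variance r (k n) - lag_variance r n) \<longlonglongrightarrow> g * ln \<bar>x - y\<bar>"
      by (rule lag_variance_diff_tendsto_ln[OF _ kt pos kn]) (use g True in simp)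
    then have "(\<lambda>n. (lag_variance r (k n) - lag_variance r n) / real n powr 0) \<longlonglongrightarrow> g * ln \<bar>x - y\<bar>"
    proof (rule Lim_transform_eventually)
      show "\<forall>\<^sub>F n in sequentially. lag_variance r (k n) - lag_variance r n = (lag_variance r (k n) - lag_variance r n) / real n powr 0"
        using eventually_gt_at_top[of 0] by eventually_elim simp
    qed
    then show ?thesis using True by (simp add: scaled_kernel_def limit_kernel_def k_def)
  next
    case False
    then have \<alpha>': "\<alpha> > 0" using \<alpha> by simp
    have kinf: "filterlim k sequentially sequentially"
    proof -
      have "filterlim (\<lambda>n. (real (k n) / real n) * real n) at_top sequentially"
        by (rule filterlim_tendsto_pos_mult_at_top[OF kt pos filterlim_real_sequentially])
      moreover have "(real (k n) / real n) * real n = real (k n)" for n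
        using kn[of n] by (cases "n = 0") auto
      ultimately show ?thesis by (simp add: filterlim_sequentially_iff_filterlim_real)
    qed
    have "(\<lambda>n. lag_variance r (k n) / real (k n) powr \<alpha> * (real (k n) / real n) powr \<alpha>) \<longlonglongrightarrow> g / \<alpha> * \<bar>x - y\<bar> powr \<alpha>"
      using pos by (intro tendsto_mult tendsto_powr kt tendsto_const
        filterlim_compose[OF lag_variance_powr_tendsto[OF g \<alpha>'] kinf]) auto
    moreover have "\<forall>\<^sub>F n in sequentially. lag_variance r (k n) / real (k n) powr \<alpha> * (real (k n) / real n) powr \<alpha>
       = lag_variance r (k n) / real n powr \<alpha>"
      using kinf[unfolded filterlim_at_top, rule_format, of 1]
      by eventually_elim (simp add: powr_divide)
    ultimately have "(\<lambda>n. lag_variance r (k n) / real n powr \<alpha>) \<longlonglongrightarrow> g / \<alpha> * \<bar>x - y\<bar> powr \<alpha>"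
      by (rule Lim_transform_eventually)
    then show ?thesis using False by (simp add: scaled_kernel_def limit_kernel_def k_def)
  qed
qed

text \<open>The logarithm is there for \<alpha> = 0. For \<alpha> > 0 the kernel is bounded
  outright, and the last clause records the underlying bound on \<open>lag_variance\<close> for the
  boundary terms.\<close>

lemma scaled_kernel_bound:
  obtains K where "K > 0" "\<And>n x y. n \<ge> 1 \<Longrightarrow> x \<in> {0<..1} \<Longrightarrow> y \<in> {0<..1} \<Longrightarrow> x \<noteq> y \<Longrightarrow>
    \<bar>scaled_kernel \<alpha> r n (grid n x) (grid n y)\<bar> \<le> K * (1 + \<bar>ln \<bar>x - y\<bar>\<bar>)"
    "\<alpha> > 0 \<Longrightarrow> (\<And>n k. k \<le> n \<Longrightarrow> \<bar>lag_variance r k\<bar> \<le> K * real n powr \<alpha>)"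
proof (cases "\<alpha> = 0")
  case False
  then have \<alpha>': "\<alpha> > 0" using \<alpha> by simp
  obtain K where K: "K > 0" "\<And>h. h \<ge> 1 \<Longrightarrow> \<bar>lag_variance r h\<bar> \<le> K * real h powr \<alpha>"
    using tendsto_imp_bound[OF lag_variance_powr_tendsto[OF g \<alpha>']] by auto
  have V: "\<bar>lag_variance r k\<bar> \<le> K * real n powr \<alpha>" if "k \<le> n" for k n
  proof (cases "k = 0")
    case True
    then show ?thesis using K(1) by (simp add: lag_variance_simps)
  next
    case False
    have "\<bar>lag_variance r k\<bar> \<le> K * real k powr \<alpha>" using K(2) False by simp
    also have "\<dots> \<le> K * real n powr \<alpha>" using K(1) \<alpha> that by (intro mult_left_mono powr_mono2) auto
    finally show ?thesis .
  qed
  show ?thesis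
  proof (rule that[OF K(1)])
    fix n :: nat and x y :: real
    assume n: "n \<ge> 1" and x: "x \<in> {0<..1}" and y: "y \<in> {0<..1}"
    have "real n * x \<le> real n" "real n * y \<le> real n" using x y by (auto intro: mult_left_le)
    then have "grid n x \<le> n" "grid n y \<le> n" by linarith+
    then have "nat \<bar>int (grid n x) - int (grid n y)\<bar> \<le> n" by linarith
    from V[OF this] have "\<bar>scaled_kernel \<alpha> r n (grid n x) (grid n y)\<bar> \<le> K"
      using n False by (simp add: scaled_kernel_def field_simps)
    also have "K \<le> K * (1 + \<bar>ln \<bar>x - y\<bar>\<bar>)" using K(1) by simp
    finally show "\<bar>scaled_kernel \<alpha> r n (grid n x) (grid n y)\<bar> \<le> K * (1 + \<bar>ln \<bar>x - y\<bar>\<bar>)" .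
  qed (rule V)
next
  case True
  obtain K0 where K0: "K0 > 0" "\<And>k n. 1 \<le> k \<Longrightarrow> k \<le> n \<Longrightarrow> \<bar>lag_variance r n - lag_variance r k\<bar> \<le> K0 * ln (real n / real k)"
    using lag_variance_diff_ln_bound[of r g] g True by auto
  define K where "K = K0 + \<bar>r 0\<bar>"
  show ?thesis
  proof (rule that[of K])
    show "K > 0" using K0 by (simp add: K_def)
    fix n :: nat and x y :: real
    assume n: "n \<ge> 1" and x: "x \<in> {0<..1}" and y: "y \<in> {0<..1}" and xy: "x \<noteq> y"
    define k where "k = nat \<bar>int (grid n x) - int (grid n y)\<bar>"
    have "real n * x \<le> real n" "real n * y \<le> real n" using x y by (auto intro: mult_left_le)
    then have "grid n x \<le> n" "grid n y \<le> n" by linarith+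
    then have kn: "k \<le> n" unfolding k_def by linarith
    \<comment> \<open>Rounding up changes each coordinate by less than one grid step, so the grid
      distance k exceeds n |x - y| - 1.\<close>
    have kb: "real n * \<bar>x - y\<bar> < real k + 1"
    proof -
      have "\<bar>real (grid n x) - real (grid n y)\<bar> = real k" by (simp add: k_def)
      moreover have "real n * \<bar>x - y\<bar> = \<bar>real n * x - real n * y\<bar>" by (simp add: abs_mult right_diff_distrib[symmetric])
      moreover note nat_ceiling_mult_bounds(2,3)[of x n] nat_ceiling_mult_bounds(2,3)[of y n]
      ultimately show ?thesis using n x y by auto linarith+
    qed
    have pos: "\<bar>x - y\<bar> > 0" using xy by simp
    have d1: "\<bar>x - y\<bar> \<le> 1" using x y by auto
    have "\<bar>lag_variance r k - lag_variance r n\<bar> \<le> K * (1 + \<bar>ln \<bar>x - y\<bar>\<bar>)"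
    proof (cases "k = 0")
      case True
      have v1: "lag_variance r 1 = r 0" by (simp add: lag_variance_def lag_partial_sum_def)
      have "\<bar>lag_variance r n\<bar> \<le> \<bar>lag_variance r n - lag_variance r 1\<bar> + \<bar>r 0\<bar>" using v1 by linarith
      also have "\<dots> \<le> K0 * ln (real n / real 1) + \<bar>r 0\<bar>" using K0(2)[of 1 n] n by simp
      \<comment> \<open>Two points in the same cell satisfy n |x - y| < 1, so ln n is dominated by
        the logarithm of their distance.\<close>
      also have "ln (real n / real 1) \<le> \<bar>ln \<bar>x - y\<bar>\<bar>"
      proof -
        have "real n \<le> 1 / \<bar>x - y\<bar>" using kb True pos by (simp add: field_simps)
        then have "ln (real n) \<le> ln (1 / \<bar>x - y\<bar>)"
          using n pos by (subst ln_le_cancel_iff) auto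
        then show ?thesis using pos by (simp add: ln_div)
      qed
      also have "K0 * \<bar>ln \<bar>x - y\<bar>\<bar> + \<bar>r 0\<bar> \<le> K * (1 + \<bar>ln \<bar>x - y\<bar>\<bar>)"
        using K0(1) by (simp add: K_def algebra_simps)
      finally show ?thesis using True K0(1) by (simp add: lag_variance_simps mult_left_mono)
    next
      case False
      have "\<bar>lag_variance r k - lag_variance r n\<bar> \<le> K0 * ln (real n / real k)"
        using K0(2)[of k n] kn False by simp
      also have "\<dots> \<le> K0 * ln (2 / \<bar>x - y\<bar>)"
      proof -
        \<comment> \<open>For k >= 1 the bound k + 1 is at most 2 k, which is the origin of the
          factor 2; its logarithm is then absorbed by ln 2 < 1.\<close>
        have "real n * \<bar>x - y\<bar> \<le> 2 * real k" using kb False by linarith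
        then have "real n / real k \<le> 2 / \<bar>x - y\<bar>" using pos False by (simp add: field_simps)
        moreover have "real n / real k > 0" using n False by simp
        ultimately show ?thesis using K0(1) pos by (intro mult_left_mono) (auto simp: ln_le_cancel_iff)
      qed
      also have "\<dots> = K0 * (ln 2 - ln \<bar>x - y\<bar>)" using pos by (simp add: ln_div)
      also have "\<dots> \<le> K0 * (1 + \<bar>ln \<bar>x - y\<bar>\<bar>)"
        using K0(1) ln_2_less_1 by (intro mult_left_mono) auto
      also have "\<dots> \<le> K * (1 + \<bar>ln \<bar>x - y\<bar>\<bar>)" by (intro mult_right_mono) (auto simp: K_def)
      finally show ?thesis .
    qed
    then show "\<bar>scaled_kernel \<alpha> r n (grid n x) (grid n y)\<bar> \<le> K * (1 + \<bar>ln \<bar>x - y\<bar>\<bar>)"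
      using True n by (simp add: scaled_kernel_def k_def)
  qed (use True in simp)
qed

lemma kernel_double_sum_tendsto:
  fixes p q :: "nat \<Rightarrow> nat \<Rightarrow> real" and p' q' :: "real \<Rightarrow> real"
  assumes [measurable]: "p' \<in> borel_measurable borel" "q' \<in> borel_measurable borel"
    and p: "\<And>x. x \<in> {0<..1} \<Longrightarrow> (\<lambda>n. p n (grid n x)) \<longlonglongrightarrow> p' x"
    and q: "\<And>x. x \<in> {0<..1} \<Longrightarrow> (\<lambda>n. q n (grid n x)) \<longlonglongrightarrow> q' x"
    and b: "\<And>n t. n \<ge> 1 \<Longrightarrow> \<bar>p n t\<bar> \<le> P" "\<And>n t. n \<ge> 1 \<Longrightarrow> \<bar>q n t\<bar> \<le> P"
  shows "(\<lambda>n. (\<Sum>t = 1..n. \<Sum>s = 1..n. p n t * q n s * scaled_kernel \<alpha> r n t s) / (real n)\<^sup>2)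
    \<longlonglongrightarrow> square_integral (\<lambda>x y. p' x * q' y * limit_kernel \<alpha> g x y)"
proof -
  obtain K where K: "K > 0" "\<And>n x y. n \<ge> 1 \<Longrightarrow> x \<in> {0<..1} \<Longrightarrow> y \<in> {0<..1} \<Longrightarrow> x \<noteq> y \<Longrightarrow>
    \<bar>scaled_kernel \<alpha> r n (grid n x) (grid n y)\<bar> \<le> K * (1 + \<bar>ln \<bar>x - y\<bar>\<bar>)"
    using scaled_kernel_bound by metis
  show ?thesis
  proof (rule double_sum_tendsto_square_integral[OF integrable_log_square[of "P * P * K"]])
    show "(\<lambda>z. p' (fst z) * q' (snd z) * limit_kernel \<alpha> g (fst z) (snd z)) \<in> borel_measurable borel"
      unfolding borel_prod[symmetric] by measurable
    fix x y :: real assume x: "x \<in> {0<..1}" and y: "y \<in> {0<..1}" and xy: "x \<noteq> y"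
    show "(\<lambda>n. p n (grid n x) * q n (grid n y) * scaled_kernel \<alpha> r n (grid n x) (grid n y))
      \<longlonglongrightarrow> p' x * q' y * limit_kernel \<alpha> g x y"
      using y by (intro tendsto_mult p q scaled_kernel_tendsto x y xy) auto
    fix n :: nat assume n: "n \<ge> 1"
    have P0: "P \<ge> 0" using b(1)[OF n, of 0] by linarith
    have "\<bar>p n (grid n x) * q n (grid n y) * scaled_kernel \<alpha> r n (grid n x) (grid n y)\<bar>
      \<le> P * P * (K * (1 + \<bar>ln \<bar>x - y\<bar>\<bar>))"
      unfolding abs_mult by (intro mult_mono b K n x y xy) (auto simp: P0)
    then show "\<bar>p n (grid n x) * q n (grid n y) * scaled_kernel \<alpha> r n (grid n x) (grid n y)\<bar>
      \<le> P * P * K * (1 + \<bar>ln \<bar>x - y\<bar>\<bar>)" by (simp add: mult.assoc)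
  qed
qed

end

section \<open>Limits of the trigonometric lag sums\<close>

lemma double_sum_subtract_const:
  fixes a b :: "nat \<Rightarrow> real"
  shows "(\<Sum>t\<in>I. \<Sum>s\<in>J. a t * b s * V t s)
    = (\<Sum>t\<in>I. \<Sum>s\<in>J. a t * b s * (V t s - v)) + (\<Sum>t\<in>I. a t) * (\<Sum>s\<in>J. b s) * v"
proof -
  have "(\<Sum>t\<in>I. \<Sum>s\<in>J. a t * b s * v) = (\<Sum>t\<in>I. a t) * (\<Sum>s\<in>J. b s) * v"
    by (simp only: sum_product[symmetric] sum_distrib_right[symmetric])
  then show ?thesis by (simp add: right_diff_distrib sum_subtractf)
qed

lemma sum_split_inner:
  fixes m m' A :: "nat \<Rightarrow> real"
  shows "(\<Sum>t\<in>I. m t * ((\<Sum>s\<in>J. m' s * V t s) / n + c * A t)) / n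
    = (\<Sum>t\<in>I. \<Sum>s\<in>J. m t * m' s * V t s) / n\<^sup>2 + c * ((\<Sum>t\<in>I. m t * A t) / n)"
proof -
  have "m t * ((\<Sum>s\<in>J. m' s * V t s) / n + c * A t) = (\<Sum>s\<in>J. m t * m' s * V t s) / n + c * (m t * A t)" for t
    by (simp add: sum_distrib_left distrib_left mult_ac)
  then show ?thesis
    by (simp add: sum.distrib sum_divide_distrib[symmetric] sum_distrib_left[symmetric] add_divide_distrib power2_eq_square)
qed

lemma combine_boundary_terms:
  fixes N :: real
  assumes "N > 0"
  shows "- 1/2 * (A + wq * B + wp * C - 2 * wp * wq * (L / N)) * N
    = - 1/2 * (N * A + wq * (N * B) + wp * (N * C - 2 * wq * L))"
  using assms by (simp add: field_simps)

text \<open>The weight received by the increment at time u when a trigonometric sum of X is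
  rewritten in its increments. The decrements of these weights are the trigonometric values
  again.\<close>

definition tail_trig :: "bool \<Rightarrow> nat \<Rightarrow> nat \<Rightarrow> nat \<Rightarrow> real" where
  "tail_trig b p n u = (\<Sum>t = u..n. trig b p (real t / real n))"

definition dtrig :: "bool \<Rightarrow> nat \<Rightarrow> real \<Rightarrow> real" where
  "dtrig b p x = 2 * pi * real p * (if b then - sin (2 * pi * real p * x) else cos (2 * pi * real p * x))"

lemma dtrig_measurable [measurable]: "dtrig b p \<in> borel_measurable borel"
  unfolding dtrig_def[abs_def] by measurable

lemma DERIV_trig: "DERIV (trig b p) x :> dtrig b p x"
  unfolding trig_def[abs_def] dtrig_def by (cases b) (auto intro!: derivative_eq_intros)

lemma isCont_dtrig: "isCont (dtrig b p) x"
  unfolding dtrig_def[abs_def] by (cases b) (auto intro!: continuous_intros)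

lemma abs_dtrig_le: "\<bar>dtrig b p x\<bar> \<le> 2 * pi * real p"
proof -
  have "\<bar>if b then - sin (2 * pi * real p * x) else cos (2 * pi * real p * x)\<bar> \<le> 1" by simp
  then have "2 * pi * real p * \<bar>if b then - sin (2 * pi * real p * x) else cos (2 * pi * real p * x)\<bar> \<le> 2 * pi * real p * 1"
    by (intro mult_left_mono) auto
  then show ?thesis by (simp only: dtrig_def abs_mult) (simp add: abs_mult)
qed

lemma trig_plus_1: "trig b p (1 + x) = trig b p x"
proof -
  have e: "2 * pi * real p * (1 + x) = 2 * pi * real p * x + 2 * pi * real p" by (simp add: algebra_simps)
  have "sin (2 * pi * real p) = 0" "cos (2 * pi * real p) = 1"
    using sin_2npi[of p] cos_2npi[of p] by (simp_all add: mult_ac)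
  then show ?thesis unfolding trig_def e by (simp add: sin_add cos_add)
qed

lemma trig_reflect: "trig b p (1 - x) = (if b then trig b p x else - trig b p x)"
  using trig_plus_1[of b p "- x"] by (simp add: trig_def)

lemma trig_diff_quotient:
  assumes "n \<ge> 1"
  obtains z where "real t / real n < z" "z < (real t + 1) / real n"
    "real n * (trig b p (real t / real n) - trig b p (real (Suc t) / real n)) = - dtrig b p z"
proof -
  have lt: "real t / real n < (real t + 1) / real n" using assms by (simp add: divide_strict_right_mono)
  obtain z where z: "real t / real n < z" "z < (real t + 1) / real n"
    "trig b p ((real t + 1) / real n) - trig b p (real t / real n) = ((real t + 1) / real n - real t / real n) * dtrig b p z"
    using MVT2[OF lt, of "trig b p" "dtrig b p"] DERIV_trig by blast
  have "(real t + 1) / real n - real t / real n = 1 / real n" by (simp add: diff_divide_distrib[symmetric])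
  then have "real n * (trig b p (real t / real n) - trig b p (real (Suc t) / real n)) = - dtrig b p z"
    using z(3) assms by (simp add: field_simps)
  then show ?thesis using that z by blast
qed

lemma abs_trig_diff_le:
  assumes "n \<ge> 1"
  shows "\<bar>real n * (trig b p (real t / real n) - trig b p (real (Suc t) / real n))\<bar> \<le> 2 * pi * real p"
proof -
  obtain z where "real n * (trig b p (real t / real n) - trig b p (real (Suc t) / real n)) = - dtrig b p z"
    using trig_diff_quotient[OF assms] by blast
  then show ?thesis using abs_dtrig_le[of b p z] by simp
qed

lemma trig_diff_tendsto:
  assumes x: "x > 0"
  shows "(\<lambda>n. real n * (trig b p (real (grid n x) / real n) - trig b p (real (Suc (grid n x)) / real n)))
    \<longlonglongrightarrow> - dtrig b p x"
proof -
  let ?t = "\<lambda>n. grid n x"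
  have "\<exists>z. n \<ge> 1 \<longrightarrow> real (?t n) / real n < z \<and> z < (real (?t n) + 1) / real n \<and>
    real n * (trig b p (real (?t n) / real n) - trig b p (real (Suc (?t n)) / real n)) = - dtrig b p z" for n
    using trig_diff_quotient[of n "?t n" b p] by blast
  then obtain z where z: "\<And>n. n \<ge> 1 \<Longrightarrow> real (?t n) / real n < z n \<and> z n < (real (?t n) + 1) / real n \<and>
    real n * (trig b p (real (?t n) / real n) - trig b p (real (Suc (?t n)) / real n)) = - dtrig b p (z n)"
    by metis
  have tx: "(\<lambda>n. real (?t n) / real n) \<longlonglongrightarrow> x" by (rule nat_ceiling_mult_tendsto(1)[OF x])
  have "(\<lambda>n. real (?t n) / real n + 1 / real n) \<longlonglongrightarrow> x + 0"
    by (intro tendsto_add tx) real_asymp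
  then have tx': "(\<lambda>n. (real (?t n) + 1) / real n) \<longlonglongrightarrow> x" by (simp add: add_divide_distrib)
  have "z \<longlonglongrightarrow> x"
  proof (rule tendsto_sandwich[OF _ _ tx tx'])
    show "\<forall>\<^sub>F n in sequentially. real (?t n) / real n \<le> z n"
      by (rule eventually_sequentiallyI[of 1]) (simp only: less_imp_le[OF conjunct1[OF z]])
    show "\<forall>\<^sub>F n in sequentially. z n \<le> (real (?t n) + 1) / real n"
      by (rule eventually_sequentiallyI[of 1]) (simp only: less_imp_le[OF conjunct1[OF conjunct2[OF z]]])
  qed
  then have "(\<lambda>n. - dtrig b p (z n)) \<longlonglongrightarrow> - dtrig b p x"
    by (intro tendsto_minus isCont_tendsto_compose[OF isCont_dtrig])
  then show ?thesis
    by (rule Lim_transform_eventually) (rule eventually_sequentiallyI[of 1], simp only: z)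
qed

lemma trig_ceiling_tendsto:
  assumes "x > 0"
  shows "(\<lambda>n. trig b p (real (grid n x) / real n)) \<longlonglongrightarrow> trig b p x"
  by (rule isCont_tendsto_compose[OF isCont_trig nat_ceiling_mult_tendsto(1)[OF assms]])

context
  fixes r :: "nat \<Rightarrow> real" and \<alpha> g :: real
  assumes \<alpha>: "\<alpha> \<ge> 0" and g: "(\<lambda>h. lag_partial_sum r h / real h powr (\<alpha> - 1)) \<longlonglongrightarrow> g"
begin

text \<open>The masses are the trigonometric values at 1..n and, at 0, minus their full sum, which
  vanishes. Hence there are no boundary terms, and total mass 0 allows
  \<open>lag_variance r n\<close> to be subtracted when \<alpha> = 0. The exponent exceeds \<alpha>
  by 2 because the masses are of order 1, not 1 / n.\<close>

lemma tail_trig_lag_sum_tendsto: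
  assumes p: "1 \<le> p" and q: "1 \<le> q"
  shows "(\<lambda>n. weighted_lag_sum r (tail_trig b p n) (tail_trig b' q n) 0 0 n / real n powr (\<alpha> + 2))
    \<longlonglongrightarrow> - 1/2 * square_integral (\<lambda>x y. trig b p x * trig b' q y * limit_kernel \<alpha> g x y)"
proof -
  let ?w = "\<lambda>b p n t. trig b p (real t / real n)"
  let ?S = "\<lambda>n. (\<Sum>t = 1..n. \<Sum>s = 1..n. ?w b p n t * ?w b' q n s * scaled_kernel \<alpha> r n t s) / (real n)\<^sup>2"
  have "(\<lambda>n. - 1/2 * ?S n) \<longlonglongrightarrow> - 1/2 * square_integral (\<lambda>x y. trig b p x * trig b' q y * limit_kernel \<alpha> g x y)"
    by (intro tendsto_mult tendsto_const kernel_double_sum_tendsto[OF \<alpha> g, where P = 1] trig_ceiling_tendsto abs_trig_le) auto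
  moreover have "\<forall>\<^sub>F n in sequentially. - 1/2 * ?S n
     = weighted_lag_sum r (tail_trig b p n) (tail_trig b' q n) 0 0 n / real n powr (\<alpha> + 2)"
    using eventually_gt_at_top[of "max p q"]
  proof eventually_elim
    case (elim n)
    have dec: "weight_decrement n (tail_trig c k n) t = (if t = 0 then 0 else ?w c k n t)"
      if "t \<le> n" "1 \<le> k" "k < n" for c k t
    proof (cases "t = 0")
      case True
      then show ?thesis using that sum_trig_eq_0[of k n c] by (simp add: weight_decrement_def tail_trig_def)
    next
      case False
      then show ?thesis using that
        by (cases "t = n") (auto simp: weight_decrement_def tail_trig_def sum.atLeast_Suc_atMost[of t n])
    qed
    let ?V = "\<lambda>t s. lag_variance r (nat \<bar>int t - int s\<bar>)"
    let ?v = "if \<alpha> = 0 then lag_variance r n else 0"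
    have "(\<Sum>t\<le>n. \<Sum>s\<le>n. weight_decrement n (tail_trig b p n) t * weight_decrement n (tail_trig b' q n) s * ?V t s)
      = (\<Sum>t\<le>n. \<Sum>s\<le>n. (if t = 0 then 0 else ?w b p n t) * (if s = 0 then 0 else ?w b' q n s) * ?V t s)"
      using elim p q by (intro sum.cong refl) (simp add: dec)
    also have "\<dots> = (\<Sum>t = 1..n. \<Sum>s\<le>n. ?w b p n t * (if s = 0 then 0 else ?w b' q n s) * ?V t s)"
      by (rule sum.mono_neutral_cong_right) auto
    also have "\<dots> = (\<Sum>t = 1..n. \<Sum>s = 1..n. ?w b p n t * ?w b' q n s * ?V t s)"
      by (intro sum.cong refl sum.mono_neutral_cong_right) auto
    also have "\<dots> = (\<Sum>t = 1..n. \<Sum>s = 1..n. ?w b p n t * ?w b' q n s * (?V t s - ?v)) + (\<Sum>t = 1..n. ?w b p n t) * (\<Sum>s = 1..n. ?w b' q n s) * ?v"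
      by (rule double_sum_subtract_const)
    also have "(\<Sum>t = 1..n. ?w b p n t) = 0" using elim p by (intro sum_trig_eq_0) auto
    also have "(\<Sum>t = 1..n. \<Sum>s = 1..n. ?w b p n t * ?w b' q n s * (?V t s - ?v)) + 0 * (\<Sum>s = 1..n. ?w b' q n s) * ?v
      = real n powr \<alpha> * (\<Sum>t = 1..n. \<Sum>s = 1..n. ?w b p n t * ?w b' q n s * scaled_kernel \<alpha> r n t s)"
      using elim by (simp add: scaled_kernel_def sum_distrib_left)
    finally have "weighted_lag_sum r (tail_trig b p n) (tail_trig b' q n) 0 0 n
      = - 1/2 * (real n powr \<alpha> * (\<Sum>t = 1..n. \<Sum>s = 1..n. ?w b p n t * ?w b' q n s * scaled_kernel \<alpha> r n t s))"
      unfolding weighted_lag_sum_by_parts by (simp only:)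
    moreover have "real n powr (\<alpha> + 2) = real n powr \<alpha> * (real n)\<^sup>2"
      using elim by (simp add: powr_add)
    ultimately show ?case using elim by simp
  qed
  ultimately show ?thesis by (rule Lim_transform_eventually)
qed

text \<open>Up to discretisation the masses are - \<open>dtrig\<close> / n along the block, together
  with the end value of the weight, taken with opposite signs at n and 0. Expanding the bilinear
  form gives a double integral, two single integrals for end points against the interior, and the
  term g / \<alpha> for the two end points against each other.\<close>

lemma trig_lag_sum_tendsto:
  assumes \<alpha>': "\<alpha> > 0"
  shows "(\<lambda>n. weighted_lag_sum r (\<lambda>u. trig b p (real u / real n)) (\<lambda>u. trig b' q (real u / real n)) 0 0 n / real n powr \<alpha>)
    \<longlonglongrightarrow> - 1/2 * (square_integral (\<lambda>x y. dtrig b p x * dtrig b' q y * limit_kernel \<alpha> g x y)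
      - trig b' q 0 * (LINT x : {0..1} | lborel. dtrig b p x * (limit_kernel \<alpha> g x 1 - limit_kernel \<alpha> g x 0))
      - trig b p 0 * (LINT x : {0..1} | lborel. dtrig b' q x * (limit_kernel \<alpha> g x 1 - limit_kernel \<alpha> g x 0))
      - 2 * trig b p 0 * trig b' q 0 * (g / \<alpha>))"
proof -
  let ?lk = "\<lambda>x. limit_kernel \<alpha> g x 1 - limit_kernel \<alpha> g x 0"
  define m where "m b p n t = real n * (trig b p (real t / real n) - trig b p (real (Suc t) / real n))" for b p n t
  let ?V = "\<lambda>t s. lag_variance r (nat \<bar>int t - int s\<bar>)"
  let ?K = "scaled_kernel \<alpha> r"
  let ?S = "\<lambda>n. (\<Sum>t = 1..n. \<Sum>s = 1..n. m b p n t * m b' q n s * ?K n t s) / (real n)\<^sup>2"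
  let ?E = "\<lambda>b p n. (\<Sum>t = 1..n. m b p n t * (?K n t n - ?K n t 0)) / real n"
  let ?w = "\<lambda>b p n. trig b p (1 / real n)"
  let ?Q = "\<lambda>n. - 1/2 * (?S n + ?w b' q n * ?E b p n + ?w b p n * ?E b' q n - 2 * ?w b p n * ?w b' q n * (lag_variance r n / real n powr \<alpha>))"
  have mb: "\<bar>m b p n t\<bar> \<le> 2 * pi * real p" if "n \<ge> 1" for b p n t
    unfolding m_def by (rule abs_trig_diff_le[OF that])
  have ml: "(\<lambda>n. m b p n (grid n x)) \<longlonglongrightarrow> - dtrig b p x" if "x > 0" for b p x
    unfolding m_def by (rule trig_diff_tendsto[OF that])
  have S: "?S \<longlonglongrightarrow> square_integral (\<lambda>x y. (- dtrig b p x) * (- dtrig b' q y) * limit_kernel \<alpha> g x y)"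
  proof (rule kernel_double_sum_tendsto[OF \<alpha> g, where P = "2 * pi * real (p + q)"])
    fix n :: nat and t assume n: "n \<ge> 1"
    have "2 * pi * real p \<le> 2 * pi * real (p + q)" "2 * pi * real q \<le> 2 * pi * real (p + q)" by auto
    then show "\<bar>m b p n t\<bar> \<le> 2 * pi * real (p + q)" "\<bar>m b' q n t\<bar> \<le> 2 * pi * real (p + q)"
      using mb[OF n, of b p t] mb[OF n, of b' q t] by linarith+
  qed (auto intro!: ml)
  obtain C where C: "C > 0" "\<And>n k. k \<le> n \<Longrightarrow> \<bar>lag_variance r k\<bar> \<le> C * real n powr \<alpha>"
    using scaled_kernel_bound[OF \<alpha> g] \<alpha>' by metis
  have Kb: "\<bar>?K n t s\<bar> \<le> C" if "n \<ge> 1" "t \<le> n" "s \<le> n" for n t s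
  proof -
    have "nat \<bar>int t - int s\<bar> \<le> n" using that by linarith
    from C(2)[OF this] show ?thesis using that(1) \<alpha>' by (simp add: scaled_kernel_def field_simps)
  qed
  have E: "?E b p \<longlonglongrightarrow> (LINT x : {0..1} | lborel. (- dtrig b p x) * ?lk x)" for b p
  proof (rule sum_tendsto_set_integral[where B = "2 * pi * real p * (2 * C)"])
    show "(\<lambda>x. - dtrig b p x * ?lk x) \<in> borel_measurable borel"
      unfolding limit_kernel_def using \<alpha>' by simp
    fix x :: real assume x: "x \<in> {0<..<1}"
    \<comment> \<open>The end points n and 0 are the grid points of 1 and 0, so the boundary rows
      are instances of the kernel limit.\<close>
    have "(\<lambda>n. ?K n (grid n x) (grid n 1)) \<longlonglongrightarrow> limit_kernel \<alpha> g x 1"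
      "(\<lambda>n. ?K n (grid n x) (grid n 0)) \<longlonglongrightarrow> limit_kernel \<alpha> g x 0"
      using x by (intro scaled_kernel_tendsto[OF \<alpha> g]; simp)+
    then show "(\<lambda>n. m b p n (grid n x) * (?K n (grid n x) n - ?K n (grid n x) 0))
      \<longlonglongrightarrow> - dtrig b p x * ?lk x"
      using x by (intro tendsto_mult tendsto_diff ml) auto
  next
    fix n :: nat and x :: real assume n: "n \<ge> 1" and x: "x \<in> {0<..1}"
    have "real n * x \<le> real n" using x by (auto intro: mult_left_le)
    then have t: "grid n x \<le> n" by linarith
    have "\<bar>?K n (grid n x) n - ?K n (grid n x) 0\<bar> \<le> 2 * C"
      using Kb[OF n t, of n] Kb[OF n t, of 0] by linarith
    then show "\<bar>m b p n (grid n x) * (?K n (grid n x) n - ?K n (grid n x) 0)\<bar> \<le> 2 * pi * real p * (2 * C)"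
      unfolding abs_mult using mb[OF n] by (intro mult_mono) auto
  qed
  have w: "(\<lambda>n. ?w b p n) \<longlonglongrightarrow> trig b p 0" for b p
    by (rule isCont_tendsto_compose[OF isCont_trig]) real_asymp
  have "?Q \<longlonglongrightarrow> - 1/2 * (square_integral (\<lambda>x y. (- dtrig b p x) * (- dtrig b' q y) * limit_kernel \<alpha> g x y)
      + trig b' q 0 * (LINT x : {0..1} | lborel. (- dtrig b p x) * ?lk x)
      + trig b p 0 * (LINT x : {0..1} | lborel. (- dtrig b' q x) * ?lk x)
      - 2 * trig b p 0 * trig b' q 0 * (g / \<alpha>))"
    by (intro tendsto_intros S E w lag_variance_powr_tendsto[OF g \<alpha>'])
  moreover have "\<forall>\<^sub>F n in sequentially. ?Q n
     = weighted_lag_sum r (\<lambda>u. trig b p (real u / real n)) (\<lambda>u. trig b' q (real u / real n)) 0 0 n / real n powr \<alpha>"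
    using eventually_ge_at_top[of 1]
  proof eventually_elim
    case (elim n)
    define \<mu> where "\<mu> b p t = weight_decrement n (\<lambda>u. trig b p (real u / real n)) t" for b p t
    have \<mu>: "(\<Sum>t\<le>n. \<mu> b p t * f t) = (\<Sum>t = 1..n. m b p n t * f t) / real n + ?w b p n * (f n - f 0)" for b p and f :: "nat \<Rightarrow> real"
    proof -
      have tn: "trig b p (real (Suc n) / real n) = ?w b p n"
      proof -
        have "real (Suc n) / real n = 1 + 1 / real n" using elim by (simp add: field_simps)
        then show ?thesis by (simp only: trig_plus_1)
      qed
      \<comment> \<open>At t = n the difference \<open>m\<close> involves the weight at n + 1, which
        by periodicity is the weight at 1; adding that value restores the weight at n. The mass at 0
        is minus the same value.\<close>
      have pt: "\<mu> b p t = (if t = 0 then 0 else m b p n t / real n) + (if t = n then ?w b p n else 0) - (if t = 0 then ?w b p n else 0)"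
        if "t \<le> n" for t
        using that elim tn by (auto simp: \<mu>_def weight_decrement_def m_def)
      have "(\<Sum>t\<le>n. \<mu> b p t * f t) = (\<Sum>t\<le>n. (if t = 0 then 0 else m b p n t / real n) * f t + (if t = n then ?w b p n * f n else 0) - (if t = 0 then ?w b p n * f 0 else 0))"
        by (intro sum.cong refl) (auto simp: pt algebra_simps)
      also have "\<dots> = (\<Sum>t\<le>n. (if t = 0 then 0 else m b p n t / real n) * f t) + ?w b p n * f n - ?w b p n * f 0"
        by (simp only: sum.distrib sum_subtractf) simp
      also have "(\<Sum>t\<le>n. (if t = 0 then 0 else m b p n t / real n) * f t) = (\<Sum>t = 1..n. m b p n t / real n * f t)"
        by (rule sum.mono_neutral_cong_right) auto
      also have "\<dots> = (\<Sum>t = 1..n. m b p n t * f t) / real n" by (simp add: sum_divide_distrib)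
      finally show ?thesis by (simp add: algebra_simps)
    qed
    have na: "real n powr \<alpha> > 0" using elim by simp
    have VK: "?V t s = real n powr \<alpha> * ?K n t s" for t s
      using na \<alpha>' by (simp add: scaled_kernel_def)
    define f where "f t = (\<Sum>s\<le>n. \<mu> b' q s * ?V t s)" for t
    have f: "f t = (\<Sum>s = 1..n. m b' q n s * ?V t s) / real n + ?w b' q n * (?V t n - ?V t 0)" for t
      unfolding f_def by (rule \<mu>)
    have sym: "?V t s = ?V s t" for t s by (simp add: abs_minus_commute)
    have "(\<Sum>t\<le>n. \<Sum>s\<le>n. \<mu> b p t * \<mu> b' q s * ?V t s) = (\<Sum>t\<le>n. \<mu> b p t * f t)"
      by (simp add: f_def sum_distrib_left mult.assoc)
    also have "\<dots> = (\<Sum>t = 1..n. m b p n t * f t) / real n + ?w b p n * (f n - f 0)" by (rule \<mu>)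
    also have "(\<Sum>t = 1..n. m b p n t * f t) / real n = (\<Sum>t = 1..n. \<Sum>s = 1..n. m b p n t * m b' q n s * ?V t s) / (real n)\<^sup>2
        + ?w b' q n * ((\<Sum>t = 1..n. m b p n t * (?V t n - ?V t 0)) / real n)"
      unfolding f by (rule sum_split_inner)
    also have "f n - f 0 = (\<Sum>s = 1..n. m b' q n s * (?V s n - ?V s 0)) / real n - 2 * ?w b' q n * lag_variance r n"
    proof -
      have "(\<Sum>s = 1..n. m b' q n s * ?V k s) = (\<Sum>s = 1..n. m b' q n s * ?V s k)" for k
        by (intro sum.cong refl arg_cong2[of _ _ _ _ "(*)"] sym)
      moreover have "?V n n = 0" "?V n 0 = lag_variance r n" "?V 0 n = lag_variance r n" "?V 0 0 = 0"
        by (simp_all add: lag_variance_simps)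
      ultimately have "f n = (\<Sum>s = 1..n. m b' q n s * ?V s n) / real n - ?w b' q n * lag_variance r n"
        "f 0 = (\<Sum>s = 1..n. m b' q n s * ?V s 0) / real n + ?w b' q n * lag_variance r n"
        unfolding f by simp_all
      then show ?thesis by (simp add: right_diff_distrib sum_subtractf diff_divide_distrib)
    qed
    finally have X: "(\<Sum>t\<le>n. \<Sum>s\<le>n. \<mu> b p t * \<mu> b' q s * ?V t s)
      = (\<Sum>t = 1..n. \<Sum>s = 1..n. m b p n t * m b' q n s * ?V t s) / (real n)\<^sup>2
        + ?w b' q n * ((\<Sum>t = 1..n. m b p n t * (?V t n - ?V t 0)) / real n)
        + ?w b p n * ((\<Sum>s = 1..n. m b' q n s * (?V s n - ?V s 0)) / real n - 2 * ?w b' q n * lag_variance r n)" .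
    have s1: "(\<Sum>t = 1..n. \<Sum>s = 1..n. m b p n t * m b' q n s * ?V t s) = real n powr \<alpha> * (\<Sum>t = 1..n. \<Sum>s = 1..n. m b p n t * m b' q n s * ?K n t s)"
      unfolding VK by (simp add: sum_distrib_left mult_ac)
    have s2: "(\<Sum>t = 1..n. m b p n t * (?V t n - ?V t 0)) = real n powr \<alpha> * (\<Sum>t = 1..n. m b p n t * (?K n t n - ?K n t 0))" for b p
      unfolding VK by (simp add: sum_distrib_left right_diff_distrib mult_ac)
    have "?Q n * real n powr \<alpha> = - 1/2 * (\<Sum>t\<le>n. \<Sum>s\<le>n. \<mu> b p t * \<mu> b' q s * ?V t s)"
      unfolding X s1 s2 times_divide_eq_right[symmetric] by (rule combine_boundary_terms[OF na])
    then have "?Q n = - 1/2 * (\<Sum>t\<le>n. \<Sum>s\<le>n. \<mu> b p t * \<mu> b' q s * ?V t s) / real n powr \<alpha>"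
      using na by (simp only: eq_divide_eq) simp
    then show ?case
      unfolding weighted_lag_sum_by_parts \<mu>_def .
  qed
  ultimately have "(\<lambda>n. weighted_lag_sum r (\<lambda>u. trig b p (real u / real n)) (\<lambda>u. trig b' q (real u / real n)) 0 0 n / real n powr \<alpha>)
    \<longlonglongrightarrow> - 1/2 * (square_integral (\<lambda>x y. (- dtrig b p x) * (- dtrig b' q y) * limit_kernel \<alpha> g x y)
      + trig b' q 0 * (LINT x : {0..1} | lborel. (- dtrig b p x) * ?lk x)
      + trig b p 0 * (LINT x : {0..1} | lborel. (- dtrig b' q x) * ?lk x)
      - 2 * trig b p 0 * trig b' q 0 * (g / \<alpha>))"
    by (rule Lim_transform_eventually)
  moreover have "(LINT x : {0..1} | lborel. (- dtrig b p x) * ?lk x)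
    = - (LINT x : {0..1} | lborel. dtrig b p x * ?lk x)" for b p
    by (simp add: set_lebesgue_integral_def)
  ultimately show ?thesis by simp
qed

end

section \<open>Signs of Fourier integrals of powers over full periods\<close>

definition unit_integral :: "(real \<Rightarrow> real) \<Rightarrow> real" where
  "unit_integral f = (\<integral>x. indicator {0<..<1} x * f x \<partial>lborel)"

definition unit_integrable :: "(real \<Rightarrow> real) \<Rightarrow> bool" where
  "unit_integrable f \<longleftrightarrow> integrable lborel (\<lambda>x. indicator {0<..<1} x * f x)"

text \<open>The end points form a null set. Working on the open interval keeps singular values at 0
  out of pointwise bounds and fits the fundamental theorem with one-sided limits.\<close>

lemma LINT_unit:
  fixes f :: "real \<Rightarrow> real"
  assumes [measurable]: "f \<in> borel_measurable borel"
  shows "(LINT x : {0..1} | lborel. f x) = unit_integral f"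
proof -
  have "AE x in lborel. indicator {0..1} x * f x = indicator {0<..<1} x * f x"
    using AE_lborel_singleton[of 0] AE_lborel_singleton[of 1] by eventually_elim (auto simp: indicator_def)
  then show ?thesis unfolding set_lebesgue_integral_def unit_integral_def real_scaleR_def
    by (intro integral_cong_AE) auto
qed

lemma unit_integral_add: "unit_integrable f \<Longrightarrow> unit_integrable g \<Longrightarrow> unit_integral (\<lambda>x. f x + g x) = unit_integral f + unit_integral g"
  and unit_integral_diff: "unit_integrable f \<Longrightarrow> unit_integrable g \<Longrightarrow> unit_integral (\<lambda>x. f x - g x) = unit_integral f - unit_integral g"
  by (simp_all add: unit_integral_def unit_integrable_def distrib_left right_diff_distrib)

lemma unit_integral_cmult: "unit_integral (\<lambda>x. c * f x) = c * unit_integral f"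
  by (simp only: unit_integral_def mult.left_commute[of "indicator _ _"] integral_mult_right_zero)

lemma unit_integrable_add: "unit_integrable f \<Longrightarrow> unit_integrable g \<Longrightarrow> unit_integrable (\<lambda>x. f x + g x)"
  and unit_integrable_diff: "unit_integrable f \<Longrightarrow> unit_integrable g \<Longrightarrow> unit_integrable (\<lambda>x. f x - g x)"
  by (simp_all add: unit_integrable_def distrib_left right_diff_distrib)

lemma unit_integrable_cmult: "unit_integrable f \<Longrightarrow> unit_integrable (\<lambda>x. c * f x)"
  by (simp add: unit_integrable_def mult.left_commute[of "indicator _ _"])

lemma unit_integrable_bound:
  assumes "g \<in> borel_measurable borel" "unit_integrable f" "\<And>x. x \<in> {0<..<1} \<Longrightarrow> \<bar>g x\<bar> \<le> f x"
  shows "unit_integrable g"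
  unfolding unit_integrable_def
proof (rule Bochner_Integration.integrable_bound)
  show "integrable lborel (\<lambda>x. indicator {0<..<1} x * f x)" using assms(2) by (simp add: unit_integrable_def)
  show "AE x in lborel. norm (indicator {0<..<1} x * g x) \<le> norm (indicator {0<..<1} x * f x)"
    using assms(3) by (intro AE_I2) (auto simp: indicator_def intro: order_trans[OF _ abs_ge_self])
qed (use assms(1) in simp)

lemma unit_integral_cong: "(\<And>x. x \<in> {0<..<1} \<Longrightarrow> f x = g x) \<Longrightarrow> unit_integral f = unit_integral g"
  unfolding unit_integral_def by (intro Bochner_Integration.integral_cong refl) (auto simp: indicator_def)

lemma unit_integral_pos:
  assumes "unit_integrable f" "\<And>x. x \<in> {0<..<1} \<Longrightarrow> f x \<ge> 0" "\<And>x. x \<in> {0<..<b} \<Longrightarrow> f x > 0" "0 < b" "b \<le> 1"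
  shows "unit_integral f > 0"
  unfolding unit_integral_def
  by (rule integral_pos_of_pos_on_interval[of _ 0 b]) (use assms in \<open>auto simp: unit_integrable_def indicator_def\<close>)

lemma unit_integral_FTC:
  assumes "\<And>x. x \<in> {0<..<1} \<Longrightarrow> (F has_real_derivative f x) (at x)" "\<And>x. x \<in> {0<..<1} \<Longrightarrow> isCont f x"
    and "unit_integrable f" "(F \<longlongrightarrow> A) (at_right 0)" "(F \<longlongrightarrow> B) (at_left 1)"
  shows "unit_integral f = B - A"
proof -
  have "(LBINT x=ereal 0..ereal 1. f x) = B - A"
  proof (rule interval_integral_FTC_integrable)
    show "set_integrable lborel (einterval (ereal 0) (ereal 1)) f"
      using assms(3) by (simp add: unit_integrable_def set_integrable_def)
  qed (use assms in \<open>auto simp: has_real_derivative_iff_has_vector_derivative ereal_tendsto_simps\<close>)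
  then show ?thesis
    by (simp add: interval_lebesgue_integral_def set_lebesgue_integral_def unit_integral_def)
qed

lemma unit_integrable_powr: "\<beta> > -1 \<Longrightarrow> unit_integrable (\<lambda>x. x powr \<beta>)"
  unfolding unit_integrable_def by (rule integrable_powr_0_1)

context
  fixes p :: nat and \<omega> :: real
  assumes p: "p \<ge> 1" and \<omega>: "\<omega> = 2 * pi * real p"
begin

lemma omega_pos: "\<omega> > 0" using p by (simp add: \<omega>)

lemma cos_omega: "cos \<omega> = 1" and sin_omega: "sin \<omega> = 0"
  using sin_2npi[of p] cos_2npi[of p] by (simp_all add: \<omega> mult_ac)

definition "cos_powr \<beta> = unit_integral (\<lambda>x. x powr \<beta> * cos (\<omega> * x))"
definition "sin_powr \<beta> = unit_integral (\<lambda>x. x powr \<beta> * sin (\<omega> * x))"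

lemma cos_powr_integrable: "\<beta> > -1 \<Longrightarrow> unit_integrable (\<lambda>x. x powr \<beta> * cos (\<omega> * x))"
  by (rule unit_integrable_bound[OF _ unit_integrable_powr]) (auto simp: abs_mult intro!: mult_left_le)

lemma powr_Suc: "x powr (\<beta> + 1) = x powr \<beta> * x" if "x > 0" for x :: real
  using that by (simp add: powr_add)

lemma sin_powr_integrable:
  assumes "\<beta> > -2"
  shows "unit_integrable (\<lambda>x. x powr \<beta> * sin (\<omega> * x))"
proof (rule unit_integrable_bound[OF _ unit_integrable_cmult[OF unit_integrable_powr[of "\<beta> + 1"], of \<omega>]])
  fix x :: real assume x: "x \<in> {0<..<1}"
  have "\<bar>sin (\<omega> * x)\<bar> \<le> \<omega> * x" using abs_sin_x_le_abs_x[of "\<omega> * x"] omega_pos x by simp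
  then have "x powr \<beta> * \<bar>sin (\<omega> * x)\<bar> \<le> x powr \<beta> * (\<omega> * x)" by (intro mult_left_mono) auto
  then show "\<bar>x powr \<beta> * sin (\<omega> * x)\<bar> \<le> \<omega> * x powr (\<beta> + 1)"
    using x by (simp add: abs_mult powr_Suc mult_ac)
qed (use assms in auto)

lemma one_minus_cos_le: "0 \<le> 1 - cos y" "1 - cos y \<le> y\<^sup>2" for y :: real
proof -
  have "1 - cos y = 2 * (sin (y / 2))\<^sup>2" using cos_double_sin[of "y / 2"] by simp
  moreover have "(sin (y / 2))\<^sup>2 \<le> (y / 2)\<^sup>2"
    using abs_sin_x_le_abs_x[of "y / 2"] by (metis abs_ge_zero power2_abs power_mono)
  moreover have "0 \<le> (sin (y / 2))\<^sup>2" "0 \<le> y\<^sup>2" by simp_all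
  moreover have "(y / 2)\<^sup>2 = y\<^sup>2 / 4" by (simp add: power_divide)
  ultimately show "0 \<le> 1 - cos y" "1 - cos y \<le> y\<^sup>2" by linarith+
qed

text \<open>The double zero of 1 - cos at the origin admits exponents down to - 3.\<close>

lemma one_minus_cos_powr:
  assumes "\<beta> > -3"
  shows "unit_integrable (\<lambda>x. x powr \<beta> * (1 - cos (\<omega> * x)))" "unit_integral (\<lambda>x. x powr \<beta> * (1 - cos (\<omega> * x))) > 0"
proof -
  show i: "unit_integrable (\<lambda>x. x powr \<beta> * (1 - cos (\<omega> * x)))"
  proof (rule unit_integrable_bound[OF _ unit_integrable_cmult[OF unit_integrable_powr[of "\<beta> + 2"], of "\<omega>\<^sup>2"]])
    fix x :: real assume x: "x \<in> {0<..<1}"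
    have "x powr \<beta> * (1 - cos (\<omega> * x)) \<le> x powr \<beta> * (\<omega> * x)\<^sup>2"
      using one_minus_cos_le by (intro mult_left_mono) auto
    also have "\<dots> = \<omega>\<^sup>2 * x powr (\<beta> + 2)" using x by (simp add: powr_add power_mult_distrib mult_ac)
    finally show "\<bar>x powr \<beta> * (1 - cos (\<omega> * x))\<bar> \<le> \<omega>\<^sup>2 * x powr (\<beta> + 2)"
      using one_minus_cos_le(1)[of "\<omega> * x"] by (simp add: abs_mult)
  qed (use assms in auto)

  show "unit_integral (\<lambda>x. x powr \<beta> * (1 - cos (\<omega> * x))) > 0"
  proof (rule unit_integral_pos[OF i, of "1 / real p"])
    fix x assume x: "x \<in> {0<..<1 / real p}"
    \<comment> \<open>On (0, 1 / p) the argument stays inside one open period, where the cosine is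
      less than 1.\<close>
    have "0 < \<omega> * x" "\<omega> * x < 2 * pi" using x p omega_pos by (auto simp: \<omega> field_simps)
    then have "cos (\<omega> * x) \<noteq> 1"
      using cos_one_2pi_int[of "\<omega> * x"] by (smt (verit) cos_monotone_0_pi cos_2pi_minus cos_zero pi_gt_zero)
    then have "cos (\<omega> * x) < 1" using cos_le_one[of "\<omega> * x"] by linarith
    then show "0 < x powr \<beta> * (1 - cos (\<omega> * x))" using x by simp
  qed (use p one_minus_cos_le in auto)
qed

text \<open>Integrating by parts with \<open>(1 - cos (\<omega> x)) / \<omega>\<close> as primitive of the sine shows that a sine
  integral over full periods has the sign of minus the derivative of the other factor.\<close>

lemma sin_powr_eq:
  assumes "\<beta> > -2"
  shows "\<omega> * sin_powr \<beta> = - \<beta> * unit_integral (\<lambda>x. x powr (\<beta> - 1) * (1 - cos (\<omega> * x)))"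
proof -
  let ?f = "\<lambda>x. \<beta> * (x powr (\<beta> - 1) * (1 - cos (\<omega> * x))) + \<omega> * (x powr \<beta> * sin (\<omega> * x))"
  have "unit_integral ?f = 0 - 0"
  proof (rule unit_integral_FTC[where F = "\<lambda>x. x powr \<beta> * (1 - cos (\<omega> * x))"])
    fix x :: real assume x: "x \<in> {0<..<1}"
    show "((\<lambda>x. x powr \<beta> * (1 - cos (\<omega> * x))) has_real_derivative ?f x) (at x)"
      using x by (auto intro!: derivative_eq_intros simp: powr_diff)
    show "isCont ?f x" using x by (auto intro!: continuous_intros)
  next
    show "unit_integrable ?f"
      using assms by (intro unit_integrable_add unit_integrable_cmult one_minus_cos_powr sin_powr_integrable) auto
    show "((\<lambda>x. x powr \<beta> * (1 - cos (\<omega> * x))) \<longlongrightarrow> 0) (at_right 0)"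
    proof (rule Lim_null_comparison)
      show "\<forall>\<^sub>F x in at_right 0. norm (x powr \<beta> * (1 - cos (\<omega> * x))) \<le> \<omega>\<^sup>2 * x powr (\<beta> + 2)"
        using eventually_at_right_less[of 0]
      proof eventually_elim
        case (elim x)
        have "x powr \<beta> * (1 - cos (\<omega> * x)) \<le> x powr \<beta> * (\<omega> * x)\<^sup>2"
          using one_minus_cos_le by (intro mult_left_mono) auto
        also have "\<dots> = \<omega>\<^sup>2 * x powr (\<beta> + 2)" using elim by (simp add: powr_add power_mult_distrib mult_ac)
        finally show ?case using one_minus_cos_le(1)[of "\<omega> * x"] by (simp add: abs_mult)
      qed
      show "((\<lambda>x. \<omega>\<^sup>2 * x powr (\<beta> + 2)) \<longlongrightarrow> 0) (at_right 0)"
        using assms by (intro tendsto_mult_right_zero) real_asymp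
    qed
    show "((\<lambda>x. x powr \<beta> * (1 - cos (\<omega> * x))) \<longlongrightarrow> 0) (at_left 1)"
      by (auto intro!: tendsto_eq_intros simp: cos_omega)
  qed
  moreover have "unit_integral ?f = \<beta> * unit_integral (\<lambda>x. x powr (\<beta> - 1) * (1 - cos (\<omega> * x))) + \<omega> * sin_powr \<beta>"
    using assms unfolding sin_powr_def
    by (subst unit_integral_add) (auto simp: unit_integral_cmult intro!: unit_integrable_cmult one_minus_cos_powr sin_powr_integrable)
  ultimately show ?thesis by simp
qed

lemma sin_powr_sign:
  "- 2 < \<beta> \<Longrightarrow> \<beta> < 0 \<Longrightarrow> sin_powr \<beta> > 0" "\<beta> > 0 \<Longrightarrow> sin_powr \<beta> < 0" "sin_powr 0 = 0"
proof -
  show "sin_powr \<beta> > 0" if "- 2 < \<beta>" "\<beta> < 0"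
  proof -
    have "0 < - \<beta> * unit_integral (\<lambda>x. x powr (\<beta> - 1) * (1 - cos (\<omega> * x)))"
      using that one_minus_cos_powr(2)[of "\<beta> - 1"] by (intro mult_pos_pos) auto
    then show ?thesis using sin_powr_eq[of \<beta>] that omega_pos by (metis zero_less_mult_pos)
  qed
  show "sin_powr \<beta> < 0" if "\<beta> > 0"
  proof -
    have "\<omega> * sin_powr \<beta> < 0"
      using sin_powr_eq[of \<beta>] that one_minus_cos_powr(2)[of "\<beta> - 1"] by simp
    then show ?thesis using omega_pos by (simp add: mult_less_0_iff)
  qed
  show "sin_powr 0 = 0" using sin_powr_eq[of 0] omega_pos by simp
qed

lemma cos_powr_eq:
  assumes "\<beta> > -1"
  shows "\<omega> * cos_powr \<beta> = - \<beta> * sin_powr (\<beta> - 1)"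
proof -
  let ?f = "\<lambda>x. \<beta> * (x powr (\<beta> - 1) * sin (\<omega> * x)) + \<omega> * (x powr \<beta> * cos (\<omega> * x))"
  have "unit_integral ?f = 0 - 0"
  proof (rule unit_integral_FTC[where F = "\<lambda>x. x powr \<beta> * sin (\<omega> * x)"])
    fix x :: real assume x: "x \<in> {0<..<1}"
    show "((\<lambda>x. x powr \<beta> * sin (\<omega> * x)) has_real_derivative ?f x) (at x)"
      using x by (auto intro!: derivative_eq_intros simp: powr_diff)
    show "isCont ?f x" using x by (auto intro!: continuous_intros)
  next
    show "unit_integrable ?f"
      using assms by (intro unit_integrable_add unit_integrable_cmult cos_powr_integrable sin_powr_integrable) auto
    show "((\<lambda>x. x powr \<beta> * sin (\<omega> * x)) \<longlongrightarrow> 0) (at_right 0)"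
      using assms omega_pos by real_asymp
    show "((\<lambda>x. x powr \<beta> * sin (\<omega> * x)) \<longlongrightarrow> 0) (at_left 1)"
      by (auto intro!: tendsto_eq_intros simp: sin_omega)
  qed
  moreover have "unit_integral ?f = \<beta> * sin_powr (\<beta> - 1) + \<omega> * cos_powr \<beta>"
    using assms unfolding sin_powr_def cos_powr_def
    by (subst unit_integral_add) (auto simp: unit_integral_cmult intro!: unit_integrable_cmult cos_powr_integrable sin_powr_integrable)
  ultimately show ?thesis by simp
qed

text \<open>Integration by parts with the cosine; the term - 1 is its boundary value at x = 1, where
  cos \<omega> = 1. It trades a sine integral for a cosine integral of lower exponent.\<close>

lemma sin_powr_eq_cos:
  assumes "\<beta> > 0"
  shows "\<omega> * sin_powr \<beta> = \<beta> * cos_powr (\<beta> - 1) - 1"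
proof -
  let ?f = "\<lambda>x. \<beta> * (x powr (\<beta> - 1) * cos (\<omega> * x)) - \<omega> * (x powr \<beta> * sin (\<omega> * x))"
  have "unit_integral ?f = 1 - 0"
  proof (rule unit_integral_FTC[where F = "\<lambda>x. x powr \<beta> * cos (\<omega> * x)"])
    fix x :: real assume x: "x \<in> {0<..<1}"
    show "((\<lambda>x. x powr \<beta> * cos (\<omega> * x)) has_real_derivative ?f x) (at x)"
      using x by (auto intro!: derivative_eq_intros simp: powr_diff)
    show "isCont ?f x" using x by (auto intro!: continuous_intros)
  next
    show "unit_integrable ?f"
      using assms by (intro unit_integrable_diff unit_integrable_cmult cos_powr_integrable sin_powr_integrable) auto
    show "((\<lambda>x. x powr \<beta> * cos (\<omega> * x)) \<longlongrightarrow> 0) (at_right 0)"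
      using assms by real_asymp
    show "((\<lambda>x. x powr \<beta> * cos (\<omega> * x)) \<longlongrightarrow> 1) (at_left 1)"
      by (auto intro!: tendsto_eq_intros simp: cos_omega)
  qed
  moreover have "unit_integral ?f = \<beta> * cos_powr (\<beta> - 1) - \<omega> * sin_powr \<beta>"
    using assms unfolding sin_powr_def cos_powr_def
    by (subst unit_integral_diff) (auto simp: unit_integral_cmult intro!: unit_integrable_cmult cos_powr_integrable sin_powr_integrable)
  ultimately show ?thesis by simp
qed

lemma cos_powr_sign:
  "- 1 < \<beta> \<Longrightarrow> \<beta> < 0 \<Longrightarrow> cos_powr \<beta> > 0" "0 < \<beta> \<Longrightarrow> \<beta> < 1 \<Longrightarrow> cos_powr \<beta> < 0"
proof -
  show "cos_powr \<beta> > 0" if "- 1 < \<beta>" "\<beta> < 0"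
  proof -
    have "0 < \<omega> * cos_powr \<beta>"
      unfolding cos_powr_eq[OF that(1)] using that by (intro mult_pos_pos sin_powr_sign) auto
    then show ?thesis using omega_pos by (simp add: zero_less_mult_iff)
  qed
  show "cos_powr \<beta> < 0" if "0 < \<beta>" "\<beta> < 1"
  proof -
    have "\<omega> * cos_powr \<beta> < 0"
      using cos_powr_eq[of \<beta>] that sin_powr_sign(1)[of "\<beta> - 1"] by simp
    then show ?thesis using omega_pos by (simp add: mult_less_0_iff)
  qed
qed

text \<open>With \<alpha> = 2 d - 1 this is the sign of - D_jj(d) for 1/2 < d < 3/2. For \<alpha> <=
  1 both terms obtained by parts have a known sign. For \<alpha> > 1 they compete; a further
  integration by parts leads to the exponents \<alpha> - 2 in (- 1, 0) and \<alpha> - 1 in (0, 1),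
  where cosine integrals are positive and negative respectively.\<close>

lemma cos_powr_diff_neg:
  assumes "0 < \<alpha>" "\<alpha> < 2"
  shows "cos_powr \<alpha> - cos_powr (\<alpha> + 1) < 0"
proof -
  have e: "\<omega> * (cos_powr \<alpha> - cos_powr (\<alpha> + 1)) = - \<alpha> * sin_powr (\<alpha> - 1) + (\<alpha> + 1) * sin_powr \<alpha>"
    using cos_powr_eq[of \<alpha>] cos_powr_eq[of "\<alpha> + 1"] assms by (simp add: algebra_simps)
  have neg: "(\<alpha> + 1) * sin_powr \<alpha> < 0" using sin_powr_sign(2)[of \<alpha>] assms by (simp add: mult_pos_neg)
  have "\<omega> * (cos_powr \<alpha> - cos_powr (\<alpha> + 1)) < 0"
  proof (cases "\<alpha> \<le> 1")
    case True
    have "sin_powr (\<alpha> - 1) \<ge> 0"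
      using sin_powr_sign(1)[of "\<alpha> - 1"] sin_powr_sign(3) True assms by (cases "\<alpha> = 1") auto
    then have "\<alpha> * sin_powr (\<alpha> - 1) \<ge> 0" using assms by simp
    then show ?thesis using neg e by linarith
  next
    case False
    have "\<omega> * (- \<alpha> * sin_powr (\<alpha> - 1) + (\<alpha> + 1) * sin_powr \<alpha>)
      = - \<alpha> * (\<omega> * sin_powr (\<alpha> - 1)) + (\<alpha> + 1) * (\<omega> * sin_powr \<alpha>)" by (simp add: algebra_simps)
    also have "\<dots> = - \<alpha> * ((\<alpha> - 1) * cos_powr (\<alpha> - 2) - 1) + (\<alpha> + 1) * (\<alpha> * cos_powr (\<alpha> - 1) - 1)"
      using sin_powr_eq_cos[of "\<alpha> - 1"] sin_powr_eq_cos[of \<alpha>] False assms by simp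
    also have "\<dots> = - 1 - \<alpha> * (\<alpha> - 1) * cos_powr (\<alpha> - 2) + \<alpha> * (\<alpha> + 1) * cos_powr (\<alpha> - 1)"
      by (simp add: algebra_simps)
    also have "\<dots> < 0"
    proof -
      have "0 < \<alpha> * (\<alpha> - 1) * cos_powr (\<alpha> - 2)" using False assms by (intro mult_pos_pos cos_powr_sign) auto
      moreover have "\<alpha> * (\<alpha> + 1) * cos_powr (\<alpha> - 1) < 0"
        using False assms cos_powr_sign(2)[of "\<alpha> - 1"] by (intro mult_pos_neg) auto
      ultimately show ?thesis by linarith
    qed
    finally show ?thesis using omega_pos e by (simp add: mult_less_0_iff)
  qed
  then show ?thesis using omega_pos by (simp add: mult_less_0_iff)
qed

text \<open>With \<alpha> = 2 d + 1 this is D_jj(d) / \<delta>(d) for - 1/2 < d < 1/2. The terms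
  with the squared frequency are reduced by parts until only integrals of known sign remain; at
  \<alpha> = 1, that is d = 0, the value is 1.\<close>

lemma boundary_combination_pos:
  assumes "0 < \<alpha>" "\<alpha> < 2"
  shows "- 1 + 2 * \<alpha> * cos_powr (\<alpha> - 1) - \<omega>\<^sup>2 * (cos_powr \<alpha> - cos_powr (\<alpha> + 1)) > 0"
proof -
  have "\<omega>\<^sup>2 * (cos_powr \<alpha> - cos_powr (\<alpha> + 1)) = \<omega> * (\<omega> * cos_powr \<alpha>) - \<omega> * (\<omega> * cos_powr (\<alpha> + 1))"
    by (simp add: power2_eq_square algebra_simps)
  also have "\<dots> = \<omega> * (- \<alpha> * sin_powr (\<alpha> - 1)) - \<omega> * (- (\<alpha> + 1) * sin_powr \<alpha>)"
    using cos_powr_eq[of \<alpha>] cos_powr_eq[of "\<alpha> + 1"] assms by simp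
  also have "\<dots> = - \<alpha> * (\<omega> * sin_powr (\<alpha> - 1)) + (\<alpha> + 1) * (\<omega> * sin_powr \<alpha>)"
    by (simp add: algebra_simps)
  also have "\<omega> * sin_powr \<alpha> = \<alpha> * cos_powr (\<alpha> - 1) - 1" using sin_powr_eq_cos assms by simp
  finally have e: "- 1 + 2 * \<alpha> * cos_powr (\<alpha> - 1) - \<omega>\<^sup>2 * (cos_powr \<alpha> - cos_powr (\<alpha> + 1))
    = \<alpha> + \<alpha> * (1 - \<alpha>) * cos_powr (\<alpha> - 1) + \<alpha> * (\<omega> * sin_powr (\<alpha> - 1))"
    by (simp add: algebra_simps)
  consider "\<alpha> < 1" | "\<alpha> = 1" | "\<alpha> > 1" by linarith
  then show ?thesis
  proof cases
    case 1
    have "0 < \<alpha> * (1 - \<alpha>) * cos_powr (\<alpha> - 1)" "0 < \<alpha> * (\<omega> * sin_powr (\<alpha> - 1))"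
      using 1 assms omega_pos by (auto intro!: mult_pos_pos cos_powr_sign sin_powr_sign)
    then show ?thesis unfolding e using assms by linarith
  next
    case 2
    then show ?thesis unfolding e by (simp add: sin_powr_sign(3))
  next
    case 3
    have s1: "\<omega> * sin_powr (\<alpha> - 1) = (\<alpha> - 1) * cos_powr (\<alpha> - 2) - 1" using sin_powr_eq_cos[of "\<alpha> - 1"] 3 by simp
    have e': "\<alpha> + \<alpha> * (1 - \<alpha>) * cos_powr (\<alpha> - 1) + \<alpha> * (\<omega> * sin_powr (\<alpha> - 1))
       = \<alpha> * (1 - \<alpha>) * cos_powr (\<alpha> - 1) + \<alpha> * ((\<alpha> - 1) * cos_powr (\<alpha> - 2))"
      unfolding s1 by (simp add: algebra_simps)
    have "0 < \<alpha> * ((\<alpha> - 1) * cos_powr (\<alpha> - 2))" using 3 assms by (intro mult_pos_pos cos_powr_sign) auto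
    moreover have "0 < \<alpha> * (1 - \<alpha>) * cos_powr (\<alpha> - 1)"
      using 3 assms cos_powr_sign(2)[of "\<alpha> - 1"] by (intro mult_neg_neg mult_pos_neg) auto
    ultimately show ?thesis unfolding e e' by linarith
  qed
qed

text \<open>The case d = 1/2. Integration by parts produces the integrals of sin (\<omega> x)
  against 1 / x, against 1 and against ln x; they are positive, zero and negative, the last by a
  second integration by parts.\<close>

lemma log_cos_integral_neg:
  "unit_integrable (\<lambda>x. (1 - x) * ln x * cos (\<omega> * x))" "unit_integral (\<lambda>x. (1 - x) * ln x * cos (\<omega> * x)) < 0"
proof -
  let ?k = "\<lambda>x. (1 - x) * ln x * cos (\<omega> * x)"
  have lni: "unit_integrable (\<lambda>x. c * x powr (- 1/2))" for c
    by (intro unit_integrable_cmult unit_integrable_powr) simp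
  have b: "\<bar>ln x * y\<bar> \<le> 2 * x powr (- 1/2)" if "x \<in> {0<..<1}" "\<bar>y\<bar> \<le> 1" for x y :: real
  proof -
    have "\<bar>ln x\<bar> * \<bar>y\<bar> \<le> (2 * x powr (- 1/2)) * 1"
      using that abs_ln_le[of x] by (intro mult_mono) auto
    then show ?thesis by (simp only: abs_mult mult_1_right)
  qed
  show i1: "unit_integrable ?k"
  proof (rule unit_integrable_bound[OF _ lni[of 2]])
    fix x :: real assume x: "x \<in> {0<..<1}"
    have "\<bar>(1 - x) * cos (\<omega> * x)\<bar> \<le> 1 * 1" unfolding abs_mult using x by (intro mult_mono) auto
    then show "\<bar>(1 - x) * ln x * cos (\<omega> * x)\<bar> \<le> 2 * x powr (- 1/2)"
      using b[OF x, of "(1 - x) * cos (\<omega> * x)"] by (simp add: mult_ac)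
  qed measurable
  have i2: "unit_integrable (\<lambda>x. ln x * sin (\<omega> * x))"
    by (rule unit_integrable_bound[OF _ lni[of 2]]) (use b in auto)
  have i3: "unit_integrable (\<lambda>x. x powr (- 1) * sin (\<omega> * x))" "unit_integrable (\<lambda>x. x powr 0 * sin (\<omega> * x))"
    by (rule sin_powr_integrable; simp)+
  let ?f = "\<lambda>x. \<omega> * ((1 - x) * ln x * cos (\<omega> * x)) + (x powr (- 1) * sin (\<omega> * x) - (x powr 0 * sin (\<omega> * x) + ln x * sin (\<omega> * x)))"
  have "unit_integral ?f = 0 - 0"
  proof (rule unit_integral_FTC[where F = "\<lambda>x. (1 - x) * ln x * sin (\<omega> * x)"])
    fix x :: real assume x: "x \<in> {0<..<1}"
    show "((\<lambda>x. (1 - x) * ln x * sin (\<omega> * x)) has_real_derivative ?f x) (at x)"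
    proof -
      have "((\<lambda>x. (1 - x) * ln x * sin (\<omega> * x)) has_real_derivative
        ((0 - 1) * ln x + 1 / x * (1 - x)) * sin (\<omega> * x) + cos (\<omega> * x) * \<omega> * ((1 - x) * ln x)) (at x)"
        using x by (auto intro!: derivative_eq_intros)
      moreover have "((0 - 1) * L + 1 / x * (1 - x)) * s + c * \<omega> * ((1 - x) * L)
        = \<omega> * ((1 - x) * L * c) + (1 / x * s - (1 * s + L * s))" for L s c :: real
        using x by (simp add: field_simps)
      moreover have "x powr (- 1) = 1 / x" "x powr 0 = 1" using x by (simp_all add: powr_minus_divide)
      ultimately show ?thesis by (simp only:)
    qed
    show "isCont ?f x" using x by (intro continuous_intros) auto
  next
    show "unit_integrable ?f"
      by (intro unit_integrable_add unit_integrable_diff unit_integrable_cmult i1 i2 i3)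
    show "((\<lambda>x. (1 - x) * ln x * sin (\<omega> * x)) \<longlongrightarrow> 0) (at_right 0)"
      using omega_pos by real_asymp
    show "((\<lambda>x. (1 - x) * ln x * sin (\<omega> * x)) \<longlongrightarrow> 0) (at_left 1)"
      by (auto intro!: tendsto_eq_intros)
  qed
  moreover have "unit_integral ?f = \<omega> * unit_integral ?k
      + (sin_powr (- 1) - (sin_powr 0 + unit_integral (\<lambda>x. ln x * sin (\<omega> * x))))"
    unfolding sin_powr_def
    by (simp only: unit_integral_add unit_integral_diff unit_integral_cmult unit_integrable_add unit_integrable_diff unit_integrable_cmult i1 i2 i3)
  moreover have "unit_integral (\<lambda>x. ln x * sin (\<omega> * x)) < 0"
  proof -
    let ?g = "\<lambda>x. x powr (- 1) * (1 - cos (\<omega> * x)) + \<omega> * (ln x * sin (\<omega> * x))"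
    have "unit_integral ?g = 0 - 0"
    proof (rule unit_integral_FTC[where F = "\<lambda>x. ln x * (1 - cos (\<omega> * x))"])
      fix x :: real assume x: "x \<in> {0<..<1}"
      show "((\<lambda>x. ln x * (1 - cos (\<omega> * x))) has_real_derivative ?g x) (at x)"
      proof -
        have "x powr (- 1) = 1 / x" using x by (simp add: powr_minus_divide)
        then show ?thesis using x by (auto intro!: derivative_eq_intros)
      qed
      show "isCont ?g x" using x by (intro continuous_intros) auto
    next
      show "unit_integrable ?g"
        by (intro unit_integrable_add unit_integrable_cmult i2 one_minus_cos_powr) auto
      show "((\<lambda>x. ln x * (1 - cos (\<omega> * x))) \<longlongrightarrow> 0) (at_right 0)"
        using omega_pos by real_asymp
      show "((\<lambda>x. ln x * (1 - cos (\<omega> * x))) \<longlongrightarrow> 0) (at_left 1)"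
        by (auto intro!: tendsto_eq_intros)
    qed
    moreover have "unit_integral ?g = unit_integral (\<lambda>x. x powr (- 1) * (1 - cos (\<omega> * x))) + \<omega> * unit_integral (\<lambda>x. ln x * sin (\<omega> * x))"
    proof (subst unit_integral_add)
      show "unit_integrable (\<lambda>x. x powr (- 1) * (1 - cos (\<omega> * x)))" by (rule one_minus_cos_powr) simp
    qed (simp_all only: unit_integral_cmult unit_integrable_cmult i2)
    ultimately have "\<omega> * unit_integral (\<lambda>x. ln x * sin (\<omega> * x)) < 0"
      using one_minus_cos_powr(2)[of "- 1"] by linarith
    then show ?thesis using omega_pos by (simp add: mult_less_0_iff)
  qed
  ultimately have "\<omega> * unit_integral ?k < 0"
    using sin_powr_sign(1)[of "- 1"] sin_powr_sign(3) by linarith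
  then show "unit_integral ?k < 0"
    using omega_pos by (simp add: mult_less_0_iff)
qed

end

section \<open>Positivity of the entries of D(d)\<close>

lemma square_integral_cmult: "square_integral (\<lambda>x y. c * f x y) = c * square_integral f"
  unfolding square_integral_def set_lebesgue_integral_def real_scaleR_def
  by (simp only: mult.left_commute[of "indicator _ _"] integral_mult_right_zero)

lemma square_integral_cong:
  "(\<And>x y. x \<in> {0..1} \<Longrightarrow> y \<in> {0..1} \<Longrightarrow> f x y = f' x y) \<Longrightarrow> square_integral f = square_integral f'"
  unfolding square_integral_def set_lebesgue_integral_def
  by (intro Bochner_Integration.integral_cong refl) (auto simp: indicator_def)

text \<open>A class of kernels integrable on the square by \<open>integrable_log_square\<close>.
  Within it \<open>square_integral\<close> is additive, since the default value of a divergent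
  integral cannot occur.\<close>

definition log_bounded_kernel :: "(real \<Rightarrow> real \<Rightarrow> real) \<Rightarrow> bool" where
  "log_bounded_kernel f \<longleftrightarrow> (\<lambda>z. f (fst z) (snd z)) \<in> borel_measurable (borel \<Otimes>\<^sub>M borel) \<and>
     (\<exists>K. \<forall>x\<in>{0..1}. \<forall>y\<in>{0..1}. \<bar>f x y\<bar> \<le> K * (1 + \<bar>ln \<bar>x - y\<bar>\<bar>))"

lemma square_integral_add:
  assumes "log_bounded_kernel f" "log_bounded_kernel f'"
  shows "square_integral (\<lambda>x y. f x y + f' x y) = square_integral f + square_integral f'"
proof -
  have "integrable lborel (\<lambda>z. square_ind z * h (fst z) (snd z))" if h: "log_bounded_kernel h" for h
  proof -
    obtain K where K: "\<And>x y. x \<in> {0..1} \<Longrightarrow> y \<in> {0..1} \<Longrightarrow> \<bar>h x y\<bar> \<le> K * (1 + \<bar>ln \<bar>x - y\<bar>\<bar>)"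
      and [measurable]: "(\<lambda>z. h (fst z) (snd z)) \<in> borel_measurable borel"
      using h unfolding log_bounded_kernel_def borel_prod by blast
    have [measurable]: "{0..1} \<times> {0..1} \<in> sets (borel :: (real \<times> real) measure)" by (simp add: borel_closed closed_Times)
    show ?thesis
    proof (rule Bochner_Integration.integrable_bound[OF integrable_log_square[of K]])
      show "AE z in lborel. norm (square_ind z * h (fst z) (snd z)) \<le> norm (square_ind z * (K * (1 + \<bar>ln \<bar>fst z - snd z\<bar>\<bar>)))"
        using K by (intro AE_I2) (auto simp: indicator_def intro: order_trans[OF _ abs_ge_self])
    qed measurable
  qed
  from this[OF assms(1)] this[OF assms(2)] show ?thesis
    by (simp add: square_integral_def set_lebesgue_integral_def distrib_left)
qed

lemma log_bounded_trig_kernel: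
  assumes k: "(\<lambda>z. k (fst z) (snd z)) \<in> borel_measurable (borel \<Otimes>\<^sub>M borel)"
    and b: "\<And>x y. x \<in> {0..1} \<Longrightarrow> y \<in> {0..1} \<Longrightarrow> \<bar>k x y\<bar> \<le> 1 + \<bar>ln \<bar>x - y\<bar>\<bar>"
  shows "log_bounded_kernel (\<lambda>x y. trig c i x * trig c' j y * k x y)"
  unfolding log_bounded_kernel_def
proof (intro conjI exI[of _ 1] ballI)
  show "(\<lambda>z. trig c i (fst z) * trig c' j (snd z) * k (fst z) (snd z)) \<in> borel_measurable (borel \<Otimes>\<^sub>M borel)"
    using k by measurable
  fix x y :: real assume xy: "x \<in> {0..1}" "y \<in> {0..1}"
  have "\<bar>trig c i x * trig c' j y * k x y\<bar> \<le> 1 * 1 * (1 + \<bar>ln \<bar>x - y\<bar>\<bar>)"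
    unfolding abs_mult by (intro mult_mono abs_trig_le b xy) auto
  then show "\<bar>trig c i x * trig c' j y * k x y\<bar> \<le> 1 * (1 + \<bar>ln \<bar>x - y\<bar>\<bar>)" by simp
qed

lemma powr_kernel_bound:
  fixes x y \<alpha> :: real
  assumes "\<alpha> \<ge> 0" "x \<in> {0..1}" "y \<in> {0..1}"
  shows "\<bar>\<bar>x - y\<bar> powr \<alpha>\<bar> \<le> 1 + \<bar>ln \<bar>x - y\<bar>\<bar>"
proof -
  have "\<bar>x - y\<bar> powr \<alpha> \<le> 1" using powr_mono2[of \<alpha> "\<bar>x - y\<bar>" 1] assms by (simp add: abs_le_iff)
  moreover have "\<bar>x - y\<bar> powr \<alpha> \<ge> 0" by simp
  ultimately show ?thesis using abs_ge_zero[of "ln \<bar>x - y\<bar>"] by (simp only: abs_of_nonneg)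
qed

text \<open>Both signs of v = x - y contribute equally, hence the factor 2 and the integral over
  (0,1) with weight 1 - v.\<close>

lemma square_integral_even_kernel:
  fixes k :: "real \<Rightarrow> real"
  assumes [measurable]: "k \<in> borel_measurable borel" and i: "unit_integrable (\<lambda>v. k v * cos (\<omega> * v))"
  shows "square_integral (\<lambda>x y. cos (\<omega> * (x - y)) * k \<bar>x - y\<bar>) = 2 * unit_integral (\<lambda>v. (1 - v) * k v * cos (\<omega> * v))"
proof -
  let ?f = "\<lambda>v. k v * cos (\<omega> * v)"
  let ?h = "\<lambda>v. indicator {-1..1} v * ?f \<bar>v\<bar>"
  have h: "integrable lborel ?h"
    using i by (intro integrable_even_extension) (auto simp: unit_integrable_def)
  have cos_abs: "cos (\<omega> * \<bar>v\<bar>) = cos (\<omega> * v)" for v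
    using cos_minus[of "\<omega> * v"] by (simp add: abs_if)
  have "square_integral (\<lambda>x y. cos (\<omega> * (x - y)) * k \<bar>x - y\<bar>) = square_integral (\<lambda>x y. ?h (x - y))"
    by (intro square_integral_cong) (auto simp: indicator_def cos_abs)
  also have "\<dots> = (\<integral>v. ?h v * max 0 (1 - \<bar>v\<bar>) \<partial>lborel)" by (rule square_integral_convolution(2)[OF h])
  also have "\<dots> = (\<integral>v. indicator {0<..<1} v * ((1 - v) * ?f v) + indicator {0<..<1} (- v) * ((1 - (- v)) * ?f (- v)) \<partial>lborel)"
  proof (rule integral_cong_AE)
    show "AE v in lborel. ?h v * max 0 (1 - \<bar>v\<bar>) = indicator {0<..<1} v * ((1 - v) * ?f v) + indicator {0<..<1} (- v) * ((1 - (- v)) * ?f (- v))"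
      using AE_lborel_singleton[of 0] AE_lborel_singleton[of 1] AE_lborel_singleton[of "- 1"]
      by eventually_elim (auto simp: indicator_def abs_if)
  qed measurable
  also have "\<dots> = unit_integral (\<lambda>v. (1 - v) * ?f v) + unit_integral (\<lambda>v. (1 - v) * ?f v)"
  proof -
    have i2: "integrable lborel (\<lambda>v. indicator {0<..<1} v * ((1 - v) * ?f v))"
    proof (rule Bochner_Integration.integrable_bound)
      show "integrable lborel (\<lambda>v. indicator {0<..<1} v * ?f v)" using i by (simp add: unit_integrable_def)
      show "AE v in lborel. norm (indicator {0<..<1} v * ((1 - v) * ?f v)) \<le> norm (indicator {0<..<1} v * ?f v)"
        by (intro AE_I2) (auto simp: indicator_def abs_mult intro!: mult_left_le_one_le mult_nonneg_nonneg)
    qed measurable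
    have e: "(\<integral>v. indicator {0<..<1} (- v) * ((1 - (- v)) * ?f (- v)) \<partial>lborel) = unit_integral (\<lambda>v. (1 - v) * ?f v)"
      unfolding unit_integral_def
      using lborel_integral_real_affine[of "- 1" "\<lambda>v. indicator {0<..<1} v * ((1 - v) * ?f v)" 0] by simp
    have i3: "integrable lborel (\<lambda>v. indicator {0<..<1} (- v) * ((1 - (- v)) * ?f (- v)))"
      using lborel_integrable_real_affine[OF i2, of "- 1" 0] by simp
    show ?thesis
      by (subst Bochner_Integration.integral_add[OF i2 i3], subst e) (simp add: unit_integral_def)
  qed
  finally show ?thesis by (simp add: mult.assoc)
qed

lemma trig_combination:
  "trig True j x * trig True j y * k + trig False j x * trig False j y * k = cos (2 * pi * real j * (x - y)) * k"
  by (simp add: trig_def right_diff_distrib cos_diff distrib_right)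

text \<open>cos cos + sin sin is the cosine of the difference, so the two double integrals in D_jj
  combine to one of an even function of x - y and collapse to an integral over (0,1).\<close>

lemma square_integral_trig_pair:
  fixes k :: "real \<Rightarrow> real"
  assumes [measurable]: "k \<in> borel_measurable borel" and i: "unit_integrable (\<lambda>v. k v * cos (2 * pi * real j * v))"
    and b: "\<And>x y. x \<in> {0..1} \<Longrightarrow> y \<in> {0..1} \<Longrightarrow> \<bar>k \<bar>x - y\<bar>\<bar> \<le> 1 + \<bar>ln \<bar>x - y\<bar>\<bar>"
  shows "square_integral (\<lambda>x y. trig True j x * trig True j y * k \<bar>x - y\<bar>)
     + square_integral (\<lambda>x y. trig False j x * trig False j y * k \<bar>x - y\<bar>)
     = 2 * unit_integral (\<lambda>v. (1 - v) * k v * cos (2 * pi * real j * v))"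
proof -
  have "square_integral (\<lambda>x y. trig True j x * trig True j y * k \<bar>x - y\<bar>)
     + square_integral (\<lambda>x y. trig False j x * trig False j y * k \<bar>x - y\<bar>)
     = square_integral (\<lambda>x y. trig True j x * trig True j y * k \<bar>x - y\<bar> + trig False j x * trig False j y * k \<bar>x - y\<bar>)"
    by (rule square_integral_add[symmetric]) (intro log_bounded_trig_kernel b; measurable)+
  also have "\<dots> = square_integral (\<lambda>x y. cos (2 * pi * real j * (x - y)) * k \<bar>x - y\<bar>)"
    by (simp only: trig_combination)
  also have "\<dots> = 2 * unit_integral (\<lambda>v. (1 - v) * k v * cos (2 * pi * real j * v))"
    by (rule square_integral_even_kernel[OF assms(1) i])
  finally show ?thesis .
qed

lemma cos_powr_unit_integral:
  assumes "j \<ge> 1" "\<alpha> > 0"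
  shows "unit_integral (\<lambda>v. (1 - v) * v powr \<alpha> * cos (2 * pi * real j * v))
    = cos_powr (2 * pi * real j) \<alpha> - cos_powr (2 * pi * real j) (\<alpha> + 1)"
proof -
  note J = assms(1) refl[of "2 * pi * real j"]
  have "unit_integral (\<lambda>v. (1 - v) * v powr \<alpha> * cos (2 * pi * real j * v))
    = unit_integral (\<lambda>v. v powr \<alpha> * cos (2 * pi * real j * v) - v powr (\<alpha> + 1) * cos (2 * pi * real j * v))"
    by (rule unit_integral_cong) (simp add: powr_add algebra_simps)
  also have "\<dots> = cos_powr (2 * pi * real j) \<alpha> - cos_powr (2 * pi * real j) (\<alpha> + 1)"
    using assms unfolding cos_powr_def[OF J]
    by (intro unit_integral_diff cos_powr_integrable[OF J]) auto
  finally show ?thesis .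
qed

text \<open>It is the sum of cosine and sine entry that reduces to one-dimensional integrals; each
  regime of d then ends in one of the three sign lemmas. The result makes D(d) invertible and gives
  the averaged block periodograms a positive limit.\<close>

lemma Sigma_pos:
  assumes d: "- 1/2 < d" "d < 3/2" and \<delta>: "\<delta> > 0" and j: "j \<ge> 1"
  shows "Sigma_c d \<delta> j j + Sigma_s d \<delta> j j > 0"
proof -
  let ?w = "2 * pi * real j"
  note J = j refl[of ?w]
  have T: "trig True j = (\<lambda>x. cos (?w * x))" "trig False j = (\<lambda>x. sin (?w * x))"
    by (simp_all add: trig_def fun_eq_iff)
  have pw: "square_integral (\<lambda>x y. trig True j x * trig True j y * \<bar>x - y\<bar> powr \<alpha>)
     + square_integral (\<lambda>x y. trig False j x * trig False j y * \<bar>x - y\<bar> powr \<alpha>)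
     = 2 * (cos_powr ?w \<alpha> - cos_powr ?w (\<alpha> + 1))" if "\<alpha> > 0" for \<alpha>
    using square_integral_trig_pair[of "\<lambda>v. v powr \<alpha>" j] cos_powr_integrable[OF J, of \<alpha>] that
      powr_kernel_bound[of \<alpha>] cos_powr_unit_integral[OF j that] by simp
  consider "d < 1/2" | "d = 1/2" | "d > 1/2" by linarith
  then show ?thesis
  proof cases
    case 3
    have "Sigma_c d \<delta> j j + Sigma_s d \<delta> j j = - \<delta> / 2 * (square_integral (\<lambda>x y. trig True j x * trig True j y * \<bar>x - y\<bar> powr (2 * d - 1))
     + square_integral (\<lambda>x y. trig False j x * trig False j y * \<bar>x - y\<bar> powr (2 * d - 1)))"
      using 3 unfolding Sigma_c_def Sigma_s_def T by (simp add: distrib_left)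
    also have "\<dots> = - \<delta> * (cos_powr ?w (2 * d - 1) - cos_powr ?w (2 * d - 1 + 1))"
      using pw[of "2 * d - 1"] 3 by simp
    also have "\<dots> > 0" using cos_powr_diff_neg[OF J, of "2 * d - 1"] 3 d \<delta> by (intro mult_neg_neg) auto
    finally show ?thesis .
  next
    case 2
    have "Sigma_c d \<delta> j j + Sigma_s d \<delta> j j = \<delta> / 2 * (square_integral (\<lambda>x y. trig True j x * trig True j y * (- ln \<bar>x - y\<bar>))
     + square_integral (\<lambda>x y. trig False j x * trig False j y * (- ln \<bar>x - y\<bar>)))"
      using 2 unfolding Sigma_c_def Sigma_s_def T by (simp add: distrib_left)
    also have "square_integral (\<lambda>x y. trig True j x * trig True j y * (- ln \<bar>x - y\<bar>))
     + square_integral (\<lambda>x y. trig False j x * trig False j y * (- ln \<bar>x - y\<bar>))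
      = 2 * unit_integral (\<lambda>v. (1 - v) * (- ln v) * cos (?w * v))"
    proof (rule square_integral_trig_pair)
      show "unit_integrable (\<lambda>v. - ln v * cos (?w * v))"
      proof (rule unit_integrable_bound[OF _ unit_integrable_cmult[OF unit_integrable_powr[of "- 1/2"], of 2]])
        fix x :: real assume x: "x \<in> {0<..<1}"
        have "\<bar>ln x\<bar> * \<bar>cos (?w * x)\<bar> \<le> (2 * x powr (- 1/2)) * 1" using abs_ln_le[of x] x by (intro mult_mono) auto
        then show "\<bar>- ln x * cos (?w * x)\<bar> \<le> 2 * x powr (- 1/2)" by (simp only: abs_mult abs_minus_cancel mult_1_right)
      qed auto
    qed auto
    also have "unit_integral (\<lambda>v. (1 - v) * (- ln v) * cos (?w * v)) = - 1 * unit_integral (\<lambda>v. (1 - v) * ln v * cos (?w * v))"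
      by (subst unit_integral_cmult[symmetric]) simp
    also have "\<delta> / 2 * (2 * (- 1 * unit_integral (\<lambda>v. (1 - v) * ln v * cos (?w * v)))) > 0"
      using log_cos_integral_neg(2)[OF J] \<delta> by (simp add: mult_pos_neg)
    finally show ?thesis .
  next
    case 1
    have b: "boundary_coeff d j j = 1 - 2 * (2 * d + 1) * cos_powr ?w (2 * d)"
    proof -
      have "(LINT x : {0..1} | lborel. x powr (2 * d) * (cos (2 * pi * j * x) + cos (2 * pi * j * x)))
        = unit_integral (\<lambda>x. 2 * (x powr (2 * d) * cos (?w * x)))"
        by (subst LINT_unit) (auto intro!: unit_integral_cong)
      then show ?thesis by (simp add: boundary_coeff_def unit_integral_cmult cos_powr_def[OF J])
    qed
    have "Sigma_c d \<delta> j j + Sigma_s d \<delta> j j = - \<delta> * (boundary_coeff d j j + 2 * pi\<^sup>2 * j * j *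
       (square_integral (\<lambda>x y. trig True j x * trig True j y * \<bar>x - y\<bar> powr (2 * d + 1))
     + square_integral (\<lambda>x y. trig False j x * trig False j y * \<bar>x - y\<bar> powr (2 * d + 1))))"
      using 1 unfolding Sigma_c_def Sigma_s_def T by (simp add: algebra_simps)
    also have "\<dots> = \<delta> * (- 1 + 2 * (2 * d + 1) * cos_powr ?w (2 * d + 1 - 1)
      - ?w\<^sup>2 * (cos_powr ?w (2 * d + 1) - cos_powr ?w (2 * d + 1 + 1)))"
    proof -
      have p: "square_integral (\<lambda>x y. trig True j x * trig True j y * \<bar>x - y\<bar> powr (2 * d + 1))
         + square_integral (\<lambda>x y. trig False j x * trig False j y * \<bar>x - y\<bar> powr (2 * d + 1))
         = 2 * (cos_powr ?w (2 * d + 1) - cos_powr ?w (2 * d + 1 + 1))" using pw[of "2 * d + 1"] d by simp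
      have d': "cos_powr ?w (2 * d + 1 - 1) = cos_powr ?w (2 * d)" by simp
      have w2: "?w\<^sup>2 = 4 * pi\<^sup>2 * j * j" by (simp add: power2_eq_square)
      show ?thesis unfolding b p d' w2 by (simp add: algebra_simps)
    qed
    also have "\<dots> > 0"
      using boundary_combination_pos[OF J, of "2 * d + 1"] 1 d \<delta> by (intro mult_pos_pos) auto
    finally show ?thesis .
  qed
qed

section \<open>Identification of the limits with the entries of the matrix\<close>

lemma square_integral_trig_mixed:
  assumes [measurable]: "k \<in> borel_measurable borel" and c: "c \<noteq> c'"
    and f: "\<And>x. f (1 - x) = (if c then f x else - f x)" "\<And>x. f' (1 - x) = (if c' then f' x else - f' x)"
    and [measurable]: "f \<in> borel_measurable borel" "f' \<in> borel_measurable borel"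
  shows "square_integral (\<lambda>x y. f x * f' y * k \<bar>x - y\<bar>) = 0"
proof -
  have "square_integral (\<lambda>x y. f x * f' y * k \<bar>x - y\<bar>) = square_integral (\<lambda>x y. f (1 - x) * f' (1 - y) * k \<bar>(1 - x) - (1 - y)\<bar>)"
    by (rule square_integral_reflect[symmetric]) (unfold borel_prod[symmetric], measurable)
  \<comment> \<open>Exactly one of the two factors is odd under the reflection, so the integral
    equals its own negative. This is why cosine and sine blocks of the matrix do not mix.\<close>
  also have "\<dots> = square_integral (\<lambda>x y. (- 1) * (f x * f' y * k \<bar>x - y\<bar>))"
    using c by (intro square_integral_cong) (auto simp: f abs_minus_commute)
  also have "\<dots> = - square_integral (\<lambda>x y. f x * f' y * k \<bar>x - y\<bar>)"
    by (subst square_integral_cmult) simp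
  finally show ?thesis by simp
qed

definition Sigma_entry :: "real \<Rightarrow> real \<Rightarrow> bool \<Rightarrow> bool \<Rightarrow> nat \<Rightarrow> nat \<Rightarrow> real" where
  "Sigma_entry d \<delta> c c' i j = (if c \<noteq> c' then 0 else if c then Sigma_c d \<delta> i j else Sigma_s d \<delta> i j)"

lemma Sigma_entry_tail:
  assumes d: "1/2 \<le> d" and \<delta>: "\<delta> = (if d = 1/2 then g else g / (2 * d - 1))"
  shows "- 1/2 * square_integral (\<lambda>x y. trig c i x * trig c' j y * limit_kernel (2 * d - 1) g x y) = Sigma_entry d \<delta> c c' i j"
proof -
  define k where "k v = (if d = 1/2 then - ln v else v powr (2 * d - 1))" for v :: real
  define e where "e = (if d = 1/2 then - \<delta> else \<delta>)"
  have [measurable]: "k \<in> borel_measurable borel" unfolding k_def by measurable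
  have "limit_kernel (2 * d - 1) g x y = e * k \<bar>x - y\<bar>" for x y
    by (simp add: limit_kernel_def k_def e_def \<delta>)
  then have "square_integral (\<lambda>x y. trig c i x * trig c' j y * limit_kernel (2 * d - 1) g x y)
     = square_integral (\<lambda>x y. e * (trig c i x * trig c' j y * k \<bar>x - y\<bar>))" by (simp add: mult_ac)
  then have eq: "square_integral (\<lambda>x y. trig c i x * trig c' j y * limit_kernel (2 * d - 1) g x y)
     = e * square_integral (\<lambda>x y. trig c i x * trig c' j y * k \<bar>x - y\<bar>)" by (simp only: square_integral_cmult)
  show ?thesis
  proof (cases "c = c'")
    case False
    then have "square_integral (\<lambda>x y. trig c i x * trig c' j y * k \<bar>x - y\<bar>) = 0"
      by (rule square_integral_trig_mixed[rotated]) (auto simp: trig_reflect)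
    then show ?thesis unfolding eq using False by (simp add: Sigma_entry_def)
  next
    case True
    then show ?thesis unfolding eq using d
      by (cases c; cases "d = 1/2") (auto simp: Sigma_entry_def Sigma_c_def Sigma_s_def e_def k_def trig_def)
  qed
qed

text \<open>The origin of \<open>boundary_coeff\<close>: by reflection the two end points contribute
  opposite single integrals for the cosine, and equal ones, which cancel, for the sine. By parts the
  cosine integral is 1 - \<alpha> times a cosine transform of x^(2 d), and two of these together
  with the end-point term g / \<alpha> = \<delta> sum to a_ij(d).\<close>

lemma Sigma_entry_plain:
  assumes d: "- 1/2 < d" "d < 1/2" and \<delta>: "\<delta> = g / (2 * d + 1)" and ij: "i \<ge> 1" "j \<ge> 1"
  shows "- 1/2 * (square_integral (\<lambda>x y. dtrig c i x * dtrig c' j y * limit_kernel (2 * d + 1) g x y)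
      - trig c' j 0 * (LINT x : {0..1} | lborel. dtrig c i x * (limit_kernel (2 * d + 1) g x 1 - limit_kernel (2 * d + 1) g x 0))
      - trig c i 0 * (LINT x : {0..1} | lborel. dtrig c' j x * (limit_kernel (2 * d + 1) g x 1 - limit_kernel (2 * d + 1) g x 0))
      - 2 * trig c i 0 * trig c' j 0 * (g / (2 * d + 1))) = Sigma_entry d \<delta> c c' i j"
proof -
  define \<alpha> where "\<alpha> = 2 * d + 1"
  have \<alpha>: "\<alpha> > 0" using d by (simp add: \<alpha>_def)
  have lk: "limit_kernel \<alpha> g x y = \<delta> * \<bar>x - y\<bar> powr \<alpha>" for x y
    using \<alpha> by (simp add: limit_kernel_def \<delta> \<alpha>_def)
  have dr: "dtrig c p (1 - x) = (if \<not> c then dtrig c p x else - dtrig c p x)" for c p x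
    using trig_reflect[of True p x] trig_reflect[of False p x] by (simp add: dtrig_def trig_def)
  let ?E = "\<lambda>c p. (LINT x : {0..1} | lborel. dtrig c p x * (limit_kernel \<alpha> g x 1 - limit_kernel \<alpha> g x 0))"
  have di: "unit_integrable (\<lambda>x. dtrig c p x * x powr \<alpha>)" "unit_integrable (\<lambda>x. dtrig c p x * (1 - x) powr \<alpha>)" for c p
  proof -
    have b: "\<bar>dtrig c p x * y\<bar> \<le> 2 * pi * real p * x powr 0" if "\<bar>y\<bar> \<le> 1" "x \<in> {0<..<1}" for x y
    proof -
      have "\<bar>dtrig c p x\<bar> * \<bar>y\<bar> \<le> (2 * pi * real p) * 1" using that by (intro mult_mono abs_dtrig_le) auto
      then show ?thesis using that by (simp add: abs_mult)
    qed
    note ui = unit_integrable_cmult[OF unit_integrable_powr[of 0], of "2 * pi * real p"]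
    show "unit_integrable (\<lambda>x. dtrig c p x * x powr \<alpha>)"
      by (rule unit_integrable_bound[OF _ ui]) (use b \<alpha> in \<open>auto simp: powr_le1\<close>)
    show "unit_integrable (\<lambda>x. dtrig c p x * (1 - x) powr \<alpha>)"
      by (rule unit_integrable_bound[OF _ ui]) (use b \<alpha> in \<open>auto simp: powr_le1\<close>)
  qed
  have refl_int: "unit_integral (\<lambda>x. f (1 - x)) = unit_integral f" for f :: "real \<Rightarrow> real"
  proof -
    have "unit_integral f = (\<integral>x. indicator {0<..<1} (1 + (- 1) * x) * f (1 + (- 1) * x) \<partial>lborel)"
      unfolding unit_integral_def using lborel_integral_real_affine[of "- 1" "\<lambda>x. indicator {0<..<1} x * f x" 1] by simp
    also have "\<dots> = unit_integral (\<lambda>x. f (1 - x))"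
      unfolding unit_integral_def by (intro Bochner_Integration.integral_cong refl) (auto simp: indicator_def)
    finally show ?thesis by simp
  qed
  have E: "?E c p = \<delta> * ((if c then - 2 else 0) * unit_integral (\<lambda>x. dtrig c p x * x powr \<alpha>))" for c p
  proof -
    have "?E c p = unit_integral (\<lambda>x. \<delta> * (dtrig c p x * (1 - x) powr \<alpha> - dtrig c p x * x powr \<alpha>))"
      by (subst LINT_unit) (auto intro!: unit_integral_cong simp: lk algebra_simps abs_minus_commute)
    also have "\<dots> = \<delta> * (unit_integral (\<lambda>x. dtrig c p x * (1 - x) powr \<alpha>) - unit_integral (\<lambda>x. dtrig c p x * x powr \<alpha>))"
      by (simp add: unit_integral_cmult unit_integral_diff di)
    also have "unit_integral (\<lambda>x. dtrig c p x * (1 - x) powr \<alpha>) = unit_integral (\<lambda>x. dtrig c p (1 - x) * x powr \<alpha>)"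
      by (subst refl_int[symmetric]) simp
    also have "\<dots> = (if c then - 1 else 1) * unit_integral (\<lambda>x. dtrig c p x * x powr \<alpha>)"
      by (subst unit_integral_cmult[symmetric]) (simp add: dr)
    finally show ?thesis by simp
  qed
  have S: "unit_integral (\<lambda>x. dtrig True p x * x powr \<alpha>) = 1 - \<alpha> * cos_powr (2 * pi * real p) (2 * d)" if "p \<ge> 1" for p
  proof -
    note J = that refl[of "2 * pi * real p"]
    have "unit_integral (\<lambda>x. dtrig True p x * x powr \<alpha>) = unit_integral (\<lambda>x. - (2 * pi * real p) * (x powr \<alpha> * sin (2 * pi * real p * x)))"
      by (rule unit_integral_cong) (simp add: dtrig_def)
    also have "\<dots> = - (2 * pi * real p * sin_powr (2 * pi * real p) \<alpha>)"
      by (simp only: unit_integral_cmult sin_powr_def[OF J]) simp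
    also have "\<dots> = 1 - \<alpha> * cos_powr (2 * pi * real p) (2 * d)"
      using sin_powr_eq_cos[OF J \<alpha>] by (simp add: \<alpha>_def)
    finally show ?thesis .
  qed
  have D: "square_integral (\<lambda>x y. dtrig c i x * dtrig c' j y * limit_kernel \<alpha> g x y)
     = \<delta> * square_integral (\<lambda>x y. dtrig c i x * dtrig c' j y * \<bar>x - y\<bar> powr \<alpha>)"
    unfolding lk by (subst square_integral_cmult[symmetric]) (simp add: mult_ac)
  have D2: "square_integral (\<lambda>x y. dtrig c i x * dtrig c j y * \<bar>x - y\<bar> powr \<alpha>)
     = 4 * pi\<^sup>2 * i * j * square_integral (\<lambda>x y. trig (\<not> c) i x * trig (\<not> c) j y * \<bar>x - y\<bar> powr \<alpha>)" for c
    by (subst square_integral_cmult[symmetric], rule square_integral_cong)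
       (cases c, auto simp: dtrig_def trig_def power2_eq_square)
  have t0: "trig c p 0 = (if c then 1 else 0)" for c p by (simp add: trig_def)
  show ?thesis unfolding \<alpha>_def[symmetric]
  proof (cases "c = c'")
    case False
    have "square_integral (\<lambda>x y. dtrig c i x * dtrig c' j y * \<bar>x - y\<bar> powr \<alpha>) = 0"
      by (rule square_integral_trig_mixed[where c = "\<not> c" and c' = "\<not> c'" and k = "\<lambda>v. v powr \<alpha>"])
         (use False dr in auto)
    then show "- 1/2 * (square_integral (\<lambda>x y. dtrig c i x * dtrig c' j y * limit_kernel \<alpha> g x y)
      - trig c' j 0 * ?E c i - trig c i 0 * ?E c' j - 2 * trig c i 0 * trig c' j 0 * (g / \<alpha>)) = Sigma_entry d \<delta> c c' i j"
      unfolding D E t0 using False by (auto simp: Sigma_entry_def)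
  next
    case True
    show "- 1/2 * (square_integral (\<lambda>x y. dtrig c i x * dtrig c' j y * limit_kernel \<alpha> g x y)
      - trig c' j 0 * ?E c i - trig c i 0 * ?E c' j - 2 * trig c i 0 * trig c' j 0 * (g / \<alpha>)) = Sigma_entry d \<delta> c c' i j"
    proof (cases c)
      case False
      then show ?thesis unfolding D E t0 using True D2[of False] d
        by (simp add: Sigma_entry_def Sigma_s_def trig_def \<alpha>_def)
    next
      case ct: True
      have b: "boundary_coeff d i j = 1 - \<alpha> * (cos_powr (2 * pi * real i) (2 * d) + cos_powr (2 * pi * real j) (2 * d))"
      proof -
        have ci: "unit_integrable (\<lambda>x. x powr (2 * d) * cos (2 * pi * real p * x))" for p
          by (rule unit_integrable_bound[OF _ unit_integrable_powr[of "2 * d"]])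
             (use d in \<open>auto simp: abs_mult intro!: mult_left_le\<close>)
        have "(LINT x : {0..1} | lborel. x powr (2 * d) * (cos (2 * pi * i * x) + cos (2 * pi * j * x)))
          = unit_integral (\<lambda>x. x powr (2 * d) * cos (2 * pi * real i * x) + x powr (2 * d) * cos (2 * pi * real j * x))"
          by (subst LINT_unit) (auto intro!: unit_integral_cong simp: algebra_simps)
        also have "\<dots> = cos_powr (2 * pi * real i) (2 * d) + cos_powr (2 * pi * real j) (2 * d)"
          by (simp add: unit_integral_add ci cos_powr_def[OF ij(1) refl] cos_powr_def[OF ij(2) refl])
        finally show ?thesis by (simp add: boundary_coeff_def \<alpha>_def)
      qed
      have ga: "g / \<alpha> = \<delta>" by (simp add: \<delta> \<alpha>_def)
      have sc: "Sigma_c d \<delta> i j = - \<delta> * (boundary_coeff d i j + 2 * pi\<^sup>2 * i * j *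
          square_integral (\<lambda>x y. trig False i x * trig False j y * \<bar>x - y\<bar> powr \<alpha>))"
        using d by (simp add: Sigma_c_def trig_def \<alpha>_def)
      have tt: "c = True" "c' = True" using True ct by auto
      show ?thesis unfolding D E t0 ga unfolding tt if_True D2 not_True_eq_False
        unfolding S[OF ij(1)] S[OF ij(2)] by (simp add: Sigma_entry_def sc b S[OF ij(1)] S[OF ij(2)] algebra_simps)
    qed
  qed
qed

section \<open>The studentised statistic\<close>

text \<open>Random denominators are replaced by their limits. Where every D' is within relative
  distance \<rho> of D, the Lipschitz property of exp (- lam x) applies; elsewhere the two
  exponentials differ by at most 1, which is dominated by some |D' - D| / (\<rho> D), a pointwise
  Markov bound. This second bound ignores the ratio, so small denominators do no harm.\<close>

lemma (in prob_space) Laplace_ratio_sum_tendsto: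
  fixes V D' :: "nat \<Rightarrow> nat \<Rightarrow> 'a \<Rightarrow> real" and D :: "nat \<Rightarrow> real" and lam B :: real
  assumes [measurable]: "\<And>k j. j < s \<Longrightarrow> V k j \<in> borel_measurable M" "\<And>k j. j < s \<Longrightarrow> D' k j \<in> borel_measurable M"
    and V: "\<And>k j \<omega>. j < s \<Longrightarrow> V k j \<omega> \<ge> 0" "\<And>k j. j < s \<Longrightarrow> integrable M (V k j)"
      "\<And>k j. j < s \<Longrightarrow> expectation (V k j) \<le> B"
    and D': "\<And>k j \<omega>. j < s \<Longrightarrow> D' k j \<omega> \<ge> 0" "\<And>k j. j < s \<Longrightarrow> integrable M (\<lambda>\<omega>. \<bar>D' k j \<omega> - D j\<bar>)"
      "\<And>j. j < s \<Longrightarrow> (\<lambda>k. expectation (\<lambda>\<omega>. \<bar>D' k j \<omega> - D j\<bar>)) \<longlonglongrightarrow> 0"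
    and D: "\<And>j. j < s \<Longrightarrow> D j > 0" and lam: "lam \<ge> 0"
  shows "(\<lambda>k. expectation (\<lambda>\<omega>. exp (- lam * (\<Sum>j<s. V k j \<omega> / D' k j \<omega>)))
      - expectation (\<lambda>\<omega>. exp (- lam * (\<Sum>j<s. V k j \<omega> / D j)))) \<longlonglongrightarrow> 0"
proof -
  let ?R = "\<lambda>k \<omega>. \<Sum>j<s. V k j \<omega> / D' k j \<omega>" and ?Q = "\<lambda>k \<omega>. \<Sum>j<s. V k j \<omega> / D j"
  define A where "A = 2 * lam * (\<Sum>j<s. B / D j)"
  \<comment> \<open>A vanishing denominator gives the ratio 0, so nonnegativity holds for every
    outcome.\<close>
  have R0: "?R k \<omega> \<ge> 0" for k \<omega> using V D' by (intro sum_nonneg divide_nonneg_nonneg) auto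
  have Q0: "?Q k \<omega> \<ge> 0" for k \<omega> using V D by (intro sum_nonneg divide_nonneg_pos) auto
  have e1: "\<bar>exp (- lam * x) - exp (- lam * y)\<bar> \<le> lam * \<bar>x - y\<bar>" if "x \<ge> 0" "y \<ge> 0" for x y :: real
  proof -
    have *: "\<bar>exp (- u) - exp (- v)\<bar> \<le> \<bar>u - v\<bar>" if "u \<ge> 0" "u \<le> v" for u v :: real
    proof -
      have "exp (- v) = exp (- u) * exp (- (v - u))" by (simp add: exp_add[symmetric])
      then have "exp (- u) - exp (- v) = exp (- u) * (1 - exp (- (v - u)))" by (simp add: algebra_simps)
      also have "\<dots> \<le> 1 * (v - u)"
      proof (intro mult_mono)
        show "1 - exp (- (v - u)) \<le> v - u" using exp_ge_add_one_self[of "- (v - u)"] by linarith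
      qed (use that in auto)
      finally show ?thesis using that by simp
    qed
    have "\<bar>exp (- (lam * x)) - exp (- (lam * y))\<bar> \<le> \<bar>lam * x - lam * y\<bar>"
      using *[of "lam * x" "lam * y"] *[of "lam * y" "lam * x"] that lam
      by (cases "lam * x \<le> lam * y") (auto simp: abs_minus_commute)
    also have "\<dots> = lam * \<bar>x - y\<bar>" using lam by (simp add: right_diff_distrib[symmetric] abs_mult)
    finally show ?thesis by simp
  qed
  have pw: "\<bar>exp (- lam * ?R k \<omega>) - exp (- lam * ?Q k \<omega>)\<bar>
     \<le> 2 * lam * \<rho> * ?Q k \<omega> + (\<Sum>j<s. \<bar>D' k j \<omega> - D j\<bar> / (\<rho> * D j))" (is "?l \<le> ?b + ?c")
    if \<rho>: "0 < \<rho>" "\<rho> \<le> 1/2" for \<rho> k \<omega>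
  proof (cases "\<forall>j<s. \<bar>D' k j \<omega> - D j\<bar> \<le> \<rho> * D j")
    case True
    have "\<bar>?R k \<omega> - ?Q k \<omega>\<bar> \<le> (\<Sum>j<s. \<bar>V k j \<omega> / D' k j \<omega> - V k j \<omega> / D j\<bar>)"
      unfolding sum_subtractf[symmetric] by (rule sum_abs)
    also have "\<dots> \<le> (\<Sum>j<s. 2 * \<rho> * (V k j \<omega> / D j))"
    proof (rule sum_mono)
      fix j assume "j \<in> {..<s}"
      then have j: "j < s" by simp
      have r: "\<bar>D' k j \<omega> - D j\<bar> \<le> \<rho> * D j" using True j by blast
      have "\<rho> * D j \<le> 1/2 * D j" using \<rho> D[OF j] by (intro mult_right_mono) auto
      then have h: "D' k j \<omega> \<ge> D j / 2" using r by linarith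
      have pos: "D' k j \<omega> > 0" using h D[OF j] by linarith
      have "\<bar>V k j \<omega> / D' k j \<omega> - V k j \<omega> / D j\<bar> = (V k j \<omega> / D j) * (\<bar>D' k j \<omega> - D j\<bar> / D' k j \<omega>)"
      proof -
        have "V k j \<omega> / D' k j \<omega> - V k j \<omega> / D j = - ((V k j \<omega> / D j) * ((D' k j \<omega> - D j) / D' k j \<omega>))"
          using pos D[OF j] by (simp add: field_simps)
        then show ?thesis using pos D[OF j] V(1)[OF j] by (simp add: abs_mult abs_divide)
      qed
      also have "\<dots> \<le> (V k j \<omega> / D j) * (2 * \<rho>)"
      proof (rule mult_left_mono)
        have "\<bar>D' k j \<omega> - D j\<bar> \<le> 2 * \<rho> * (D j / 2)" using r by simp
        also have "\<dots> \<le> 2 * \<rho> * D' k j \<omega>" using h \<rho> by (intro mult_left_mono) auto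
        finally show "\<bar>D' k j \<omega> - D j\<bar> / D' k j \<omega> \<le> 2 * \<rho>" using pos by (simp add: field_simps)
        show "0 \<le> V k j \<omega> / D j" using V(1)[OF j] D[OF j] by simp
      qed
      finally show "\<bar>V k j \<omega> / D' k j \<omega> - V k j \<omega> / D j\<bar> \<le> 2 * \<rho> * (V k j \<omega> / D j)" by (simp add: mult_ac)
    qed
    also have "\<dots> = 2 * \<rho> * ?Q k \<omega>" by (rule sum_distrib_left[symmetric])
    finally have "lam * \<bar>?R k \<omega> - ?Q k \<omega>\<bar> \<le> lam * (2 * \<rho> * ?Q k \<omega>)" using lam by (rule mult_left_mono)
    moreover have "?c \<ge> 0" using \<rho> D by (intro sum_nonneg) (auto simp: less_imp_le)
    moreover have "lam * (2 * \<rho> * ?Q k \<omega>) = ?b" by simp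
    ultimately show ?thesis using e1[OF R0[of k \<omega>] Q0[of k \<omega>]] by linarith
  next
    case False
    then obtain j where j: "j < s" "\<bar>D' k j \<omega> - D j\<bar> > \<rho> * D j" by auto
    have "1 \<le> \<bar>D' k j \<omega> - D j\<bar> / (\<rho> * D j)" using j D[OF j(1)] \<rho> by (simp add: field_simps)
    also have "\<dots> \<le> ?c"
      using j(1) \<rho> D by (intro member_le_sum) (auto simp: less_imp_le)
    finally have "1 \<le> ?c" .
    moreover have "?b \<ge> 0" using Q0[of k \<omega>] \<rho> lam by simp
    moreover have "?l \<le> 1"
    proof -
      have "exp (- lam * ?R k \<omega>) \<le> 1" "exp (- lam * ?Q k \<omega>) \<le> 1"
        using mult_nonneg_nonneg[OF lam R0[of k \<omega>]] mult_nonneg_nonneg[OF lam Q0[of k \<omega>]] by simp_all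
      moreover have "exp (- lam * ?R k \<omega>) > 0" "exp (- lam * ?Q k \<omega>) > 0" by simp_all
      ultimately show ?thesis unfolding abs_le_iff by linarith
    qed
    ultimately show ?thesis by linarith
  qed
  let ?d = "\<lambda>k. expectation (\<lambda>\<omega>. exp (- lam * ?R k \<omega>)) - expectation (\<lambda>\<omega>. exp (- lam * ?Q k \<omega>))"
  let ?E = "\<lambda>k \<rho>. \<Sum>j<s. expectation (\<lambda>\<omega>. \<bar>D' k j \<omega> - D j\<bar>) / (\<rho> * D j)"
  have bound: "\<bar>?d k\<bar> \<le> A * \<rho> + (?E k \<rho>)"
    if \<rho>: "0 < \<rho>" "\<rho> \<le> 1/2" for \<rho> k
  proof -
    have ie: "integrable M (\<lambda>\<omega>. exp (- lam * f \<omega>))"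
      if [measurable]: "f \<in> borel_measurable M" and "\<And>\<omega>. f \<omega> \<ge> 0" for f
      by (rule integrable_const_bound[where B = 1]) (use that lam in auto)
    have [measurable]: "?R k \<in> borel_measurable M" "?Q k \<in> borel_measurable M" by measurable
    have iQ: "integrable M (?Q k)" using V by (intro Bochner_Integration.integrable_sum integrable_divide_zero) auto
    have EQ: "expectation (?Q k) \<le> (\<Sum>j<s. B / D j)"
      using V D by (subst Bochner_Integration.integral_sum)
        (auto intro!: sum_mono divide_right_mono simp: less_imp_le)
    have ic: "integrable M (\<lambda>\<omega>. \<Sum>j<s. \<bar>D' k j \<omega> - D j\<bar> / (\<rho> * D j))"
      using D' by (intro Bochner_Integration.integrable_sum integrable_divide_zero) auto
    have "?d k = expectation (\<lambda>\<omega>. exp (- lam * ?R k \<omega>) - exp (- lam * ?Q k \<omega>))"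
      by (rule Bochner_Integration.integral_diff[symmetric]) (rule ie; use R0 Q0 in simp)+
    also have "\<bar>\<dots>\<bar> \<le> expectation (\<lambda>\<omega>. \<bar>exp (- lam * ?R k \<omega>) - exp (- lam * ?Q k \<omega>)\<bar>)"
      by (rule integral_abs_bound)
    also have "\<dots> \<le> expectation (\<lambda>\<omega>. 2 * lam * \<rho> * ?Q k \<omega> + (\<Sum>j<s. \<bar>D' k j \<omega> - D j\<bar> / (\<rho> * D j)))"
      by (intro integral_mono integrable_abs Bochner_Integration.integrable_diff ie R0 Q0
            Bochner_Integration.integrable_add integrable_mult_right iQ ic pw[OF \<rho>]) measurable
    also have "\<dots> = 2 * lam * \<rho> * expectation (?Q k) + (?E k \<rho>)"
      using iQ ic D' by (simp only: Bochner_Integration.integral_add integrable_mult_right integral_mult_right_zero)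
        (simp add: Bochner_Integration.integral_sum)
    also have "2 * lam * \<rho> * expectation (?Q k) \<le> 2 * lam * \<rho> * (\<Sum>j<s. B / D j)"
      using EQ lam \<rho> by (intro mult_left_mono) auto
    finally show ?thesis by (simp add: A_def mult_ac)
  qed
  have A0: "A \<ge> 0"
  proof (cases "s = 0")
    case False
    then have "expectation (V 0 0) \<ge> 0" using V(1) by (intro Bochner_Integration.integral_nonneg) auto
    then have "B \<ge> 0" using V(3)[of 0 0] False by auto
    then show ?thesis unfolding A_def using D lam by (intro mult_nonneg_nonneg sum_nonneg divide_nonneg_pos) auto
  qed (simp add: A_def)
  show ?thesis
  proof (rule LIMSEQ_I)
    fix r :: real assume r: "r > 0"
    \<comment> \<open>The bound 1/2 keeps D' at least D / 2 in the good case, the other one makes A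
      \<rho> at most r / 2; A + 1 avoids a zero denominator.\<close>
    define \<rho> where "\<rho> = min (1/2) (r / (2 * (A + 1)))"
    have "\<rho> \<le> 1/2" unfolding \<rho>_def by (rule min.cobounded1)
    moreover have "0 < \<rho>" using r A0 by (simp add: \<rho>_def)
    ultimately have \<rho>: "0 < \<rho>" "\<rho> \<le> 1/2" by simp_all
    have "A * \<rho> \<le> (A + 1) * (r / (2 * (A + 1)))" using A0 \<rho> by (intro mult_mono) (auto simp: \<rho>_def)
    also have "\<dots> = r / 2" using A0 by (simp add: field_simps)
    finally have A\<rho>: "A * \<rho> \<le> r / 2" .
    have "(\<lambda>k. \<Sum>j<s. expectation (\<lambda>\<omega>. \<bar>D' k j \<omega> - D j\<bar>) / (\<rho> * D j)) \<longlonglongrightarrow> (\<Sum>j<s. 0 / (\<rho> * D j))"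
      by (intro tendsto_intros) (use D' D \<rho> in \<open>auto dest: less_imp_neq[OF D]\<close>)
    then have "\<forall>\<^sub>F k in sequentially. (?E k \<rho>) < r / 2"
      using r by (intro order_tendstoD(2)) auto
    then obtain k0 where k0: "\<And>k. k \<ge> k0 \<Longrightarrow> (?E k \<rho>) < r / 2"
      by (auto simp: eventually_sequentially)
    have "\<bar>?d k\<bar> < r" if "k \<ge> k0" for k
    proof -
      have "(?E k \<rho>) < r / 2" using that by (rule k0)
      then show ?thesis using bound[OF \<rho>, of k] A\<rho> by linarith
    qed
    then show "\<exists>no. \<forall>n\<ge>no. norm (?d n - 0) < r" by (intro exI[of _ k0]) auto
  qed
qed

section \<open>Law of large numbers and central limit theorem for weighted sums\<close>

lemma weighted_lag_sum_commute: "weighted_lag_sum r W W' p q l = weighted_lag_sum r W' W q p l"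
  unfolding weighted_lag_sum_def
  by (subst sum.swap) (simp add: abs_minus_commute mult_ac)

lemma weighted_lag_sum_sum_left:
  "weighted_lag_sum r (\<lambda>u. \<Sum>p<N. x p * w p u) W' i j l = (\<Sum>p<N. x p * weighted_lag_sum r (w p) W' i j l)"
proof -
  have "weighted_lag_sum r (\<lambda>u. \<Sum>p<N. x p * w p u) W' i j l
     = (\<Sum>u = 1..l. \<Sum>p<N. \<Sum>v = 1..l. x p * (w p u * W' v * r (nat \<bar>int (i + u) - int (j + v)\<bar>)))"
    unfolding weighted_lag_sum_def sum_distrib_right by (intro sum.cong refl, subst sum.swap) (simp add: mult_ac)
  also have "\<dots> = (\<Sum>p<N. \<Sum>u = 1..l. \<Sum>v = 1..l. x p * (w p u * W' v * r (nat \<bar>int (i + u) - int (j + v)\<bar>)))"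
    by (rule sum.swap)
  finally show ?thesis by (simp only: weighted_lag_sum_def sum_distrib_left)
qed

lemma weighted_lag_sum_sum:
  "weighted_lag_sum r (\<lambda>u. \<Sum>p<N. x p * w p u) (\<lambda>u. \<Sum>p<N. x p * w p u) i j l
     = (\<Sum>p<N. \<Sum>q<N. x p * x q * weighted_lag_sum r (w p) (w q) i j l)"
proof -
  have "weighted_lag_sum r (w p) (\<lambda>u. \<Sum>p<N. x p * w p u) i j l = (\<Sum>q<N. x q * weighted_lag_sum r (w p) (w q) i j l)" for p
    unfolding weighted_lag_sum_commute[of r "w p"] by (rule weighted_lag_sum_sum_left)
  then show ?thesis unfolding weighted_lag_sum_sum_left by (simp add: sum_distrib_left mult.assoc)
qed

lemma weight_increment_sum:
  "weight_increment l (\<lambda>u. \<Sum>p<N. x p * w p u) = (\<lambda>u. \<Sum>p<N. x p * weight_increment l (w p) u)"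
  by (auto simp: weight_increment_def fun_eq_iff right_diff_distrib sum_subtractf sum_negf)

text \<open>Each distance is realised by at most 2 m pairs of indices.\<close>

lemma sum_abs_difference_le:
  fixes g :: "nat \<Rightarrow> real"
  assumes g: "\<And>\<rho>. g \<rho> \<ge> 0"
  shows "(\<Sum>h<m. \<Sum>h'<m. g (nat \<bar>int h - int h'\<bar>)) \<le> 2 * real m * (\<Sum>\<rho><m. g \<rho>)"
proof -
  have "(\<Sum>h'<m. g (nat \<bar>int h - int h'\<bar>)) \<le> 2 * (\<Sum>\<rho><m. g \<rho>)" if h: "h < m" for h
  proof -
    have "(\<Sum>h'<m. g (nat \<bar>int h - int h'\<bar>)) \<le> (\<Sum>h'\<in>{..<Suc h}. g (nat \<bar>int h - int h'\<bar>)) + (\<Sum>h'\<in>{h..<m}. g (nat \<bar>int h - int h'\<bar>))"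
    proof -
      have "{..<m} = {..<Suc h} \<union> {Suc h..<m}" using h by auto
      then have "(\<Sum>h'<m. g (nat \<bar>int h - int h'\<bar>)) = (\<Sum>h'\<in>{..<Suc h}. g (nat \<bar>int h - int h'\<bar>)) + (\<Sum>h'\<in>{Suc h..<m}. g (nat \<bar>int h - int h'\<bar>))"
        by (metis (no_types, lifting) sum.union_disjoint finite_lessThan finite_atLeastLessThan ivl_disj_int_one(2))
      also have "\<dots> \<le> (\<Sum>h'\<in>{..<Suc h}. g (nat \<bar>int h - int h'\<bar>)) + (\<Sum>h'\<in>{h..<m}. g (nat \<bar>int h - int h'\<bar>))"
        by (intro add_left_mono sum_mono2) (auto simp: g)
      finally show ?thesis .
    qed
    also have "(\<Sum>h'\<in>{..<Suc h}. g (nat \<bar>int h - int h'\<bar>)) = (\<Sum>\<rho><Suc h. g \<rho>)"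
      by (rule sum.reindex_bij_witness[of _ "\<lambda>\<rho>. h - \<rho>" "\<lambda>h'. h - h'"]) (auto simp: nat_abs_int_diff nat_diff_distrib)
    also have "\<dots> \<le> (\<Sum>\<rho><m. g \<rho>)" using h g by (intro sum_mono2) auto
    also have "(\<Sum>h'\<in>{h..<m}. g (nat \<bar>int h - int h'\<bar>)) = (\<Sum>\<rho><m - h. g \<rho>)"
      by (rule sum.reindex_bij_witness[of _ "\<lambda>\<rho>. h + \<rho>" "\<lambda>h'. h' - h"]) (auto simp: nat_abs_int_diff nat_diff_distrib)
    also have "\<dots> \<le> (\<Sum>\<rho><m. g \<rho>)" using g by (intro sum_mono2) auto
    finally show ?thesis by simp
  qed
  then have "(\<Sum>h<m. \<Sum>h'<m. g (nat \<bar>int h - int h'\<bar>)) \<le> (\<Sum>h<m. 2 * (\<Sum>\<rho><m. g \<rho>))" by (intro sum_mono) auto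
  then show ?thesis by simp
qed

lemma Cesaro_mean_tendsto_0:
  fixes g :: "nat \<Rightarrow> real"
  assumes "g \<longlonglongrightarrow> 0"
  shows "(\<lambda>m. (\<Sum>\<rho><m. g \<rho>) / real m) \<longlonglongrightarrow> 0"
  by (rule Stolz_Cesaro_at_top) (use assms in \<open>auto simp: filterlim_real_sequentially\<close>)

context linear_proc begin

text \<open>Cauchy-Schwarz for the coefficient vectors of the truncated sums, passed to the limit;
  the bound is free of the offsets by stationarity.\<close>

lemma cross_sum_Cauchy_Schwarz:
  "\<bar>cross_sum W W' p q l\<bar> \<le> sqrt (cross_sum W W 0 0 l) * sqrt (cross_sum W' W' 0 0 l)"
proof -
  let ?r = "lag_product_upto a"
  have "(weighted_lag_sum (?r n) W W' p q l)\<^sup>2 \<le> weighted_lag_sum (?r n) W W 0 0 l * weighted_lag_sum (?r n) W' W' 0 0 l" for n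
  proof -
    have "(weighted_lag_sum (?r n) W W' p q l)\<^sup>2 = (\<Sum>k = - int n..int (p + q + l). weighted_coeff a n W p l k * weighted_coeff a n W' q l k)\<^sup>2"
      by (subst sum_weighted_coeff) auto
    also have "\<dots> \<le> (\<Sum>k = - int n..int (p + q + l). (weighted_coeff a n W p l k)\<^sup>2) * (\<Sum>k = - int n..int (p + q + l). (weighted_coeff a n W' q l k)\<^sup>2)"
      by (rule Cauchy_Schwarz_ineq_sum)
    also have "(\<Sum>k = - int n..int (p + q + l). (weighted_coeff a n W p l k)\<^sup>2) = weighted_lag_sum (?r n) W W p p l"
      unfolding power2_eq_square by (subst sum_weighted_coeff) auto
    also have "(\<Sum>k = - int n..int (p + q + l). (weighted_coeff a n W' q l k)\<^sup>2) = weighted_lag_sum (?r n) W' W' q q l"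
      unfolding power2_eq_square by (subst sum_weighted_coeff) auto
    finally show ?thesis by (simp only: weighted_lag_sum_shift[of _ _ _ p] weighted_lag_sum_shift[of _ _ _ q])
  qed
  then have "(cross_sum W W' p q l)\<^sup>2 \<le> cross_sum W W 0 0 l * cross_sum W' W' 0 0 l"
    by (intro LIMSEQ_le[OF tendsto_power[OF weighted_lag_sum_tendsto[OF summable_sq]]
          tendsto_mult[OF weighted_lag_sum_tendsto[OF summable_sq] weighted_lag_sum_tendsto[OF summable_sq]]]) auto
  then show ?thesis unfolding real_sqrt_mult[symmetric] by (intro real_le_rsqrt) simp
qed

text \<open>The Lindeberg-type condition: the largest squared coefficient is of smaller order than
  n^\<kappa>, the order of the variance.\<close>

lemma sup_bound_scaled_tendsto_0:
  assumes S: "(\<lambda>n. cross_sum (w n) (w n) 0 0 n / real n powr \<kappa>) \<longlonglongrightarrow> S"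
    and inc: "(\<lambda>n. increment_lag_sum (lag_product a) n (w n) / real n powr \<kappa>) \<longlonglongrightarrow> 0"
  shows "(\<lambda>n. (sup_bound (w n) n)\<^sup>2 / real n powr \<kappa>) \<longlonglongrightarrow> 0"
proof -
  have "(\<lambda>n. 2 * sqrt (cross_sum (w n) (w n) 0 0 n / real n powr \<kappa>)
      * sqrt (increment_lag_sum (lag_product a) n (w n) / real n powr \<kappa>)) \<longlonglongrightarrow> 2 * sqrt S * sqrt 0"
    by (intro tendsto_intros S inc)
  moreover have "2 * sqrt (x / y) * sqrt (z / y) = 2 * sqrt x * sqrt z / y" if "y \<ge> 0" for x y z :: real
    using that by (simp add: real_sqrt_divide)
  ultimately show ?thesis by (simp add: sup_bound_def cross_sum_nonneg)
qed

text \<open>After division by the square of m l^\<kappa>, the sum of squared covariances over pairs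
  of blocks is at most twice a Cesaro mean of \<open>g\<close>, which is \<eta> squared at distances
  of at least 2 and a constant for equal and adjacent blocks. The cumulant term is the scaled
  squared maximum, which tends to 0, times a bounded variance.\<close>

lemma block_average_tendsto:
  fixes w :: "nat \<Rightarrow> nat \<Rightarrow> real" and m l :: "nat \<Rightarrow> nat"
  assumes S: "(\<lambda>n. cross_sum (w n) (w n) 0 0 n / real n powr \<kappa>) \<longlonglongrightarrow> S"
    and inc: "(\<lambda>n. increment_lag_sum (lag_product a) n (w n) / real n powr \<kappa>) \<longlonglongrightarrow> 0"
    and \<eta>: "\<eta> \<longlonglongrightarrow> 0"
    and far: "\<And>l h h'. l \<ge> 1 \<Longrightarrow> h' + 2 \<le> h \<Longrightarrow> \<bar>cross_sum (w l) (w l) (h * l) (h' * l) l\<bar> \<le> real l powr \<kappa> * \<eta> (h - h')"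
    and m: "filterlim m at_top sequentially" and l: "filterlim l at_top sequentially"
  shows "integrable M (\<lambda>\<omega>. \<bar>(\<Sum>h<m k. (weighted_sum Y (w (l k)) (h * l k) (l k) \<omega>)\<^sup>2) / (real (m k) * real (l k) powr \<kappa>) - \<sigma>\<^sup>2 * S\<bar>)"
    "(\<lambda>k. expectation (\<lambda>\<omega>. \<bar>(\<Sum>h<m k. (weighted_sum Y (w (l k)) (h * l k) (l k) \<omega>)\<^sup>2) / (real (m k) * real (l k) powr \<kappa>) - \<sigma>\<^sup>2 * S\<bar>)) \<longlonglongrightarrow> 0"
proof -
  let ?F = "\<lambda>k \<omega>. (\<Sum>h<m k. (weighted_sum Y (w (l k)) (h * l k) (l k) \<omega>)\<^sup>2)"
  let ?N = "\<lambda>k. real (m k) * real (l k) powr \<kappa>"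
  let ?H = "\<lambda>k. \<lambda>\<omega>. \<bar>?F k \<omega> / ?N k - \<sigma>\<^sup>2 * S\<bar>"
  have iF: "integrable M (?F k)" for k by (intro Bochner_Integration.integrable_sum weighted_sum_square)
  show i: "integrable M (?H k)" for k
    using iF[of k] by (intro integrable_abs Bochner_Integration.integrable_diff integrable_divide_zero) auto
  define C where "C n = cross_sum (w n) (w n) 0 0 n / real n powr \<kappa>" for n
  define G where "G n = (sup_bound (w n) n)\<^sup>2 / real n powr \<kappa>" for n
  have C0: "C n \<ge> 0" for n by (simp add: C_def cross_sum_nonneg)
  have C: "C \<longlonglongrightarrow> S" unfolding C_def by (rule S)
  have G: "G \<longlonglongrightarrow> 0" unfolding G_def by (rule sup_bound_scaled_tendsto_0[OF S inc])
  obtain B where B: "\<And>n. \<bar>C n\<bar> \<le> B" using convergent_imp_Bseq[OF convergentI[OF C]] by (auto simp: Bseq_def)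
  define g where "g \<rho> = (if \<rho> < 2 then B\<^sup>2 else (\<eta> \<rho>)\<^sup>2)" for \<rho> :: nat
  have g0: "g \<rho> \<ge> 0" for \<rho> by (simp add: g_def)
  have "g \<longlonglongrightarrow> 0"
  proof (rule Lim_transform_eventually)
    show "(\<lambda>\<rho>. (\<eta> \<rho>)\<^sup>2) \<longlonglongrightarrow> 0" using tendsto_power[OF \<eta>, of 2] by simp
    show "\<forall>\<^sub>F \<rho> in sequentially. (\<eta> \<rho>)\<^sup>2 = g \<rho>" using eventually_ge_at_top[of 2] by eventually_elim (simp add: g_def)
  qed
  note gm = filterlim_compose[OF Cesaro_mean_tendsto_0[OF this] m]
  define K where "K = \<bar>fourth_moment - 3 * \<sigma> ^ 4\<bar>"
  let ?e = "\<lambda>k. 2 * \<sigma> ^ 4 * (2 * ((\<Sum>\<rho><m k. g \<rho>) / real (m k))) + K * (G (l k) * C (l k))"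
  have cross: "(cross_sum (w n) (w n) (h * n) (h' * n) n)\<^sup>2 \<le> (real n powr \<kappa>)\<^sup>2 * g (nat \<bar>int h - int h'\<bar>)" if n: "n \<ge> 1" for n h h'
  proof -
    have far': "(cross_sum (w n) (w n) (h * n) (h' * n) n)\<^sup>2 \<le> (real n powr \<kappa>)\<^sup>2 * (\<eta> (h - h'))\<^sup>2" if "h' + 2 \<le> h" for h h'
    proof -
      have "(cross_sum (w n) (w n) (h * n) (h' * n) n)\<^sup>2 \<le> (real n powr \<kappa> * \<eta> (h - h'))\<^sup>2"
        using far[OF n that] by (intro power2_le_iff_abs_le[THEN iffD2]) auto
      then show ?thesis by (simp add: power_mult_distrib)
    qed
    consider "h' + 2 \<le> h" | "h + 2 \<le> h'" | "nat \<bar>int h - int h'\<bar> < 2"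
      unfolding nat_abs_int_diff by (cases "h' + 2 \<le> h"; cases "h + 2 \<le> h'"; cases "h \<le> h'") auto
    then show ?thesis
    proof cases
      case 1
      then have "nat \<bar>int h - int h'\<bar> = h - h'" unfolding nat_abs_int_diff by auto
      then show ?thesis using far'[OF 1] 1 by (auto simp: g_def)
    next
      case 2
      then have "nat \<bar>int h - int h'\<bar> = h' - h" unfolding nat_abs_int_diff by auto
      then show ?thesis using far'[OF 2] 2 weighted_lag_sum_commute[of _ "w n" "w n" "h * n"] by (auto simp: g_def)
    next
      case 3
      have "\<bar>cross_sum (w n) (w n) (h * n) (h' * n) n\<bar> \<le> cross_sum (w n) (w n) 0 0 n"
        using cross_sum_Cauchy_Schwarz[of "w n" "w n" "h * n" "h' * n" n] cross_sum_nonneg[of "w n" n] by simp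
      also have "\<dots> = real n powr \<kappa> * C n" using n by (simp add: C_def)
      also have "\<dots> \<le> real n powr \<kappa> * B" using B[of n] by (intro mult_left_mono) auto
      finally have "(cross_sum (w n) (w n) (h * n) (h' * n) n)\<^sup>2 \<le> (real n powr \<kappa> * B)\<^sup>2"
        by (metis abs_ge_zero power2_abs power_mono)
      then show ?thesis using 3 by (simp add: g_def power_mult_distrib)
    qed
  qed
  have main: "expectation (?H k)
     \<le> sqrt (?e k) + \<sigma>\<^sup>2 * \<bar>C (l k) - S\<bar>"
    if k: "m k \<ge> 1" "l k \<ge> 1" for k
  proof -
    let ?c = "cross_sum (w (l k)) (w (l k)) 0 0 (l k)"
    have N: "?N k > 0" using k by simp
    have cC: "?c = real (l k) powr \<kappa> * C (l k)" using k by (simp add: C_def)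
    have sG: "(sup_bound (w (l k)) (l k))\<^sup>2 = real (l k) powr \<kappa> * G (l k)" using k by (simp add: G_def)
    have eq: "(\<Sum>h<m k. (weighted_sum Y (w (l k)) (h * l k) (l k) \<omega>)\<^sup>2 - \<sigma>\<^sup>2 * ?c) = ?N k * (?F k \<omega> / ?N k - \<sigma>\<^sup>2 * C (l k))" for \<omega>
      using N k unfolding cC by (simp add: sum_subtractf right_diff_distrib mult_ac)
    have "?N k * expectation (\<lambda>\<omega>. \<bar>?F k \<omega> / ?N k - \<sigma>\<^sup>2 * C (l k)\<bar>)
      = expectation (\<lambda>\<omega>. \<bar>\<Sum>h<m k. (weighted_sum Y (w (l k)) (h * l k) (l k) \<omega>)\<^sup>2 - \<sigma>\<^sup>2 * ?c\<bar>)"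
      unfolding eq abs_mult using N by simp
    also have "\<dots> \<le> sqrt (\<Sum>h<m k. \<Sum>h'<m k. 2 * \<sigma> ^ 4 * (cross_sum (w (l k)) (w (l k)) (h * l k) (h' * l k) (l k))\<^sup>2
        + K * ((sup_bound (w (l k)) (l k))\<^sup>2 * ?c))"
      unfolding K_def by (rule weighted_sum_squares_deviation)
    also have "\<dots> \<le> sqrt ((?N k)\<^sup>2 * (?e k))"
    proof (rule real_sqrt_le_mono)
      have "(\<Sum>h<m k. \<Sum>h'<m k. 2 * \<sigma> ^ 4 * (cross_sum (w (l k)) (w (l k)) (h * l k) (h' * l k) (l k))\<^sup>2
          + K * ((sup_bound (w (l k)) (l k))\<^sup>2 * ?c))
        \<le> (\<Sum>h<m k. \<Sum>h'<m k. 2 * \<sigma> ^ 4 * ((real (l k) powr \<kappa>)\<^sup>2 * g (nat \<bar>int h - int h'\<bar>))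
          + K * ((sup_bound (w (l k)) (l k))\<^sup>2 * ?c))"
        by (intro sum_mono add_right_mono mult_left_mono cross k) auto
      also have "\<dots> = 2 * \<sigma> ^ 4 * ((real (l k) powr \<kappa>)\<^sup>2 * (\<Sum>h<m k. \<Sum>h'<m k. g (nat \<bar>int h - int h'\<bar>)))
          + (real (m k))\<^sup>2 * (K * ((sup_bound (w (l k)) (l k))\<^sup>2 * ?c))"
        by (simp add: sum.distrib sum_distrib_left power2_eq_square mult.assoc)
      also have "\<dots> \<le> 2 * \<sigma> ^ 4 * ((real (l k) powr \<kappa>)\<^sup>2 * (2 * real (m k) * (\<Sum>\<rho><m k. g \<rho>)))
          + (real (m k))\<^sup>2 * (K * ((sup_bound (w (l k)) (l k))\<^sup>2 * ?c))"
        by (intro add_right_mono mult_left_mono sum_abs_difference_le g0) auto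
      also have "\<dots> = (?N k)\<^sup>2 * (?e k)"
        unfolding cC sG using k by (simp add: field_simps power2_eq_square)
      finally show "(\<Sum>h<m k. \<Sum>h'<m k. 2 * \<sigma> ^ 4 * (cross_sum (w (l k)) (w (l k)) (h * l k) (h' * l k) (l k))\<^sup>2
          + K * ((sup_bound (w (l k)) (l k))\<^sup>2 * ?c)) \<le> \<dots>" .
    qed
    also have "\<dots> = ?N k * sqrt (?e k)"
      using N by (simp add: real_sqrt_mult)
    finally have 1: "expectation (\<lambda>\<omega>. \<bar>?F k \<omega> / ?N k - \<sigma>\<^sup>2 * C (l k)\<bar>)
       \<le> sqrt (?e k)"
      using N by (rule mult_left_le_imp_le)
    have "expectation (?H k) \<le> expectation (\<lambda>\<omega>. \<bar>?F k \<omega> / ?N k - \<sigma>\<^sup>2 * C (l k)\<bar> + \<sigma>\<^sup>2 * \<bar>C (l k) - S\<bar>)"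
    proof (rule integral_mono[OF i])
      show "integrable M (\<lambda>\<omega>. \<bar>?F k \<omega> / ?N k - \<sigma>\<^sup>2 * C (l k)\<bar> + \<sigma>\<^sup>2 * \<bar>C (l k) - S\<bar>)"
        using iF[of k] by (intro Bochner_Integration.integrable_add integrable_abs Bochner_Integration.integrable_diff integrable_divide_zero) auto
      fix \<omega>
      have "\<bar>\<sigma>\<^sup>2 * C (l k) - \<sigma>\<^sup>2 * S\<bar> = \<sigma>\<^sup>2 * \<bar>C (l k) - S\<bar>" by (simp add: right_diff_distrib[symmetric] abs_mult)
      then show "\<bar>?F k \<omega> / ?N k - \<sigma>\<^sup>2 * S\<bar> \<le> \<bar>?F k \<omega> / ?N k - \<sigma>\<^sup>2 * C (l k)\<bar> + \<sigma>\<^sup>2 * \<bar>C (l k) - S\<bar>" by linarith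
    qed
    also have "\<dots> = expectation (\<lambda>\<omega>. \<bar>?F k \<omega> / ?N k - \<sigma>\<^sup>2 * C (l k)\<bar>) + \<sigma>\<^sup>2 * \<bar>C (l k) - S\<bar>"
      using iF[of k] by (subst Bochner_Integration.integral_add) (auto simp: prob_space)
    finally show ?thesis using 1 by linarith
  qed
  have "(\<lambda>k. sqrt (?e k) + \<sigma>\<^sup>2 * \<bar>C (l k) - S\<bar>)
     \<longlonglongrightarrow> sqrt (2 * \<sigma> ^ 4 * (2 * 0) + K * (0 * S)) + \<sigma>\<^sup>2 * \<bar>S - S\<bar>"
    by (intro tendsto_intros gm filterlim_compose[OF C l] filterlim_compose[OF G l])
  then have lim: "(\<lambda>k. sqrt (?e k) + \<sigma>\<^sup>2 * \<bar>C (l k) - S\<bar>) \<longlonglongrightarrow> 0"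
    by simp
  show "(\<lambda>k. expectation (?H k)) \<longlonglongrightarrow> 0"
  proof (rule Lim_null_comparison[OF _ lim])
    have "\<forall>\<^sub>F k in sequentially. m k \<ge> 1" "\<forall>\<^sub>F k in sequentially. l k \<ge> 1"
      using m l by (auto simp: filterlim_at_top)
    then show "\<forall>\<^sub>F k in sequentially. norm (expectation (?H k))
       \<le> sqrt (?e k) + \<sigma>\<^sup>2 * \<bar>C (l k) - S\<bar>"
    proof eventually_elim
      case (elim k)
      have "expectation (?H k) \<ge> 0" by simp
      then show ?case using main[OF elim] by (simp only: real_norm_def abs_of_nonneg)
    qed
  qed
qed

text \<open>The Cramer-Wold device: a linear combination of weighted sums is a weighted sum with
  combined weights, the normalisation absorbed into them, so the one-dimensional bound applies.
  Mixed increment sums are controlled by the diagonal ones through Cauchy-Schwarz.\<close>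

lemma char_weighted_sums_tendsto:
  fixes w :: "nat \<Rightarrow> nat \<Rightarrow> nat \<Rightarrow> real" and x :: "nat \<Rightarrow> real"
  assumes S: "\<And>p q. p < N \<Longrightarrow> q < N \<Longrightarrow> (\<lambda>n. cross_sum (w p n) (w q n) 0 0 n / real n powr \<kappa>) \<longlonglongrightarrow> S p q"
    and inc: "\<And>p. p < N \<Longrightarrow>
      (\<lambda>n. increment_lag_sum (lag_product a) n (w p n) / real n powr \<kappa>) \<longlonglongrightarrow> 0"
  shows "(\<lambda>n. expectation (\<lambda>\<omega>. iexp (\<Sum>p<N. x p * (weighted_sum Y (w p n) 0 n \<omega> / sqrt (real n powr \<kappa>)))))
     \<longlonglongrightarrow> complex_of_real (exp (- (\<Sum>p<N. \<Sum>q<N. x p * x q * (\<sigma>\<^sup>2 * S p q)) / 2))"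
proof -
  define W where "W n = (\<lambda>u. \<Sum>p<N. (x p / sqrt (real n powr \<kappa>)) * w p n u)" for n
  let ?Z = "\<Sum>p<N. \<Sum>q<N. x p * x q * S p q"
  have W: "(\<Sum>p<N. x p * (weighted_sum Y (w p n) 0 n \<omega> / sqrt (real n powr \<kappa>))) = weighted_sum Y (W n) 0 n \<omega>" for n \<omega>
    unfolding weighted_sum_def W_def sum_distrib_right sum_divide_distrib sum_distrib_left
    by (subst sum.swap) (simp add: mult_ac)
  have q: "(\<lambda>n. cross_sum (W n) (W n) 0 0 n) \<longlonglongrightarrow> ?Z"
  proof -
    have "cross_sum (W n) (W n) 0 0 n = (\<Sum>p<N. \<Sum>q<N. x p * x q * (cross_sum (w p n) (w q n) 0 0 n / real n powr \<kappa>))" for n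
      unfolding W_def weighted_lag_sum_sum by (intro sum.cong refl) (simp add: field_simps)
    then show ?thesis by (simp only:) (intro tendsto_intros S; simp)
  qed
  have z: "(\<lambda>n. increment_lag_sum (lag_product a) n (W n)) \<longlonglongrightarrow> 0"
  proof -
    have eq: "increment_lag_sum (lag_product a) n (W n)
       = (\<Sum>p<N. \<Sum>q<N. x p * x q * (cross_sum (weight_increment n (w p n)) (weight_increment n (w q n)) 0 0 (Suc n) / real n powr \<kappa>))" for n
      unfolding W_def weight_increment_sum weighted_lag_sum_sum by (intro sum.cong refl) (simp add: field_simps)
    have "(\<lambda>n. cross_sum (weight_increment n (w p n)) (weight_increment n (w q n)) 0 0 (Suc n) / real n powr \<kappa>) \<longlonglongrightarrow> 0"
      if "p < N" "q < N" for p q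
    proof (rule Lim_null_comparison[OF always_eventually])
      let ?c = "\<lambda>p q n. cross_sum (weight_increment n (w p n)) (weight_increment n (w q n)) 0 0 (Suc n)"
      have "(\<lambda>n. sqrt (?c p p n / real n powr \<kappa>) * sqrt (?c q q n / real n powr \<kappa>)) \<longlonglongrightarrow> sqrt 0 * sqrt 0"
        by (intro tendsto_intros inc that)
      then show "(\<lambda>n. sqrt (?c p p n / real n powr \<kappa>) * sqrt (?c q q n / real n powr \<kappa>)) \<longlonglongrightarrow> 0" by simp
      show "\<forall>n. norm (?c p q n / real n powr \<kappa>) \<le> sqrt (?c p p n / real n powr \<kappa>) * sqrt (?c q q n / real n powr \<kappa>)"
      proof
        fix n
        have "\<bar>?c p q n\<bar> / real n powr \<kappa> \<le> (sqrt (?c p p n) * sqrt (?c q q n)) / real n powr \<kappa>"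
          by (intro divide_right_mono cross_sum_Cauchy_Schwarz) simp
        then show "norm (?c p q n / real n powr \<kappa>) \<le> sqrt (?c p p n / real n powr \<kappa>) * sqrt (?c q q n / real n powr \<kappa>)"
          by (simp add: real_sqrt_divide)
      qed
    qed
    then have "(\<lambda>n. \<Sum>p<N. \<Sum>q<N. x p * x q * (cross_sum (weight_increment n (w p n)) (weight_increment n (w q n)) 0 0 (Suc n) / real n powr \<kappa>))
       \<longlonglongrightarrow> (\<Sum>p<N. \<Sum>q<N. x p * x q * 0)" by (intro tendsto_intros) auto
    then show ?thesis unfolding eq by simp
  qed
  have sb: "(\<lambda>n. sup_bound (W n) n) \<longlonglongrightarrow> 0"
  proof -
    have "(\<lambda>n. sup_bound (W n) n) \<longlonglongrightarrow> sqrt (2 * sqrt ?Z * sqrt 0)"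
      unfolding sup_bound_def by (intro tendsto_intros q z)
    then show ?thesis by simp
  qed
  let ?B = "\<lambda>n. (expectation (\<lambda>\<omega>. \<bar>\<epsilon> 0 \<omega>\<bar> ^ 3) * sup_bound (W n) n + \<sigma> ^ 4 * (sup_bound (W n) n)\<^sup>2) * cross_sum (W n) (W n) 0 0 n"
  have "?B \<longlonglongrightarrow> (expectation (\<lambda>\<omega>. \<bar>\<epsilon> 0 \<omega>\<bar> ^ 3) * 0 + \<sigma> ^ 4 * 0\<^sup>2) * ?Z" by (intro tendsto_intros sb q)
  then have B: "?B \<longlonglongrightarrow> 0" by simp
  have d: "(\<lambda>n. expectation (\<lambda>\<omega>. iexp (weighted_sum Y (W n) 0 n \<omega>)) - complex_of_real (exp (- \<sigma>\<^sup>2 * cross_sum (W n) (W n) 0 0 n / 2))) \<longlonglongrightarrow> 0"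
    by (rule Lim_null_comparison[OF always_eventually B]) (intro allI char_weighted_sum)
  have e: "(\<lambda>n. complex_of_real (exp (- \<sigma>\<^sup>2 * cross_sum (W n) (W n) 0 0 n / 2))) \<longlonglongrightarrow> complex_of_real (exp (- \<sigma>\<^sup>2 * ?Z / 2))"
    by (intro tendsto_intros q) simp
  have "(\<lambda>n. expectation (\<lambda>\<omega>. iexp (weighted_sum Y (W n) 0 n \<omega>))) \<longlonglongrightarrow> complex_of_real (exp (- \<sigma>\<^sup>2 * ?Z / 2))"
    using tendsto_add[OF d e] by simp
  moreover have "- \<sigma>\<^sup>2 * ?Z / 2 = - (\<Sum>p<N. \<Sum>q<N. x p * x q * (\<sigma>\<^sup>2 * S p q)) / 2"
  proof -
    have "(\<Sum>p<N. \<Sum>q<N. x p * x q * (\<sigma>\<^sup>2 * S p q)) = \<sigma>\<^sup>2 * ?Z"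
      unfolding sum_distrib_left by (intro sum.cong refl) simp
    then show ?thesis by simp
  qed
  ultimately show ?thesis unfolding W by simp
qed

end

section \<open>Estimates for trigonometric weights and their tail sums\<close>

lemma abs_weighted_lag_sum_le:
  "\<bar>weighted_lag_sum r W W' p q l\<bar> \<le> (\<Sum>u = 1..l. \<Sum>v = 1..l. \<bar>W u\<bar> * \<bar>W' v\<bar> * \<bar>r (nat \<bar>int (p + u) - int (q + v)\<bar>)\<bar>)"
  unfolding weighted_lag_sum_def abs_mult[symmetric] by (intro order_trans[OF sum_abs] sum_mono order_refl)

lemma abs_weighted_lag_sum_le_lags:
  assumes "\<And>u. u \<in> {1..l} \<Longrightarrow> \<bar>W u\<bar> \<le> B" "\<And>u. u \<in> {1..l} \<Longrightarrow> \<bar>W' u\<bar> \<le> B" "B \<ge> 0"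
  shows "\<bar>weighted_lag_sum r W W' p q l\<bar> \<le> B\<^sup>2 * (\<Sum>u = 1..l. \<Sum>v = 1..l. \<bar>r (nat \<bar>int (p + u) - int (q + v)\<bar>)\<bar>)"
  by (rule order_trans[OF abs_weighted_lag_sum_le], unfold sum_distrib_left power2_eq_square,
      intro sum_mono mult_right_mono mult_mono assms) auto

lemma abs_weighted_lag_sum_le_weights:
  assumes "\<And>h. \<bar>r h\<bar> \<le> R"
  shows "\<bar>weighted_lag_sum r W W' p q l\<bar> \<le> R * ((\<Sum>u = 1..l. \<bar>W u\<bar>) * (\<Sum>v = 1..l. \<bar>W' v\<bar>))"
  by (rule order_trans[OF abs_weighted_lag_sum_le], unfold sum_product, unfold sum_distrib_left,
      unfold mult.commute[of R],
      intro sum_mono mult_left_mono assms) auto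

text \<open>Inside the block the increment of a tail sum is minus a trigonometric value; at u = 1 it
  is the full sum, which is 0, and at \<open>Suc n\<close> minus the last value.\<close>

lemma weight_increment_tail_trig:
  assumes "1 \<le> p" "p < n" "u \<in> {1..Suc n}"
  shows "\<bar>weight_increment n (tail_trig b p n) u\<bar> \<le> 1"
proof -
  consider "u = 1" | "1 < u" "u \<le> n" | "u = Suc n" using assms(3) by force
  then show ?thesis
  proof cases
    case 1
    then show ?thesis using sum_trig_eq_0[OF assms(1,2), of b] assms by (simp add: weight_increment_def tail_trig_def)
  next
    case 2
    have "{u - 1..n} = insert (u - 1) {u..n}" using 2 by auto
    moreover have "u - 1 \<notin> {u..n}" using 2 by auto
    ultimately have "tail_trig b p n (u - 1) = trig b p (real (u - 1) / real n) + tail_trig b p n u"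
      unfolding tail_trig_def by (simp del: of_nat_diff)
    then show ?thesis using 2 abs_trig_le[of b p "real (u - 1) / real n"] by (simp add: weight_increment_def)
  next
    case 3
    then show ?thesis using assms abs_trig_le[of b p "real n / real n"] by (simp add: weight_increment_def tail_trig_def)
  qed
qed

text \<open>Total variation of the weights: two end jumps of size at most 1, and n - 1 inner
  increments of size at most 2 pi p / n.\<close>

lemma sum_weight_increment_trig:
  assumes "n \<ge> 1"
  shows "(\<Sum>u = 1..Suc n. \<bar>weight_increment n (\<lambda>u. trig b p (real u / real n)) u\<bar>) \<le> 2 + 2 * pi * real p"
proof -
  let ?f = "\<lambda>u. \<bar>weight_increment n (\<lambda>u. trig b p (real u / real n)) u\<bar>"
  have "(\<Sum>u = 1..Suc n. ?f u) = ?f 1 + (\<Sum>u = 2..n. ?f u) + ?f (Suc n)"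
  proof -
    have "{1..Suc n} = insert 1 (insert (Suc n) {2..n})" using assms by auto
    then show ?thesis using assms by simp
  qed
  also have "?f 1 \<le> 1" using assms abs_trig_le[of b p "1 / real n"] by (simp add: weight_increment_def)
  also have "?f (Suc n) \<le> 1" using assms abs_trig_le[of b p "real n / real n"] by (simp add: weight_increment_def)
  also have "(\<Sum>u = 2..n. ?f u) \<le> (\<Sum>u = 2..n. 2 * pi * real p / real n)"
  proof (rule sum_mono)
    fix u assume u: "u \<in> {2..n}"
    have "real n * \<bar>trig b p (real (u - 1) / real n) - trig b p (real u / real n)\<bar> \<le> 2 * pi * real p"
      using abs_trig_diff_le[OF assms, of b p "u - 1"] u by (simp add: abs_mult Suc_diff_Suc numeral_2_eq_2 del: of_nat_diff of_nat_Suc)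
    then have "\<bar>trig b p (real (u - 1) / real n) - trig b p (real u / real n)\<bar> \<le> 2 * pi * real p / real n"
      using assms by (simp add: field_simps)
    then show "?f u \<le> 2 * pi * real p / real n" using u by (simp add: weight_increment_def abs_minus_commute del: of_nat_diff)
  qed
  also have "\<dots> \<le> real n * (2 * pi * real p / real n)" unfolding sum_constant by (intro mult_right_mono) auto
  also have "\<dots> = 2 * pi * real p" using assms by simp
  finally show ?thesis by simp
qed

lemma abs_tail_trig_le: "u \<ge> 1 \<Longrightarrow> \<bar>tail_trig b p n u\<bar> \<le> real n"
proof -
  assume u: "u \<ge> 1"
  have "\<bar>tail_trig b p n u\<bar> \<le> (\<Sum>t = u..n. 1)"
    unfolding tail_trig_def by (intro order_trans[OF sum_abs] sum_mono abs_trig_le)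
  then show ?thesis using u by simp
qed

lemma sum_double_abs_lag:
  "(\<Sum>u = 1..n. \<Sum>v = 1..n. \<bar>r (nat \<bar>int (0 + u) - int (0 + v)\<bar>)\<bar>) \<le> 2 * real n * (\<Sum>\<rho><n. \<bar>r \<rho>\<bar>)" for r :: "nat \<Rightarrow> real"
proof -
  have "(\<Sum>u = 1..n. \<Sum>v = 1..n. \<bar>r (nat \<bar>int (0 + u) - int (0 + v)\<bar>)\<bar>) = (\<Sum>u<n. \<Sum>v<n. \<bar>r (nat \<bar>int u - int v\<bar>)\<bar>)"
    by (simp add: sum.atLeast1_atMost_eq)
  also have "\<dots> \<le> 2 * real n * (\<Sum>\<rho><n. \<bar>r \<rho>\<bar>)" by (rule sum_abs_difference_le) simp
  finally show ?thesis .
qed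

text \<open>Bounded increments leave the double sum of |r|, at most 2 n times a sum over n lags up
  to an index shift, hence o(n^2) by Cesaro; here \<kappa> = 2 d + 1 >= 2.\<close>

lemma increment_tail_tendsto:
  assumes r: "r \<longlonglongrightarrow> 0" and \<kappa>: "\<kappa> \<ge> 2" and p: "1 \<le> p"
  shows "(\<lambda>n. increment_lag_sum r n (tail_trig b p n) / real n powr \<kappa>) \<longlonglongrightarrow> 0"
proof (rule Lim_null_comparison)
  let ?S = "\<lambda>n. \<Sum>\<rho><Suc n. \<bar>r \<rho>\<bar>"
  have "(\<lambda>n. (?S n) / real (Suc n)) \<longlonglongrightarrow> 0"
    using Cesaro_mean_tendsto_0[OF tendsto_rabs_zero[OF r]] by (subst filterlim_sequentially_Suc)
  moreover have "(\<lambda>n. 2 * (real (Suc n))\<^sup>2 / (real n)\<^sup>2) \<longlonglongrightarrow> 2" by real_asymp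
  ultimately have "(\<lambda>n. 2 * (real (Suc n))\<^sup>2 / (real n)\<^sup>2 * ((?S n) / real (Suc n))) \<longlonglongrightarrow> 2 * 0"
    by (intro tendsto_mult)
  then show "(\<lambda>n. 2 * (real (Suc n))\<^sup>2 / (real n)\<^sup>2 * ((?S n) / real (Suc n))) \<longlonglongrightarrow> 0" by simp
  show "\<forall>\<^sub>F n in sequentially. norm (increment_lag_sum r n (tail_trig b p n) / real n powr \<kappa>)
     \<le> 2 * (real (Suc n))\<^sup>2 / (real n)\<^sup>2 * ((?S n) / real (Suc n))"
    using eventually_gt_at_top[of p]
  proof eventually_elim
    case (elim n)
    let ?x = "increment_lag_sum r n (tail_trig b p n)"
    have n: "real n \<ge> 1" using elim p by simp
    have "\<bar>?x\<bar> \<le> 1\<^sup>2 * (\<Sum>u = 1..Suc n. \<Sum>v = 1..Suc n. \<bar>r (nat \<bar>int (0 + u) - int (0 + v)\<bar>)\<bar>)"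
      by (rule abs_weighted_lag_sum_le_lags) (use weight_increment_tail_trig[OF p elim] in auto)
    also have "\<dots> \<le> 2 * real (Suc n) * (?S n)" using sum_double_abs_lag[where r = r and n = "Suc n"] by simp
    finally have x: "\<bar>?x\<bar> \<le> 2 * real (Suc n) * (?S n)" .
    have "(real n)\<^sup>2 \<le> real n powr \<kappa>" using powr_mono[OF \<kappa> n] n by (simp add: powr_numeral)
    then have "\<bar>?x\<bar> / real n powr \<kappa> \<le> (2 * real (Suc n) * (?S n)) / (real n)\<^sup>2"
      using x n by (intro frac_le) (auto intro!: mult_nonneg_nonneg sum_nonneg)
    moreover have "2 * y\<^sup>2 / z * (x / y) = 2 * y * x / z" if "y \<noteq> 0" for x y z :: real
      using that by (simp add: power2_eq_square)
    ultimately show ?case by (simp del: sum.lessThan_Suc of_nat_Suc)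
  qed
qed

text \<open>The weights have bounded variation and r is bounded, so the numerator stays bounded
  while n^\<kappa> diverges.\<close>

lemma increment_trig_tendsto:
  assumes r: "r \<longlonglongrightarrow> 0" and \<kappa>: "\<kappa> > 0"
  shows "(\<lambda>n. weighted_lag_sum r (weight_increment n (\<lambda>u. trig b p (real u / real n))) (weight_increment n (\<lambda>u. trig b p (real u / real n))) 0 0 (Suc n) / real n powr \<kappa>) \<longlonglongrightarrow> 0"
proof -
  obtain R where R: "\<And>h. \<bar>r h\<bar> \<le> R" using convergent_imp_Bseq[OF convergentI[OF r]] by (auto simp: Bseq_def)
  then have R0: "R \<ge> 0" using abs_ge_zero order_trans by blast
  let ?P = "2 + 2 * pi * real p"
  show ?thesis
  proof (rule Lim_null_comparison)
  show "(\<lambda>n. R * (?P * ?P) / real n powr \<kappa>) \<longlonglongrightarrow> 0" using \<kappa> by real_asymp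
  show "\<forall>\<^sub>F n in sequentially. norm (weighted_lag_sum r (weight_increment n (\<lambda>u. trig b p (real u / real n))) (weight_increment n (\<lambda>u. trig b p (real u / real n))) 0 0 (Suc n) / real n powr \<kappa>)
     \<le> R * (?P * ?P) / real n powr \<kappa>"
    using eventually_ge_at_top[of 1]
  proof eventually_elim
    case (elim n)
    let ?V = "weight_increment n (\<lambda>u. trig b p (real u / real n))"
    have "\<bar>weighted_lag_sum r ?V ?V 0 0 (Suc n)\<bar> \<le> R * ((\<Sum>u = 1..Suc n. \<bar>?V u\<bar>) * (\<Sum>u = 1..Suc n. \<bar>?V u\<bar>))"
      by (rule abs_weighted_lag_sum_le_weights[OF R])
    also have "\<dots> \<le> R * (?P * ?P)"
      by (intro mult_left_mono mult_mono sum_weight_increment_trig elim R0 sum_nonneg) auto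
    finally show ?case by (simp add: abs_divide divide_right_mono)
  qed
  qed
qed

text \<open>For separated blocks the absolute value in the lag resolves: with h' + 2 <= h it is the
  natural number (h - h') l + u - v.\<close>

lemma far_block_bound:
  fixes r \<eta> :: "nat \<Rightarrow> real"
  assumes \<eta>: "(\<Sum>u = 1..l. \<Sum>v = 1..l. \<bar>r ((h - h') * l + u - v)\<bar>) \<le> real l powr \<alpha> * \<eta> (h - h')"
    and h: "h' + 2 \<le> h" and W: "\<And>u. u \<in> {1..l} \<Longrightarrow> \<bar>W u\<bar> \<le> B" "B \<ge> 0"
  shows "\<bar>weighted_lag_sum r W W (h * l) (h' * l) l\<bar> \<le> B\<^sup>2 * (real l powr \<alpha> * \<eta> (h - h'))"
proof -
  have "nat \<bar>int (h * l + u) - int (h' * l + v)\<bar> = (h - h') * l + u - v" if "u \<in> {1..l}" "v \<in> {1..l}" for u v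
  proof -
    have "(h - h') * l + h' * l = h * l" using h by (simp add: add_mult_distrib[symmetric])
    moreover have "2 * l \<le> (h - h') * l" using h by (intro mult_le_mono1) simp
    moreover have "nat \<bar>int (x + u) - int (z + v)\<bar> = y + u - v" if "y + z = x" "2 * l \<le> y" for x y z
      using that \<open>u \<in> {1..l}\<close> \<open>v \<in> {1..l}\<close> by auto
    ultimately show ?thesis by blast
  qed
  then have "(\<Sum>u = 1..l. \<Sum>v = 1..l. \<bar>r (nat \<bar>int (h * l + u) - int (h' * l + v)\<bar>)\<bar>) = (\<Sum>u = 1..l. \<Sum>v = 1..l. \<bar>r ((h - h') * l + u - v)\<bar>)"
    by (intro sum.cong refl) (simp only:)
  then show ?thesis
    using abs_weighted_lag_sum_le_lags[of l W B W r "h * l" "h' * l", OF W(1) W(1) W(2)] mult_left_mono[OF \<eta> zero_le_power2[of B]] by simp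
qed

lemma sum_lessThan_double: "(\<Sum>i<s + t. f i) = (\<Sum>i<s. f i) + (\<Sum>i<t. f (s + i))" for f :: "nat \<Rightarrow> 'b::comm_monoid_add"
  by (induction t) (auto simp: add_ac)

context linear_proc begin

text \<open>Positions j and s + j hold the cosine and the sine weight of one frequency, so 1 / D_j
  occurs twice on the diagonal. With deterministic denominators the statistic is a sum of squares of
  forms that are asymptotically normal and uncorrelated with variances \<zeta>; the random
  denominators are exchanged afterwards.\<close>

theorem studentized_sum_squares_Laplace:
  fixes w :: "nat \<Rightarrow> nat \<Rightarrow> nat \<Rightarrow> real" and m l :: "nat \<Rightarrow> nat" and A :: "real mat" and D :: "nat \<Rightarrow> real"
  assumes A: "A \<in> carrier_mat (s + s) (s + s)"
    and S: "\<And>p q. p < s + s \<Longrightarrow> q < s + s \<Longrightarrow>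
      (\<lambda>n. \<sigma>\<^sup>2 * (cross_sum (w p n) (w q n) 0 0 n / real n powr \<kappa>)) \<longlonglongrightarrow> A $$ (p, q)"
    and inc: "\<And>p. p < s + s \<Longrightarrow>
      (\<lambda>n. increment_lag_sum (lag_product a) n (w p n) / real n powr \<kappa>) \<longlonglongrightarrow> 0"
    and \<eta>: "\<eta> \<longlonglongrightarrow> 0"
    and far: "\<And>p l h h'. p < s + s \<Longrightarrow> l \<ge> 1 \<Longrightarrow> h' + 2 \<le> h \<Longrightarrow>
      \<bar>cross_sum (w p l) (w p l) (h * l) (h' * l) l\<bar> \<le> real l powr \<kappa> * \<eta> (h - h')"
    and D: "\<And>j. j < s \<Longrightarrow> D j = A $$ (j, j) + A $$ (s + j, s + j)" "\<And>j. j < s \<Longrightarrow> D j > 0"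
    and m: "filterlim m at_top sequentially" and l: "filterlim l at_top sequentially"
  obtains \<zeta> where "\<And>p. p < s + s \<Longrightarrow> \<zeta> p \<ge> 0"
    "char_poly (A * mat_diag (s + s) (\<lambda>i. 1 / D (if i < s then i else i - s))) = (\<Prod>p<s + s. [:- \<zeta> p, 1:])"
    "\<And>lam. lam \<ge> 0 \<Longrightarrow> (\<lambda>k. expectation (\<lambda>\<omega>. exp (- lam * (\<Sum>j<s.
        ((weighted_sum Y (w j (m k * l k)) 0 (m k * l k) \<omega>)\<^sup>2 + (weighted_sum Y (w (s + j) (m k * l k)) 0 (m k * l k) \<omega>)\<^sup>2)
          / real (m k * l k) powr \<kappa>
        / ((\<Sum>h<m k. (weighted_sum Y (w j (l k)) (h * l k) (l k) \<omega>)\<^sup>2 + (weighted_sum Y (w (s + j) (l k)) (h * l k) (l k) \<omega>)\<^sup>2)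
          / (real (m k) * real (l k) powr \<kappa>))))))
      \<longlonglongrightarrow> (\<Prod>p<s + s. \<integral>g. exp (- lam * \<zeta> p * g\<^sup>2) \<partial>std_normal_distribution)"
proof -
  let ?C = "\<lambda>i j n. \<sigma>\<^sup>2 * (cross_sum (w i n) (w j n) 0 0 n / real n powr \<kappa>)"
  have s2: "\<sigma>\<^sup>2 > 0" using sigma_pos by simp
  define S where "S p q = A $$ (p, q) / \<sigma>\<^sup>2" for p q
  have cs: "(\<lambda>n. cross_sum (w p n) (w q n) 0 0 n / real n powr \<kappa>) \<longlonglongrightarrow> S p q" if "p < s + s" "q < s + s" for p q
    using tendsto_mult_left[OF S[OF that], of "1 / \<sigma>\<^sup>2"] s2 by (simp add: S_def)
  have sS: "\<sigma>\<^sup>2 * S p q = A $$ (p, q)" for p q using s2 by (simp add: S_def)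
  have sym: "transpose_mat A = A"
  proof (rule eq_matI)
    fix p q assume "p < dim_row A" "q < dim_col A"
    then have pq: "p < s + s" "q < s + s" using A by auto
    have "A $$ (q, p) = A $$ (p, q)"
      by (rule LIMSEQ_unique[OF S[OF pq(2,1), unfolded weighted_lag_sum_commute[of _ "w q _"]] S[OF pq]])
    then show "transpose_mat A $$ (p, q) = A $$ (p, q)" using pq A by simp
  qed (use A in auto)
  let ?D = "\<lambda>i. D (if i < s then i else i - s)"
  have Dpos: "?D i > 0" if "i < s + s" for i using that D(2)[of i] D(2)[of "i - s"] by auto
  obtain v \<zeta> where v: "\<And>x. (\<Sum>p<s + s. (\<Sum>i<s + s. v p i * x i)\<^sup>2) = (\<Sum>i<s + s. (x i)\<^sup>2 / ?D i)"
    and orth: "\<And>p q. p < s + s \<Longrightarrow> q < s + s \<Longrightarrow>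
      (\<Sum>i<s + s. \<Sum>j<s + s. v p i * v q j * A $$ (i, j)) = (if p = q then \<zeta> p else 0)"
    and cp: "char_poly (A * mat_diag (s + s) (\<lambda>i. 1 / ?D i)) = (\<Prod>p<s + s. [:- \<zeta> p, 1:])"
    using scaled_diagonalization[OF A sym, of ?D] Dpos by blast
  let ?P = "\<lambda>lam. \<Prod>p<s + s. \<integral>g. exp (- lam * \<zeta> p * g\<^sup>2) \<partial>std_normal_distribution"
  let ?n = "\<lambda>k. m k * l k"
  have n: "filterlim ?n at_top sequentially"
  proof (rule filterlim_at_top_mono[OF m])
    have "\<forall>\<^sub>F k in sequentially. l k \<ge> 1" using l by (auto simp: filterlim_at_top)
    then show "\<forall>\<^sub>F k in sequentially. m k \<le> ?n k" by eventually_elim simp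
  qed
  \<comment> \<open>\<zeta> p is a limit of quadratic lag sums of combined weights, that is of
    variances.\<close>
  have \<zeta>0: "\<zeta> p \<ge> 0" if p: "p < s + s" for p
  proof (rule LIMSEQ_le_const)
    show "(\<lambda>n. \<Sum>i<s + s. \<Sum>j<s + s. v p i * v p j * (?C i j n)) \<longlonglongrightarrow> \<zeta> p"
    proof -
      have "(\<lambda>n. \<Sum>i<s + s. \<Sum>j<s + s. v p i * v p j * (?C i j n))
        \<longlonglongrightarrow> (\<Sum>i<s + s. \<Sum>j<s + s. v p i * v p j * A $$ (i, j))" by (intro tendsto_sum tendsto_mult_left S) auto
      then show ?thesis using orth[OF p p] by simp
    qed
    have nn: "0 \<le> (\<Sum>i<s + s. \<Sum>j<s + s. v p i * v p j * (?C i j n))" for n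
    proof -
      have "0 \<le> \<sigma>\<^sup>2 / real n powr \<kappa> * cross_sum (\<lambda>u. \<Sum>i<s + s. v p i * w i n u) (\<lambda>u. \<Sum>i<s + s. v p i * w i n u) 0 0 n"
        by (intro mult_nonneg_nonneg cross_sum_nonneg) auto
      also have "\<dots> = (\<Sum>i<s + s. \<Sum>j<s + s. v p i * v p j * (?C i j n))"
        unfolding weighted_lag_sum_sum sum_distrib_left by (intro sum.cong refl) simp
      finally show ?thesis .
    qed
    show "\<exists>N. \<forall>n\<ge>N. 0 \<le> (\<Sum>i<s + s. \<Sum>j<s + s. v p i * v p j * (?C i j n))"
      by (intro exI allI impI nn)
  qed
  define J where "J k i \<omega> = weighted_sum Y (w i (?n k)) 0 (?n k) \<omega> / sqrt (real (?n k) powr \<kappa>)" for k i \<omega>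
  have [measurable]: "J k i \<in> borel_measurable M" for k i unfolding J_def[abs_def] by measurable
  define V where "V k j \<omega> = (J k j \<omega>)\<^sup>2 + (J k (s + j) \<omega>)\<^sup>2" for k j \<omega>
  define D' where "D' k j \<omega> = (\<Sum>h<m k. (weighted_sum Y (w j (l k)) (h * l k) (l k) \<omega>)\<^sup>2 + (weighted_sum Y (w (s + j) (l k)) (h * l k) (l k) \<omega>)\<^sup>2)
          / (real (m k) * real (l k) powr \<kappa>)" for k j \<omega>
  have quad: "(\<Sum>p<s + s. (\<Sum>i<s + s. v p i * J k i \<omega>)\<^sup>2) = (\<Sum>j<s. V k j \<omega> / D j)" for k \<omega>
    unfolding v unfolding sum_lessThan_double by (simp add: V_def sum.distrib add_divide_distrib)
  have L: "(\<lambda>k. expectation (\<lambda>\<omega>. exp (- lam * (\<Sum>j<s. V k j \<omega> / D j))))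
     \<longlonglongrightarrow> (?P lam)" if lam: "lam \<ge> 0" for lam
    unfolding quad[symmetric]
  proof (rule Laplace_sum_squares_tendsto[OF _ _ \<zeta>0 lam])
    fix u :: "nat \<Rightarrow> real"
    \<comment> \<open>A linear form in the transformed coefficients with frequencies u is one in the
      original coefficients with frequencies x; \<open>orth\<close> then turns its limiting variance
      into a diagonal form in u.\<close>
    define x where "x i = (\<Sum>p<s + s. u p * v p i)" for i
    have "(\<lambda>k. expectation (\<lambda>\<omega>. iexp (\<Sum>i<s + s. x i * J k i \<omega>)))
       \<longlonglongrightarrow> complex_of_real (exp (- (\<Sum>i<s + s. \<Sum>j<s + s. x i * x j * (\<sigma>\<^sup>2 * S i j)) / 2))"
      unfolding J_def by (rule filterlim_compose[OF char_weighted_sums_tendsto[OF cs inc] n])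
    moreover have "(\<Sum>i<s + s. x i * J k i \<omega>) = (\<Sum>p<s + s. u p * (\<Sum>i<s + s. v p i * J k i \<omega>))" for k \<omega>
      unfolding x_def sum_distrib_right sum_distrib_left by (subst sum.swap) (simp add: mult_ac)
    moreover have "(\<Sum>i<s + s. \<Sum>j<s + s. x i * x j * (\<sigma>\<^sup>2 * S i j)) = (\<Sum>p<s + s. \<zeta> p * (u p)\<^sup>2)"
    proof -
      have "(\<Sum>i<s + s. \<Sum>j<s + s. x i * x j * A $$ (i, j))
        = (\<Sum>i<s + s. \<Sum>j<s + s. \<Sum>p<s + s. \<Sum>q<s + s. u p * u q * (v p i * v q j * A $$ (i, j)))"
        unfolding x_def sum_product unfolding sum_distrib_right by (intro sum.cong refl) (simp add: mult_ac)
      also have "\<dots> = (\<Sum>i<s + s. \<Sum>p<s + s. \<Sum>j<s + s. \<Sum>q<s + s. u p * u q * (v p i * v q j * A $$ (i, j)))"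
        by (intro sum.cong refl sum.swap)
      also have "\<dots> = (\<Sum>p<s + s. \<Sum>i<s + s. \<Sum>j<s + s. \<Sum>q<s + s. u p * u q * (v p i * v q j * A $$ (i, j)))"
        by (rule sum.swap)
      also have "\<dots> = (\<Sum>p<s + s. \<Sum>i<s + s. \<Sum>q<s + s. \<Sum>j<s + s. u p * u q * (v p i * v q j * A $$ (i, j)))"
        by (intro sum.cong refl sum.swap)
      also have "\<dots> = (\<Sum>p<s + s. \<Sum>q<s + s. \<Sum>i<s + s. \<Sum>j<s + s. u p * u q * (v p i * v q j * A $$ (i, j)))"
        by (intro sum.cong refl sum.swap)
      also have "\<dots> = (\<Sum>p<s + s. \<Sum>q<s + s. u p * u q * (if p = q then \<zeta> p else 0))"
        unfolding sum_distrib_left[symmetric] by (intro sum.cong refl) (simp only: orth lessThan_iff)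
      also have "\<dots> = (\<Sum>p<s + s. \<Sum>q<s + s. if p = q then \<zeta> p * (u p)\<^sup>2 else 0)"
        by (intro sum.cong refl) (auto simp: power2_eq_square)
      also have "\<dots> = (\<Sum>p<s + s. \<zeta> p * (u p)\<^sup>2)" by (simp add: sum.delta)
      finally show ?thesis by (simp only: sS)
    qed
    ultimately show "(\<lambda>k. expectation (\<lambda>\<omega>. iexp (\<Sum>p<s + s. u p * (\<Sum>i<s + s. v p i * J k i \<omega>))))
        \<longlonglongrightarrow> complex_of_real (exp (- (\<Sum>p<s + s. \<zeta> p * (u p)\<^sup>2) / 2))"
      by (simp only:)
  qed auto
  obtain B where B: "\<And>j k. j < s \<Longrightarrow> integrable M (V k j)" "\<And>j k. j < s \<Longrightarrow> expectation (V k j) \<le> B"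
  proof -
    have "\<exists>B. \<forall>n. \<sigma>\<^sup>2 * (cross_sum (w i n) (w i n) 0 0 n / real n powr \<kappa>) \<le> B" if "i \<in> {..<s + s}" for i
    proof -
      have i: "i < s + s" using that by simp
      show ?thesis
      proof (rule BseqE[OF convergent_imp_Bseq[OF convergentI[OF S[OF i i]]]])
        fix K assume K: "\<forall>n. norm (\<sigma>\<^sup>2 * (cross_sum (w i n) (w i n) 0 0 n / real n powr \<kappa>)) \<le> K"
        show ?thesis
          by (rule exI[of _ K], rule allI, rule order_trans[OF abs_ge_self K[rule_format, unfolded real_norm_def]])
      qed
    qed
    from bchoice[OF ballI[OF this]]
    obtain b where b': "\<forall>i\<in>{..<s + s}. \<forall>n. \<sigma>\<^sup>2 * (cross_sum (w i n) (w i n) 0 0 n / real n powr \<kappa>) \<le> b i" ..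
    have b: "\<sigma>\<^sup>2 * (cross_sum (w i n) (w i n) 0 0 n / real n powr \<kappa>) \<le> b i" if "i < s + s" for i n
      by (rule b'[THEN bspec, THEN spec]) (simp add: that)
    have J2: "(J k i \<omega>)\<^sup>2 = (weighted_sum Y (w i (?n k)) 0 (?n k) \<omega>)\<^sup>2 / real (?n k) powr \<kappa>" for k i \<omega>
      by (simp add: J_def power_divide)
    have iJ: "integrable M (\<lambda>\<omega>. (J k i \<omega>)\<^sup>2)" for k i unfolding J2 by (intro integrable_divide_zero weighted_sum_square)
    have eJ: "expectation (\<lambda>\<omega>. (J k i \<omega>)\<^sup>2) \<le> \<bar>b i\<bar>" if "i < s + s" for k i
    proof -
      have "expectation (\<lambda>\<omega>. (J k i \<omega>)\<^sup>2) \<le> \<sigma>\<^sup>2 * cross_sum (w i (?n k)) (w i (?n k)) 0 0 (?n k) / real (?n k) powr \<kappa>"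
        unfolding J2 integral_divide_zero by (intro divide_right_mono weighted_sum_square) simp
      then show ?thesis using b[OF that, of "?n k"] by simp
    qed
    show ?thesis
    proof
      fix j k assume j: "j < s"
      show "integrable M (V k j)" unfolding V_def by (intro Bochner_Integration.integrable_add iJ)
      have "expectation (V k j) = expectation (\<lambda>\<omega>. (J k j \<omega>)\<^sup>2) + expectation (\<lambda>\<omega>. (J k (s + j) \<omega>)\<^sup>2)"
        unfolding V_def by (rule Bochner_Integration.integral_add[OF iJ iJ])
      also have "\<dots> \<le> \<bar>b j\<bar> + \<bar>b (s + j)\<bar>" using eJ[of j k] eJ[of "s + j" k] j by simp
      also have "\<dots> \<le> (\<Sum>i<s. \<bar>b i\<bar>) + (\<Sum>i<s. \<bar>b (s + i)\<bar>)"
        using j by (intro add_mono member_le_sum) auto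
      finally show "expectation (V k j) \<le> (\<Sum>i<s. \<bar>b i\<bar>) + (\<Sum>i<s. \<bar>b (s + i)\<bar>)" .
    qed
  qed
  let ?a = "\<lambda>i k \<omega>. (\<Sum>h<m k. (weighted_sum Y (w i (l k)) (h * l k) (l k) \<omega>)\<^sup>2) / (real (m k) * real (l k) powr \<kappa>)"
  let ?H = "\<lambda>k j. \<lambda>\<omega>. \<bar>D' k j \<omega> - D j\<bar>"
  have LLN1: "integrable M (\<lambda>\<omega>. \<bar>?a i k \<omega> - A $$ (i, i)\<bar>)" if i: "i < s + s" for i k
    unfolding sS[symmetric] by (rule block_average_tendsto(1)[OF cs[OF i i] inc[OF i] \<eta> far[OF i] m l])
  have LLN2: "(\<lambda>k. expectation (\<lambda>\<omega>. \<bar>?a i k \<omega> - A $$ (i, i)\<bar>)) \<longlonglongrightarrow> 0" if i: "i < s + s" for i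
    unfolding sS[symmetric] by (rule block_average_tendsto(2)[OF cs[OF i i] inc[OF i] \<eta> far[OF i] m l])
  have D'a: "D' k j \<omega> = ?a j k \<omega> + ?a (s + j) k \<omega>" for k j \<omega>
    by (simp add: D'_def sum.distrib add_divide_distrib)
  have D': "integrable M (?H k j)" "(\<lambda>k. expectation (?H k j)) \<longlonglongrightarrow> 0" if j: "j < s" for j k
  proof -
    have jj: "j < s + s" "s + j < s + s" using j by auto
    show i: "integrable M (?H k j)" for k
      unfolding D'a by (intro integrable_abs Bochner_Integration.integrable_diff Bochner_Integration.integrable_add
        integrable_divide_zero Bochner_Integration.integrable_sum weighted_sum_square) auto
    have lim: "(\<lambda>k. expectation (\<lambda>\<omega>. \<bar>?a j k \<omega> - A $$ (j, j)\<bar>) + expectation (\<lambda>\<omega>. \<bar>?a (s + j) k \<omega> - A $$ (s + j, s + j)\<bar>)) \<longlonglongrightarrow> 0"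
      using tendsto_add[OF LLN2[OF jj(1)] LLN2[OF jj(2)]] by simp
    show "(\<lambda>k. expectation (?H k j)) \<longlonglongrightarrow> 0"
    proof (rule Lim_null_comparison[OF always_eventually lim], rule allI)
      fix k
      have "expectation (?H k j) \<le> expectation (\<lambda>\<omega>. \<bar>?a j k \<omega> - A $$ (j, j)\<bar> + \<bar>?a (s + j) k \<omega> - A $$ (s + j, s + j)\<bar>)"
        unfolding D'a D(1)[OF j]
        by (intro integral_mono Bochner_Integration.integrable_add LLN1[OF jj(1)] LLN1[OF jj(2)] i[of k, unfolded D'a D(1)[OF j]] abs_diff_triangle_ineq)
      also have "\<dots> = expectation (\<lambda>\<omega>. \<bar>?a j k \<omega> - A $$ (j, j)\<bar>) + expectation (\<lambda>\<omega>. \<bar>?a (s + j) k \<omega> - A $$ (s + j, s + j)\<bar>)"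
        by (rule Bochner_Integration.integral_add[OF LLN1[OF jj(1)] LLN1[OF jj(2)]])
      finally show "norm (expectation (?H k j)) \<le> \<dots>" by simp
    qed
  qed
  have V0: "V k j \<omega> \<ge> 0" for k j \<omega> by (simp add: V_def)
  have D'0: "D' k j \<omega> \<ge> 0" for k j \<omega> unfolding D'_def by (intro divide_nonneg_nonneg sum_nonneg) auto
  have [measurable]: "V k j \<in> borel_measurable M" "D' k j \<in> borel_measurable M" for k j
    unfolding V_def[abs_def] D'_def[abs_def] by measurable
  have R: "(\<lambda>k. expectation (\<lambda>\<omega>. exp (- lam * (\<Sum>j<s. V k j \<omega> / D' k j \<omega>))))
     \<longlonglongrightarrow> (?P lam)" if lam: "lam \<ge> 0" for lam
  proof -
    have "(\<lambda>k. expectation (\<lambda>\<omega>. exp (- lam * (\<Sum>j<s. V k j \<omega> / D' k j \<omega>)))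
      - expectation (\<lambda>\<omega>. exp (- lam * (\<Sum>j<s. V k j \<omega> / D j)))) \<longlonglongrightarrow> 0"
    proof (rule Laplace_ratio_sum_tendsto[where B = B, OF _ _ _ _ _ _ _ _ _ lam])
      fix k j :: nat and \<omega> assume j: "j < s"
      show "V k j \<omega> \<ge> 0" "D' k j \<omega> \<ge> 0" by (rule V0, rule D'0)
      show "integrable M (V k j)" "expectation (V k j) \<le> B" "D j > 0" by (rule B(1)[OF j], rule B(2)[OF j], rule D(2)[OF j])
      show "integrable M (?H k j)" by (rule D'(1)[OF j])
      show "(\<lambda>k. expectation (?H k j)) \<longlonglongrightarrow> 0" by (rule D'(2)[OF j])
    qed measurable
    from tendsto_add[OF this L[OF lam]] show ?thesis by simp
  qed
  have VJ: "V k j \<omega> = ((weighted_sum Y (w j (?n k)) 0 (?n k) \<omega>)\<^sup>2 + (weighted_sum Y (w (s + j) (?n k)) 0 (?n k) \<omega>)\<^sup>2) / real (?n k) powr \<kappa>" for k j \<omega>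
    by (simp add: V_def J_def power_divide add_divide_distrib)
  show ?thesis by (rule that[OF \<zeta>0 cp R[unfolded VJ D'_def]])
qed

end

section \<open>Periodograms as squares of weighted sums\<close>

lemma trig_plus_nat: "trig b p (real k + x) = trig b p x"
proof (induction k)
  case (Suc k)
  have "real (Suc k) + x = 1 + (real k + x)" by simp
  then show ?case using Suc by (simp only: trig_plus_1)
qed simp

definition base_process :: "real \<Rightarrow> (nat \<Rightarrow> 'a \<Rightarrow> real) \<Rightarrow> nat \<Rightarrow> 'a \<Rightarrow> real" where
  "base_process d X = (if d < 1/2 then X else increments X)"

definition base_weight :: "real \<Rightarrow> bool \<Rightarrow> nat \<Rightarrow> nat \<Rightarrow> nat \<Rightarrow> real" where
  "base_weight d b p n = (if d < 1/2 then (\<lambda>u. trig b p (real u / real n)) else tail_trig b p n)"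

text \<open>X is telescoped back to the value just before the block; that value is multiplied by the
  sum of the weights, which is 0, so the arbitrary level of X drops out. Exchanging the sums leaves
  tail sums as weights.\<close>

lemma weighted_sum_increments:
  assumes "(\<Sum>u = 1..l. f u) = 0"
  shows "(\<Sum>u = 1..l. f u * X (p + u) \<omega>) = weighted_sum (increments X) (\<lambda>v. \<Sum>u = v..l. f u) p l \<omega>"
proof -
  have X: "X (p + u) \<omega> = X p \<omega> + (\<Sum>v = 1..u. increments X (p + v) \<omega>)" for u
    by (induction u) (auto simp: increments_def)
  have "(\<Sum>u = 1..l. f u * X (p + u) \<omega>) = (\<Sum>u = 1..l. f u * (\<Sum>v = 1..u. increments X (p + v) \<omega>))"
    unfolding X using assms by (simp add: distrib_left sum.distrib sum_distrib_right[symmetric])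
  also have "\<dots> = (\<Sum>u = 1..l. \<Sum>v = 1..l. if v \<le> u then f u * increments X (p + v) \<omega> else 0)"
    unfolding sum_distrib_left by (intro sum.cong refl sum.mono_neutral_cong_left) auto
  also have "\<dots> = (\<Sum>v = 1..l. \<Sum>u = 1..l. if v \<le> u then f u * increments X (p + v) \<omega> else 0)"
    by (rule sum.swap)
  also have "\<dots> = (\<Sum>v = 1..l. \<Sum>u = v..l. f u * increments X (p + v) \<omega>)"
    by (intro sum.cong refl sum.mono_neutral_cong_right) auto
  finally show ?thesis by (simp add: weighted_sum_def sum_distrib_right)
qed

lemma trig_block_sum:
  assumes "1 \<le> j" "j < l"
  shows "(\<Sum>u = 1..l. trig b j (real u / real l) * X (p + u) \<omega>) = weighted_sum (base_process d X) (base_weight d b j l) p l \<omega>"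
proof (cases "d < 1/2")
  case True
  then show ?thesis by (simp add: weighted_sum_def base_process_def base_weight_def)
next
  case False
  then show ?thesis
    using weighted_sum_increments[OF sum_trig_eq_0[OF assms], of b X p \<omega>]
    by (simp add: base_process_def base_weight_def tail_trig_def[abs_def])
qed

text \<open>The offset (h - 1) l of the block is a whole number of periods, so it leaves no phase,
  and all blocks share the same weights.\<close>

lemma block_periodogram_eq:
  assumes h: "1 \<le> h" and j: "1 \<le> j" "j < l"
  shows "block_periodogram X l h (2 * pi * real j / real l) \<omega>
    = 1 / (2 * pi * real l) * ((weighted_sum (base_process d X) (base_weight d True j l) ((h - 1) * l) l \<omega>)\<^sup>2
      + (weighted_sum (base_process d X) (base_weight d False j l) ((h - 1) * l) l \<omega>)\<^sup>2)"
proof -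
  let ?p = "(h - 1) * l"
  have hl: "h * l = ?p + l" using h by (cases h) auto
  have ph: "trig b j (real (?p + u) / real l) = trig b j (real u / real l)" for b u
  proof -
    have "real (?p + u) / real l = real (h - 1) + real u / real l" using j by (simp add: add_divide_distrib)
    then show ?thesis by (simp only: trig_plus_nat)
  qed
  have e: "complex_of_real x * exp (\<i> * complex_of_real (real t * (2 * pi * real j / real l)))
     = Complex (trig True j (real t / real l) * x) (trig False j (real t / real l) * x)" for x t
  proof -
    have "real t * (2 * pi * real j / real l) = 2 * pi * real j * (real t / real l)" by simp
    then show ?thesis by (simp only: cis_conv_exp[symmetric]) (simp add: complex_eq_iff trig_def)
  qed
  let ?S = "\<lambda>b. \<Sum>u = 1..l. trig b j (real u / real l) * X (?p + u) \<omega>"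
  have "(\<Sum>t = ?p + 1..h * l. complex_of_real (X t \<omega>) * exp (\<i> * complex_of_real (real t * (2 * pi * real j / real l))))
     = (\<Sum>u = 1..l. Complex (trig True j (real (?p + u) / real l) * X (?p + u) \<omega>) (trig False j (real (?p + u) / real l) * X (?p + u) \<omega>))"
    unfolding e hl by (rule sum.reindex_bij_witness[of _ "\<lambda>u. ?p + u" "\<lambda>t. t - ?p"]) auto
  also have "\<dots> = Complex (?S True) (?S False)" unfolding ph by (simp add: complex_eq_iff)
  finally have "block_periodogram X l h (2 * pi * real j / real l) \<omega> = 1 / (2 * pi * real l) * ((?S True)\<^sup>2 + (?S False)\<^sup>2)"
    unfolding block_periodogram_def by (simp add: cmod_power2)
  then show ?thesis unfolding trig_block_sum[OF j, where d = d] .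
qed

lemma periodogram_eq_block: "periodogram X n \<theta> \<omega> = block_periodogram X n 1 \<theta> \<omega>"
  by (simp add: periodogram_def block_periodogram_def)

text \<open>The factors 2 pi cancel, and both normalisations reduce to m^(- 2 d) times the quotient
  of the unscaled sums because n = m l. The condition s < l makes the trigonometric sums over every
  block vanish.\<close>

lemma Q_stat_eq:
  assumes m: "m \<ge> 1" and l: "s < l"
  shows "Q_stat X s d m l \<omega> = (\<Sum>j<s.
    ((weighted_sum (base_process d X) (base_weight d True (Suc j) (m * l)) 0 (m * l) \<omega>)\<^sup>2
      + (weighted_sum (base_process d X) (base_weight d False (Suc j) (m * l)) 0 (m * l) \<omega>)\<^sup>2) / real (m * l) powr (2 * d + 1)
    / ((\<Sum>h<m. (weighted_sum (base_process d X) (base_weight d True (Suc j) l) (h * l) l \<omega>)\<^sup>2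
      + (weighted_sum (base_process d X) (base_weight d False (Suc j) l) (h * l) l \<omega>)\<^sup>2) / (real m * real l powr (2 * d + 1))))"
proof -
  let ?V = "\<lambda>j. (weighted_sum (base_process d X) (base_weight d True (Suc j) (m * l)) 0 (m * l) \<omega>)\<^sup>2
      + (weighted_sum (base_process d X) (base_weight d False (Suc j) (m * l)) 0 (m * l) \<omega>)\<^sup>2"
  let ?F = "\<lambda>j h. (weighted_sum (base_process d X) (base_weight d True (Suc j) l) (h * l) l \<omega>)\<^sup>2
      + (weighted_sum (base_process d X) (base_weight d False (Suc j) l) (h * l) l \<omega>)\<^sup>2"
  have "l \<le> m * l" using m by simp
  then have ml: "s < m * l" using l by linarith
  have l0: "real l > 0" and m0: "real m > 0" using l m by auto
  have p: "real m powr (- 2 * d) * (1 / (2 * pi * real (m * l)) * V / (1 / real m * (1 / (2 * pi * real l) * F)))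
     = V / real (m * l) powr (2 * d + 1) / (F / (real m * real l powr (2 * d + 1)))" for V F
  proof -
    have "real (m * l) powr (2 * d + 1) = real m powr (2 * d + 1) * real l powr (2 * d + 1)"
      using l0 m0 by (simp add: powr_mult)
    moreover have "real m powr (2 * d + 1) * real m powr (- 2 * d) = real m"
      unfolding powr_add[symmetric] using m0 by simp
    \<comment> \<open>For F = 0 both sides are 0 by the convention for division.\<close>
    ultimately show ?thesis using l0 m0 by (cases "F = 0") (simp_all add: field_simps)
  qed
  have "Q_stat X s d m l \<omega> = real m powr (- 2 * d) * (\<Sum>j = 1..s. periodogram X (m * l) (2 * pi * real j / real (m * l)) \<omega> /
         (1 / real m * (\<Sum>h = 1..m. block_periodogram X l h (2 * pi * real j / real l) \<omega>)))"
    by (simp only: Q_stat_def Let_def)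
  also have "\<dots> = (\<Sum>j<s. real m powr (- 2 * d) * (periodogram X (m * l) (2 * pi * real (Suc j) / real (m * l)) \<omega> /
         (1 / real m * (\<Sum>h<m. block_periodogram X l (Suc h) (2 * pi * real (Suc j) / real l) \<omega>))))"
    unfolding One_nat_def sum.atLeast1_atMost_eq sum_distrib_left ..
  also have "\<dots> = (\<Sum>j<s. real m powr (- 2 * d) * (1 / (2 * pi * real (m * l)) * ?V j / (1 / real m * (1 / (2 * pi * real l) * (\<Sum>h<m. ?F j h)))))"
  proof (intro sum.cong refl)
    fix j assume "j \<in> {..<s}"
    then have j: "1 \<le> Suc j" "Suc j < l" "Suc j < m * l" using l ml by auto
    have V: "periodogram X (m * l) (2 * pi * real (Suc j) / real (m * l)) \<omega> = 1 / (2 * pi * real (m * l)) * ?V j"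
      unfolding periodogram_eq_block block_periodogram_eq[OF order_refl j(1,3), where d = d] by simp
    have F: "block_periodogram X l (Suc h) (2 * pi * real (Suc j) / real l) \<omega> = 1 / (2 * pi * real l) * ?F j h" for h
      using block_periodogram_eq[of "Suc h" "Suc j" l X \<omega> d] j by simp
    show "real m powr (- 2 * d) * (periodogram X (m * l) (2 * pi * real (Suc j) / real (m * l)) \<omega> /
         (1 / real m * (\<Sum>h<m. block_periodogram X l (Suc h) (2 * pi * real (Suc j) / real l) \<omega>)))
      = real m powr (- 2 * d) * (1 / (2 * pi * real (m * l)) * ?V j / (1 / real m * (1 / (2 * pi * real l) * (\<Sum>h<m. ?F j h))))"
      unfolding V F sum_distrib_left ..
  qed
  finally show ?thesis unfolding p .
qed

lemma Q_stat_nonneg: "Q_stat X s d m l \<omega> \<ge> 0"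
  unfolding Q_stat_def Let_def periodogram_def block_periodogram_def
  by (intro mult_nonneg_nonneg sum_nonneg divide_nonneg_nonneg) auto

lemma Sigma_entry_scale: "Sigma_entry d (x * \<delta>) c c' i j = x * Sigma_entry d \<delta> c c' i j"
  by (simp add: Sigma_entry_def Sigma_c_def Sigma_s_def algebra_simps)

lemma (in prob_space) I_process_measurable:
  assumes "I_process d a c \<sigma> \<epsilon> X"
  shows "X t \<in> borel_measurable M"
proof (cases "d < 1/2")
  case True
  then show ?thesis using assms by (simp add: I_process_def stationary_I_process_def linear_process_def)
next
  case False
  then have 0: "X 0 \<in> borel_measurable M" and i: "\<And>t. t \<ge> 1 \<Longrightarrow> increments X t \<in> borel_measurable M"
    using assms by (auto simp: I_process_def stationary_I_process_def linear_process_def)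
  show ?thesis
  proof (induction t)
    case (Suc t)
    have "(\<lambda>\<omega>. X t \<omega> + increments X (Suc t) \<omega>) \<in> borel_measurable M"
      using Suc i[of "Suc t"] by (intro borel_measurable_add) auto
    then show ?case by (simp add: increments_def)
  qed (rule 0)
qed

lemma (in prob_space) Q_stat_measurable:
  assumes "I_process d a c \<sigma> \<epsilon> X"
  shows "Q_stat X s d' m l \<in> borel_measurable M"
proof -
  note [measurable] = I_process_measurable[OF assms]
  show ?thesis
    unfolding Q_stat_def[abs_def] Let_def periodogram_def block_periodogram_def by measurable
qed

lemma (in prob_space) I_process_base_process:
  assumes X: "I_process d a c \<sigma> \<epsilon> X" and d: "- 1/2 < d" "d < 3/2"
  defines "d' \<equiv> if d < 1/2 then d else d - 1"
  shows "linear_proc M \<sigma> \<epsilon> a (base_process d X)" "memory_coeffs d' a c" "- 1/2 \<le> d'" "d' < 1/2"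
    "I_delta d a c \<sigma> X = delta d' a c \<sigma> (base_process d X)"
proof -
  have s: "\<exists>T. {1..} \<subseteq> T \<and> stationary_I_process T d' a c \<sigma> \<epsilon> (base_process d X)"
  proof (cases "d < 1/2")
    case True
    then show ?thesis using X by (intro exI[of _ "{0..}"]) (auto simp: I_process_def base_process_def d'_def)
  next
    case False
    then show ?thesis using X by (intro exI[of _ "{1..}"]) (auto simp: I_process_def base_process_def d'_def)
  qed
  then obtain T where T: "{1..} \<subseteq> T" and s: "stationary_I_process T d' a c \<sigma> \<epsilon> (base_process d X)" by blast
  show mc: "memory_coeffs d' a c" using s by (simp add: stationary_I_process_def)
  show "- 1/2 \<le> d'" "d' < 1/2" using d by (auto simp: d'_def)
  show "I_delta d a c \<sigma> X = delta d' a c \<sigma> (base_process d X)" by (simp add: I_delta_def base_process_def d'_def)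
  show "linear_proc M \<sigma> \<epsilon> a (base_process d X)"
  proof (intro linear_proc.intro innovation_space.intro linear_proc_axioms.intro innovation_space_axioms.intro)
    show "prob_space M" by unfold_locales
    show "innovations \<sigma> \<epsilon>" using s by (simp add: stationary_I_process_def)
    show "summable (\<lambda>j. (a j)\<^sup>2)" using mc by (simp add: memory_coeffs_def)
    show "linear_process {1..} a \<epsilon> (base_process d X)"
      using s T by (auto simp: stationary_I_process_def linear_process_def)
  qed
qed

text \<open>Makes the definite description in \<open>autocov_const\<close> denote the constant
  found.\<close>

lemma asymp_equiv_const_unique:
  fixes f :: "nat \<Rightarrow> real"
  assumes "f \<sim>[at_top] (\<lambda>h. C * real h powr \<beta>)" "f \<sim>[at_top] (\<lambda>h. C' * real h powr \<beta>)" "C' \<noteq> 0"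
  shows "C = C'"
proof -
  have "(\<lambda>h. C * real h powr \<beta>) \<sim>[at_top] (\<lambda>h::nat. C' * real h powr \<beta>)"
    using asymp_equiv_trans[OF asymp_equiv_symI[OF assms(1)] assms(2)] .
  from asymp_equivD[OF this]
  have "(\<lambda>h::nat. if C * real h powr \<beta> = 0 \<and> C' * real h powr \<beta> = 0 then 1 else C * real h powr \<beta> / (C' * real h powr \<beta>)) \<longlonglongrightarrow> 1" .
  moreover have "\<forall>\<^sub>F h::nat in sequentially.
      (if C * real h powr \<beta> = 0 \<and> C' * real h powr \<beta> = 0 then 1 else C * real h powr \<beta> / (C' * real h powr \<beta>)) = C / C'"
    using eventually_gt_at_top[of 0] by eventually_elim (use assms(3) in simp)
  ultimately have "(\<lambda>h::nat. C / C') \<longlonglongrightarrow> 1" by (rule Lim_transform_eventually)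
  then have "C / C' = 1" by (simp add: LIMSEQ_const_iff)
  then show ?thesis using assms(3) by simp
qed

text \<open>The three definitions of \<delta> become one formula: for d = 0 and d = - 1/2 the value
  of g is explicit, and otherwise the autocovariance constant \<sigma>^2 d g divided by d (2 d + 1)
  leaves \<sigma>^2 g / (2 d + 1).\<close>

lemma (in linear_proc) delta_eq:
  assumes mc: "memory_coeffs d a c" and d: "- 1/2 \<le> d" "d < 1/2"
  obtains g where "g > 0" "(\<lambda>h. lag_partial_sum (lag_product a) h / real h powr (2 * d)) \<longlonglongrightarrow> g"
    "delta d a c \<sigma> Y = \<sigma>\<^sup>2 * (if d = - 1/2 then g else g / (2 * d + 1))"
proof -
  obtain g where g: "g > 0" "(\<lambda>h. lag_partial_sum (lag_product a) h / real h powr (2 * d)) \<longlonglongrightarrow> g"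
    and r: "d \<noteq> 0 \<Longrightarrow> (\<lambda>h. lag_product a h / real h powr (2 * d - 1)) \<longlonglongrightarrow> d * g"
    and g0: "d = 0 \<Longrightarrow> g = (\<Sum>j. a j)\<^sup>2" and g1: "d = - 1/2 \<Longrightarrow> g = 8 * c\<^sup>2"
    using memory_coeffs_lag_asymptotics[OF mc d] by blast
  have s2: "\<sigma>\<^sup>2 > 0" using sigma_pos by simp
  have "autocov_const d Y = \<sigma>\<^sup>2 * (d * g)" if d0: "d \<noteq> 0"
    unfolding autocov_const_def
  proof (rule the_equality)
    let ?C = "\<sigma>\<^sup>2 * (d * g)"
    have C: "?C \<noteq> 0" using s2 d0 g(1) by simp
    have ae: "autocov Y \<sim>[at_top] (\<lambda>h. ?C * real h powr (2 * d - 1))"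
    proof (rule asymp_equivI')
      have "(\<lambda>h. \<sigma>\<^sup>2 * (lag_product a h / real h powr (2 * d - 1)) / ?C) \<longlonglongrightarrow> ?C / ?C"
        by (intro tendsto_divide tendsto_mult_left r d0 tendsto_const C)
      then show "(\<lambda>h. autocov Y h / (?C * real h powr (2 * d - 1))) \<longlonglongrightarrow> 1"
        using C by (simp add: autocov_Y mult.commute)
    qed
    show "?C \<noteq> 0 \<and> autocov Y \<sim>[at_top] (\<lambda>h. ?C * real h powr (2 * d - 1))" using C ae by blast
    fix C' assume "C' \<noteq> 0 \<and> autocov Y \<sim>[at_top] (\<lambda>h. C' * real h powr (2 * d - 1))"
    then show "C' = ?C" using asymp_equiv_const_unique[OF _ ae C] by blast
  qed
  then have "delta d a c \<sigma> Y = \<sigma>\<^sup>2 * (if d = - 1/2 then g else g / (2 * d + 1))"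
    using g0 g1 by (auto simp: delta_def)
  then show ?thesis using that g by blast
qed

section \<open>The matrices, the limit law and the assembly\<close>

lemma Sigma_mat_entry:
  assumes "p < s + s" "q < s + s"
  shows "Sigma_mat s d \<delta> $$ (p, q) = Sigma_entry d \<delta> (p < s) (q < s)
    (if p < s then Suc p else Suc (p - s)) (if q < s then Suc q else Suc (q - s))"
  using assms by (auto simp: Sigma_mat_def Sigma_entry_def)

lemma Sigma_mat_carrier: "Sigma_mat s d \<delta> \<in> carrier_mat (s + s) (s + s)"
  by (simp add: Sigma_mat_def)

lemma D_mat_eq:
  "D_mat s d \<delta> = mat_diag (s + s) (\<lambda>i. Sigma_c d \<delta> (Suc (if i < s then i else i - s)) (Suc (if i < s then i else i - s))
     + Sigma_s d \<delta> (Suc (if i < s then i else i - s)) (Suc (if i < s then i else i - s)))"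
  unfolding D_mat_def Let_def by (rule eq_matI) (auto simp: mat_diag_def)

lemma inverts_mat_diag:
  assumes "\<And>i. i < n \<Longrightarrow> f i \<noteq> (0 :: real)"
  shows "inverts_mat (mat_diag n f) (mat_diag n (\<lambda>i. 1 / f i))" "inverts_mat (mat_diag n (\<lambda>i. 1 / f i)) (mat_diag n f)"
proof -
  have "mat_diag n f * mat_diag n (\<lambda>i. 1 / f i) = 1\<^sub>m n" "mat_diag n (\<lambda>i. 1 / f i) * mat_diag n f = 1\<^sub>m n"
    unfolding mat_diag_diag using assms by (auto intro!: eq_matI simp: mat_diag_def)
  then show "inverts_mat (mat_diag n f) (mat_diag n (\<lambda>i. 1 / f i))" "inverts_mat (mat_diag n (\<lambda>i. 1 / f i)) (mat_diag n f)"
    by (simp_all add: inverts_mat_def carrier_matD(1)[OF mat_diag_dim])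
qed

lemma chi_square_1_Laplace:
  "(\<integral>x. exp (- lam * x) \<partial>chi_square_1) = (\<integral>g. exp (- lam * g\<^sup>2) \<partial>std_normal_distribution)"
  unfolding chi_square_1_def by (subst integral_distr) auto

text \<open>Independence factors the Laplace transform; nonnegative weights keep every factor
  bounded by 1 and hence integrable.\<close>

lemma (in prob_space) weighted_chi_square_sum_Laplace:
  fixes Q :: "nat \<Rightarrow> 'a \<Rightarrow> real"
  assumes ind: "indep_vars (\<lambda>_. borel) Q I" and I: "finite I"
    and Q: "\<And>i. i \<in> I \<Longrightarrow> distr M borel (Q i) = chi_square_1" and \<zeta>: "\<And>i. i \<in> I \<Longrightarrow> \<zeta> i \<ge> 0" and lam: "lam \<ge> 0"
  shows "AE \<omega> in M. (\<Sum>i\<in>I. \<zeta> i * Q i \<omega>) \<ge> 0"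
    "expectation (\<lambda>\<omega>. exp (- lam * (\<Sum>i\<in>I. \<zeta> i * Q i \<omega>))) = (\<Prod>i\<in>I. \<integral>g. exp (- lam * \<zeta> i * g\<^sup>2) \<partial>std_normal_distribution)"
proof -
  let ?P = "\<Prod>i\<in>I. \<integral>g. exp (- lam * \<zeta> i * g\<^sup>2) \<partial>std_normal_distribution"
  let ?X = "\<lambda>i. \<lambda>\<omega>. exp (- (lam * \<zeta> i) * Q i \<omega>)"
  have m[measurable]: "Q i \<in> borel_measurable M" if "i \<in> I" for i using ind that by (auto simp: indep_vars_def)
  have "AE x in chi_square_1. x \<ge> 0" unfolding chi_square_1_def by (subst AE_distr_iff) auto
  then have Q0: "AE \<omega> in M. Q i \<omega> \<ge> 0" if "i \<in> I" for i
    using AE_distrD[OF m[OF that]] unfolding Q[OF that] by blast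
  have AE0: "AE \<omega> in M. \<forall>i\<in>I. Q i \<omega> \<ge> 0" using Q0 I by (simp add: AE_finite_all)
  then show "AE \<omega> in M. (\<Sum>i\<in>I. \<zeta> i * Q i \<omega>) \<ge> 0"
    by eventually_elim (use \<zeta> in \<open>auto intro!: sum_nonneg\<close>)
  have "expectation (\<lambda>\<omega>. exp (- lam * (\<Sum>i\<in>I. \<zeta> i * Q i \<omega>))) = expectation (\<lambda>\<omega>. \<Prod>i\<in>I. exp (- (lam * \<zeta> i) * Q i \<omega>))"
    unfolding exp_sum[OF I, symmetric] by (simp add: sum_distrib_left sum_negf mult_ac)
  also have "\<dots> = (\<Prod>i\<in>I. expectation (?X i))"
  proof (rule indep_vars_lebesgue_integral[OF I])
    show "indep_vars (\<lambda>_. borel) (\<lambda>i \<omega>. exp (- (lam * \<zeta> i) * Q i \<omega>)) I"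
      by (rule indep_vars_compose2[OF ind]) auto
    fix i assume i: "i \<in> I"
    note [measurable] = m[OF i]
    show "integrable M (?X i)"
    proof (rule integrable_const_bound[where B = 1])
      show "AE \<omega> in M. norm (exp (- (lam * \<zeta> i) * Q i \<omega>)) \<le> 1"
        using Q0[OF i] by eventually_elim (use \<zeta>[OF i] lam in auto)
    qed measurable
  qed
  also have "\<dots> = ?P"
  proof (rule prod.cong[OF refl])
    fix i assume i: "i \<in> I"
    have "expectation (?X i) = (\<integral>x. exp (- (lam * \<zeta> i) * x) \<partial>distr M borel (Q i))"
      by (rule integral_distr[symmetric, OF m[OF i]]) simp
    then show "expectation (?X i) = (\<integral>g. exp (- lam * \<zeta> i * g\<^sup>2) \<partial>std_normal_distribution)"
      unfolding Q[OF i] chi_square_1_Laplace by simp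
  qed
  finally show "expectation (\<lambda>\<omega>. exp (- lam * (\<Sum>i\<in>I. \<zeta> i * Q i \<omega>))) = ?P" .
qed

text \<open>Provides the hypotheses of \<open>studentized_sum_squares_Laplace\<close> with the
  exponent 2 d + 1 in both regimes: from d = 1/2 on the tail weights are of size up to l, and their
  contribution l^2 raises 2 d' + 1 to 2 d + 1.\<close>

lemma (in linear_proc) base_weight_asymptotics:
  assumes mc: "memory_coeffs d' a c" and d: "- 1/2 < d" "d < 3/2" and d': "d' = (if d < 1/2 then d else d - 1)"
    and g: "(\<lambda>h. lag_partial_sum (lag_product a) h / real h powr (2 * d')) \<longlonglongrightarrow> g"
    and \<delta>: "\<delta> = \<sigma>\<^sup>2 * (if d' = - 1/2 then g else g / (2 * d' + 1))"
  shows "1 \<le> p \<Longrightarrow> 1 \<le> q \<Longrightarrow>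
      (\<lambda>n. \<sigma>\<^sup>2 * (cross_sum (base_weight d b p n) (base_weight d b' q n) 0 0 n / real n powr (2 * d + 1))) \<longlonglongrightarrow> Sigma_entry d \<delta> b b' p q"
    and "1 \<le> p \<Longrightarrow>
      (\<lambda>n. increment_lag_sum (lag_product a) n (base_weight d b p n) / real n powr (2 * d + 1)) \<longlonglongrightarrow> 0"
    and "\<exists>\<eta>. \<eta> \<longlonglongrightarrow> 0 \<and> (\<forall>b p l h h'. l \<ge> 1 \<longrightarrow> h' + 2 \<le> h \<longrightarrow>
      \<bar>cross_sum (base_weight d b p l) (base_weight d b p l) (h * l) (h' * l) l\<bar> \<le> real l powr (2 * d + 1) * \<eta> (h - h'))"
proof -
  define \<delta>0 where "\<delta>0 = (if d' = - 1/2 then g else g / (2 * d' + 1))"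
  have d'b: "- 1/2 \<le> d'" "d' < 1/2" using d by (auto simp: d')
  have g': "(\<lambda>h. lag_partial_sum (lag_product a) h / real h powr ((2 * d' + 1) - 1)) \<longlonglongrightarrow> g" using g by simp
  obtain \<eta> where \<eta>: "\<eta> \<longlonglongrightarrow> 0"
    and eb: "\<And>\<rho> l. \<rho> \<ge> 2 \<Longrightarrow> l \<ge> 1 \<Longrightarrow> (\<Sum>u = 1..l. \<Sum>v = 1..l. \<bar>lag_product a (\<rho> * l + u - v)\<bar>) \<le> real l powr (2 * d' + 1) * \<eta> \<rho>"
    using cross_block_lag_bound[OF mc d'b] by blast
  \<comment> \<open>The cross-block bound for blocks of length 1 is a bound on single lag
    products.\<close>
  have r0: "lag_product a \<longlonglongrightarrow> 0"
  proof (rule Lim_null_comparison[OF _ \<eta>])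
    show "\<forall>\<^sub>F h in sequentially. norm (lag_product a h) \<le> \<eta> h"
      using eventually_ge_at_top[of 2]
    proof eventually_elim
      case (elim h)
      then show ?case using eb[of h 1] by simp
    qed
  qed
  show "(\<lambda>n. \<sigma>\<^sup>2 * (cross_sum (base_weight d b p n) (base_weight d b' q n) 0 0 n / real n powr (2 * d + 1))) \<longlonglongrightarrow> Sigma_entry d \<delta> b b' p q"
    if p: "1 \<le> p" and q: "1 \<le> q"
    unfolding \<delta> Sigma_entry_scale \<delta>0_def[symmetric]
  proof (rule tendsto_mult_left, cases "d < 1/2")
    case True
    then have dd: "d' = d" and \<delta>0: "\<delta>0 = g / (2 * d + 1)" and \<alpha>: "2 * d + 1 \<ge> 0" "2 * d + 1 > 0" using d by (auto simp: d' \<delta>0_def)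
    show "(\<lambda>n. cross_sum (base_weight d b p n) (base_weight d b' q n) 0 0 n / real n powr (2 * d + 1)) \<longlonglongrightarrow> Sigma_entry d \<delta>0 b b' p q"
      using trig_lag_sum_tendsto[OF \<alpha>(1) g'[unfolded dd] \<alpha>(2), of b p b' q] True
      unfolding Sigma_entry_plain[OF d(1) True \<delta>0 p q] by (simp add: base_weight_def)
  next
    case False
    then have dd: "2 * d' + 1 = 2 * d - 1" "1/2 \<le> d" and \<delta>0: "\<delta>0 = (if d = 1/2 then g else g / (2 * d - 1))" and \<alpha>: "2 * d - 1 \<ge> 0"
      using d by (auto simp: d' \<delta>0_def)
    have e: "2 * d - 1 + 2 = 2 * d + 1" by simp
    show "(\<lambda>n. cross_sum (base_weight d b p n) (base_weight d b' q n) 0 0 n / real n powr (2 * d + 1)) \<longlonglongrightarrow> Sigma_entry d \<delta>0 b b' p q"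
      using tail_trig_lag_sum_tendsto[OF \<alpha> g'[unfolded dd(1)] p q, of b b'] False
      unfolding Sigma_entry_tail[OF dd(2) \<delta>0] e by (simp add: base_weight_def)
  qed
  show "(\<lambda>n. increment_lag_sum (lag_product a) n (base_weight d b p n) / real n powr (2 * d + 1)) \<longlonglongrightarrow> 0"
    if p: "1 \<le> p"
  proof (cases "d < 1/2")
    case True
    then show ?thesis using increment_trig_tendsto[OF r0, of "2 * d + 1" b p] d by (simp add: base_weight_def)
  next
    case False
    then show ?thesis using increment_tail_tendsto[OF r0 _ p, of "2 * d + 1" b] by (simp add: base_weight_def)
  qed
  have "\<bar>cross_sum (base_weight d b p l) (base_weight d b p l) (h * l) (h' * l) l\<bar> \<le> real l powr (2 * d + 1) * \<eta> (h - h')"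
    if l: "l \<ge> 1" and h: "h' + 2 \<le> h" for b p l h h'
  proof -
    have "h - h' \<ge> 2" using h by simp
    note e = eb[OF this l]
    show ?thesis
    proof (cases "d < 1/2")
      case True
      have "\<bar>cross_sum (base_weight d b p l) (base_weight d b p l) (h * l) (h' * l) l\<bar> \<le> 1\<^sup>2 * (real l powr (2 * d' + 1) * \<eta> (h - h'))"
        by (rule far_block_bound[where r = "lag_product a" and l = l and h = h and h' = h' and \<alpha> = "2 * d' + 1" and \<eta> = \<eta>, OF e h]) (use True abs_trig_le in \<open>auto simp: base_weight_def\<close>)
      then show ?thesis using True by (simp add: d')
    next
      case False
      have "\<bar>cross_sum (base_weight d b p l) (base_weight d b p l) (h * l) (h' * l) l\<bar> \<le> (real l)\<^sup>2 * (real l powr (2 * d' + 1) * \<eta> (h - h'))"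
        by (rule far_block_bound[where r = "lag_product a" and l = l and h = h and h' = h' and \<alpha> = "2 * d' + 1" and \<eta> = \<eta>, OF e h]) (use False abs_tail_trig_le in \<open>auto simp: base_weight_def\<close>)
      also have "\<dots> = (real l powr 2 * real l powr (2 * d' + 1)) * \<eta> (h - h')" using l by (simp add: powr_numeral)
      also have "\<dots> = real l powr (2 * d + 1) * \<eta> (h - h')"
      proof -
        have "2 + (2 * d' + 1) = 2 * d + 1" using False by (simp add: d')
        then show ?thesis by (simp only: powr_add[symmetric])
      qed
      finally show ?thesis .
    qed
  qed
  then show "\<exists>\<eta>. \<eta> \<longlonglongrightarrow> 0 \<and> (\<forall>b p l h h'. l \<ge> 1 \<longrightarrow> h' + 2 \<le> h \<longrightarrow>
      \<bar>cross_sum (base_weight d b p l) (base_weight d b p l) (h * l) (h' * l) l\<bar> \<le> real l powr (2 * d + 1) * \<eta> (h - h'))"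
    by (intro exI[of _ \<eta>] conjI \<eta> allI impI)
qed

lemma prod_shift_index: "(\<Prod>i = 1..2 * s. f (i - 1)) = (\<Prod>p<s + s. f p)"
  for f :: "nat \<Rightarrow> 'b::comm_monoid_mult"
  by (simp add: prod.atLeast1_atMost_eq mult_2)

text \<open>Eigenvalues enter as roots of the characteristic polynomial, counted with multiplicity,
  and the limit law is realised on a probability space of its own. The inverse of
  \<open>D_mat\<close> is the explicit diagonal one, available by \<open>Sigma_pos\<close>.\<close>

theorem theorem1:
  fixes M :: "'a measure" and N :: "'b measure"
    and d c \<sigma> :: real and s :: nat
    and a :: "nat \<Rightarrow> real" and \<epsilon> :: "int \<Rightarrow> 'a \<Rightarrow> real" and X :: "nat \<Rightarrow> 'a \<Rightarrow> real"
    and m l :: "nat \<Rightarrow> nat" and Q :: "nat \<Rightarrow> 'b \<Rightarrow> real"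
  assumes "prob_space M"
    and "- 1/2 < d" and "d < 3/2" and "s \<ge> 1"
    and "prob_space.I_process M d a c \<sigma> \<epsilon> X"
    and "filterlim m at_top sequentially" and "filterlim l at_top sequentially"
    and "prob_space N"
    and "prob_space.indep_vars N (\<lambda>_. borel) Q {1..2 * s}"
    and "\<forall>i\<in>{1..2 * s}. distr N borel (Q i) = chi_square_1"
  shows "let \<delta> = prob_space.I_delta M d a c \<sigma> X in \<exists>Dinv \<zeta>.
     inverts_mat (D_mat s d \<delta>) Dinv \<and> inverts_mat Dinv (D_mat s d \<delta>) \<and>
     char_poly (Sigma_mat s d \<delta> * Dinv) = (\<Prod>i = 1..2 * s. [:- \<zeta> i, 1:]) \<and>
     weak_conv_m (\<lambda>k. distr M borel (Q_stat X s d (m k) (l k)))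
       (distr N borel (\<lambda>\<omega>. \<Sum>i = 1..2 * s. \<zeta> i * Q i \<omega>))"
proof -
  interpret prob_space M by fact
  interpret N: prob_space N by fact
  note d = assms(2,3) and X = assms(5) and m = assms(6) and l = assms(7)
  define d' where "d' = (if d < 1/2 then d else d - 1)"
  note base = I_process_base_process[OF X d, folded d'_def]
  interpret linear_proc M \<sigma> \<epsilon> a "base_process d X" by (rule base(1))
  obtain g where g: "g > 0" "(\<lambda>h. lag_partial_sum (lag_product a) h / real h powr (2 * d')) \<longlonglongrightarrow> g"
    and \<delta>': "delta d' a c \<sigma> (base_process d X) = \<sigma>\<^sup>2 * (if d' = - 1/2 then g else g / (2 * d' + 1))"
    using delta_eq[OF base(2,3,4)] by blast
  define \<delta> where "\<delta> = I_delta d a c \<sigma> X"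
  have \<delta>_eq: "\<delta> = \<sigma>\<^sup>2 * (if d' = - 1/2 then g else g / (2 * d' + 1))" unfolding \<delta>_def base(5) by (rule \<delta>')
  have "\<sigma>\<^sup>2 > 0" using sigma_pos by simp
  then have \<delta>: "\<delta> > 0" unfolding \<delta>_eq using g(1) base(3) by (intro mult_pos_pos) (auto intro!: divide_pos_pos)
  note asy = base_weight_asymptotics[OF base(2) d d'_def g(2) \<delta>_eq]
  obtain \<eta> where \<eta>: "\<eta> \<longlonglongrightarrow> 0"
    and far: "\<And>b p l h h'. l \<ge> 1 \<Longrightarrow> h' + 2 \<le> h \<Longrightarrow>
      \<bar>cross_sum (base_weight d b p l) (base_weight d b p l) (h * l) (h' * l) l\<bar> \<le> real l powr (2 * d + 1) * \<eta> (h - h')"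
    using asy(3) by blast
  define w where "w i = base_weight d (i < s) (if i < s then Suc i else Suc (i - s))" for i
  define D where "D j = Sigma_c d \<delta> (Suc j) (Suc j) + Sigma_s d \<delta> (Suc j) (Suc j)" for j
  have D: "D j > 0" for j unfolding D_def using Sigma_pos[OF d \<delta>, of "Suc j"] by simp
  let ?D = "\<lambda>i. D (if i < s then i else i - s)"
  define Z where "Z k \<omega> = (\<Sum>j<s.
        ((weighted_sum (base_process d X) (w j (m k * l k)) 0 (m k * l k) \<omega>)\<^sup>2
          + (weighted_sum (base_process d X) (w (s + j) (m k * l k)) 0 (m k * l k) \<omega>)\<^sup>2) / real (m k * l k) powr (2 * d + 1)
        / ((\<Sum>h<m k. (weighted_sum (base_process d X) (w j (l k)) (h * l k) (l k) \<omega>)\<^sup>2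
          + (weighted_sum (base_process d X) (w (s + j) (l k)) (h * l k) (l k) \<omega>)\<^sup>2) / (real (m k) * real (l k) powr (2 * d + 1))))" for k \<omega>
  obtain \<zeta> where \<zeta>0: "\<And>p. p < s + s \<Longrightarrow> \<zeta> p \<ge> 0"
    and cp: "char_poly (Sigma_mat s d \<delta> * mat_diag (s + s) (\<lambda>i. 1 / ?D i)) = (\<Prod>p<s + s. [:- \<zeta> p, 1:])"
    and lim: "\<And>lam. lam \<ge> 0 \<Longrightarrow> (\<lambda>k. expectation (\<lambda>\<omega>. exp (- lam * Z k \<omega>)))
      \<longlonglongrightarrow> (\<Prod>p<s + s. \<integral>g. exp (- lam * \<zeta> p * g\<^sup>2) \<partial>std_normal_distribution)"
  proof -
    have "\<exists>\<zeta>. (\<forall>p<s + s. \<zeta> p \<ge> 0) \<and>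
      char_poly (Sigma_mat s d \<delta> * mat_diag (s + s) (\<lambda>i. 1 / ?D i)) = (\<Prod>p<s + s. [:- \<zeta> p, 1:]) \<and>
      (\<forall>lam\<ge>0. (\<lambda>k. expectation (\<lambda>\<omega>. exp (- lam * Z k \<omega>)))
        \<longlonglongrightarrow> (\<Prod>p<s + s. \<integral>g. exp (- lam * \<zeta> p * g\<^sup>2) \<partial>std_normal_distribution))"
    unfolding Z_def
  proof (rule studentized_sum_squares_Laplace[OF Sigma_mat_carrier _ _ \<eta> _ _ _ m l, where w = w and D = D and \<kappa> = "2 * d + 1"])
    fix p q assume pq: "p < s + s" "q < s + s"
    show "(\<lambda>n. \<sigma>\<^sup>2 * (cross_sum (w p n) (w q n) 0 0 n / real n powr (2 * d + 1))) \<longlonglongrightarrow> Sigma_mat s d \<delta> $$ (p, q)"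
      unfolding Sigma_mat_entry[OF pq] w_def by (rule asy(1)) auto
  next
    fix p assume "p < s + s"
    show "(\<lambda>n. increment_lag_sum (lag_product a) n (w p n) / real n powr (2 * d + 1)) \<longlonglongrightarrow> 0"
      unfolding w_def by (intro asy(2)) auto
  next
    fix p l h h' :: nat assume "p < s + s" "l \<ge> 1" "h' + 2 \<le> h"
    then show "\<bar>cross_sum (w p l) (w p l) (h * l) (h' * l) l\<bar> \<le> real l powr (2 * d + 1) * \<eta> (h - h')"
      unfolding w_def by (intro far)
  next
    fix j assume "j < s"
    then show "D j = Sigma_mat s d \<delta> $$ (j, j) + Sigma_mat s d \<delta> $$ (s + j, s + j)"
      by (simp add: Sigma_mat_entry D_def Sigma_entry_def)
    show "D j > 0" by (rule D)
  qed (intro exI conjI allI impI; assumption | blast)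
  then show ?thesis using that by blast
  qed
  define Dinv where "Dinv = mat_diag (s + s) (\<lambda>i. 1 / ?D i)"
  define \<xi> where "\<xi> i = \<zeta> (i - 1)" for i
  have Dm: "D_mat s d \<delta> = mat_diag (s + s) ?D" unfolding D_mat_eq D_def ..
  have inv: "inverts_mat (D_mat s d \<delta>) Dinv" "inverts_mat Dinv (D_mat s d \<delta>)"
    unfolding Dm Dinv_def using less_imp_neq[OF D] by (intro inverts_mat_diag; metis)+
  have cp': "char_poly (Sigma_mat s d \<delta> * Dinv) = (\<Prod>i = 1..2 * s. [:- \<xi> i, 1:])"
    unfolding Dinv_def cp \<xi>_def by (rule prod_shift_index[symmetric])
  let ?Q = "\<lambda>\<omega>. \<Sum>i = 1..2 * s. \<xi> i * Q i \<omega>"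
  have \<xi>0: "\<xi> i \<ge> 0" if "i \<in> {1..2 * s}" for i unfolding \<xi>_def using that by (intro \<zeta>0) auto
  have QN: "distr N borel (Q i) = chi_square_1" if "i \<in> {1..2 * s}" for i using assms(10) that by blast
  have Q0: "AE \<omega> in N. 0 \<le> ?Q \<omega>"
    by (rule N.weighted_chi_square_sum_Laplace(1)[OF assms(9) _ QN \<xi>0 order_refl]) auto
  have "Q i \<in> borel_measurable N" if "i \<in> {1..2 * s}" for i using assms(9) that by (auto simp: N.indep_vars_def)
  then have Qm[measurable]: "?Q \<in> borel_measurable N" by (intro borel_measurable_sum borel_measurable_times) auto
  note Sm[measurable] = Q_stat_measurable[OF X]
  have "weak_conv_m (\<lambda>k. distr M borel (Q_stat X s d (m k) (l k))) (distr N borel ?Q)"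
  proof (rule weak_conv_m_Laplace)
    show "real_distribution (distr M borel (Q_stat X s d (m k) (l k)))" for k
      by (rule real_distribution_distr) measurable
    show "real_distribution (distr N borel ?Q)" by (rule N.real_distribution_distr) measurable
    show "AE x in distr M borel (Q_stat X s d (m k) (l k)). 0 \<le> x" for k
      by (subst AE_distr_iff) (auto simp: Q_stat_nonneg)
    show "AE x in distr N borel ?Q. 0 \<le> x"
    proof -
      have "(AE x in distr N borel ?Q. 0 \<le> x) = (AE \<omega> in N. 0 \<le> ?Q \<omega>)" by (rule AE_distr_iff[OF Qm]) simp
      then show ?thesis using Q0 by (simp only:)
    qed
    fix k :: nat
    have "(\<integral>x. exp (- real k * x) \<partial>distr N borel ?Q) = N.expectation (\<lambda>\<omega>. exp (- real k * ?Q \<omega>))"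
      by (rule integral_distr[OF Qm]) simp
    also have "\<dots> = (\<Prod>i = 1..2 * s. \<integral>g. exp (- real k * \<xi> i * g\<^sup>2) \<partial>std_normal_distribution)"
      by (rule N.weighted_chi_square_sum_Laplace(2)[OF assms(9) _ QN \<xi>0]) auto
    also have "\<dots> = (\<Prod>p<s + s. \<integral>g. exp (- real k * \<zeta> p * g\<^sup>2) \<partial>std_normal_distribution)"
      unfolding \<xi>_def by (rule prod_shift_index)
    finally have R: "(\<integral>x. exp (- real k * x) \<partial>distr N borel ?Q) = \<dots>" .
    \<comment> \<open>Eventually all s frequency indices are below l, where \<open>Q_stat_eq\<close>
      applies; earlier terms do not affect the limit.\<close>
    have "\<forall>\<^sub>F n in sequentially. m n \<ge> 1" "\<forall>\<^sub>F n in sequentially. l n > s"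
      using m l unfolding less_eq_Suc_le by (auto simp: filterlim_at_top)
    then have ev: "\<forall>\<^sub>F n in sequentially. expectation (\<lambda>\<omega>. exp (- real k * Z n \<omega>)) = (\<integral>x. exp (- real k * x) \<partial>distr M borel (Q_stat X s d (m n) (l n)))"
    proof eventually_elim
      case (elim n)
      have "Q_stat X s d (m n) (l n) \<omega> = Z n \<omega>" for \<omega>
        unfolding Q_stat_eq[OF elim] Z_def w_def by (intro sum.cong refl) simp
      then have "expectation (\<lambda>\<omega>. exp (- real k * Z n \<omega>)) = expectation (\<lambda>\<omega>. exp (- real k * Q_stat X s d (m n) (l n) \<omega>))" by simp
      also have "\<dots> = (\<integral>x. exp (- real k * x) \<partial>distr M borel (Q_stat X s d (m n) (l n)))"
        by (rule integral_distr[symmetric]) auto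
      finally show ?case .
    qed
    show "(\<lambda>n. \<integral>x. exp (- real k * x) \<partial>distr M borel (Q_stat X s d (m n) (l n))) \<longlonglongrightarrow> (\<integral>x. exp (- real k * x) \<partial>distr N borel ?Q)"
      unfolding R by (rule Lim_transform_eventually[OF lim ev]) simp
  qed
  then show ?thesis using inv cp' unfolding Let_def \<delta>_def by blast
qed

end
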